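(* Let $N$ be a closed connected manifold and let $H$ be a time-periodic Tonelli Hamiltonian on $T^*N$. If $\phi\in\mathcal{G}$ is such that $H\circ\phi$ is still Tonelli, then $\alpha_{H\circ\phi}=\alpha_H$.
   Context: $T^*N$ carries the symplectic form $\omega=dp\wedge dq$; the Hamiltonian vector field is defined by $\omega(X_H,\cdot)=-dH_t$, $H_t=H(t,\cdot)$. $\mathcal{G}$ is the group of time-$1$ maps of compactly supported time-dependent Hamiltonians on $T^*N$. $(H\circ\phi)(t,z)=H(t,\phi(z))$. A Hamiltonian is Tonelli if it is fiberwise strictly convex and superlinear and has complete flow; time-periodic means $1$-periodic in $t$. Let $L(t,q,v)=\max_{p\in T_q^*N}(\langle p,v\rangle-H(t,q,p))$ be the associated Lagrangian on $(\mathbb{R}/\mathbb{Z})\times TN$. Mather's alpha function $\alpha_H:H^1(N;\mathbb{R})\to\mathbb{R}$ is $\alpha_H(a)=-\min_\mu\int(L-\eta)\,d\mu$, where $\eta$ is any closed $1$-form in the class $a$, viewed as a fiberwise linear function on $TN$, and $\mu$ runs over Borel probability measures on $(\mathbb{R}/\mathbb{Z})\times TN$ invariant under the Euler–Lagrange flow of $L$. *)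

theory Defs
  imports "HOL-Probability.Probability_Measure"
begin

section \<open>Smooth maps between open subsets of finite-dimensional spaces\<close>

primrec differentiable_times_on ::
  "nat \<Rightarrow> 'a::real_normed_vector set \<Rightarrow> ('a \<Rightarrow> 'b::real_normed_vector) \<Rightarrow> bool" where
  "differentiable_times_on 0 S f \<longleftrightarrow> continuous_on S f"
| "differentiable_times_on (Suc k) S f \<longleftrightarrow>
     (\<forall>x\<in>S. f differentiable (at x)) \<and>
     (\<forall>v. differentiable_times_on k S (\<lambda>x. frechet_derivative f (at x) v))"

definition smooth_on :: "'a::real_normed_vector set \<Rightarrow> ('a \<Rightarrow> 'b::real_normed_vector) \<Rightarrow> bool" where
  "smooth_on S f \<longleftrightarrow> (\<forall>k. differentiable_times_on k S f)"


section \<open>Manifolds\<close>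

text \<open>
  A chart is a domain together with a coordinate map; the values of the coordinate map outside
  the domain are irrelevant. The model space \<open>'e\<close> is only of class \<^class>\<open>real_inner\<close>, and its
  finite dimension is a condition on the atlas, because the types of class
  \<^class>\<open>euclidean_space\<close> have positive dimension and would exclude the one-point manifold.
\<close>

type_synonym ('m, 'e) chart = "'m set \<times> ('m \<Rightarrow> 'e)"

type_synonym ('m, 'e) atlas = "('m, 'e) chart set"

abbreviation chart_dom :: "('m, 'e) chart \<Rightarrow> 'm set" where
  "chart_dom c \<equiv> fst c"

abbreviation chart_map :: "('m, 'e) chart \<Rightarrow> 'm \<Rightarrow> 'e" where
  "chart_map c \<equiv> snd c"

definition chart_inv :: "('m, 'e) chart \<Rightarrow> 'e \<Rightarrow> 'm" where
  "chart_inv c = inv_into (chart_dom c) (chart_map c)"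

definition points :: "('m, 'e) atlas \<Rightarrow> 'm set" where
  "points A = (\<Union>c\<in>A. chart_dom c)"

definition smooth_atlas :: "('m, 'e::real_inner) atlas \<Rightarrow> bool" where
  "smooth_atlas A \<longleftrightarrow>
     (\<exists>B::'e set. finite B \<and> span B = UNIV) \<and>
     (\<forall>c\<in>A. inj_on (chart_map c) (chart_dom c) \<and> open (chart_map c ` chart_dom c)) \<and>
     (\<forall>c\<in>A. \<forall>d\<in>A. open (chart_map c ` (chart_dom c \<inter> chart_dom d)) \<and>
        smooth_on (chart_map c ` (chart_dom c \<inter> chart_dom d)) (chart_map d \<circ> chart_inv c))"

definition manifold_topology :: "('m, 'e::real_inner) atlas \<Rightarrow> 'm topology" where
  "manifold_topology A = topology (\<lambda>W. W \<subseteq> points A \<and>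
     (\<forall>c\<in>A. open (chart_map c ` (W \<inter> chart_dom c))))"

lemma openin_manifold_topology:
  assumes inj: "\<And>c. c \<in> A \<Longrightarrow> inj_on (chart_map c) (chart_dom c)"
  shows "openin (manifold_topology A) W \<longleftrightarrow>
    W \<subseteq> points A \<and> (\<forall>c\<in>A. open (chart_map c ` (W \<inter> chart_dom c)))"
proof -
  have "istopology (\<lambda>W. W \<subseteq> points A \<and> (\<forall>c\<in>A. open (chart_map c ` (W \<inter> chart_dom c))))"
    unfolding istopology_def
  proof (intro conjI allI impI ballI)
    fix S T c
    assume S: "S \<subseteq> points A \<and> (\<forall>c\<in>A. open (chart_map c ` (S \<inter> chart_dom c)))"
      and T: "T \<subseteq> points A \<and> (\<forall>c\<in>A. open (chart_map c ` (T \<inter> chart_dom c)))"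
      and c: "c \<in> A"
    have "chart_map c ` ((S \<inter> T) \<inter> chart_dom c) =
        chart_map c ` (S \<inter> chart_dom c) \<inter> chart_map c ` (T \<inter> chart_dom c)"
      using inj_on_image_Int[OF inj[OF c], of "S \<inter> chart_dom c" "T \<inter> chart_dom c"]
      by (simp add: Int_ac)
    then show "open (chart_map c ` ((S \<inter> T) \<inter> chart_dom c))"
      using S T c by auto
  next
    fix \<K> c
    assume K: "\<forall>K\<in>\<K>. K \<subseteq> points A \<and> (\<forall>c\<in>A. open (chart_map c ` (K \<inter> chart_dom c)))"
      and c: "c \<in> A"
    have "chart_map c ` (\<Union>\<K> \<inter> chart_dom c) = (\<Union>K\<in>\<K>. chart_map c ` (K \<inter> chart_dom c))"
      by blast
    then show "open (chart_map c ` (\<Union>\<K> \<inter> chart_dom c))"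
      using K c by auto
  qed blast+
  then show ?thesis
    by (simp add: manifold_topology_def)
qed

text \<open>Second countability follows from compactness.\<close>

definition closed_connected_manifold :: "('m, 'e::real_inner) atlas \<Rightarrow> bool" where
  "closed_connected_manifold A \<longleftrightarrow>
     smooth_atlas A \<and> points A \<noteq> {} \<and> Hausdorff_space (manifold_topology A) \<and>
     compact_space (manifold_topology A) \<and> connected_space (manifold_topology A)"

definition smooth_function :: "('m, 'e::real_inner) atlas \<Rightarrow> ('m \<Rightarrow> real) \<Rightarrow> bool" where
  "smooth_function A f \<longleftrightarrow>
     (\<forall>c\<in>A. smooth_on (chart_map c ` chart_dom c) (f \<circ> chart_inv c))"

definition smooth_time_function :: "('m, 'e::real_inner) atlas \<Rightarrow> (real \<Rightarrow> 'm \<Rightarrow> real) \<Rightarrow> bool" where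
  "smooth_time_function A F \<longleftrightarrow>
     (\<forall>c\<in>A. smooth_on (UNIV \<times> chart_map c ` chart_dom c) (\<lambda>(t, x). F t (chart_inv c x)))"


section \<open>Tangent and cotangent bundle\<close>

text \<open>
  A tangent vector (covector) at \<open>q\<close> is given by the family of its coordinate vectors in all the
  charts around \<open>q\<close>, which transform by the differentials of the coordinate changes (their inverse
  transposes); the family is \<open>0\<close> at all other arguments. Coordinates of covectors are paired with
  those of vectors by the inner product of \<open>'e\<close>.
\<close>

type_synonym ('m, 'e) coords = "('m, 'e) chart \<Rightarrow> 'e"

definition charts_at :: "('m, 'e) atlas \<Rightarrow> 'm \<Rightarrow> ('m, 'e) chart set" where
  "charts_at A q = {c\<in>A. q \<in> chart_dom c}"

definition transition_deriv ::
  "('m, 'e::real_inner) chart \<Rightarrow> ('m, 'e) chart \<Rightarrow> 'm \<Rightarrow> 'e \<Rightarrow> 'e" where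
  "transition_deriv c d q = frechet_derivative (chart_map d \<circ> chart_inv c) (at (chart_map c q))"

definition tangent_space :: "('m, 'e::real_inner) atlas \<Rightarrow> 'm \<Rightarrow> ('m, 'e) coords set" where
  "tangent_space A q = {v. (\<forall>c. c \<notin> charts_at A q \<longrightarrow> v c = 0) \<and>
     (\<forall>c\<in>charts_at A q. \<forall>d\<in>charts_at A q. v d = transition_deriv c d q (v c))}"

definition cotangent_space :: "('m, 'e::real_inner) atlas \<Rightarrow> 'm \<Rightarrow> ('m, 'e) coords set" where
  "cotangent_space A q = {p. (\<forall>c. c \<notin> charts_at A q \<longrightarrow> p c = 0) \<and>
     (\<forall>c\<in>charts_at A q. \<forall>d\<in>charts_at A q. \<forall>\<xi>. p d \<bullet> transition_deriv c d q \<xi> = p c \<bullet> \<xi>)}"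

text \<open>The number \<open>p c \<bullet> v c\<close> does not depend on the chart.\<close>

definition pairing ::
  "('m, 'e::real_inner) atlas \<Rightarrow> 'm \<Rightarrow> ('m, 'e) coords \<Rightarrow> ('m, 'e) coords \<Rightarrow> real" where
  "pairing A q p v = (let c = (SOME c. c \<in> charts_at A q) in p c \<bullet> v c)"

definition bundle_chart ::
  "('m \<Rightarrow> ('m, 'e) coords set) \<Rightarrow> ('m, 'e) chart \<Rightarrow> ('m \<times> ('m, 'e) coords, 'e \<times> 'e) chart" where
  "bundle_chart E c =
     (Sigma (chart_dom c) E, \<lambda>(q, v). (chart_map c q, v c))"

definition tangent_atlas ::
  "('m, 'e::real_inner) atlas \<Rightarrow> ('m \<times> ('m, 'e) coords, 'e \<times> 'e) atlas" where
  "tangent_atlas A = bundle_chart (tangent_space A) ` A"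

definition cotangent_atlas ::
  "('m, 'e::real_inner) atlas \<Rightarrow> ('m \<times> ('m, 'e) coords, 'e \<times> 'e) atlas" where
  "cotangent_atlas A = bundle_chart (cotangent_space A) ` A"


section \<open>Hamiltonian dynamics\<close>

type_synonym ('m, 'e) hamiltonian = "real \<Rightarrow> 'm \<times> ('m, 'e) coords \<Rightarrow> real"

text \<open>The form \<open>dp \<and> dq\<close> in the coordinates \<open>(q, p)\<close> of a chart of the cotangent bundle.\<close>

definition symplectic_form :: "'e::real_inner \<times> 'e \<Rightarrow> 'e \<times> 'e \<Rightarrow> real" where
  "symplectic_form \<xi> \<eta> = snd \<xi> \<bullet> fst \<eta> - fst \<xi> \<bullet> snd \<eta>"

definition hamiltonian_vector_field ::
  "('m \<times> ('m, 'e::real_inner) coords, 'e \<times> 'e) chart \<Rightarrow> ('m, 'e) hamiltonian \<Rightarrow>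
   real \<Rightarrow> 'm \<times> ('m, 'e) coords \<Rightarrow> 'e \<times> 'e" where
  "hamiltonian_vector_field c H t z = (THE \<xi>. \<forall>\<eta>.
     symplectic_form \<xi> \<eta> = - frechet_derivative (H t \<circ> chart_inv c) (at (chart_map c z)) \<eta>)"

definition hamiltonian_orbit ::
  "('m, 'e::real_inner) atlas \<Rightarrow> ('m, 'e) hamiltonian \<Rightarrow> (real \<Rightarrow> 'm \<times> ('m, 'e) coords) \<Rightarrow> bool" where
  "hamiltonian_orbit A H z \<longleftrightarrow>
     continuous_map euclideanreal (manifold_topology (cotangent_atlas A)) z \<and>
     (\<forall>t. \<forall>c\<in>charts_at (cotangent_atlas A) (z t).
        ((\<lambda>s. chart_map c (z s)) has_vector_derivative hamiltonian_vector_field c H t (z t)) (at t))"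

definition compactly_supported :: "('m, 'e::real_inner) atlas \<Rightarrow> ('m, 'e) hamiltonian \<Rightarrow> bool" where
  "compactly_supported A F \<longleftrightarrow>
     (\<exists>K. compactin (manifold_topology (cotangent_atlas A)) K \<and>
        (\<forall>t. \<forall>z\<in>points (cotangent_atlas A) - K. F t z = 0))"

text \<open>The elements are maps of the cotangent bundle; their values at other arguments are arbitrary.\<close>

definition hamiltonian_group ::
  "('m, 'e::real_inner) atlas \<Rightarrow> ('m \<times> ('m, 'e) coords \<Rightarrow> 'm \<times> ('m, 'e) coords) set" where
  "hamiltonian_group A = {\<phi>. \<exists>F. smooth_time_function (cotangent_atlas A) F \<and>
     compactly_supported A F \<and>
     (\<forall>z0\<in>points (cotangent_atlas A). \<exists>z. hamiltonian_orbit A F z \<and> z 0 = z0 \<and> z 1 = \<phi> z0)}"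

definition time_periodic :: "('m, 'e::real_inner) atlas \<Rightarrow> ('m, 'e) hamiltonian \<Rightarrow> bool" where
  "time_periodic A H \<longleftrightarrow> (\<forall>t. \<forall>z\<in>points (cotangent_atlas A). H (t + 1) z = H t z)"

definition fiberwise_strictly_convex ::
  "('m, 'e::real_inner) atlas \<Rightarrow> ('m, 'e) hamiltonian \<Rightarrow> bool" where
  "fiberwise_strictly_convex A H \<longleftrightarrow>
     (\<forall>t. \<forall>q\<in>points A. \<forall>p\<in>cotangent_space A q. \<forall>p'\<in>cotangent_space A q. \<forall>u.
        p \<noteq> p' \<and> 0 < u \<and> u < 1 \<longrightarrow>
        H t (q, \<lambda>c. (1 - u) *\<^sub>R p c + u *\<^sub>R p' c) < (1 - u) * H t (q, p) + u * H t (q, p'))"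

definition fiberwise_superlinear ::
  "('m, 'e::real_inner) atlas \<Rightarrow> ('m, 'e) hamiltonian \<Rightarrow> bool" where
  "fiberwise_superlinear A H \<longleftrightarrow>
     (\<forall>t. \<forall>q\<in>points A. \<forall>c\<in>charts_at A q. \<forall>K. \<exists>R. \<forall>p\<in>cotangent_space A q.
        norm (p c) \<ge> R \<longrightarrow> H t (q, p) \<ge> K * norm (p c))"

definition complete_flow :: "('m, 'e::real_inner) atlas \<Rightarrow> ('m, 'e) hamiltonian \<Rightarrow> bool" where
  "complete_flow A H \<longleftrightarrow>
     (\<forall>t0. \<forall>z0\<in>points (cotangent_atlas A). \<exists>z. hamiltonian_orbit A H z \<and> z t0 = z0)"

definition tonelli :: "('m, 'e::real_inner) atlas \<Rightarrow> ('m, 'e) hamiltonian \<Rightarrow> bool" where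
  "tonelli A H \<longleftrightarrow> smooth_time_function (cotangent_atlas A) H \<and>
     fiberwise_strictly_convex A H \<and> fiberwise_superlinear A H \<and> complete_flow A H"


section \<open>The associated Lagrangian and its Euler-Lagrange flow\<close>

type_synonym ('m, 'e) lagrangian = "real \<Rightarrow> 'm \<times> ('m, 'e) coords \<Rightarrow> real"

definition lagrangian_of ::
  "('m, 'e::real_inner) atlas \<Rightarrow> ('m, 'e) hamiltonian \<Rightarrow> ('m, 'e) lagrangian" where
  "lagrangian_of A H t w = (case w of (q, v) \<Rightarrow>
     (GREATEST y. \<exists>p\<in>cotangent_space A q. y = pairing A q p v - H t (q, p)))"

text \<open>
  An orbit is the lift \<open>(\<gamma>, \<gamma>')\<close> of a curve \<open>\<gamma>\<close> solving \<open>d/dt \<partial>\<^sub>v L = \<partial>\<^sub>q L\<close>. In this form, where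
  only the momentum has to be differentiable, the equation makes sense for a Lagrangian of class
  \<open>C\<^sup>1\<close>. This matters because \<open>L\<close> need not be of class \<open>C\<^sup>2\<close> if the fiberwise second derivative of
  \<open>H\<close> degenerates.
\<close>

definition euler_lagrange_orbit ::
  "('m, 'e::real_inner) atlas \<Rightarrow> ('m, 'e) lagrangian \<Rightarrow> (real \<Rightarrow> 'm \<times> ('m, 'e) coords) \<Rightarrow> bool" where
  "euler_lagrange_orbit A L w \<longleftrightarrow>
     continuous_map euclideanreal (manifold_topology (tangent_atlas A)) w \<and>
     (\<forall>t. \<forall>c\<in>charts_at (tangent_atlas A) (w t).
        let x = (\<lambda>s. fst (chart_map c (w s)));
            \<xi> = (\<lambda>s. snd (chart_map c (w s)));
            Lc = (\<lambda>s y \<zeta>. L s (chart_inv c (y, \<zeta>)))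
        in (x has_vector_derivative \<xi> t) (at t) \<and>
           (\<forall>\<eta>. ((\<lambda>s. frechet_derivative (\<lambda>\<zeta>. Lc s (x s) \<zeta>) (at (\<xi> s)) \<eta>)
              has_real_derivative frechet_derivative (\<lambda>y. Lc t y (\<xi> t)) (at (x t)) \<eta>) (at t)))"

definition time_class :: "real \<Rightarrow> real set" where
  "time_class t = {s. s - t \<in> \<int>}"

definition circle_topology :: "real set topology" where
  "circle_topology = topology (\<lambda>W. W \<subseteq> range time_class \<and> open (time_class -` W))"

definition phase_topology ::
  "('m, 'e::real_inner) atlas \<Rightarrow> (real set \<times> 'm \<times> ('m, 'e) coords) topology" where
  "phase_topology A = prod_topology circle_topology (manifold_topology (tangent_atlas A))"

definition borel_of_topology :: "'a topology \<Rightarrow> 'a measure" where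
  "borel_of_topology X = sigma (topspace X) {W. openin X W}"

definition euler_lagrange_flow ::
  "('m, 'e::real_inner) atlas \<Rightarrow> ('m, 'e) lagrangian \<Rightarrow> real \<Rightarrow>
   real set \<times> 'm \<times> ('m, 'e) coords \<Rightarrow> real set \<times> 'm \<times> ('m, 'e) coords" where
  "euler_lagrange_flow A L s y = (THE y'. \<exists>w t. euler_lagrange_orbit A L w \<and>
     y = (time_class t, w t) \<and> y' = (time_class (t + s), w (t + s)))"

definition invariant_measures ::
  "('m, 'e::real_inner) atlas \<Rightarrow> ('m, 'e) lagrangian \<Rightarrow>
   (real set \<times> 'm \<times> ('m, 'e) coords) measure set" where
  "invariant_measures A L = {\<mu>. prob_space \<mu> \<and>
     sets \<mu> = sets (borel_of_topology (phase_topology A)) \<and>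
     (\<forall>s. euler_lagrange_flow A L s \<in> measurable \<mu> \<mu> \<and>
          distr \<mu> \<mu> (euler_lagrange_flow A L s) = \<mu>)}"


section \<open>Closed one-forms and Mather's alpha function\<close>

type_synonym ('m, 'e) one_form = "'m \<Rightarrow> ('m, 'e) coords"

definition closed_one_form :: "('m, 'e::real_inner) atlas \<Rightarrow> ('m, 'e) one_form \<Rightarrow> bool" where
  "closed_one_form A \<eta> \<longleftrightarrow>
     (\<forall>q\<in>points A. \<eta> q \<in> cotangent_space A q) \<and>
     (\<forall>c\<in>A. let g = (\<lambda>x. \<eta> (chart_inv c x) c) in
        smooth_on (chart_map c ` chart_dom c) g \<and>
        (\<forall>x\<in>chart_map c ` chart_dom c. \<forall>u w.
           frechet_derivative g (at x) u \<bullet> w = frechet_derivative g (at x) w \<bullet> u))"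

definition cohomologous ::
  "('m, 'e::real_inner) atlas \<Rightarrow> (('m, 'e) one_form \<times> ('m, 'e) one_form) set" where
  "cohomologous A = {(\<eta>, \<theta>). closed_one_form A \<eta> \<and> closed_one_form A \<theta> \<and>
     (\<exists>f. smooth_function A f \<and>
        (\<forall>q\<in>points A. \<forall>c\<in>charts_at A q. \<forall>u.
           (\<theta> q c - \<eta> q c) \<bullet> u = frechet_derivative (f \<circ> chart_inv c) (at (chart_map c q)) u))}"

definition first_cohomology :: "('m, 'e::real_inner) atlas \<Rightarrow> ('m, 'e) one_form set set" where
  "first_cohomology A = {\<eta>. closed_one_form A \<eta>} // cohomologous A"

text \<open>
  The integrand of \<open>\<integral> (L - \<eta>) d\<mu>\<close>. It does not depend on the representative of the time class
  when \<open>L\<close> is periodic in time.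
\<close>

definition action_integrand ::
  "('m, 'e::real_inner) atlas \<Rightarrow> ('m, 'e) lagrangian \<Rightarrow> ('m, 'e) one_form \<Rightarrow>
   real set \<times> 'm \<times> ('m, 'e) coords \<Rightarrow> real" where
  "action_integrand A L \<eta> y = (case y of (\<tau>, q, v) \<Rightarrow>
     L (SOME t. t \<in> \<tau>) (q, v) - pairing A q (\<eta> q) v)"

text \<open>
  The integrand is bounded below, so that a measure for which it is not integrable has action
  \<open>+\<infinity>\<close> and does not take part in the minimum; the Bochner integral would give it the value \<open>0\<close>.
  The choice of the form \<open>\<eta>\<close> in the class \<open>a\<close> is immaterial, since exact forms integrate to \<open>0\<close>
  against the measures that do take part.
\<close>

definition mather_alpha ::
  "('m, 'e::real_inner) atlas \<Rightarrow> ('m, 'e) hamiltonian \<Rightarrow> ('m, 'e) one_form set \<Rightarrow> real" where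
  "mather_alpha A H a =
     (let L = lagrangian_of A H; \<eta> = (SOME \<eta>. \<eta> \<in> a)
      in - (LEAST r. \<exists>\<mu>\<in>invariant_measures A L.
              integrable \<mu> (action_integrand A L \<eta>) \<and> r = (\<integral>y. action_integrand A L \<eta> y \<partial>\<mu>)))"

end

theory Submission
  imports Defs
begin

text \<open>
  Put \<open>K = H \<circ> \<phi>\<close>, let \<open>\<eta>\<close> be a closed form in the class \<open>a\<close> and \<open>\<theta> = p dq - \<eta>\<close>, so that
  \<open>d\<theta>\<close> is the symplectic form. Since \<open>\<phi>\<close> is the time-1 map of a Hamiltonian \<open>F\<close> with compact
  support, it is symplectic, and \<open>\<phi>\<^sup>*\<theta> - \<theta> = dS\<close> for the function \<open>S\<close> of compact support that
  integrates \<open>\<theta>(X\<^sub>F) - F\<close> along the orbits of \<open>F\<close>. Hence \<open>\<phi>\<close> maps the orbits of \<open>K\<close> to those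
  of \<open>H\<close>. Read through the Legendre transformations, it is a homeomorphism of the phase space
  that conjugates the two Euler-Lagrange flows and induces a bijection of their invariant
  measures. At corresponding points the Lagrangian minus the form \<open>\<eta>\<close> is \<open>\<theta>(X\<^sub>K) - K\<close> and
  \<open>\<theta>(X\<^sub>H) - H\<close>. The difference of these is minus the derivative of the bounded function \<open>S\<close> along
  the flow of \<open>K\<close>, which integrates to 0 against invariant measures. So both minima are taken
  over the same set of values.
\<close>

section \<open>Calculus in finite-dimensional inner product spaces\<close>

text \<open>Orbits of \<open>F\<close> are given through each point at time 0 only, so the
  regularity of \<open>\<phi>\<close> has to be read off from the orbits: in flow boxes, Gronwall
  estimates yield continuity, openness and a differential at single points, and these properties
  spread from time 0 to time 1 because the interval is connected. For the same reason surjectivity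
  of \<open>\<phi>\<close> is not immediate; it follows since the image is open, is closed because
  \<open>\<phi>\<close> is the identity outside a compact set, and the cotangent bundle is
  connected. Strict convexity leaves room for a degenerate fibre Hessian. The inverse Legendre
  transformation is then merely continuous, as the position of a maximum, and the derivatives of the
  Lagrangian come from an envelope argument. Flows are therefore compared on the Hamiltonian side,
  where the vector fields are smooth. Besides \<open>S\<close>, its derivative along the orbits of
  \<open>K\<close> must be bounded, for dominated convergence. Outside the compact set it vanishes,
  and inside it periodicity reduces the bound to a compact set of times and points.\<close>

text \<open>
  The finite Parseval frames. They express finite dimension without the class
  \<^class>\<open>euclidean_space\<close>, and unlike a mere spanning set they compute coordinates by inner products.
\<close>

definition frame :: "'v::real_inner set \<Rightarrow> bool" where
  "frame B \<longleftrightarrow> finite B \<and> (\<forall>x. (\<Sum>b\<in>B. (x \<bullet> b) *\<^sub>R b) = x)"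

lemma frameD: "frame B \<Longrightarrow> finite B" "frame B \<Longrightarrow> (\<Sum>b\<in>B. (x \<bullet> b) *\<^sub>R b) = x"
  by (auto simp: frame_def)

text \<open>An orthogonal spanning set without 0 becomes an orthonormal basis by normalisation, and
  orthonormal bases are Parseval frames. The expansion is verified by induction over the span, one
  scaled basis vector at a time.\<close>

lemma frame_exists:
  fixes B :: "'v::real_inner set"
  assumes "finite B" "span B = UNIV"
  shows "\<exists>C::'v set. frame C"
proof -
  obtain C0 where C0: "finite C0" "span C0 = (UNIV :: 'v set)" "pairwise orthogonal C0"
    using basis_orthogonal[OF assms(1)] assms(2) by auto
  define C1 where "C1 = C0 - {0}"
  have C1: "finite C1" "span C1 = (UNIV :: 'v set)" "pairwise orthogonal C1" "0 \<notin> C1"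
    using C0 unfolding C1_def by (auto simp: pairwise_def)
  define n where "n b = b /\<^sub>R norm b" for b :: 'v
  have inj: "inj_on n C1"
  proof (rule inj_onI, rule ccontr)
    fix x y assume xy: "x \<in> C1" "y \<in> C1" "n x = n y" "x \<noteq> y"
    then have "x \<bullet> y = 0" "norm x \<noteq> 0" "norm y \<noteq> 0"
      using C1 by (auto simp: pairwise_def orthogonal_def)
    then have "n x \<bullet> n y = 0" by (simp add: n_def)
    then have "n x \<bullet> n x = 0" using xy by simp
    with \<open>norm x \<noteq> 0\<close> show False by (simp add: n_def)
  qed
  have 1: "(\<Sum>b\<in>n ` C1. (x \<bullet> b) *\<^sub>R b) = (\<Sum>b\<in>C1. (x \<bullet> n b) *\<^sub>R n b)" for x
    by (simp add: sum.reindex[OF inj])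
  have "(\<Sum>b\<in>n ` C1. (x \<bullet> b) *\<^sub>R b) = x" for x
  proof -
    have "x \<in> span C1" using C1 by simp
    then show ?thesis
    proof (induction rule: span_induct_alt)
      case base
      then show ?case by simp
    next
      case (step c x y)
      have "(\<Sum>b\<in>C1. (x \<bullet> n b) *\<^sub>R n b) = (\<Sum>b\<in>C1. if b = x then x else 0)"
      proof (rule sum.cong[OF refl])
        fix b assume b: "b \<in> C1"
        show "(x \<bullet> n b) *\<^sub>R n b = (if b = x then x else 0)"
        proof (cases "b = x")
          case True
          then have "norm x \<noteq> 0" using C1 step by auto
          then show ?thesis using True
            by (simp add: n_def norm_eq_sqrt_inner field_simps)
        next
          case False
          then have "x \<bullet> b = 0" using C1 step b by (auto simp: pairwise_def orthogonal_def)
          then show ?thesis using False by (simp add: n_def)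
        qed
      qed
      also have "\<dots> = x" using C1 step by simp
      finally show ?case using step unfolding 1
        by (simp add: inner_add_left scaleR_add_left sum.distrib scaleR_sum_right[symmetric]
            flip: scaleR_scaleR)
    qed
  qed
  then have "frame (n ` C1)" using C1 by (simp add: frame_def)
  then show ?thesis by blast
qed

text \<open>The two frames are placed on the axes. If both contain 0, its copies coincide; removing
  0 from \<open>B\<close> makes the union disjoint and leaves the expansion unchanged.\<close>

lemma frame_Times:
  fixes B :: "'v::real_inner set" and C :: "'w::real_inner set"
  assumes "frame B" "frame C"
  shows "\<exists>D :: ('v \<times> 'w) set. frame D"
proof -
  note f = frameD[OF assms(1)] frameD[OF assms(2)]
  define D where "D = (\<lambda>b. (b, 0::'w)) ` (B - {0}) \<union> (\<lambda>c. (0::'v, c)) ` C"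
  have B': "(\<Sum>b\<in>B - {0}. (x \<bullet> b) *\<^sub>R b) = x" for x :: 'v
    using f(2)[of x] f(1) by (subst sum.mono_neutral_left[of B]) auto
  have "(\<Sum>b\<in>D. (z \<bullet> b) *\<^sub>R b) = z" for z :: "'v \<times> 'w"
  proof -
    have "(\<Sum>b\<in>D. (z \<bullet> b) *\<^sub>R b) = (\<Sum>b\<in>(\<lambda>b. (b, 0::'w)) ` (B - {0}). (z \<bullet> b) *\<^sub>R b)
        + (\<Sum>b\<in>(\<lambda>c. (0::'v, c)) ` C. (z \<bullet> b) *\<^sub>R b)"
      unfolding D_def using f by (subst sum.union_disjoint) auto
    also have "\<dots> = (\<Sum>b\<in>B - {0}. (z \<bullet> (b, 0)) *\<^sub>R (b, 0)) + (\<Sum>c\<in>C. (z \<bullet> (0, c)) *\<^sub>R (0, c))"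
      by (subst (1 2) sum.reindex) (auto simp: inj_on_def)
    also have "\<dots> = (\<Sum>b\<in>B - {0}. (fst z \<bullet> b) *\<^sub>R b, \<Sum>c\<in>C. (snd z \<bullet> c) *\<^sub>R c)"
      by (cases z) (simp add: prod_eq_iff fst_sum snd_sum inner_prod_def)
    also have "\<dots> = z" using B' f by simp
    finally show ?thesis .
  qed
  moreover have "finite D" using f by (simp add: D_def)
  ultimately show ?thesis unfolding frame_def by blast
qed

lemma frame_real: "frame {1::real}"
  by (simp add: frame_def)

section \<open>Linear maps, compactness and completeness in terms of a frame\<close>

lemma frame_riesz:
  fixes B :: "'v::real_inner set" and f :: "'v \<Rightarrow> real"
  assumes "frame B" "linear f"
  shows "f x = x \<bullet> (\<Sum>b\<in>B. f b *\<^sub>R b)"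
proof -
  have "f x = f (\<Sum>b\<in>B. (x \<bullet> b) *\<^sub>R b)" using frameD(2)[OF assms(1)] by simp
  also have "\<dots> = (\<Sum>b\<in>B. (x \<bullet> b) * f b)"
    by (simp add: linear_sum[OF assms(2)] linear_scale[OF assms(2)])
  finally show ?thesis by (simp add: inner_sum_right mult.commute)
qed

text \<open>\<open>smooth_on\<close> controls a derivative only direction by direction; the finitely
  many directions of the frame suffice to control its norm.\<close>

lemma frame_linear_bound:
  fixes B :: "'v::real_inner set" and f :: "'v \<Rightarrow> 'w::real_normed_vector"
  assumes "frame B" "linear f" "\<And>b. b \<in> B \<Longrightarrow> norm (f b) \<le> e"
  shows "norm (f x) \<le> e * (\<Sum>b\<in>B. norm b) * norm x"
proof -
  have "f x = f (\<Sum>b\<in>B. (x \<bullet> b) *\<^sub>R b)" using frameD(2)[OF assms(1)] by simp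
  also have "\<dots> = (\<Sum>b\<in>B. (x \<bullet> b) *\<^sub>R f b)"
    by (simp add: linear_sum[OF assms(2)] linear_scale[OF assms(2)])
  finally have "norm (f x) \<le> (\<Sum>b\<in>B. \<bar>x \<bullet> b\<bar> * norm (f b))"
    by (simp add: sum_norm_le)
  also have "\<dots> \<le> (\<Sum>b\<in>B. (norm x * norm b) * e)"
    using assms(3) Cauchy_Schwarz_ineq2 by (intro sum_mono mult_mono) auto
  also have "\<dots> = e * (\<Sum>b\<in>B. norm b) * norm x"
    by (simp add: sum_distrib_left sum_distrib_right algebra_simps)
  finally show ?thesis .
qed

lemma frame_bounded_linear:
  fixes B :: "'v::real_inner set" and f :: "'v \<Rightarrow> 'w::real_normed_vector"
  assumes B: "frame B" and f: "linear f"
  shows "bounded_linear f"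
proof -
  have "norm (f b) \<le> (\<Sum>b\<in>B. norm (f b))" if "b \<in> B" for b
    using that frameD(1)[OF B] by (intro member_le_sum) auto
  from frame_linear_bound[OF B f this]
  have "\<forall>x. norm (f x) \<le> norm x * ((\<Sum>b\<in>B. norm (f b)) * (\<Sum>b\<in>B. norm b))"
    by (simp add: mult.commute)
  then show ?thesis
    using f by (auto simp: bounded_linear_def bounded_linear_axioms_def)
qed

text \<open>The set is a finite Minkowski sum of compact segments. When \<open>B\<close> is a frame
  and \<open>R\<close> is large it contains a given bounded set, with the coefficients
  \<open>x \<bullet> b\<close>; this is the way to Heine-Borel.\<close>

lemma compact_box_combinations:
  fixes B :: "'v::real_normed_vector set"
  assumes "finite B"
  shows "compact {\<Sum>b\<in>B. c b *\<^sub>R b | c. \<forall>b\<in>B. \<bar>c b\<bar> \<le> R}"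
  using assms
proof (induction B)
  case (insert b B)
  have eq: "{\<Sum>b\<in>insert b B. c b *\<^sub>R b | c. \<forall>b\<in>insert b B. \<bar>c b\<bar> \<le> R} =
     {x + y | x y. x \<in> (\<lambda>t. t *\<^sub>R b) ` {-R..R} \<and> y \<in> {\<Sum>b\<in>B. c b *\<^sub>R b | c. \<forall>b\<in>B. \<bar>c b\<bar> \<le> R}}"
    (is "?L = ?R")
  proof (intro equalityI subsetI)
    fix x assume "x \<in> ?L"
    then obtain c where "x = (\<Sum>b\<in>insert b B. c b *\<^sub>R b)" "\<forall>b\<in>insert b B. \<bar>c b\<bar> \<le> R" by blast
    then have "x = c b *\<^sub>R b + (\<Sum>b\<in>B. c b *\<^sub>R b)" "c b \<in> {-R..R}" "\<forall>b\<in>B. \<bar>c b\<bar> \<le> R"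
      using insert by auto
    then show "x \<in> ?R" by blast
  next
    fix x assume "x \<in> ?R"
    then obtain t c where tc: "x = t *\<^sub>R b + (\<Sum>b\<in>B. c b *\<^sub>R b)" "t \<in> {-R..R}"
      "\<forall>b\<in>B. \<bar>c b\<bar> \<le> R" by blast
    let ?c = "c(b := t)"
    have "x = (\<Sum>b\<in>insert b B. ?c b *\<^sub>R b)"
      using tc insert by (simp, intro sum.cong) auto
    moreover have "\<forall>b\<in>insert b B. \<bar>?c b\<bar> \<le> R" using tc by auto
    ultimately show "x \<in> ?L" by blast
  qed
  show ?case unfolding eq
    by (rule compact_sums[OF compact_continuous_image insert.IH])
      (auto intro!: continuous_intros)
qed auto

lemma frame_compact:
  fixes B S :: "'v::real_inner set"
  assumes B: "frame B" and S: "closed S" "bounded S"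
  shows "compact S"
proof -
  obtain R where R: "\<And>x. x \<in> S \<Longrightarrow> norm x \<le> R" using S(2) by (auto simp: bounded_iff)
  define M where "M = (\<Sum>b\<in>B. norm b)"
  have "S \<subseteq> {\<Sum>b\<in>B. c b *\<^sub>R b | c. \<forall>b\<in>B. \<bar>c b\<bar> \<le> R * M}"
  proof
    fix x assume x: "x \<in> S"
    have "\<bar>x \<bullet> b\<bar> \<le> R * M" if "b \<in> B" for b
    proof -
      have "norm b \<le> M" unfolding M_def
        using that frameD(1)[OF B] by (intro member_le_sum) auto
      then have "norm x * norm b \<le> R * M"
        using R[OF x] by (intro mult_mono) (auto intro: order_trans[OF norm_ge_zero])
      then show ?thesis using Cauchy_Schwarz_ineq2[of x b] by linarith
    qed
    then show "x \<in> {\<Sum>b\<in>B. c b *\<^sub>R b | c. \<forall>b\<in>B. \<bar>c b\<bar> \<le> R * M}"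
      using frameD(2)[OF B, of x] by (intro CollectI exI[of _ "\<lambda>b. x \<bullet> b"]) auto
  qed
  then have "S = S \<inter> {\<Sum>b\<in>B. c b *\<^sub>R b | c. \<forall>b\<in>B. \<bar>c b\<bar> \<le> R * M}" by blast
  moreover have "compact \<dots>"
    using S compact_box_combinations[OF frameD(1)[OF B]] by (intro closed_Int_compact) auto
  ultimately show ?thesis by simp
qed

lemma frame_Cauchy_convergent:
  fixes B :: "'v::real_inner set" and X :: "nat \<Rightarrow> 'v"
  assumes B: "frame B" and X: "Cauchy X"
  shows "\<exists>l. X \<longlonglongrightarrow> l"
proof -
  have "bounded (range X)" by (rule cauchy_imp_bounded[OF X])
  then have "compact (closure (range X))"
    by (intro frame_compact[OF B]) auto
  then have "complete (closure (range X))" by (rule compact_imp_complete)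
  moreover have "\<forall>n. X n \<in> closure (range X)" by (simp add: closure_subset[THEN subsetD])
  ultimately show ?thesis using X unfolding complete_def by blast
qed

subsection \<open>Strict differentiability\<close>

lemma smooth_onD:
  assumes "smooth_on S f" "x \<in> S"
  shows "(f has_derivative frechet_derivative f (at x)) (at x)"
proof -
  have "differentiable_times_on (Suc 0) S f" using assms unfolding smooth_on_def by blast
  then show ?thesis using assms(2) by (simp add: frechet_derivative_works)
qed

lemma smooth_on_continuous: "smooth_on S f \<Longrightarrow> continuous_on S f"
  unfolding smooth_on_def using differentiable_times_on.simps(1) by blast

lemma smooth_on_derivative:
  "smooth_on S f \<Longrightarrow> smooth_on S (\<lambda>x. frechet_derivative f (at x) v)"
  unfolding smooth_on_def using differentiable_times_on.simps(2) by blast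

text \<open>The directional derivatives along the frame are continuous at \<open>x0\<close>, so the
  derivative is close to its value there in operator norm, and the mean value inequality applies to
  \<open>f\<close> minus its linearisation. Having two free points in the estimate is what Lipschitz
  bounds and the comparison of orbits require.\<close>

lemma smooth_on_strict:
  fixes B :: "'v::real_inner set" and f :: "'v \<Rightarrow> 'w::real_normed_vector"
  assumes B: "frame B" and S: "open S" "x0 \<in> S" and f: "smooth_on S f" and "\<eta> > 0"
  shows "\<exists>\<delta>>0. ball x0 \<delta> \<subseteq> S \<and> (\<forall>x\<in>ball x0 \<delta>. \<forall>y\<in>ball x0 \<delta>.
     norm (f y - f x - frechet_derivative f (at x0) (y - x)) \<le> \<eta> * norm (y - x))"
proof -
  let ?D = "\<lambda>x. frechet_derivative f (at x)"
  define M where "M = (\<Sum>b\<in>B. norm b)"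
  have M: "M \<ge> 0" by (simp add: M_def sum_nonneg)
  \<comment> \<open>The summand 1 keeps the quotient meaningful when \<open>M\<close> is 0, as for a
    zero-dimensional model.\<close>
  define e where "e = \<eta> / (M + 1)"
  have e: "e > 0" using M \<open>\<eta> > 0\<close> by (simp add: e_def)
  have eM: "e * M \<le> \<eta>" using M \<open>\<eta> > 0\<close> by (simp add: e_def field_simps)
  have "\<exists>d>0. \<forall>y. dist y x0 < d \<longrightarrow> dist (?D y b) (?D x0 b) < e" for b
  proof -
    have "continuous_on S (\<lambda>x. ?D x b)"
      using smooth_on_continuous smooth_on_derivative f by blast
    then have "isCont (\<lambda>x. ?D x b) x0" using S by (simp add: continuous_on_eq_continuous_at)
    then show ?thesis using e unfolding continuous_at_eps_delta by blast
  qed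
  then obtain d where d: "\<And>b. d b > 0" "\<And>b y. dist y x0 < d b \<Longrightarrow> dist (?D y b) (?D x0 b) < e"
    by metis
  obtain r where r: "r > 0" "ball x0 r \<subseteq> S" using S open_contains_ball by blast
  define \<delta> where "\<delta> = Min (insert r (d ` B))"
  have \<delta>: "\<delta> > 0" "\<delta> \<le> r" "\<And>b. b \<in> B \<Longrightarrow> \<delta> \<le> d b"
    using frameD(1)[OF B] r d by (auto simp: \<delta>_def)
  have sub: "ball x0 \<delta> \<subseteq> S" using r \<delta> by auto
  have der: "(f has_derivative ?D x) (at x)" if "x \<in> ball x0 \<delta>" for x
    using smooth_onD[OF f] that sub by blast
  have lin: "linear (?D x)" if "x \<in> ball x0 \<delta>" for x
    using der[OF that] has_derivative_linear by blast
  have x0: "x0 \<in> ball x0 \<delta>" using \<delta> by simp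
  have "norm (f y - f x - ?D x0 (y - x)) \<le> \<eta> * norm (y - x)"
    if xy: "x \<in> ball x0 \<delta>" "y \<in> ball x0 \<delta>" for x y
  proof -
    have "norm ((f y - ?D x0 y) - (f x - ?D x0 x)) \<le> \<eta> * norm (y - x)"
    proof (rule differentiable_bound[where S = "ball x0 \<delta>" and f' = "\<lambda>x h. ?D x h - ?D x0 h"])
      fix x assume x: "x \<in> ball x0 \<delta>"
      show "((\<lambda>x. f x - ?D x0 x) has_derivative (\<lambda>h. ?D x h - ?D x0 h)) (at x within ball x0 \<delta>)"
        by (intro has_derivative_diff has_derivative_at_withinI[OF der[OF x]]
            bounded_linear.has_derivative[OF has_derivative_bounded_linear[OF der[OF x0]]]
            has_derivative_ident)
      show "onorm (\<lambda>h. ?D x h - ?D x0 h) \<le> \<eta>"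
      proof (rule onorm_bound)
        fix h
        have "norm (?D x h - ?D x0 h) \<le> e * (\<Sum>b\<in>B. norm b) * norm h"
        proof (rule frame_linear_bound[OF B])
          show "linear (\<lambda>h. ?D x h - ?D x0 h)"
            using lin[OF x] lin[OF x0] by (rule linear_compose_sub)
          show "norm (?D x b - ?D x0 b) \<le> e" if "b \<in> B" for b
            using d(2)[of x b] \<delta>(3)[OF that] x by (auto simp: dist_norm norm_minus_commute)
        qed
        also have "\<dots> \<le> \<eta> * norm h" using eM by (intro mult_right_mono) (auto simp: M_def)
        finally show "norm (?D x h - ?D x0 h) \<le> \<eta> * norm h" .
      qed (use \<open>\<eta> > 0\<close> in simp)
    qed (use xy in auto)
    then show ?thesis
      unfolding linear_diff[OF lin[OF x0]] by (simp add: algebra_simps)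
  qed
  with sub \<delta> show ?thesis by blast
qed

text \<open>The second difference is \<open>G s - G 0\<close> for the increment \<open>G\<close> of
  \<open>f\<close> in direction \<open>w\<close>. The mean value theorem turns it into
  \<open>s\<close> times an increment of the derivative in direction \<open>u\<close>, and strict
  differentiability of that derivative makes the increment linear in \<open>s *\<^sub>R w\<close> up
  to a small multiple of \<open>s\<close>.\<close>

lemma second_difference_estimate:
  fixes B :: "'v::real_inner set" and f :: "'v \<Rightarrow> real"
  assumes B: "frame B" and S: "open S" "x0 \<in> S" and f: "smooth_on S f" and "\<eta> > 0"
  shows "\<exists>d>0. \<forall>s. 0 < s \<and> s < d \<longrightarrow>
    \<bar>f (x0 + s *\<^sub>R u + s *\<^sub>R w) - f (x0 + s *\<^sub>R u) - f (x0 + s *\<^sub>R w) + f x0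
      - s\<^sup>2 * frechet_derivative (\<lambda>y. frechet_derivative f (at y) u) (at x0) w\<bar> \<le> s\<^sup>2 * \<eta>"
proof -
  let ?h = "\<lambda>y. frechet_derivative f (at y) u"
  let ?A = "frechet_derivative ?h (at x0)"
  have sh: "smooth_on S ?h" by (rule smooth_on_derivative[OF f])
  define e where "e = \<eta> / (norm w + 1)"
  have "norm w + 1 > 0" using norm_ge_zero[of w] by linarith
  then have e: "e > 0" "e * norm w \<le> \<eta>" using \<open>\<eta> > 0\<close> by (auto simp: e_def field_simps)
  obtain \<delta> where \<delta>: "\<delta> > 0" "ball x0 \<delta> \<subseteq> S"
    and st: "\<And>x y. x \<in> ball x0 \<delta> \<Longrightarrow> y \<in> ball x0 \<delta> \<Longrightarrow> norm (?h y - ?h x - ?A (y - x)) \<le> e * norm (y - x)"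
    using smooth_on_strict[OF B S sh e(1)] by blast
  \<comment> \<open>For \<open>s < d\<close> the parallelogram spanned by
    \<open>s *\<^sub>R u\<close> and \<open>s *\<^sub>R w\<close> at \<open>x0\<close> stays in the
    ball.\<close>
  define d where "d = \<delta> / (norm u + norm w + 1)"
  have pos: "norm u + norm w + 1 > 0" by (simp add: add_nonneg_pos)
  have d: "d > 0" using \<delta> pos by (simp add: d_def)
  have lin: "linear ?A" using smooth_onD[OF sh S(2)] has_derivative_linear by blast
  have "\<bar>f (x0 + s *\<^sub>R u + s *\<^sub>R w) - f (x0 + s *\<^sub>R u) - f (x0 + s *\<^sub>R w) + f x0 - s\<^sup>2 * ?A w\<bar> \<le> s\<^sup>2 * \<eta>"
    if s: "0 < s" "s < d" for s
  proof -
    have sb: "s * (norm u + norm w) < \<delta>"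
    proof -
      have "s * (norm u + norm w + 1) < \<delta>" using s pos by (simp add: d_def field_simps)
      then show ?thesis using s by (simp add: algebra_simps)
    qed
    have inb: "x0 + r *\<^sub>R u + q *\<^sub>R w \<in> ball x0 \<delta>" if "0 \<le> r" "r \<le> s" "0 \<le> q" "q \<le> s" for r q
    proof -
      have "norm (r *\<^sub>R u + q *\<^sub>R w) \<le> r * norm u + q * norm w"
        using that norm_triangle_ineq[of "r *\<^sub>R u" "q *\<^sub>R w"] by simp
      also have "\<dots> \<le> s * norm u + s * norm w"
        using that by (intro add_mono mult_right_mono) auto
      finally show ?thesis using sb by (simp add: dist_norm algebra_simps norm_minus_commute)
    qed
    define G where "G r = f (x0 + r *\<^sub>R u + s *\<^sub>R w) - f (x0 + r *\<^sub>R u)" for r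
    have dG: "DERIV G r :> ?h (x0 + r *\<^sub>R u + s *\<^sub>R w) - ?h (x0 + r *\<^sub>R u)" if "0 \<le> r" "r \<le> s" for r
    proof -
      have "DERIV (\<lambda>r. f (x0 + r *\<^sub>R u + q *\<^sub>R w)) r :> ?h (x0 + r *\<^sub>R u + q *\<^sub>R w)"
        if "0 \<le> q" "q \<le> s" for q
      proof -
        have inS: "x0 + r *\<^sub>R u + q *\<^sub>R w \<in> S" using inb[of r q] that \<open>0 \<le> r\<close> \<open>r \<le> s\<close> \<delta> by blast
        from smooth_onD[OF f inS]
        have "((\<lambda>r. f (x0 + r *\<^sub>R u + q *\<^sub>R w)) has_derivative
          (\<lambda>h. frechet_derivative f (at (x0 + r *\<^sub>R u + q *\<^sub>R w)) (h *\<^sub>R u))) (at r)"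
          by (rule has_derivative_compose[rotated]) (auto intro!: derivative_eq_intros)
        moreover have "linear (frechet_derivative f (at (x0 + r *\<^sub>R u + q *\<^sub>R w)))"
          using smooth_onD[OF f inS] has_derivative_linear by blast
        ultimately show ?thesis
          unfolding has_field_derivative_def by (simp add: linear_scale mult_commute_abs)
      qed
      from this[of s] this[of 0] s show ?thesis unfolding G_def
        by (intro DERIV_diff) auto
    qed
    from MVT2[OF s(1) dG] obtain r where r: "0 < r" "r < s"
      "G s - G 0 = s * (?h (x0 + r *\<^sub>R u + s *\<^sub>R w) - ?h (x0 + r *\<^sub>R u))" by auto
    have "\<bar>?h (x0 + r *\<^sub>R u + s *\<^sub>R w) - ?h (x0 + r *\<^sub>R u) - ?A (s *\<^sub>R w)\<bar> \<le> e * norm (s *\<^sub>R w)"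
      using st[OF inb[of r 0] inb[of r s]] r s by simp
    then have "s * \<bar>?h (x0 + r *\<^sub>R u + s *\<^sub>R w) - ?h (x0 + r *\<^sub>R u) - s * ?A w\<bar> \<le> s * (s * (e * norm w))"
      using s linear_scale[OF lin, of s w] by (intro mult_left_mono) (auto simp: mult.left_commute)
    also have "\<dots> \<le> s * (s * \<eta>)" using s e by (intro mult_left_mono) auto
    finally have "\<bar>s * (?h (x0 + r *\<^sub>R u + s *\<^sub>R w) - ?h (x0 + r *\<^sub>R u) - s * ?A w)\<bar> \<le> s\<^sup>2 * \<eta>"
      using s by (simp add: abs_mult power2_eq_square mult.assoc)
    then show ?thesis using r(3) by (simp add: G_def algebra_simps power2_eq_square)
  qed
  with d show ?thesis by blast
qed

text \<open>The second difference is symmetric in \<open>u\<close> and \<open>w\<close>; divided by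
  the square of \<open>s\<close>, it is within \<open>e / 2\<close> of either mixed
  derivative.\<close>

lemma second_derivative_symmetric_real:
  fixes B :: "'v::real_inner set" and f :: "'v \<Rightarrow> real"
  assumes B: "frame B" and S: "open S" "x0 \<in> S" and f: "smooth_on S f"
  shows "frechet_derivative (\<lambda>y. frechet_derivative f (at y) u) (at x0) w =
    frechet_derivative (\<lambda>y. frechet_derivative f (at y) w) (at x0) u" (is "?a = ?b")
proof -
  have "\<bar>?a - ?b\<bar> \<le> e" if "e > 0" for e
  proof -
    from that have "e / 2 > 0" by simp
    from second_difference_estimate[OF B S f this, of u w]
      second_difference_estimate[OF B S f this, of w u]
    obtain d1 d2 where d: "d1 > 0" "d2 > 0"
      and 1: "\<And>s. 0 < s \<Longrightarrow> s < d1 \<Longrightarrow>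
    \<bar>f (x0 + s *\<^sub>R u + s *\<^sub>R w) - f (x0 + s *\<^sub>R u) - f (x0 + s *\<^sub>R w) + f x0 - s\<^sup>2 * ?a\<bar> \<le> s\<^sup>2 * (e/2)"
      and 2: "\<And>s. 0 < s \<Longrightarrow> s < d2 \<Longrightarrow>
    \<bar>f (x0 + s *\<^sub>R w + s *\<^sub>R u) - f (x0 + s *\<^sub>R w) - f (x0 + s *\<^sub>R u) + f x0 - s\<^sup>2 * ?b\<bar> \<le> s\<^sup>2 * (e/2)"
      by blast
    define s where "s = min d1 d2 / 2"
    have s: "0 < s" "s < d1" "s < d2" using d by (auto simp: s_def)
    from 1[OF s(1,2)] 2[OF s(1,3)]
    have "\<bar>s\<^sup>2 * ?a - s\<^sup>2 * ?b\<bar> \<le> s\<^sup>2 * (e/2) + s\<^sup>2 * (e/2)"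
      unfolding add.assoc add.commute[of "s *\<^sub>R w" "s *\<^sub>R u"] by linarith
    moreover have "s\<^sup>2 * (e/2) + s\<^sup>2 * (e/2) = s\<^sup>2 * e" by simp
    ultimately have "s\<^sup>2 * \<bar>?a - ?b\<bar> \<le> s\<^sup>2 * e"
      unfolding right_diff_distrib[symmetric] abs_mult by (simp only: abs_power2)
    then show ?thesis using s by (simp add: mult_le_cancel_left)
  qed
  then have "\<bar>?a - ?b\<bar> \<le> 0" using field_le_epsilon[of "\<bar>?a - ?b\<bar>" 0] by simp
  then show ?thesis by simp
qed

section \<open>Closure properties of smooth maps\<close>

lemma frechet_derivative_bounded_linear:
  assumes "f differentiable (at x)" "bounded_linear L"
  shows "frechet_derivative (\<lambda>x. L (f x)) (at x) u = L (frechet_derivative f (at x) u)"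
proof -
  have "((\<lambda>x. L (f x)) has_derivative (\<lambda>u. L (frechet_derivative f (at x) u))) (at x)"
    by (rule bounded_linear.has_derivative[OF assms(2) assms(1)[unfolded frechet_derivative_works]])
  from fun_cong[OF frechet_derivative_at[OF this, symmetric]] show ?thesis .
qed

lemmas frechet_derivative_inner = frechet_derivative_bounded_linear[OF _ bounded_linear_inner_left]

text \<open>\<open>frechet_derivative\<close> is a choice among all derivatives, and the two
  functions have the same ones; the equality therefore also covers points where neither is
  differentiable.\<close>

lemma frechet_derivative_cong_open:
  assumes "open S" "x \<in> S" "\<And>y. y \<in> S \<Longrightarrow> f y = g y"
  shows "frechet_derivative f (at x) = frechet_derivative g (at x)"
proof -
  have "(f has_derivative D) (at x) = (g has_derivative D) (at x)" for D
    using has_derivative_transform_within_open[OF _ assms(1,2), of f D UNIV g]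
      has_derivative_transform_within_open[OF _ assms(1,2), of g D UNIV f] assms(3) by auto
  then show ?thesis by (simp add: frechet_derivative_def)
qed

lemma differentiable_times_on_cong:
  assumes "open S"
  shows "(\<And>y. y \<in> S \<Longrightarrow> f y = g y) \<Longrightarrow> differentiable_times_on k S f \<Longrightarrow> differentiable_times_on k S g"
proof (induction k arbitrary: f g)
  case 0
  then show ?case by (simp cong: continuous_on_cong)
next
  case (Suc k)
  have fd: "frechet_derivative f (at x) = frechet_derivative g (at x)" if "x \<in> S" for x
    using frechet_derivative_cong_open[OF assms that] Suc.prems(1) by blast
  have "g differentiable (at x)" if "x \<in> S" for x
  proof -
    have "(f has_derivative frechet_derivative f (at x)) (at x)"
      using Suc.prems(2) that by (simp add: frechet_derivative_works)
    then have "(g has_derivative frechet_derivative f (at x)) (at x)"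
      using has_derivative_transform_within_open[OF _ assms that] Suc.prems(1) by blast
    then show ?thesis by (auto simp: differentiable_def)
  qed
  moreover have "differentiable_times_on k S (\<lambda>x. frechet_derivative g (at x) v)" for v
    using Suc.IH[of "\<lambda>x. frechet_derivative f (at x) v" "\<lambda>x. frechet_derivative g (at x) v"]
      Suc.prems(2) fd by simp
  ultimately show ?case by simp
qed

lemma smooth_on_bounded_linear:
  assumes S: "open S" and L: "bounded_linear L" and f: "smooth_on S f"
  shows "smooth_on S (\<lambda>x. L (f x))"
proof -
  have "differentiable_times_on n S f \<Longrightarrow> differentiable_times_on n S (\<lambda>x. L (f x))" for n f
  proof (induction n arbitrary: f)
    case 0
    then show ?case by (auto intro!: bounded_linear.continuous_on[OF L])
  next
    case (Suc n)
    have d: "f differentiable at x" if "x \<in> S" for x using Suc.prems that by simp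
    have "(\<lambda>x. L (f x)) differentiable at x" if "x \<in> S" for x
      using d[OF that] unfolding differentiable_def
      by (blast intro: bounded_linear.has_derivative[OF L])
    moreover have "differentiable_times_on n S (\<lambda>x. frechet_derivative (\<lambda>x. L (f x)) (at x) v)" for v
    proof (rule differentiable_times_on_cong[OF S])
      show "differentiable_times_on n S (\<lambda>x. L (frechet_derivative f (at x) v))"
        using Suc by simp
      show "L (frechet_derivative f (at x) v) = frechet_derivative (\<lambda>x. L (f x)) (at x) v"
        if "x \<in> S" for x
        using frechet_derivative_bounded_linear[OF d[OF that] L] by metis
    qed
    ultimately show ?case by simp
  qed
  with f show ?thesis unfolding smooth_on_def by blast
qed

lemmas smooth_on_inner = smooth_on_bounded_linear[OF _ bounded_linear_inner_left]

lemma smooth_on_add: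
  assumes S: "open S" and f: "smooth_on S f" and g: "smooth_on S g"
  shows "smooth_on S (\<lambda>x. f x + g x)"
proof -
  have "differentiable_times_on n S f \<Longrightarrow> differentiable_times_on n S g \<Longrightarrow>
    differentiable_times_on n S (\<lambda>x. f x + g x)" for n f g
  proof (induction n arbitrary: f g)
    case 0
    then show ?case by (auto intro!: continuous_intros)
  next
    case (Suc n)
    have d: "((\<lambda>x. f x + g x) has_derivative (\<lambda>v. frechet_derivative f (at x) v + frechet_derivative g (at x) v)) (at x)"
      if "x \<in> S" for x using Suc.prems that
      by (intro has_derivative_add) (simp_all add: frechet_derivative_works)
    have "differentiable_times_on n S (\<lambda>x. frechet_derivative (\<lambda>x. f x + g x) (at x) v)" for v
    proof (rule differentiable_times_on_cong[OF S])
      show "differentiable_times_on n S (\<lambda>x. frechet_derivative f (at x) v + frechet_derivative g (at x) v)"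
        using Suc by simp
      show "frechet_derivative f (at x) v + frechet_derivative g (at x) v = frechet_derivative (\<lambda>x. f x + g x) (at x) v"
        if "x \<in> S" for x
        using frechet_derivative_at[OF d[OF that]] by metis
    qed
    then show ?case using d by (auto simp: differentiable_def)
  qed
  with f g show ?thesis unfolding smooth_on_def by blast
qed

lemma smooth_on_const: "smooth_on S (\<lambda>x::'a::real_normed_vector. c::'b::real_normed_vector)"
proof -
  have "differentiable_times_on n S (\<lambda>x::'a. c)" for n and c :: 'b
    by (induction n arbitrary: c) auto
  then show ?thesis unfolding smooth_on_def by blast
qed

lemma smooth_on_sum:
  assumes "open S" "\<And>i. i \<in> I \<Longrightarrow> smooth_on S (f i)"
  shows "smooth_on S (\<lambda>x. \<Sum>i\<in>I. f i x)"
  using assms(2)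
proof (induction I rule: infinite_finite_induct)
  case (insert i I)
  then show ?case by (simp add: smooth_on_add[OF assms(1)])
qed (simp_all add: smooth_on_const)

lemma second_derivative_symmetric:
  fixes B :: "'v::real_inner set" and f :: "'v \<Rightarrow> 'w::real_inner"
  assumes B: "frame B" and S: "open S" "x0 \<in> S" and f: "smooth_on S f"
  shows "frechet_derivative (\<lambda>y. frechet_derivative f (at y) u) (at x0) w =
    frechet_derivative (\<lambda>y. frechet_derivative f (at y) w) (at x0) u"
proof -
  have *: "frechet_derivative (\<lambda>y. frechet_derivative (\<lambda>x. f x \<bullet> k) (at y) u) (at x0) w =
    frechet_derivative (\<lambda>y. frechet_derivative f (at y) u) (at x0) w \<bullet> k" for k u w
  proof -
    have d: "f differentiable at x" "(\<lambda>y. frechet_derivative f (at y) u) differentiable at x" if "x \<in> S" for x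
      using smooth_onD[OF f that] smooth_onD[OF smooth_on_derivative[OF f] that]
      by (auto simp: differentiable_def)
    have "frechet_derivative (\<lambda>y. frechet_derivative (\<lambda>x. f x \<bullet> k) (at y) u) (at x0) =
       frechet_derivative (\<lambda>y. frechet_derivative f (at y) u \<bullet> k) (at x0)"
      by (rule frechet_derivative_cong_open[OF S]) (rule frechet_derivative_inner[OF d(1)])
    then show ?thesis by (simp add: frechet_derivative_inner[OF d(2)[OF S(2)]])
  qed
  show ?thesis
    using second_derivative_symmetric_real[OF B S smooth_on_inner[OF S(1) f], of _ u w]
    unfolding * by (metis vector_eq_rdot)
qed

lemma norm_diff_le_add:
  fixes a b :: "'v::real_normed_vector"
  shows "norm a \<le> x \<Longrightarrow> norm b \<le> y \<Longrightarrow> norm (a - b) \<le> x + y"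
  using norm_triangle_ineq4[of a b] by linarith

lemma small_factor:
  assumes "e > 0" "Q \<ge> (0::real)"
  shows "e / (Q + 1) > 0" "e / (Q + 1) * Q \<le> e"
proof -
  show 1: "e / (Q + 1) > 0" using assms by (simp add: add_nonneg_pos)
  have "e / (Q + 1) * (Q + 1) = e" using assms by simp
  then have "e / (Q + 1) * Q + e / (Q + 1) = e" by (simp only: distrib_left mult_1_right)
  with 1 show "e / (Q + 1) * Q \<le> e" by linarith
qed

lemma onorm_scaleR_le:
  fixes v :: "'v::real_normed_vector"
  assumes "norm v \<le> c"
  shows "onorm (\<lambda>r. r *\<^sub>R v) \<le> c"
proof (rule onorm_bound)
  show "norm (r *\<^sub>R v) \<le> c * norm r" for r
    using mult_right_mono[OF assms, of "\<bar>r\<bar>"] by (simp add: mult.commute)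
qed (use assms norm_ge_zero[of v] in linarith)

text \<open>Both \<open>D\<close> and \<open>L\<close> approximate the increments of
  \<open>g\<close> at \<open>x\<close>; on a short multiple \<open>r *\<^sub>R v\<close> the errors
  are proportional to \<open>r\<close>, which cancels. With \<open>L\<close> equal to 0 this bounds
  the derivative of a Lipschitz map.\<close>

lemma derivative_norm_diff_le:
  fixes g :: "'v::real_normed_vector \<Rightarrow> 'w::real_normed_vector"
  assumes D: "(g has_derivative D) (at x)" and U: "open U" "x \<in> U" and L: "linear L"
    and le: "\<And>y. y \<in> U \<Longrightarrow> norm (g y - g x - L (y - x)) \<le> e * norm (y - x)"
  shows "norm (D v - L v) \<le> e * norm v"
proof (cases "v = 0")
  case True
  then show ?thesis using L linear_0[OF has_derivative_linear[OF D]] by (simp add: linear_0)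
next
  case False
  have "norm (D v - L v) \<le> e * norm v + d" if "d > 0" for d
  proof -
    define e' where "e' = d / norm v"
    have e': "e' > 0" using that False by (simp add: e'_def)
    obtain \<delta> where \<delta>: "\<delta> > 0" "\<And>y. norm (y - x) < \<delta> \<Longrightarrow> norm (g y - g x - D (y - x)) \<le> e' * norm (y - x)"
      using D e' unfolding has_derivative_at_alt by blast
    obtain \<epsilon> where \<epsilon>: "\<epsilon> > 0" "ball x \<epsilon> \<subseteq> U" using U open_contains_ball by blast
    define r where "r = min \<delta> \<epsilon> / (2 * norm v)"
    have r: "r > 0" using \<delta> \<epsilon> False by (simp add: r_def)
    have nr: "norm (r *\<^sub>R v) < \<delta>" "norm (r *\<^sub>R v) < \<epsilon>"
      using \<delta>(1) \<epsilon>(1) False by (auto simp: r_def)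
    have "x + r *\<^sub>R v \<in> U" using \<epsilon>(2) nr by (auto simp: dist_norm subset_iff)
    from le[OF this] \<delta>(2)[of "x + r *\<^sub>R v"] nr
    have "norm (g (x + r *\<^sub>R v) - g x - L (r *\<^sub>R v)) \<le> e * norm (r *\<^sub>R v)"
      "norm (g (x + r *\<^sub>R v) - g x - D (r *\<^sub>R v)) \<le> e' * norm (r *\<^sub>R v)" by simp_all
    then have "norm ((g (x + r *\<^sub>R v) - g x - L (r *\<^sub>R v)) - (g (x + r *\<^sub>R v) - g x - D (r *\<^sub>R v)))
       \<le> e * norm (r *\<^sub>R v) + e' * norm (r *\<^sub>R v)"
      by (rule norm_diff_le_add)
    moreover have "(g (x + r *\<^sub>R v) - g x - L (r *\<^sub>R v)) - (g (x + r *\<^sub>R v) - g x - D (r *\<^sub>R v)) = r *\<^sub>R (D v - L v)"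
      by (simp add: linear_scale[OF L] linear_scale[OF has_derivative_linear[OF D]] scaleR_diff_right)
    ultimately have "r * norm (D v - L v) \<le> r * (e * norm v + e' * norm v)"
      using r by (simp add: distrib_left mult.left_commute)
    then have "norm (D v - L v) \<le> e * norm v + e' * norm v" using r by simp
    then show ?thesis using False by (simp add: e'_def)
  qed
  then show ?thesis by (rule field_le_epsilon)
qed

text \<open>Strictness near each point of \<open>K\<close> becomes uniform through a Lebesgue number
  of the covering. The centre \<open>z\<close> of the covering ball differs from \<open>x\<close>;
  exchanging its derivative for the one at \<open>x\<close> costs the second
  \<open>\<eta> / 2\<close>.\<close>

lemma smooth_on_strict_compact:
  fixes B :: "'v::real_inner set" and f :: "'v \<Rightarrow> 'w::real_normed_vector"
  assumes B: "frame B" and S: "open S" and K: "compact K" "K \<subseteq> S" and f: "smooth_on S f" and "\<eta> > 0"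
  shows "\<exists>\<delta>>0. \<forall>x\<in>K. \<forall>y\<in>ball x \<delta>. y \<in> S \<and>
     norm (f y - f x - frechet_derivative f (at x) (y - x)) \<le> \<eta> * norm (y - x)"
proof -
  let ?D = "\<lambda>x. frechet_derivative f (at x)"
  have "\<forall>z\<in>K. \<exists>\<delta>>0. ball z \<delta> \<subseteq> S \<and> (\<forall>x\<in>ball z \<delta>. \<forall>y\<in>ball z \<delta>.
     norm (f y - f x - ?D z (y - x)) \<le> (\<eta>/2) * norm (y - x))"
    using smooth_on_strict[OF B S _ f, of _ "\<eta>/2"] K \<open>\<eta> > 0\<close> by auto
  then obtain d where d: "\<And>z. z \<in> K \<Longrightarrow> d z > 0" "\<And>z. z \<in> K \<Longrightarrow> ball z (d z) \<subseteq> S"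
    and st: "\<And>z x y. z \<in> K \<Longrightarrow> x \<in> ball z (d z) \<Longrightarrow> y \<in> ball z (d z) \<Longrightarrow>
      norm (f y - f x - ?D z (y - x)) \<le> (\<eta>/2) * norm (y - x)"
    by metis
  have "K \<subseteq> \<Union>((\<lambda>z. ball z (d z)) ` K)" using d by auto
  from Heine_Borel_lemma[OF K(1) this]
  obtain e where e: "e > 0" "\<And>x. x \<in> K \<Longrightarrow> \<exists>G\<in>(\<lambda>z. ball z (d z)) ` K. ball x e \<subseteq> G" by auto
  have "y \<in> S \<and> norm (f y - f x - ?D x (y - x)) \<le> \<eta> * norm (y - x)" if x: "x \<in> K" and y: "y \<in> ball x e" for x y
  proof -
    obtain z where z: "z \<in> K" "ball x e \<subseteq> ball z (d z)" using e(2)[OF x] by auto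
    have "x \<in> ball x e" using e by simp
    then have xz: "x \<in> ball z (d z)" and yz: "y \<in> ball z (d z)" using z(2) y by blast+
    have linz: "linear (?D z)" using smooth_onD[OF f] has_derivative_linear K z by blast
    have "norm (?D x (y - x) - ?D z (y - x)) \<le> \<eta>/2 * norm (y - x)"
      using derivative_norm_diff_le[OF smooth_onD[OF f] open_ball xz linz st[OF z(1) xz]] K x by blast
    with st[OF z(1) xz yz]
    have "norm ((f y - f x - ?D z (y - x)) - (?D x (y - x) - ?D z (y - x))) \<le> \<eta>/2 * norm (y - x) + \<eta>/2 * norm (y - x)"
      by (rule norm_diff_le_add)
    then show ?thesis using yz d(2)[OF z(1)] by auto
  qed
  with e(1) show ?thesis by blast
qed

section \<open>Dependence of solutions on initial values\<close>

text \<open>The maximum of \<open>norm (u \<tau>)\<close> over the segment, inserted in the mean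
  value inequality, reproduces itself with a factor of at most 1/2 and can be absorbed. The
  absorption doubles the other terms, whence the factors 2.\<close>

lemma short_gronwall:
  fixes u :: "real \<Rightarrow> 'v::real_normed_vector"
  assumes du: "\<And>\<tau>. \<tau> \<in> closed_segment s t \<Longrightarrow> (u has_vector_derivative u' \<tau>) (at \<tau> within closed_segment s t)"
    and le: "\<And>\<tau>. \<tau> \<in> closed_segment s t \<Longrightarrow> norm (u' \<tau>) \<le> C * norm (u \<tau>) + e"
    and C: "\<bar>t - s\<bar> * C \<le> 1/2" "C \<ge> 0" "e \<ge> 0"
    and \<tau>: "\<tau> \<in> closed_segment s t"
  shows "norm (u \<tau>) \<le> 2 * norm (u s) + 2 * \<bar>t - s\<bar> * e"
proof -
  let ?I = "closed_segment s t"
  have cont: "continuous_on ?I (\<lambda>x. norm (u x))"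
    by (intro continuous_on_norm)
      (auto simp: continuous_on_eq_continuous_within intro: has_vector_derivative_continuous du)
  obtain m where m: "m \<in> ?I" "\<And>x. x \<in> ?I \<Longrightarrow> norm (u x) \<le> norm (u m)"
    using continuous_attains_sup[OF compact_segment _ cont] by (metis ends_in_segment(1) empty_iff)
  have "norm (u m - u s) \<le> (C * norm (u m) + e) * norm (m - s)"
  proof (rule differentiable_bound[where S = ?I and f' = "\<lambda>x h. h *\<^sub>R u' x"])
    fix x assume x: "x \<in> ?I"
    show "(u has_derivative (\<lambda>h. h *\<^sub>R u' x)) (at x within ?I)"
      using du[OF x] by (simp add: has_vector_derivative_def)
    have "norm (u' x) \<le> C * norm (u m) + e"
      using le[OF x] m(2)[OF x] C by (meson add_right_mono mult_left_mono order_trans)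
    then show "onorm (\<lambda>h. h *\<^sub>R u' x) \<le> C * norm (u m) + e"
      by (rule onorm_scaleR_le)
  qed (use m in auto)
  also have "\<dots> \<le> (C * norm (u m) + e) * \<bar>t - s\<bar>"
    using m C by (intro mult_left_mono) (auto simp: closed_segment_eq_real_ivl split: if_splits)
  also have "\<dots> \<le> norm (u m) / 2 + \<bar>t - s\<bar> * e"
    using mult_right_mono[OF C(1) norm_ge_zero[of "u m"]] by (simp add: algebra_simps)
  finally have "norm (u m) \<le> 2 * norm (u s) + 2 * \<bar>t - s\<bar> * e"
    using norm_triangle_ineq2[of "u m" "u s"] by simp
  then show ?thesis using m(2)[OF \<tau>] by simp
qed

text \<open>A criterion for differentiability that does not name the derivative: linearity up to an
  error of smaller order. The derivative of a flow can thus arise as the limit of the rescaled maps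
  \<open>q n\<close> instead of as a solution of the linearised equation.\<close>

lemma almost_linear_differentiable:
  fixes B :: "'w::real_inner set" and g :: "'v::real_inner \<Rightarrow> 'w"
  assumes B: "frame B" and C: "frame (C :: 'v set)"
    and al: "\<And>\<eta>. \<eta> > 0 \<Longrightarrow> \<exists>\<delta>>0. \<forall>x y \<alpha> \<beta>. norm x < \<delta> \<and> norm y < \<delta> \<and> \<bar>\<alpha>\<bar> \<le> 1 \<and> \<bar>\<beta>\<bar> \<le> 1 \<longrightarrow>
      norm (g (\<alpha> *\<^sub>R x + \<beta> *\<^sub>R y) - \<alpha> *\<^sub>R g x - \<beta> *\<^sub>R g y) \<le> \<eta> * (\<bar>\<alpha>\<bar> * norm x + \<bar>\<beta>\<bar> * norm y)"
  shows "\<exists>Y. (g has_derivative Y) (at 0)"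
proof -
  define q where "q n x = real (Suc n) *\<^sub>R g (x /\<^sub>R real (Suc n))" for n x
  have q_al: "\<exists>N. \<forall>n\<ge>N. \<forall>\<alpha> \<beta> :: real. \<bar>\<alpha>\<bar> \<le> 1 \<longrightarrow> \<bar>\<beta>\<bar> \<le> 1 \<longrightarrow>
     norm (q n (\<alpha> *\<^sub>R x + \<beta> *\<^sub>R y) - \<alpha> *\<^sub>R q n x - \<beta> *\<^sub>R q n y) \<le> \<eta> * (\<bar>\<alpha>\<bar> * norm x + \<bar>\<beta>\<bar> * norm y)"
    if \<eta>: "\<eta> > 0" for \<eta> :: real and x y :: 'v
  proof -
    obtain \<delta> where \<delta>: "\<delta> > 0" and st: "\<And>x y \<alpha> \<beta>. norm x < \<delta> \<Longrightarrow> norm y < \<delta> \<Longrightarrow> \<bar>\<alpha>\<bar> \<le> 1 \<Longrightarrow> \<bar>\<beta>\<bar> \<le> 1 \<Longrightarrow>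
      norm (g (\<alpha> *\<^sub>R x + \<beta> *\<^sub>R y) - \<alpha> *\<^sub>R g x - \<beta> *\<^sub>R g y) \<le> \<eta> * (\<bar>\<alpha>\<bar> * norm x + \<bar>\<beta>\<bar> * norm y)"
      using al[OF \<eta>] by blast
    obtain N where N: "(norm x + norm y) / \<delta> < real N" using reals_Archimedean2 by blast
    show ?thesis
    proof (intro exI[of _ N] allI impI)
      fix n and \<alpha> \<beta> :: real assume n: "n \<ge> N" and ab: "\<bar>\<alpha>\<bar> \<le> 1" "\<bar>\<beta>\<bar> \<le> 1"
      let ?k = "real (Suc n)"
      have "norm x + norm y < real N * \<delta>" using N \<delta> by (simp add: pos_divide_less_eq)
      also have "\<dots> \<le> ?k * \<delta>" using n \<delta> by (intro mult_right_mono) auto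
      finally have lt: "norm x + norm y < ?k * \<delta>" .
      then have "norm x < ?k * \<delta>" "norm y < ?k * \<delta>"
        using norm_ge_zero[of x] norm_ge_zero[of y] by linarith+
      then have small: "norm (x /\<^sub>R ?k) < \<delta>" "norm (y /\<^sub>R ?k) < \<delta>"
        by (auto simp: divide_inverse[symmetric] pos_divide_less_eq mult.commute)
      have e1: "\<alpha> *\<^sub>R (x /\<^sub>R ?k) + \<beta> *\<^sub>R (y /\<^sub>R ?k) = (\<alpha> *\<^sub>R x + \<beta> *\<^sub>R y) /\<^sub>R ?k"
        by (simp add: scaleR_add_right mult.commute)
      have "q n (\<alpha> *\<^sub>R x + \<beta> *\<^sub>R y) - \<alpha> *\<^sub>R q n x - \<beta> *\<^sub>R q n y =
         ?k *\<^sub>R (g ((\<alpha> *\<^sub>R x + \<beta> *\<^sub>R y) /\<^sub>R ?k) - \<alpha> *\<^sub>R g (x /\<^sub>R ?k) - \<beta> *\<^sub>R g (y /\<^sub>R ?k))"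
        unfolding q_def by (simp add: scaleR_diff_right mult.commute)
      then have "norm (q n (\<alpha> *\<^sub>R x + \<beta> *\<^sub>R y) - \<alpha> *\<^sub>R q n x - \<beta> *\<^sub>R q n y) =
         ?k * norm (g ((\<alpha> *\<^sub>R x + \<beta> *\<^sub>R y) /\<^sub>R ?k) - \<alpha> *\<^sub>R g (x /\<^sub>R ?k) - \<beta> *\<^sub>R g (y /\<^sub>R ?k))"
        by (simp only: norm_scaleR abs_of_nat)
      also have "\<dots> \<le> ?k * (\<eta> * (\<bar>\<alpha>\<bar> * norm (x /\<^sub>R ?k) + \<bar>\<beta>\<bar> * norm (y /\<^sub>R ?k)))"
        using st[OF small ab] unfolding e1 by (intro mult_left_mono) auto
      also have "\<dots> = \<eta> * (\<bar>\<alpha>\<bar> * norm x + \<bar>\<beta>\<bar> * norm y)"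
      proof -
        have k: "?k \<noteq> 0" by simp
        have n: "norm (z /\<^sub>R ?k) = norm z / ?k" for z :: 'v by (simp add: divide_inverse mult.commute)
        have "?k * (\<eta> * (p / ?k + q / ?k)) = \<eta> * (p + q)" for p q
          using k unfolding add_divide_distrib[symmetric] by (simp del: of_nat_Suc)
        then show ?thesis unfolding n times_divide_eq_right .
      qed
      finally show "norm (q n (\<alpha> *\<^sub>R x + \<beta> *\<^sub>R y) - \<alpha> *\<^sub>R q n x - \<beta> *\<^sub>R q n y)
        \<le> \<eta> * (\<bar>\<alpha>\<bar> * norm x + \<bar>\<beta>\<bar> * norm y)" .
    qed
  qed
  \<comment> \<open>Two scales are compared with \<open>\<alpha>\<close> as their ratio, which lies
    in [0, 1], and with 0 as the second vector.\<close>
  have q_diff: "norm (q m x - q n x) \<le> \<eta> * norm x"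
    if st: "\<And>x y \<alpha> \<beta>. norm x < \<delta> \<and> norm y < \<delta> \<and> \<bar>\<alpha>\<bar> \<le> 1 \<and> \<bar>\<beta>\<bar> \<le> 1 \<Longrightarrow>
      norm (g (\<alpha> *\<^sub>R x + \<beta> *\<^sub>R y) - \<alpha> *\<^sub>R g x - \<beta> *\<^sub>R g y) \<le> \<eta> * (\<bar>\<alpha>\<bar> * norm x + \<bar>\<beta>\<bar> * norm y)"
    and \<delta>: "\<delta> > 0" and nm: "n \<le> m" and small: "norm (x /\<^sub>R real (Suc n)) < \<delta>" for x m n \<delta> \<eta>
  proof -
    let ?m = "real (Suc m)" and ?n = "real (Suc n)"
    define a where "a = ?n / ?m"
    have a: "0 \<le> a" "a \<le> 1" using nm by (auto simp: a_def)
    have ax: "a *\<^sub>R (x /\<^sub>R ?n) = x /\<^sub>R ?m" by (simp add: a_def divide_inverse)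
    have "norm (g (a *\<^sub>R (x /\<^sub>R ?n) + 0 *\<^sub>R 0) - a *\<^sub>R g (x /\<^sub>R ?n) - 0 *\<^sub>R g 0) \<le> \<eta> * (\<bar>a\<bar> * norm (x /\<^sub>R ?n) + \<bar>0\<bar> * norm (0::'v))"
      using a small \<delta> by (intro st) auto
    then have b: "norm (g (x /\<^sub>R ?m) - a *\<^sub>R g (x /\<^sub>R ?n)) \<le> \<eta> * (a * norm (x /\<^sub>R ?n))"
      using a unfolding ax by simp
    have "norm (q m x - q n x) = norm (?m *\<^sub>R (g (x /\<^sub>R ?m) - a *\<^sub>R g (x /\<^sub>R ?n)))"
      unfolding q_def a_def by (simp add: scaleR_diff_right)
    also have "\<dots> = ?m * norm (g (x /\<^sub>R ?m) - a *\<^sub>R g (x /\<^sub>R ?n))" by (simp only: norm_scaleR abs_of_nat)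
    also have "\<dots> \<le> ?m * (\<eta> * (a * norm (x /\<^sub>R ?n)))" using b by (intro mult_left_mono) auto
    also have "\<dots> = \<eta> * norm x"
    proof -
      have n: "norm (x /\<^sub>R ?n) = norm x / ?n" by (simp add: divide_inverse mult.commute)
      have "?m * (\<eta> * (?n / ?m * (norm x / ?n))) = \<eta> * norm x"
        by (simp del: of_nat_Suc)
      then show ?thesis unfolding n a_def .
    qed
    finally show ?thesis .
  qed
  have "\<exists>l. (\<lambda>n. q n x) \<longlonglongrightarrow> l" for x
  proof (rule frame_Cauchy_convergent[OF B], rule CauchyI')
    fix e :: real assume e: "e > 0"
    define \<eta> where "\<eta> = e / (norm x + 1)"
    have nx: "norm x + 1 > 0" using norm_ge_zero[of x] by linarith
    have \<eta>: "\<eta> > 0" "\<eta> * norm x < e" using e nx by (auto simp: \<eta>_def field_simps)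
    obtain \<delta> where \<delta>: "\<delta> > 0" and st: "\<And>x y \<alpha> \<beta>. norm x < \<delta> \<and> norm y < \<delta> \<and> \<bar>\<alpha>\<bar> \<le> 1 \<and> \<bar>\<beta>\<bar> \<le> 1 \<Longrightarrow>
      norm (g (\<alpha> *\<^sub>R x + \<beta> *\<^sub>R y) - \<alpha> *\<^sub>R g x - \<beta> *\<^sub>R g y) \<le> \<eta> * (\<bar>\<alpha>\<bar> * norm x + \<bar>\<beta>\<bar> * norm y)"
      using al[OF \<eta>(1)] by blast
    obtain N where N: "norm x / \<delta> < real N" using reals_Archimedean2 by blast
    show "\<exists>M. \<forall>m\<ge>M. \<forall>n>m. dist (q m x) (q n x) < e"
    proof (intro exI[of _ N] allI impI)
      fix n m assume mn: "m \<ge> N" "n > m"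
      have "norm x < real N * \<delta>" using N \<delta> by (simp add: pos_divide_less_eq)
      also have "\<dots> \<le> real (Suc m) * \<delta>" using mn \<delta> by (intro mult_right_mono) auto
      finally have "norm (x /\<^sub>R real (Suc m)) < \<delta>"
        by (auto simp: divide_inverse[symmetric] pos_divide_less_eq mult.commute)
      from q_diff[OF st \<delta> _ this, of n] mn \<eta> show "dist (q m x) (q n x) < e"
        by (simp add: dist_norm norm_minus_commute)
    qed
  qed
  then obtain Y where Y: "\<And>x. (\<lambda>n. q n x) \<longlonglongrightarrow> Y x" by metis
  have comb: "Y (\<alpha> *\<^sub>R x + \<beta> *\<^sub>R y) = \<alpha> *\<^sub>R Y x + \<beta> *\<^sub>R Y y" if ab: "\<bar>\<alpha>\<bar> \<le> 1" "\<bar>\<beta>\<bar> \<le> 1" for \<alpha> \<beta> x y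
  proof -
    let ?s = "\<bar>\<alpha>\<bar> * norm x + \<bar>\<beta>\<bar> * norm y"
    have s: "?s \<ge> 0" by simp
    have lim: "(\<lambda>n. norm (q n (\<alpha> *\<^sub>R x + \<beta> *\<^sub>R y) - \<alpha> *\<^sub>R q n x - \<beta> *\<^sub>R q n y)) \<longlonglongrightarrow>
       norm (Y (\<alpha> *\<^sub>R x + \<beta> *\<^sub>R y) - \<alpha> *\<^sub>R Y x - \<beta> *\<^sub>R Y y)"
      by (intro tendsto_intros Y)
    have "norm (Y (\<alpha> *\<^sub>R x + \<beta> *\<^sub>R y) - \<alpha> *\<^sub>R Y x - \<beta> *\<^sub>R Y y) \<le> 0 + e" if "e > 0" for e
    proof -
      define \<eta> where "\<eta> = e / (?s + 1)"
      have \<eta>: "\<eta> > 0" "\<eta> * ?s \<le> e" unfolding \<eta>_def by (rule small_factor[OF that s])+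
      obtain N where "\<forall>n\<ge>N. norm (q n (\<alpha> *\<^sub>R x + \<beta> *\<^sub>R y) - \<alpha> *\<^sub>R q n x - \<beta> *\<^sub>R q n y) \<le> \<eta> * ?s"
        using q_al[OF \<eta>(1), of x y] ab by blast
      then have "norm (Y (\<alpha> *\<^sub>R x + \<beta> *\<^sub>R y) - \<alpha> *\<^sub>R Y x - \<beta> *\<^sub>R Y y) \<le> \<eta> * ?s"
        by (intro LIMSEQ_le_const2[OF lim]) blast
      with \<eta> show ?thesis by simp
    qed
    then have "norm (Y (\<alpha> *\<^sub>R x + \<beta> *\<^sub>R y) - \<alpha> *\<^sub>R Y x - \<beta> *\<^sub>R Y y) \<le> 0" by (rule field_le_epsilon)
    then show ?thesis by (simp add: algebra_simps)
  qed
  have add: "Y (x + y) = Y x + Y y" for x y using comb[of 1 1 x y] by simp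
  \<comment> \<open>The hypothesis covers coefficients up to 1 only; larger factors are reached
    through their inverses.\<close>
  have sc: "Y (r *\<^sub>R x) = r *\<^sub>R Y x" for r x
  proof (cases "\<bar>r\<bar> \<le> 1")
    case True
    then show ?thesis using comb[of r 0 x 0] by simp
  next
    case False
    then have "\<bar>1 / r\<bar> \<le> 1" "r \<noteq> 0" by (auto simp: field_simps)
    then have "Y ((1/r) *\<^sub>R (r *\<^sub>R x)) = (1/r) *\<^sub>R Y (r *\<^sub>R x)" using comb[of "1/r" 0 "r *\<^sub>R x" 0] by simp
    then show ?thesis using \<open>r \<noteq> 0\<close> by simp
  qed
  have "linear Y" using add sc by (intro linearI)
  then have bl: "bounded_linear Y" by (rule frame_bounded_linear[OF C])
  \<comment> \<open>The bound between \<open>q m y\<close> and \<open>q 0 y\<close>, which is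
    \<open>g y\<close>, does not depend on \<open>m\<close> and so passes to the limit
    \<open>Y y\<close>.\<close>
  have est: "\<exists>d>0. \<forall>y. norm (y - 0) < d \<longrightarrow> norm (g y - g 0 - Y (y - 0)) \<le> e * norm (y - 0)" if e: "e > 0" for e
  proof -
    obtain \<delta> where \<delta>: "\<delta> > 0" and st: "\<And>x y \<alpha> \<beta>. norm x < \<delta> \<and> norm y < \<delta> \<and> \<bar>\<alpha>\<bar> \<le> 1 \<and> \<bar>\<beta>\<bar> \<le> 1 \<Longrightarrow>
      norm (g (\<alpha> *\<^sub>R x + \<beta> *\<^sub>R y) - \<alpha> *\<^sub>R g x - \<beta> *\<^sub>R g y) \<le> e * (\<bar>\<alpha>\<bar> * norm x + \<bar>\<beta>\<bar> * norm y)"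
      using al[OF e] by blast
    have g0: "g 0 = 0" using st[of 0 0 0 0] \<delta> by simp
    have "norm (g y - Y y) \<le> e * norm y" if y: "norm y < \<delta>" for y
    proof -
      have "norm (q m y - q 0 y) \<le> e * norm y" for m
        using q_diff[OF st \<delta>, of 0 m y] y by simp
      moreover have "(\<lambda>m. norm (q m y - q 0 y)) \<longlonglongrightarrow> norm (Y y - q 0 y)"
        by (intro tendsto_intros Y)
      ultimately have "norm (Y y - q 0 y) \<le> e * norm y" by (intro LIMSEQ_le_const2) auto
      then show ?thesis by (simp add: q_def norm_minus_commute)
    qed
    with \<delta> show ?thesis by (auto simp: g0)
  qed
  from bl est show ?thesis unfolding has_derivative_at_alt by blast
qed

text \<open>
  The solutions \<open>X h\<close> start at time \<open>s\<close> at the points \<open>X 0 s + h\<close> and are followed to the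
  time \<open>t\<close>; the segment is so short that they separate by a factor of at most 2.
\<close>

locale local_flow =
  fixes B :: "'v::real_inner set" and f :: "real \<Rightarrow> 'v \<Rightarrow> 'v" and X :: "'v \<Rightarrow> real \<Rightarrow> 'v"
    and s t \<rho> C :: real and M :: "real \<Rightarrow> 'v \<Rightarrow> 'v"
  assumes B: "frame B" and \<rho>: "\<rho> > 0" and C: "C \<ge> 0" "\<bar>t - s\<bar> * C \<le> 1/4"
    and sol: "\<And>h \<tau>. norm h < \<rho> \<Longrightarrow> \<tau> \<in> closed_segment s t \<Longrightarrow>
      (X h has_vector_derivative f \<tau> (X h \<tau>)) (at \<tau> within closed_segment s t)"
    and init: "\<And>h. norm h < \<rho> \<Longrightarrow> X h s = X 0 s + h"
    and lips: "\<And>h k \<tau>. norm h < \<rho> \<Longrightarrow> norm k < \<rho> \<Longrightarrow> \<tau> \<in> closed_segment s t \<Longrightarrow>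
      norm (f \<tau> (X h \<tau>) - f \<tau> (X k \<tau>)) \<le> C * norm (X h \<tau> - X k \<tau>)"
    and M_linear: "\<And>\<tau>. \<tau> \<in> closed_segment s t \<Longrightarrow> linear (M \<tau>)"
    and M_bound: "\<And>\<tau> v. \<tau> \<in> closed_segment s t \<Longrightarrow> norm (M \<tau> v) \<le> C * norm v"
    and M_strict: "\<And>\<eta>. \<eta> > 0 \<Longrightarrow> \<exists>\<delta>>0. \<forall>\<tau>\<in>closed_segment s t. \<forall>y\<in>ball (X 0 \<tau>) \<delta>.
      norm (f \<tau> y - f \<tau> (X 0 \<tau>) - M \<tau> (y - X 0 \<tau>)) \<le> \<eta> * norm (y - X 0 \<tau>)"
begin

lemma C_half: "\<bar>t - s\<bar> * C \<le> 1/2"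
  using C by linarith

lemma near:
  assumes "norm h < \<rho>" "norm k < \<rho>" "\<tau> \<in> closed_segment s t"
  shows "norm (X h \<tau> - X k \<tau>) \<le> 2 * norm (h - k)"
proof -
  have "norm (X h \<tau> - X k \<tau>) \<le> 2 * norm (X h s - X k s) + 2 * \<bar>t - s\<bar> * 0"
  proof (rule short_gronwall[where u = "\<lambda>\<tau>. X h \<tau> - X k \<tau>" and C = C, OF _ _ C_half C(1) _ assms(3)])
    show "((\<lambda>\<tau>. X h \<tau> - X k \<tau>) has_vector_derivative f \<tau> (X h \<tau>) - f \<tau> (X k \<tau>)) (at \<tau> within closed_segment s t)"
      if "\<tau> \<in> closed_segment s t" for \<tau>
      by (intro derivative_intros sol assms that)
  qed (use lips assms in auto)
  then show ?thesis using init[OF assms(1)] init[OF assms(2)] by simp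
qed

text \<open>Integrating the Lipschitz bound over the segment shows that \<open>h\<close> is moved by
  a map with Lipschitz constant 1/2. The 1/4 in the locale, instead of the 1/2 of
  \<open>short_gronwall\<close>, compensates the factor 2 of \<open>near\<close>.\<close>

lemma drift:
  assumes "norm h < \<rho>" "norm k < \<rho>"
  shows "norm ((X h t - h) - (X k t - k)) \<le> 1/2 * norm (h - k)"
proof -
  let ?I = "closed_segment s t"
  have "norm ((X h t - X k t) - (X h s - X k s)) \<le> (C * (2 * norm (h - k))) * norm (t - s)"
  proof (rule differentiable_bound[where S = ?I and f' = "\<lambda>x r. r *\<^sub>R (f x (X h x) - f x (X k x))"])
    fix \<tau> assume \<tau>: "\<tau> \<in> ?I"
    show "((\<lambda>\<tau>. X h \<tau> - X k \<tau>) has_derivative (\<lambda>r. r *\<^sub>R (f \<tau> (X h \<tau>) - f \<tau> (X k \<tau>)))) (at \<tau> within ?I)"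
      unfolding has_vector_derivative_def[symmetric] by (intro derivative_intros sol assms \<tau>)
    have "norm (f \<tau> (X h \<tau>) - f \<tau> (X k \<tau>)) \<le> C * (2 * norm (h - k))"
      using lips[OF assms \<tau>] near[OF assms \<tau>] C(1) by (meson mult_left_mono order_trans)
    then show "onorm (\<lambda>r. r *\<^sub>R (f \<tau> (X h \<tau>) - f \<tau> (X k \<tau>))) \<le> C * (2 * norm (h - k))"
      by (rule onorm_scaleR_le)
  qed auto
  also have "\<dots> \<le> 1/2 * norm (h - k)"
    using mult_right_mono[OF C(2), of "2 * norm (h - k)"] by (simp add: algebra_simps)
  finally show ?thesis using init[OF assms(1)] init[OF assms(2)] by (simp add: algebra_simps)
qed

text \<open>The required \<open>h\<close> is a fixed point of \<open>T\<close>, a contraction with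
  constant 1/2 by \<open>drift\<close>; it preserves the ball of radius \<open>r\<close> because
  \<open>y\<close> is at most \<open>r / 2\<close> away from \<open>X 0 t\<close>. This is the local
  openness of the flow.\<close>

lemma flow_onto:
  assumes r: "0 < r" "r < \<rho>" and y: "norm (y - X 0 t) \<le> r / 2"
  shows "\<exists>h. norm h \<le> r \<and> X h t = y"
proof -
  define T where "T h = y - (X h t - h)" for h
  have "\<exists>!h\<in>cball 0 r. T h = h"
  proof (rule Banach_fix[where c = "1/2"])
    show "complete (cball (0::'v) r)"
      by (intro compact_imp_complete frame_compact[OF B]) auto
    show "T ` cball 0 r \<subseteq> cball 0 r"
    proof
      fix z assume "z \<in> T ` cball 0 r"
      then obtain h where h: "norm h \<le> r" "z = T h" by auto
      have "norm ((X h t - h) - (X 0 t - 0)) \<le> 1/2 * norm (h - 0)"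
        using h r \<rho> by (intro drift) auto
      then have "norm ((X h t - h) - X 0 t) \<le> r/2" using h by simp
      from y this have "norm ((y - X 0 t) - ((X h t - h) - X 0 t)) \<le> r/2 + r/2"
        by (rule norm_diff_le_add)
      moreover have "z = (y - X 0 t) - ((X h t - h) - X 0 t)" using h by (simp add: T_def)
      ultimately show "z \<in> cball 0 r" by simp
    qed
    fix h k :: 'v assume "h \<in> cball 0 r" "k \<in> cball 0 r"
    then have "norm ((X k t - k) - (X h t - h)) \<le> 1/2 * norm (k - h)" using r by (intro drift) auto
    moreover have "T h - T k = (X k t - k) - (X h t - h)" by (simp add: T_def)
    ultimately show "dist (T h) (T k) \<le> 1/2 * dist h k" by (simp add: dist_norm norm_minus_commute)
  qed (use r in auto)
  then obtain h where "h \<in> cball 0 r" "T h = h" by blast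
  then show ?thesis by (auto simp: T_def algebra_simps)
qed

lemma linearization_error:
  assumes "\<eta> > 0"
  shows "\<exists>\<delta>>0. \<delta> \<le> \<rho> \<and> (\<forall>(h::'v) \<tau>. norm h < \<delta> \<and> \<tau> \<in> closed_segment s t \<longrightarrow>
    norm (f \<tau> (X h \<tau>) - f \<tau> (X 0 \<tau>) - M \<tau> (X h \<tau> - X 0 \<tau>)) \<le> \<eta> * norm h)"
proof -
  obtain \<delta> where \<delta>: "\<delta> > 0" and st: "\<And>\<tau> y. \<tau> \<in> closed_segment s t \<Longrightarrow> y \<in> ball (X 0 \<tau>) \<delta> \<Longrightarrow>
    norm (f \<tau> y - f \<tau> (X 0 \<tau>) - M \<tau> (y - X 0 \<tau>)) \<le> (\<eta>/2) * norm (y - X 0 \<tau>)"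
    using M_strict[of "\<eta>/2"] assms by auto
  show ?thesis
  \<comment> \<open>Orbits separate at most by the factor 2, hence
    \<open>\<delta> / 2\<close>.\<close>
  proof (intro exI[of _ "min \<rho> (\<delta>/2)"] conjI allI impI)
    fix h :: 'v and \<tau> assume h: "norm h < min \<rho> (\<delta> / 2) \<and> \<tau> \<in> closed_segment s t"
    then have n: "norm (X h \<tau> - X 0 \<tau>) \<le> 2 * norm h" using near[of h 0 \<tau>] \<rho> by simp
    then have "X h \<tau> \<in> ball (X 0 \<tau>) \<delta>" using h by (simp add: dist_norm norm_minus_commute)
    from st[OF _ this] h have "norm (f \<tau> (X h \<tau>) - f \<tau> (X 0 \<tau>) - M \<tau> (X h \<tau> - X 0 \<tau>)) \<le> (\<eta>/2) * norm (X h \<tau> - X 0 \<tau>)"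
      by blast
    also have "\<dots> \<le> (\<eta>/2) * (2 * norm h)" using n assms by (intro mult_left_mono) auto
    finally show "norm (f \<tau> (X h \<tau>) - f \<tau> (X 0 \<tau>) - M \<tau> (X h \<tau> - X 0 \<tau>)) \<le> \<eta> * norm h" by simp
  qed (use \<delta> \<rho> in auto)
qed

text \<open>The combination of displaced orbits that measures the failure of linearity vanishes at
  time \<open>s\<close> and solves the linearised equation up to a small error; the Gronwall
  estimate keeps it small up to time \<open>t\<close>.\<close>

lemma flow_differentiable: "\<exists>Y. ((\<lambda>h. X h t) has_derivative Y) (at 0)"
proof -
  have "\<exists>Y. ((\<lambda>h. X h t - X 0 t) has_derivative Y) (at 0)"
  proof (rule almost_linear_differentiable[OF B B])
    fix \<eta> :: real assume \<eta>: "\<eta> > 0"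
    \<comment> \<open>The 4 is the product of the 2 in the Gronwall estimate and the 2 in the bound
      \<open>2 * e * ?N\<close> for the sum of the three linearisation errors.\<close>
    define e where "e = \<eta> / (4 * \<bar>t - s\<bar> + 1)"
    have pos: "4 * \<bar>t - s\<bar> + 1 > 0" by (intro add_nonneg_pos) auto
    then have e: "e > 0" using \<eta> unfolding e_def by (rule divide_pos_pos[rotated])
    have "e * (4 * \<bar>t - s\<bar> + 1) = \<eta>" using pos unfolding e_def by simp
    then have e4: "4 * \<bar>t - s\<bar> * e \<le> \<eta>" using e by (simp add: algebra_simps)
    obtain \<delta> where \<delta>: "\<delta> > 0" "\<delta> \<le> \<rho>" and st: "\<And>h \<tau>. norm h < \<delta> \<Longrightarrow> \<tau> \<in> closed_segment s t \<Longrightarrow>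
       norm (f \<tau> (X h \<tau>) - f \<tau> (X 0 \<tau>) - M \<tau> (X h \<tau> - X 0 \<tau>)) \<le> e * norm h"
      using linearization_error[OF e] by blast
    show "\<exists>\<delta>>0. \<forall>x y \<alpha> \<beta>. norm x < \<delta> \<and> norm y < \<delta> \<and> \<bar>\<alpha>\<bar> \<le> 1 \<and> \<bar>\<beta>\<bar> \<le> 1 \<longrightarrow>
      norm (X (\<alpha> *\<^sub>R x + \<beta> *\<^sub>R y) t - X 0 t - \<alpha> *\<^sub>R (X x t - X 0 t) - \<beta> *\<^sub>R (X y t - X 0 t))
        \<le> \<eta> * (\<bar>\<alpha>\<bar> * norm x + \<bar>\<beta>\<bar> * norm y)"
    proof (intro exI[of _ "\<delta>/2"] conjI allI impI)
      fix x y :: 'v and \<alpha> \<beta> :: real assume *: "norm x < \<delta>/2 \<and> norm y < \<delta>/2 \<and> \<bar>\<alpha>\<bar> \<le> 1 \<and> \<bar>\<beta>\<bar> \<le> 1"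
      let ?z = "\<alpha> *\<^sub>R x + \<beta> *\<^sub>R y" and ?N = "\<bar>\<alpha>\<bar> * norm x + \<bar>\<beta>\<bar> * norm y"
      let ?\<xi> = "\<lambda>h \<tau>. X h \<tau> - X 0 \<tau>" and ?f = "\<lambda>h \<tau>. f \<tau> (X h \<tau>) - f \<tau> (X 0 \<tau>)"
      have nz: "norm ?z \<le> ?N" using norm_triangle_ineq[of "\<alpha> *\<^sub>R x" "\<beta> *\<^sub>R y"] by simp
      have "?N \<le> 1 * norm x + 1 * norm y" using * by (intro add_mono mult_right_mono) auto
      then have small: "norm ?z < \<delta>" "norm x < \<delta>" "norm y < \<delta>" "norm (0::'v) < \<rho>" using nz * \<delta> \<rho> by auto
      then have small': "norm ?z < \<rho>" "norm x < \<rho>" "norm y < \<rho>" using \<delta> by auto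
      let ?u = "\<lambda>\<tau>. ?\<xi> ?z \<tau> - \<alpha> *\<^sub>R ?\<xi> x \<tau> - \<beta> *\<^sub>R ?\<xi> y \<tau>"
      let ?u' = "\<lambda>\<tau>. ?f ?z \<tau> - \<alpha> *\<^sub>R ?f x \<tau> - \<beta> *\<^sub>R ?f y \<tau>"
      have "norm (?u t) \<le> 2 * norm (?u s) + 2 * \<bar>t - s\<bar> * (2 * e * ?N)"
      proof (rule short_gronwall[where u = ?u and u' = ?u' and C = C, OF _ _ C_half C(1)])
        fix \<tau> assume \<tau>: "\<tau> \<in> closed_segment s t"
        show "(?u has_vector_derivative ?u' \<tau>) (at \<tau> within closed_segment s t)"
          using small small' \<tau> by (intro has_vector_derivative_diff sol
              bounded_linear.has_vector_derivative[OF bounded_linear_scaleR_right])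
        have lin: "M \<tau> (?u \<tau>) = M \<tau> (?\<xi> ?z \<tau>) - \<alpha> *\<^sub>R M \<tau> (?\<xi> x \<tau>) - \<beta> *\<^sub>R M \<tau> (?\<xi> y \<tau>)"
          using M_linear[OF \<tau>] by (simp add: linear_diff linear_scale)
        let ?E = "\<lambda>h. ?f h \<tau> - M \<tau> (?\<xi> h \<tau>)"
        have E1: "?u' \<tau> - M \<tau> (?u \<tau>) = ?E ?z - \<alpha> *\<^sub>R ?E x - \<beta> *\<^sub>R ?E y"
          unfolding lin by (simp add: scaleR_diff_right algebra_simps)
        have E2: "norm (?E ?z - \<alpha> *\<^sub>R ?E x - \<beta> *\<^sub>R ?E y) \<le> norm (?E ?z) + \<bar>\<alpha>\<bar> * norm (?E x) + \<bar>\<beta>\<bar> * norm (?E y)"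
          unfolding norm_scaleR[symmetric] by (intro norm_diff_le_add order_refl)
        have E3: "norm (?E ?z) + \<bar>\<alpha>\<bar> * norm (?E x) + \<bar>\<beta>\<bar> * norm (?E y)
          \<le> e * ?N + \<bar>\<alpha>\<bar> * (e * norm x) + \<bar>\<beta>\<bar> * (e * norm y)"
        proof (intro add_mono mult_left_mono)
          show "norm (?E ?z) \<le> e * ?N"
            using st[OF small(1) \<tau>] mult_left_mono[OF nz, of e] e by linarith
        qed (use st small \<tau> in auto)
        have "e * ?N + \<bar>\<alpha>\<bar> * (e * norm x) + \<bar>\<beta>\<bar> * (e * norm y) = 2 * e * ?N" by (simp add: algebra_simps)
        with E2 E3 have "norm (?u' \<tau> - M \<tau> (?u \<tau>)) \<le> 2 * e * ?N" unfolding E1 by linarith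
        then show "norm (?u' \<tau>) \<le> C * norm (?u \<tau>) + 2 * e * ?N"
          using M_bound[OF \<tau>, of "?u \<tau>"] norm_triangle_ineq2[of "?u' \<tau>" "M \<tau> (?u \<tau>)"] by linarith
      qed (use e in auto)
      also have "?u s = 0" using init[OF small'(1)] init[OF small'(2)] init[OF small'(3)] by simp
      finally have "norm (?u t) \<le> (4 * \<bar>t - s\<bar> * e) * ?N" by (simp add: algebra_simps)
      also have "\<dots> \<le> \<eta> * ?N" using e4 by (intro mult_right_mono) auto
      finally show "norm (?u t) \<le> \<eta> * ?N" .
    qed (use \<delta> in auto)
  qed
  then obtain Y where "((\<lambda>h. X h t - X 0 t) has_derivative Y) (at 0)" by blast
  from has_derivative_add[OF this has_derivative_const[of "X 0 t"]] show ?thesis by auto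
qed

text \<open>Along the segment, \<open>\<omega>\<close> of two displacements changes only through the
  linearisation errors, because the linear parts cancel by \<open>inv\<close>. For displacements of
  size \<open>r\<close>, this change and the error of replacing them by \<open>Y\<close> are of
  order \<open>r\<^sup>2 * e\<close>, while both sides of the claim scale exactly with
  \<open>r\<^sup>2\<close>.\<close>

lemma flow_preserves:
  assumes \<omega>: "bounded_bilinear \<omega>"
    and inv: "\<And>\<tau> u v. \<tau> \<in> closed_segment s t \<Longrightarrow> \<omega> (M \<tau> u) v + \<omega> u (M \<tau> v) = (0::real)"
    and Y: "((\<lambda>h. X h t) has_derivative Y) (at 0)"
  shows "\<omega> (Y u) (Y v) = \<omega> u v"
proof -
  interpret \<omega>: bounded_bilinear \<omega> by fact
  obtain K where K: "K > 0" "\<And>a b. norm (\<omega> a b) \<le> norm a * norm b * K" using \<omega>.pos_bounded by blast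
  have linY: "linear Y" using Y has_derivative_linear by blast
  define Q where "Q = 4 * K * norm u * norm v * \<bar>t - s\<bar> + K * (2 * norm u * norm v + norm (Y u) * norm v)"
  have Q: "Q \<ge> 0" using K by (simp add: Q_def)
  have key: "\<bar>\<omega> (Y u) (Y v) - \<omega> u v\<bar> \<le> Q * e" if e: "e > 0" for e
  proof -
    obtain \<delta> where \<delta>: "\<delta> > 0" "\<delta> \<le> \<rho>" and st: "\<And>h \<tau>. norm h < \<delta> \<Longrightarrow> \<tau> \<in> closed_segment s t \<Longrightarrow>
       norm (f \<tau> (X h \<tau>) - f \<tau> (X 0 \<tau>) - M \<tau> (X h \<tau> - X 0 \<tau>)) \<le> e * norm h"
      using linearization_error[OF e] by blast
    obtain d where d: "d > 0" "\<And>y. norm y < d \<Longrightarrow> norm (X y t - X 0 t - Y y) \<le> e * norm y"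
      using Y e unfolding has_derivative_at_alt by (metis diff_zero)
    define r where "r = (min \<delta> d / 2) / (norm u + norm v + 1)"
    have pos: "norm u + norm v + 1 > 0" by (simp add: add_nonneg_pos)
    have r: "r > 0" using \<delta> d pos by (simp add: r_def)
    have "r * (norm u + norm v + 1) = min \<delta> d / 2"
      using pos unfolding r_def by (metis less_irrefl nonzero_eq_divide_eq)
    moreover have "min \<delta> d / 2 < min \<delta> d" using \<delta>(1) d(1) by (simp add: min_def)
    ultimately have rr: "r * (norm u + norm v + 1) < min \<delta> d" by linarith
    have "r * norm u \<le> r * (norm u + norm v + 1)" "r * norm v \<le> r * (norm u + norm v + 1)"
      using r by (auto intro!: mult_left_mono)
    moreover have "\<bar>r\<bar> = r" using r by simp
    ultimately have small: "norm (r *\<^sub>R u) < \<delta>" "norm (r *\<^sub>R v) < \<delta>" "norm (r *\<^sub>R u) < d" "norm (r *\<^sub>R v) < d"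
      using rr r unfolding norm_scaleR by linarith+
    then have small': "norm (r *\<^sub>R u) < \<rho>" "norm (r *\<^sub>R v) < \<rho>" using \<delta> by auto
    let ?\<xi> = "\<lambda>h \<tau>. X h \<tau> - X 0 \<tau>" and ?f = "\<lambda>h \<tau>. f \<tau> (X h \<tau>) - f \<tau> (X 0 \<tau>)"
    let ?U = "?\<xi> (r *\<^sub>R u)" and ?V = "?\<xi> (r *\<^sub>R v)"
    have nU: "norm (?U \<tau>) \<le> 2 * (r * norm u)" and nV: "norm (?V \<tau>) \<le> 2 * (r * norm v)"
      if "\<tau> \<in> closed_segment s t" for \<tau>
      using near[OF small'(1) _ that, of 0] near[OF small'(2) _ that, of 0] \<rho> r by auto
    have "norm (\<omega> (?U t) (?V t) - \<omega> (?U s) (?V s)) \<le> (4 * K * (r * norm u) * (r * norm v) * e) * norm (t - s)"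
    proof (rule differentiable_bound[where S = "closed_segment s t" and
          f' = "\<lambda>x h. h *\<^sub>R (\<omega> (?U x) (?f (r *\<^sub>R v) x) + \<omega> (?f (r *\<^sub>R u) x) (?V x))"])
      fix \<tau> assume \<tau>: "\<tau> \<in> closed_segment s t"
      have 1: "(?U has_vector_derivative ?f (r *\<^sub>R u) \<tau>) (at \<tau> within closed_segment s t)"
        "(?V has_vector_derivative ?f (r *\<^sub>R v) \<tau>) (at \<tau> within closed_segment s t)"
        using small' \<tau> \<rho> by (auto intro!: has_vector_derivative_diff sol)
      show "((\<lambda>\<tau>. \<omega> (?U \<tau>) (?V \<tau>)) has_derivative (\<lambda>h. h *\<^sub>R (\<omega> (?U \<tau>) (?f (r *\<^sub>R v) \<tau>) + \<omega> (?f (r *\<^sub>R u) \<tau>) (?V \<tau>))))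
        (at \<tau> within closed_segment s t)"
        unfolding has_vector_derivative_def[symmetric]
        by (rule \<omega>.has_vector_derivative[OF 1])
      let ?E = "\<lambda>h. ?f h \<tau> - M \<tau> (?\<xi> h \<tau>)"
      have E: "norm (?E (r *\<^sub>R u)) \<le> e * (r * norm u)" "norm (?E (r *\<^sub>R v)) \<le> e * (r * norm v)"
        using st[OF small(1) \<tau>] st[OF small(2) \<tau>] r by auto
      have E1: "\<omega> (?U \<tau>) (?f (r *\<^sub>R v) \<tau>) + \<omega> (?f (r *\<^sub>R u) \<tau>) (?V \<tau>)
         = \<omega> (?U \<tau>) (?E (r *\<^sub>R v)) + \<omega> (?E (r *\<^sub>R u)) (?V \<tau>)"
        using inv[OF \<tau>, of "?U \<tau>" "?V \<tau>"] by (simp add: \<omega>.diff_left \<omega>.diff_right)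
      have E2: "norm (\<omega> (?U \<tau>) (?E (r *\<^sub>R v)) + \<omega> (?E (r *\<^sub>R u)) (?V \<tau>))
         \<le> norm (?U \<tau>) * norm (?E (r *\<^sub>R v)) * K + norm (?E (r *\<^sub>R u)) * norm (?V \<tau>) * K"
        by (intro norm_triangle_le add_mono K)
      have E3: "norm (?U \<tau>) * norm (?E (r *\<^sub>R v)) * K + norm (?E (r *\<^sub>R u)) * norm (?V \<tau>) * K
         \<le> (2 * (r * norm u)) * (e * (r * norm v)) * K + (e * (r * norm u)) * (2 * (r * norm v)) * K"
        using K(1) E nU[OF \<tau>] nV[OF \<tau>] r e by (intro add_mono mult_right_mono mult_mono) auto
      have "(2 * (r * norm u)) * (e * (r * norm v)) * K + (e * (r * norm u)) * (2 * (r * norm v)) * K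
         = 4 * K * (r * norm u) * (r * norm v) * e" by (simp add: algebra_simps)
      with E2 E3 have "norm (\<omega> (?U \<tau>) (?f (r *\<^sub>R v) \<tau>) + \<omega> (?f (r *\<^sub>R u) \<tau>) (?V \<tau>)) \<le> 4 * K * (r * norm u) * (r * norm v) * e"
        unfolding E1 by linarith
      then show "onorm (\<lambda>h. h *\<^sub>R (\<omega> (?U \<tau>) (?f (r *\<^sub>R v) \<tau>) + \<omega> (?f (r *\<^sub>R u) \<tau>) (?V \<tau>)))
          \<le> 4 * K * (r * norm u) * (r * norm v) * e"
        by (rule onorm_scaleR_le)
    qed auto
    moreover have "\<omega> (?U s) (?V s) = r\<^sup>2 * \<omega> u v"
      using init[OF small'(1)] init[OF small'(2)] by (simp add: \<omega>.scaleR_left \<omega>.scaleR_right power2_eq_square)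
    moreover have "norm (\<omega> (?U t) (?V t) - r\<^sup>2 * \<omega> (Y u) (Y v)) \<le> r\<^sup>2 * (K * (2 * norm u * norm v + norm (Y u) * norm v) * e)"
    proof -
      let ?a = "?U t - r *\<^sub>R Y u" and ?b = "?V t - r *\<^sub>R Y v"
      have ab: "norm ?a \<le> e * (r * norm u)" "norm ?b \<le> e * (r * norm v)"
        using d(2)[OF small(3)] d(2)[OF small(4)] r by (auto simp: linear_scale[OF linY])
      have E1: "\<omega> (?U t) (?V t) - r\<^sup>2 * \<omega> (Y u) (Y v) = \<omega> ?a (?V t) + \<omega> (r *\<^sub>R Y u) ?b"
        by (simp add: \<omega>.diff_left \<omega>.diff_right \<omega>.scaleR_left \<omega>.scaleR_right power2_eq_square right_diff_distrib)
      have E2: "norm (\<omega> ?a (?V t) + \<omega> (r *\<^sub>R Y u) ?b) \<le> norm ?a * norm (?V t) * K + norm (r *\<^sub>R Y u) * norm ?b * K"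
        by (intro norm_triangle_le add_mono K)
      have E3: "norm ?a * norm (?V t) * K + norm (r *\<^sub>R Y u) * norm ?b * K
        \<le> (e * (r * norm u)) * (2 * (r * norm v)) * K + (r * norm (Y u)) * (e * (r * norm v)) * K"
        using K(1) ab nV[of t] r e by (intro add_mono mult_right_mono mult_mono) auto
      have "(e * (r * norm u)) * (2 * (r * norm v)) * K + (r * norm (Y u)) * (e * (r * norm v)) * K
        = r\<^sup>2 * (K * (2 * norm u * norm v + norm (Y u) * norm v) * e)"
        by (simp add: algebra_simps power2_eq_square)
      with E2 E3 show ?thesis unfolding E1 by linarith
    qed
    ultimately have "\<bar>r\<^sup>2 * \<omega> (Y u) (Y v) - r\<^sup>2 * \<omega> u v\<bar> \<le> (4 * K * (r * norm u) * (r * norm v) * e) * \<bar>t - s\<bar>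
       + r\<^sup>2 * (K * (2 * norm u * norm v + norm (Y u) * norm v) * e)"
      unfolding real_norm_def by linarith
    then have "r\<^sup>2 * \<bar>\<omega> (Y u) (Y v) - \<omega> u v\<bar> \<le> r\<^sup>2 * (Q * e)"
      unfolding right_diff_distrib[symmetric] abs_mult Q_def by (simp add: algebra_simps power2_eq_square)
    then show ?thesis using r by simp
  qed
  have "\<bar>\<omega> (Y u) (Y v) - \<omega> u v\<bar> \<le> 0 + e" if "e > 0" for e
  proof -
    have "\<bar>\<omega> (Y u) (Y v) - \<omega> u v\<bar> \<le> Q * (e / (Q + 1))" using that Q by (intro key) simp
    also have "\<dots> \<le> e" using that Q by (simp add: field_simps)
    finally show ?thesis by simp
  qed
  then have "\<bar>\<omega> (Y u) (Y v) - \<omega> u v\<bar> \<le> 0" by (rule field_le_epsilon)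
  then show ?thesis by simp
qed

text \<open>The first variation formula. \<open>\<sigma> h\<close> is the action along
  \<open>X h\<close>, and \<open>\<theta>\<close> a form along the reference orbit; by
  \<open>eq\<close> the action density varies like the time derivative of
  \<open>\<theta> \<tau> (X h \<tau> - X 0 \<tau>)\<close>. Hence the difference of the actions
  minus the boundary terms is of smaller order than \<open>h\<close>.\<close>

lemma flow_action_derivative:
  fixes \<sigma> :: "'v \<Rightarrow> real \<Rightarrow> real" and \<theta> :: "real \<Rightarrow> 'v \<Rightarrow> real"
  assumes \<theta>: "\<And>\<tau>. \<tau> \<in> closed_segment s t \<Longrightarrow> linear (\<theta> \<tau>)"
    and d\<sigma>: "\<And>h \<tau>. norm h < \<rho> \<Longrightarrow> \<tau> \<in> closed_segment s t \<Longrightarrow>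
      (\<sigma> h has_vector_derivative b h \<tau>) (at \<tau> within closed_segment s t)"
    and d\<theta>: "\<And>h \<tau>. norm h < \<rho> \<Longrightarrow> \<tau> \<in> closed_segment s t \<Longrightarrow>
      ((\<lambda>\<tau>. \<theta> \<tau> (X h \<tau> - X 0 \<tau>)) has_vector_derivative d h \<tau>) (at \<tau> within closed_segment s t)"
    and eq: "\<And>\<eta>. \<eta> > 0 \<Longrightarrow> \<exists>\<delta>>0. \<forall>h \<tau>. norm h < \<delta> \<and> \<tau> \<in> closed_segment s t \<longrightarrow>
      \<bar>b h \<tau> - b 0 \<tau> - d h \<tau>\<bar> \<le> \<eta> * norm h"
    and Y: "((\<lambda>h. X h t) has_derivative Y) (at 0)"
  shows "((\<lambda>h. \<sigma> h t - \<sigma> h s) has_derivative (\<lambda>u. \<theta> t (Y u) - \<theta> s u)) (at 0)"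
proof -
  have st: "s \<in> closed_segment s t" "t \<in> closed_segment s t" by auto
  define R where "R h = (\<sigma> h t - \<sigma> 0 t - \<theta> t (X h t - X 0 t)) - (\<sigma> h s - \<sigma> 0 s - \<theta> s (X h s - X 0 s))" for h
  have R: "\<exists>d>0. \<forall>h. norm h < d \<longrightarrow> norm (R h) \<le> e * norm h" if e: "e > 0" for e
  proof -
    define \<eta> where "\<eta> = e / (\<bar>t - s\<bar> + 1)"
    have \<eta>: "\<eta> > 0" "\<eta> * \<bar>t - s\<bar> \<le> e" using e by (auto simp: \<eta>_def field_simps)
    obtain \<delta> where \<delta>: "\<delta> > 0" and est: "\<And>h \<tau>. norm h < \<delta> \<Longrightarrow> \<tau> \<in> closed_segment s t \<Longrightarrow>
      \<bar>b h \<tau> - b 0 \<tau> - d h \<tau>\<bar> \<le> \<eta> * norm h" using eq[OF \<eta>(1)] by blast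
    have "norm (R h) \<le> e * norm h" if h: "norm h < min \<rho> \<delta>" for h
    proof -
      have "norm (R h) \<le> (\<eta> * norm h) * norm (t - s)" unfolding R_def
      proof (rule differentiable_bound[where S = "closed_segment s t" and
            f = "\<lambda>\<tau>. \<sigma> h \<tau> - \<sigma> 0 \<tau> - \<theta> \<tau> (X h \<tau> - X 0 \<tau>)" and f' = "\<lambda>x r. r *\<^sub>R (b h x - b 0 x - d h x)"])
        fix \<tau> assume \<tau>: "\<tau> \<in> closed_segment s t"
        show "((\<lambda>\<tau>. \<sigma> h \<tau> - \<sigma> 0 \<tau> - \<theta> \<tau> (X h \<tau> - X 0 \<tau>)) has_derivative (\<lambda>r. r *\<^sub>R (b h \<tau> - b 0 \<tau> - d h \<tau>)))
          (at \<tau> within closed_segment s t)"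
          unfolding has_vector_derivative_def[symmetric]
          using h \<rho> \<tau> by (intro has_vector_derivative_diff d\<sigma> d\<theta>) auto
        show "onorm (\<lambda>r. r *\<^sub>R (b h \<tau> - b 0 \<tau> - d h \<tau>)) \<le> \<eta> * norm h"
          using est[of h \<tau>] h \<tau> by (intro onorm_scaleR_le) auto
      qed (use st in auto)
      also have "\<dots> = (\<eta> * \<bar>t - s\<bar>) * norm h" by simp
      also have "\<dots> \<le> e * norm h" using \<eta> by (intro mult_right_mono) auto
      finally show ?thesis .
    qed
    moreover have "min \<rho> \<delta> > 0" using \<delta> \<rho> by simp
    ultimately show ?thesis by blast
  qed
  have R0: "R 0 = 0" using st \<theta> by (simp add: R_def linear_0)
  have dR: "(R has_derivative (\<lambda>_. 0)) (at 0)"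
    unfolding has_derivative_at_alt using R R0 by simp
  have d1: "((\<lambda>h. \<theta> t (X h t - X 0 t)) has_derivative (\<lambda>u. \<theta> t (Y u))) (at 0)"
    by (intro bounded_linear.has_derivative[OF frame_bounded_linear[OF B \<theta>[OF st(2)]]]
        has_derivative_diff[OF Y has_derivative_const, simplified])
  have d2: "((\<lambda>h. \<theta> s h) has_derivative (\<lambda>u. \<theta> s u)) (at 0)"
    by (intro bounded_linear.has_derivative[OF frame_bounded_linear[OF B \<theta>[OF st(1)]]] has_derivative_ident)
  have "((\<lambda>h. R h + \<theta> t (X h t - X 0 t) - \<theta> s h + (\<sigma> 0 t - \<sigma> 0 s)) has_derivative (\<lambda>u. 0 + \<theta> t (Y u) - \<theta> s u + 0)) (at 0)"
    by (intro has_derivative_add has_derivative_diff dR d1 d2 has_derivative_const)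
  then have "((\<lambda>h. R h + \<theta> t (X h t - X 0 t) - \<theta> s h + (\<sigma> 0 t - \<sigma> 0 s)) has_derivative (\<lambda>u. \<theta> t (Y u) - \<theta> s u)) (at 0)"
    by simp
  then show ?thesis
  proof (rule has_derivative_transform_within_open[where s = "ball 0 \<rho>"])
    fix h assume "h \<in> ball (0::'v) \<rho>"
    then have "X h s - X 0 s = h" using init[of h] by simp
    then show "R h + \<theta> t (X h t - X 0 t) - \<theta> s h + (\<sigma> 0 t - \<sigma> 0 s) = \<sigma> h t - \<sigma> h s"
      by (simp add: R_def)
  qed (use \<rho> in auto)
qed

end

section \<open>The topology of an atlas\<close>

text \<open>The portion of \<open>smooth_atlas\<close> that governs the topology. It is what is
  verified for the atlases of the two bundles, whose coordinate changes involve first derivatives of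
  those of the base.\<close>

definition topological_atlas :: "('x, 'v::real_inner) atlas \<Rightarrow> bool" where
  "topological_atlas \<A> \<longleftrightarrow>
     (\<forall>c\<in>\<A>. inj_on (chart_map c) (chart_dom c) \<and> open (chart_map c ` chart_dom c)) \<and>
     (\<forall>c\<in>\<A>. \<forall>d\<in>\<A>. open (chart_map c ` (chart_dom c \<inter> chart_dom d)) \<and>
        continuous_on (chart_map c ` (chart_dom c \<inter> chart_dom d)) (chart_map d \<circ> chart_inv c))"

lemma smooth_imp_topological_atlas: "smooth_atlas A \<Longrightarrow> topological_atlas A"
  unfolding smooth_atlas_def topological_atlas_def using smooth_on_continuous by blast

lemma chart_map_inv: "y \<in> chart_map c ` chart_dom c \<Longrightarrow> chart_map c (chart_inv c y) = y"
  unfolding chart_inv_def by (rule f_inv_into_f)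

lemma chart_inv_dom: "y \<in> chart_map c ` chart_dom c \<Longrightarrow> chart_inv c y \<in> chart_dom c"
  unfolding chart_inv_def by (rule inv_into_into)

lemma topological_atlas_image:
  assumes "\<And>c. c \<in> A \<Longrightarrow> inj_on (chart_map (f c)) (chart_dom (f c))"
    and "\<And>c. c \<in> A \<Longrightarrow> open (chart_map (f c) ` chart_dom (f c))"
    and "\<And>c d. c \<in> A \<Longrightarrow> d \<in> A \<Longrightarrow> open (chart_map (f c) ` (chart_dom (f c) \<inter> chart_dom (f d)))"
    and "\<And>c d. c \<in> A \<Longrightarrow> d \<in> A \<Longrightarrow>
      continuous_on (chart_map (f c) ` (chart_dom (f c) \<inter> chart_dom (f d))) (chart_map (f d) \<circ> chart_inv (f c))"
  shows "topological_atlas (f ` A)"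
  unfolding topological_atlas_def ball_simps using assms by blast

context
  fixes \<A> :: "('x, 'v::real_inner) atlas"
  assumes \<A>: "topological_atlas \<A>"
begin

lemma atlas_inj: "c \<in> \<A> \<Longrightarrow> inj_on (chart_map c) (chart_dom c)"
  and atlas_open: "c \<in> \<A> \<Longrightarrow> open (chart_map c ` chart_dom c)"
  and atlas_open_Int: "c \<in> \<A> \<Longrightarrow> d \<in> \<A> \<Longrightarrow> open (chart_map c ` (chart_dom c \<inter> chart_dom d))"
  and atlas_cont: "c \<in> \<A> \<Longrightarrow> d \<in> \<A> \<Longrightarrow>
    continuous_on (chart_map c ` (chart_dom c \<inter> chart_dom d)) (chart_map d \<circ> chart_inv c)"
  using \<A> unfolding topological_atlas_def by blast+

lemma chart_inv_map: "c \<in> \<A> \<Longrightarrow> x \<in> chart_dom c \<Longrightarrow> chart_inv c (chart_map c x) = x"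
  unfolding chart_inv_def by (rule inv_into_f_f[OF atlas_inj])

lemma openin_atlas:
  "openin (manifold_topology \<A>) W \<longleftrightarrow>
    W \<subseteq> points \<A> \<and> (\<forall>c\<in>\<A>. open (chart_map c ` (W \<inter> chart_dom c)))"
  by (rule openin_manifold_topology[OF atlas_inj])

lemma topspace_atlas: "topspace (manifold_topology \<A>) = points \<A>"
proof -
  have "points \<A> \<inter> chart_dom c = chart_dom c" if "c \<in> \<A>" for c
    using that by (auto simp: points_def)
  then have "openin (manifold_topology \<A>) (points \<A>)"
    unfolding openin_atlas using atlas_open by auto
  moreover have "openin (manifold_topology \<A>) (topspace (manifold_topology \<A>))" by simp
  then have "topspace (manifold_topology \<A>) \<subseteq> points \<A>" unfolding openin_atlas by blast
  ultimately show ?thesis using openin_subset by blast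
qed

lemma chart_preimage_open:
  assumes c: "c \<in> \<A>" and V: "open V"
  shows "openin (manifold_topology \<A>) {x \<in> chart_dom c. chart_map c x \<in> V}"
  unfolding openin_atlas
proof (intro conjI ballI)
  show "{x \<in> chart_dom c. chart_map c x \<in> V} \<subseteq> points \<A>" using c by (auto simp: points_def)
  fix d assume d: "d \<in> \<A>"
  let ?S = "chart_map d ` (chart_dom d \<inter> chart_dom c)"
  have "chart_map d ` ({x \<in> chart_dom c. chart_map c x \<in> V} \<inter> chart_dom d) =
    {y \<in> ?S. (chart_map c \<circ> chart_inv d) y \<in> V}"
    using chart_inv_map[OF d] by (auto intro!: imageI)
  also have "\<dots> = (chart_map c \<circ> chart_inv d) -` V \<inter> ?S" by blast
  also have "open \<dots>"
    using atlas_cont[OF d c] atlas_open_Int[OF d c] V continuous_on_open_vimage by blast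
  finally show "open (chart_map d ` ({x \<in> chart_dom c. chart_map c x \<in> V} \<inter> chart_dom d))" .
qed

lemma chart_dom_open: "c \<in> \<A> \<Longrightarrow> openin (manifold_topology \<A>) (chart_dom c)"
  using chart_preimage_open[of c UNIV] by simp

lemma open_image_chart:
  "openin (manifold_topology \<A>) W \<Longrightarrow> c \<in> \<A> \<Longrightarrow> open (chart_map c ` (W \<inter> chart_dom c))"
  unfolding openin_atlas by blast

lemma continuous_map_into_atlas:
  assumes "\<And>y. y \<in> topspace Y \<Longrightarrow> \<exists>c\<in>\<A>. f y \<in> chart_dom c \<and>
     (\<forall>V. open V \<and> chart_map c (f y) \<in> V \<longrightarrow>
       (\<exists>U. openin Y U \<and> y \<in> U \<and> (\<forall>y'\<in>U. f y' \<in> chart_dom c \<and> chart_map c (f y') \<in> V)))"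
  shows "continuous_map Y (manifold_topology \<A>) f"
  unfolding continuous_map_eq_topcontinuous_at topcontinuous_at_def topspace_atlas
proof (intro ballI conjI allI impI)
  fix y assume y: "y \<in> topspace Y"
  from assms[OF y] obtain c where c: "c \<in> \<A>" "f y \<in> chart_dom c"
    and V: "\<And>V. open V \<Longrightarrow> chart_map c (f y) \<in> V \<Longrightarrow>
       \<exists>U. openin Y U \<and> y \<in> U \<and> (\<forall>y'\<in>U. f y' \<in> chart_dom c \<and> chart_map c (f y') \<in> V)" by blast
  show "y \<in> topspace Y" by fact
  show "f \<in> topspace Y \<rightarrow> points \<A>"
  proof
    fix y assume "y \<in> topspace Y"
    from assms[OF this] show "f y \<in> points \<A>" by (auto simp: points_def)
  qed
  fix W assume W: "openin (manifold_topology \<A>) W \<and> f y \<in> W"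
  then have "open (chart_map c ` (W \<inter> chart_dom c))" using open_image_chart c by blast
  moreover have "chart_map c (f y) \<in> chart_map c ` (W \<inter> chart_dom c)" using W c by blast
  ultimately obtain U where U: "openin Y U" "y \<in> U"
    "\<forall>y'\<in>U. f y' \<in> chart_dom c \<and> chart_map c (f y') \<in> chart_map c ` (W \<inter> chart_dom c)"
    using V by blast
  have "f y' \<in> W" if "y' \<in> U" for y'
    using U(3)[rule_format, OF that] atlas_inj[OF c(1)] by (auto dest: inj_onD)
  with U show "\<exists>U. openin Y U \<and> y \<in> U \<and> (\<forall>y'\<in>U. f y' \<in> W)" by blast
qed

lemma continuous_map_from_atlas:
  assumes "\<And>x. x \<in> points \<A> \<Longrightarrow> f x \<in> topspace Y"
    and "\<And>x. x \<in> points \<A> \<Longrightarrow> \<exists>c\<in>\<A>. x \<in> chart_dom c \<and>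
     (\<forall>W. openin Y W \<and> f x \<in> W \<longrightarrow>
       (\<exists>V. open V \<and> chart_map c x \<in> V \<and> (\<forall>x'\<in>chart_dom c. chart_map c x' \<in> V \<longrightarrow> f x' \<in> W)))"
  shows "continuous_map (manifold_topology \<A>) Y f"
  unfolding continuous_map_eq_topcontinuous_at topcontinuous_at_def topspace_atlas
proof (intro ballI conjI allI impI)
  fix x assume x: "x \<in> points \<A>"
  show "x \<in> points \<A>" "f \<in> points \<A> \<rightarrow> topspace Y" using x assms(1) by blast+
  fix W assume W: "openin Y W \<and> f x \<in> W"
  from assms(2)[OF x] obtain c where c: "c \<in> \<A>" "x \<in> chart_dom c"
    "\<forall>W. openin Y W \<and> f x \<in> W \<longrightarrow>
       (\<exists>V. open V \<and> chart_map c x \<in> V \<and> (\<forall>x'\<in>chart_dom c. chart_map c x' \<in> V \<longrightarrow> f x' \<in> W))" by blast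
  then obtain V where V: "open V" "chart_map c x \<in> V"
    "\<forall>x'\<in>chart_dom c. chart_map c x' \<in> V \<longrightarrow> f x' \<in> W" using W by blast
  show "\<exists>U. openin (manifold_topology \<A>) U \<and> x \<in> U \<and> (\<forall>y\<in>U. f y \<in> W)"
    using c V by (intro exI[of _ "{x \<in> chart_dom c. chart_map c x \<in> V}"] conjI chart_preimage_open) auto
qed

lemma chart_curve_continuous:
  fixes z :: "real \<Rightarrow> 'x"
  assumes z: "continuous_map euclideanreal (manifold_topology \<A>) z" and c: "c \<in> \<A>"
  shows "open {s. z s \<in> chart_dom c}" "continuous_on {s. z s \<in> chart_dom c} (\<lambda>s. chart_map c (z s))"
proof -
  have o: "open {s. z s \<in> chart_dom c \<and> chart_map c (z s) \<in> V}" if "open V" for V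
    using openin_continuous_map_preimage[OF z chart_preimage_open[OF c that]] by simp
  from o[of UNIV] show 1: "open {s. z s \<in> chart_dom c}" by simp
  show "continuous_on {s. z s \<in> chart_dom c} (\<lambda>s. chart_map c (z s))"
    unfolding continuous_on_open_vimage[OF 1]
  proof (intro allI impI)
    fix V :: "'v set" assume "open V"
    from o[OF this] show "open ((\<lambda>s. chart_map c (z s)) -` V \<inter> {s. z s \<in> chart_dom c})"
      by (rule back_subst[where P = "open"]) auto
  qed
qed

lemma chart_inv_continuous:
  assumes c: "c \<in> \<A>"
  shows "continuous_map (top_of_set (chart_map c ` chart_dom c)) (manifold_topology \<A>) (chart_inv c)"
  unfolding continuous_map_def
proof (intro conjI allI impI)
  show "chart_inv c \<in> topspace (top_of_set (chart_map c ` chart_dom c)) \<rightarrow> topspace (manifold_topology \<A>)"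
  proof
    fix y assume "y \<in> topspace (top_of_set (chart_map c ` chart_dom c))"
    then have "chart_inv c y \<in> chart_dom c" using chart_inv_dom[of y c] by simp
    then show "chart_inv c y \<in> topspace (manifold_topology \<A>)"
      using c unfolding topspace_atlas points_def by blast
  qed
  fix U assume U: "openin (manifold_topology \<A>) U"
  have "{y \<in> chart_map c ` chart_dom c. chart_inv c y \<in> U} = chart_map c ` (U \<inter> chart_dom c)"
  proof (intro equalityI subsetI)
    fix y assume y: "y \<in> {y \<in> chart_map c ` chart_dom c. chart_inv c y \<in> U}"
    then have "chart_inv c y \<in> U \<inter> chart_dom c" using chart_inv_dom[of y c] by blast
    then show "y \<in> chart_map c ` (U \<inter> chart_dom c)"
      using chart_map_inv[of y c] y by (auto intro: rev_image_eqI)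
  next
    fix y assume "y \<in> chart_map c ` (U \<inter> chart_dom c)"
    then show "y \<in> {y \<in> chart_map c ` chart_dom c. chart_inv c y \<in> U}"
      using chart_inv_map[OF c] by auto
  qed
  with open_image_chart[OF U c]
  show "openin (top_of_set (chart_map c ` chart_dom c))
     {x \<in> topspace (top_of_set (chart_map c ` chart_dom c)). chart_inv c x \<in> U}"
    by (auto intro!: open_subset)
qed

text \<open>Makes closed coordinate balls closed in a Hausdorff manifold, which serves to confine
  orbits to a chart.\<close>

lemma compactin_chart_preimage:
  assumes c: "c \<in> \<A>" and K: "compact K" "K \<subseteq> chart_map c ` chart_dom c"
  shows "compactin (manifold_topology \<A>) {x \<in> chart_dom c. chart_map c x \<in> K}"
proof -
  have "{x \<in> chart_dom c. chart_map c x \<in> K} = chart_inv c ` K"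
  proof (intro equalityI subsetI)
    fix x assume "x \<in> {x \<in> chart_dom c. chart_map c x \<in> K}"
    then show "x \<in> chart_inv c ` K" using chart_inv_map[OF c, of x] by (auto intro: rev_image_eqI)
  next
    fix x assume "x \<in> chart_inv c ` K"
    then show "x \<in> {x \<in> chart_dom c. chart_map c x \<in> K}"
      using K chart_inv_dom[of _ c] chart_map_inv[of _ c] by auto
  qed
  moreover have "compactin (top_of_set (chart_map c ` chart_dom c)) K"
    using K by (simp add: compactin_subtopology)
  ultimately show ?thesis using image_compactin chart_inv_continuous[OF c] by metis
qed

end

text \<open>At the first time outside \<open>V\<close> the curve would still be in the closed set \<open>C \<subseteq> V\<close>.\<close>

lemma curve_confined:
  fixes z :: "real \<Rightarrow> 'x"
  assumes z: "continuous_map euclideanreal X z" and V: "openin X V" and C: "closedin X C" "C \<subseteq> V"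
    and s: "z s \<in> V"
    and step: "\<And>\<tau>. \<tau> \<in> closed_segment s t \<Longrightarrow> (\<And>\<sigma>. \<sigma> \<in> closed_segment s \<tau> \<Longrightarrow> z \<sigma> \<in> V) \<Longrightarrow> z \<tau> \<in> C"
    and \<tau>: "\<tau> \<in> closed_segment s t"
  shows "z \<tau> \<in> V"
proof (rule ccontr)
  assume nV: "z \<tau> \<notin> V"
  define N where "N = {\<sigma> \<in> closed_segment s \<tau>. z \<sigma> \<notin> V}"
  have "open {\<sigma>. z \<sigma> \<in> V}" using openin_continuous_map_preimage[OF z V] by simp
  then have "closed (- {\<sigma>. z \<sigma> \<in> V})" by (rule closed_Compl)
  moreover have "N = closed_segment s \<tau> \<inter> - {\<sigma>. z \<sigma> \<in> V}" by (auto simp: N_def)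
  ultimately have "closed N" by (auto intro: closed_Int closed_segment)
  moreover have "N \<noteq> {}" using nV by (auto simp: N_def)
  ultimately obtain m where m: "m \<in> N" "\<And>y. y \<in> N \<Longrightarrow> dist s m \<le> dist s y"
    using distance_attains_inf by blast
  have ms: "m \<noteq> s" using m s by (auto simp: N_def)
  have mseg: "m \<in> closed_segment s \<tau>" using m by (simp add: N_def)
  have inV: "z \<sigma> \<in> V" if "\<sigma> \<in> open_segment s m" for \<sigma>
  proof (rule ccontr)
    assume "z \<sigma> \<notin> V"
    moreover have "\<sigma> \<in> closed_segment s \<tau>" using that mseg
      by (auto simp: open_segment_eq_real_ivl closed_segment_eq_real_ivl split: if_splits)
    ultimately have "\<sigma> \<in> N" by (simp add: N_def)
    from m(2)[OF this] that show False
      by (auto simp: open_segment_eq_real_ivl dist_real_def split: if_splits)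
  qed
  have inC: "z \<sigma> \<in> C" if "\<sigma> \<in> open_segment s m" for \<sigma>
  proof (rule step)
    show "\<sigma> \<in> closed_segment s t" using that mseg \<tau>
      by (auto simp: open_segment_eq_real_ivl closed_segment_eq_real_ivl split: if_splits)
    fix \<rho> assume "\<rho> \<in> closed_segment s \<sigma>"
    then have "\<rho> = s \<or> \<rho> \<in> open_segment s m" using that
      by (auto simp: open_segment_eq_real_ivl closed_segment_eq_real_ivl split: if_splits)
    then show "z \<rho> \<in> V" using s inV by blast
  qed
  have "closed {\<sigma>. z \<sigma> \<in> C}" using closedin_continuous_map_preimage[OF z C(1)] by simp
  then have "closure (open_segment s m) \<subseteq> {\<sigma>. z \<sigma> \<in> C}" using inC by (intro closure_minimal) auto
  moreover have "m \<in> closure (open_segment s m)" using ms by (simp add: closure_open_segment)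
  ultimately show False using m C by (auto simp: N_def)
qed

section \<open>The cotangent and the tangent bundle of a closed manifold\<close>

locale closed_manifold =
  fixes A :: "('m, 'e::real_inner) atlas"
  assumes closed_connected: "closed_connected_manifold A"
begin

lemma smooth_atlas_A: "smooth_atlas A"
  and Hausdorff_A: "Hausdorff_space (manifold_topology A)"
  and compact_A: "compact_space (manifold_topology A)"
  and connected_A: "connected_space (manifold_topology A)"
  and nonempty_A: "points A \<noteq> {}"
  using closed_connected by (auto simp: closed_connected_manifold_def)

lemma topological_A: "topological_atlas A"
  using smooth_atlas_A by (rule smooth_imp_topological_atlas)

definition model_frame :: "'e set" where "model_frame = (SOME B. frame B)"

lemma model_frame: "frame model_frame"
proof -
  obtain B :: "'e set" where "finite B" "span B = UNIV"
    using smooth_atlas_A by (auto simp: smooth_atlas_def)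
  from frame_exists[OF this] show ?thesis unfolding model_frame_def by (rule someI_ex)
qed

lemma charts_at_nonempty: "q \<in> points A \<Longrightarrow> \<exists>c. c \<in> charts_at A q"
  by (auto simp: points_def charts_at_def)

lemma transition_smooth:
  assumes "c \<in> A" "d \<in> A"
  shows "smooth_on (chart_map c ` (chart_dom c \<inter> chart_dom d)) (chart_map d \<circ> chart_inv c)"
  using smooth_atlas_A assms by (auto simp: smooth_atlas_def)

lemma overlap_open: "c \<in> A \<Longrightarrow> d \<in> A \<Longrightarrow> open (chart_map c ` (chart_dom c \<inter> chart_dom d))"
  by (rule atlas_open_Int[OF topological_A])

lemmas inv_map = chart_inv_map[OF topological_A]

lemma inner_eqI: "(\<And>w::'e. x \<bullet> w = y \<bullet> w) \<Longrightarrow> x = y"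
  using vector_eq_rdot by blast

lemma transition_has_derivative:
  assumes "c \<in> charts_at A q" "d \<in> charts_at A q"
  shows "((chart_map d \<circ> chart_inv c) has_derivative transition_deriv c d q) (at (chart_map c q))"
  unfolding transition_deriv_def using assms
  by (intro smooth_onD[OF transition_smooth]) (auto simp: charts_at_def)

lemma transition_linear:
  "c \<in> charts_at A q \<Longrightarrow> d \<in> charts_at A q \<Longrightarrow> linear (transition_deriv c d q)"
  using transition_has_derivative has_derivative_linear by blast

lemma transition_compose:
  assumes c: "c \<in> charts_at A q" and d: "d \<in> charts_at A q" and e: "e \<in> charts_at A q"
  shows "transition_deriv d e q (transition_deriv c d q u) = transition_deriv c e q u"
proof -
  have cA: "c \<in> A" "d \<in> A" "e \<in> A" and q: "q \<in> chart_dom c" "q \<in> chart_dom d" "q \<in> chart_dom e"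
    using assms by (auto simp: charts_at_def)
  have eq: "(chart_map d \<circ> chart_inv c) (chart_map c q) = chart_map d q" using inv_map cA q by simp
  have "((chart_map e \<circ> chart_inv d) \<circ> (chart_map d \<circ> chart_inv c) has_derivative
     transition_deriv d e q \<circ> transition_deriv c d q) (at (chart_map c q))"
    using transition_has_derivative[OF c d] transition_has_derivative[OF d e]
    by (intro diff_chain_at) (simp_all only: eq)
  moreover have "open (chart_map c ` (chart_dom c \<inter> chart_dom d) \<inter> chart_map c ` (chart_dom c \<inter> chart_dom e))"
    using cA by (intro open_Int overlap_open)
  moreover have "chart_map c q \<in> chart_map c ` (chart_dom c \<inter> chart_dom d) \<inter> chart_map c ` (chart_dom c \<inter> chart_dom e)"
    using q by blast
  moreover have "((chart_map e \<circ> chart_inv d) \<circ> (chart_map d \<circ> chart_inv c)) y = (chart_map e \<circ> chart_inv c) y"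
    if y: "y \<in> chart_map c ` (chart_dom c \<inter> chart_dom d) \<inter> chart_map c ` (chart_dom c \<inter> chart_dom e)" for y
  proof -
    obtain x where "x \<in> chart_dom c" "x \<in> chart_dom d" "y = chart_map c x" using y by blast
    then show ?thesis using inv_map[OF cA(1)] inv_map[OF cA(2)] by simp
  qed
  ultimately have "(chart_map e \<circ> chart_inv c has_derivative transition_deriv d e q \<circ> transition_deriv c d q) (at (chart_map c q))"
    by (rule has_derivative_transform_within_open)
  from has_derivative_unique[OF this transition_has_derivative[OF c e]]
  show ?thesis by (metis comp_apply)
qed

lemma transition_refl:
  assumes c: "c \<in> charts_at A q"
  shows "transition_deriv c c q u = u"
proof -
  have cA: "c \<in> A" "q \<in> chart_dom c" using assms by (auto simp: charts_at_def)
  have "((\<lambda>x. x) has_derivative (\<lambda>x. x)) (at (chart_map c q))" by simp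
  moreover have "open (chart_map c ` chart_dom c)" by (rule atlas_open[OF topological_A cA(1)])
  moreover have "chart_map c q \<in> chart_map c ` chart_dom c" using cA by blast
  moreover have "y = (chart_map c \<circ> chart_inv c) y" if "y \<in> chart_map c ` chart_dom c" for y
    using that inv_map[OF cA(1)] by auto
  ultimately have "(chart_map c \<circ> chart_inv c has_derivative (\<lambda>x. x)) (at (chart_map c q))"
    by (rule has_derivative_transform_within_open)
  from has_derivative_unique[OF this transition_has_derivative[OF c c]]
  show ?thesis by metis
qed

definition tangent_of :: "'m \<Rightarrow> ('m, 'e) chart \<Rightarrow> 'e \<Rightarrow> ('m, 'e) coords" where
  "tangent_of q c \<xi> = (\<lambda>d. if d \<in> charts_at A q then transition_deriv c d q \<xi> else 0)"

text \<open>The sum is the Riesz vector of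
  \<open>\<lambda>b. \<xi> \<bullet> transition_deriv d c q b\<close>, that is, the transpose of the
  coordinate change from \<open>d\<close> to \<open>c\<close> applied to
  \<open>\<xi>\<close>.\<close>

definition cotangent_of :: "'m \<Rightarrow> ('m, 'e) chart \<Rightarrow> 'e \<Rightarrow> ('m, 'e) coords" where
  "cotangent_of q c \<xi> = (\<lambda>d. if d \<in> charts_at A q then \<Sum>b\<in>model_frame. (\<xi> \<bullet> transition_deriv d c q b) *\<^sub>R b else 0)"

lemma tangent_of:
  assumes "c \<in> charts_at A q"
  shows "tangent_of q c \<xi> \<in> tangent_space A q" "tangent_of q c \<xi> c = \<xi>"
  using assms transition_compose transition_refl by (auto simp: tangent_of_def tangent_space_def)

lemma tangent_spaceD:
  assumes "v \<in> tangent_space A q" "c \<in> charts_at A q"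
  shows "v = tangent_of q c (v c)"
proof
  fix d
  show "v d = tangent_of q c (v c) d"
  proof (cases "d \<in> charts_at A q")
    case True
    then have "v d = transition_deriv c d q (v c)" using assms unfolding tangent_space_def by blast
    then show ?thesis using True by (simp only: tangent_of_def if_True)
  next
    case False
    then have "v d = 0" using assms(1) unfolding tangent_space_def by blast
    then show ?thesis using False by (simp only: tangent_of_def if_False)
  qed
qed

lemma cotangent_of_inner:
  assumes "c \<in> charts_at A q" "d \<in> charts_at A q"
  shows "cotangent_of q c \<xi> d \<bullet> w = \<xi> \<bullet> transition_deriv d c q w"
proof -
  have "linear (\<lambda>w. \<xi> \<bullet> transition_deriv d c q w)"
    using linear_compose[OF transition_linear[OF assms(2,1)] bounded_linear.linear[OF bounded_linear_inner_right]]
    by (simp add: o_def)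
  from frame_riesz[OF model_frame this, of w] show ?thesis
    using assms by (simp add: cotangent_of_def inner_commute)
qed

lemma cotangent_of:
  assumes c: "c \<in> charts_at A q"
  shows "cotangent_of q c \<xi> \<in> cotangent_space A q" "cotangent_of q c \<xi> c = \<xi>"
proof -
  show "cotangent_of q c \<xi> \<in> cotangent_space A q"
    unfolding cotangent_space_def mem_Collect_eq
  proof (intro conjI allI impI ballI)
    show "cotangent_of q c \<xi> d = 0" if "d \<notin> charts_at A q" for d
      using that by (simp add: cotangent_of_def)
    show "cotangent_of q c \<xi> e \<bullet> transition_deriv d e q w = cotangent_of q c \<xi> d \<bullet> w"
      if "d \<in> charts_at A q" "e \<in> charts_at A q" for d e w
      using that c by (simp add: cotangent_of_inner transition_compose)
  qed
  show "cotangent_of q c \<xi> c = \<xi>"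
    by (rule inner_eqI) (simp add: cotangent_of_inner[OF c c] transition_refl[OF c])
qed

lemma cotangent_space_inner:
  assumes "p \<in> cotangent_space A q" "c \<in> charts_at A q" "d \<in> charts_at A q"
  shows "p d \<bullet> transition_deriv c d q u = p c \<bullet> u"
  using assms unfolding cotangent_space_def by blast

lemma cotangent_spaceD:
  assumes p: "p \<in> cotangent_space A q" and c: "c \<in> charts_at A q"
  shows "p = cotangent_of q c (p c)"
proof
  fix d
  show "p d = cotangent_of q c (p c) d"
  proof (cases "d \<in> charts_at A q")
    case True
    have "p d \<bullet> w = cotangent_of q c (p c) d \<bullet> w" for w
      using cotangent_space_inner[OF p c True, of "transition_deriv d c q w"]
      unfolding cotangent_of_inner[OF c True] transition_compose[OF True c True] transition_refl[OF True] .
    then show ?thesis by (rule inner_eqI)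
  next
    case False
    then have "p d = 0" using p unfolding cotangent_space_def by blast
    then show ?thesis using False by (simp only: cotangent_of_def if_False)
  qed
qed

lemma pairing_eq:
  assumes "p \<in> cotangent_space A q" "v \<in> tangent_space A q" "c \<in> charts_at A q"
  shows "pairing A q p v = p c \<bullet> v c"
proof -
  define d where "d = (SOME c. c \<in> charts_at A q)"
  have d: "d \<in> charts_at A q" unfolding d_def using assms(3) by (rule someI)
  have "v d = transition_deriv c d q (v c)" using assms(2,3) d unfolding tangent_space_def by blast
  then have "p d \<bullet> v d = p c \<bullet> v c" using cotangent_space_inner[OF assms(1,3) d] by simp
  then show ?thesis by (simp add: pairing_def d_def Let_def)
qed

abbreviation cb :: "('m, 'e) chart \<Rightarrow> ('m \<times> ('m, 'e) coords, 'e \<times> 'e) chart" where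
  "cb \<equiv> bundle_chart (cotangent_space A)"

abbreviation tb :: "('m, 'e) chart \<Rightarrow> ('m \<times> ('m, 'e) coords, 'e \<times> 'e) chart" where
  "tb \<equiv> bundle_chart (tangent_space A)"

lemma bundle_map [simp]: "chart_map (bundle_chart E c) z = (chart_map c (fst z), snd z c)"
  by (simp add: bundle_chart_def split_beta)

lemma bundle_dom: "z \<in> chart_dom (bundle_chart E c) \<longleftrightarrow> fst z \<in> chart_dom c \<and> snd z \<in> E (fst z)"
  by (cases z) (simp add: bundle_chart_def)

lemma cb_inj: "c \<in> A \<Longrightarrow> inj_on (chart_map (cb c)) (chart_dom (cb c))"
  and tb_inj: "c \<in> A \<Longrightarrow> inj_on (chart_map (tb c)) (chart_dom (tb c))"
proof -
  \<comment> \<open>One argument for both bundles: \<open>mk\<close> rebuilds an element of the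
    fibre from its coordinate in one chart.\<close>
  have *: "inj_on (chart_map (bundle_chart E c)) (chart_dom (bundle_chart E c))"
    if c: "c \<in> A" and E: "\<And>q v. c \<in> charts_at A q \<Longrightarrow> v \<in> E q \<Longrightarrow> v = mk q c (v c)"
    for c E and mk :: "'m \<Rightarrow> ('m, 'e) chart \<Rightarrow> 'e \<Rightarrow> ('m, 'e) coords"
  proof (rule inj_onI)
    fix z w assume zw: "z \<in> chart_dom (bundle_chart E c)" "w \<in> chart_dom (bundle_chart E c)"
      "chart_map (bundle_chart E c) z = chart_map (bundle_chart E c) w"
    then have "fst z = fst w"
      using atlas_inj[OF topological_A c] by (auto simp: bundle_dom dest: inj_onD)
    moreover have "snd z = mk (fst z) c (snd z c)" "snd w = mk (fst w) c (snd w c)"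
      using E[of "fst z" "snd z"] E[of "fst w" "snd w"] zw c by (simp_all add: bundle_dom charts_at_def)
    ultimately show "z = w" using zw(3) by (metis bundle_map prod.collapse prod.inject)
  qed
  show "c \<in> A \<Longrightarrow> inj_on (chart_map (cb c)) (chart_dom (cb c))"
    using *[of c "cotangent_space A" cotangent_of] cotangent_spaceD by blast
  show "c \<in> A \<Longrightarrow> inj_on (chart_map (tb c)) (chart_dom (tb c))"
    using *[of c "tangent_space A" tangent_of] tangent_spaceD by blast
qed

lemma cb_image: "c \<in> A \<Longrightarrow> d \<in> A \<Longrightarrow>
    chart_map (cb c) ` (chart_dom (cb c) \<inter> chart_dom (cb d)) = chart_map c ` (chart_dom c \<inter> chart_dom d) \<times> UNIV"
  and tb_image: "c \<in> A \<Longrightarrow> d \<in> A \<Longrightarrow>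
    chart_map (tb c) ` (chart_dom (tb c) \<inter> chart_dom (tb d)) = chart_map c ` (chart_dom c \<inter> chart_dom d) \<times> UNIV"
proof -
  have *: "chart_map (bundle_chart E c) ` (chart_dom (bundle_chart E c) \<inter> chart_dom (bundle_chart E d)) =
      chart_map c ` (chart_dom c \<inter> chart_dom d) \<times> (UNIV :: 'e set)"
    if c: "c \<in> A" and E: "\<And>q \<xi>. c \<in> charts_at A q \<Longrightarrow> mk q c \<xi> \<in> E q \<and> mk q c \<xi> c = \<xi>"
    for c d E and mk :: "'m \<Rightarrow> ('m, 'e) chart \<Rightarrow> 'e \<Rightarrow> ('m, 'e) coords"
  proof (intro equalityI subsetI)
    fix y assume "y \<in> chart_map c ` (chart_dom c \<inter> chart_dom d) \<times> (UNIV :: 'e set)"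
    then obtain q \<xi> where q: "q \<in> chart_dom c" "q \<in> chart_dom d" "y = (chart_map c q, \<xi>)" by auto
    then have "mk q c \<xi> \<in> E q" "mk q c \<xi> c = \<xi>" using E[of q \<xi>] c by (auto simp: charts_at_def)
    then show "y \<in> chart_map (bundle_chart E c) ` (chart_dom (bundle_chart E c) \<inter> chart_dom (bundle_chart E d))"
      using q by (intro image_eqI[of _ _ "(q, mk q c \<xi>)"]) (auto simp: bundle_dom)
  qed (auto simp: bundle_dom)
  show "c \<in> A \<Longrightarrow> d \<in> A \<Longrightarrow>
    chart_map (cb c) ` (chart_dom (cb c) \<inter> chart_dom (cb d)) = chart_map c ` (chart_dom c \<inter> chart_dom d) \<times> UNIV"
    using *[of c cotangent_of "cotangent_space A" d] cotangent_of by blast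
  show "c \<in> A \<Longrightarrow> d \<in> A \<Longrightarrow>
    chart_map (tb c) ` (chart_dom (tb c) \<inter> chart_dom (tb d)) = chart_map c ` (chart_dom c \<inter> chart_dom d) \<times> UNIV"
    using *[of c tangent_of "tangent_space A" d] tangent_of by blast
qed

lemma cb_range: "c \<in> A \<Longrightarrow> chart_map (cb c) ` chart_dom (cb c) = chart_map c ` chart_dom c \<times> UNIV"
  and tb_range: "c \<in> A \<Longrightarrow> chart_map (tb c) ` chart_dom (tb c) = chart_map c ` chart_dom c \<times> UNIV"
  using cb_image[of c c] tb_image[of c c] by auto

lemma cb_inv:
  assumes "c \<in> A" "x \<in> chart_map c ` chart_dom c"
  shows "chart_inv (cb c) (x, \<xi>) = (chart_inv c x, cotangent_of (chart_inv c x) c \<xi>)"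
proof -
  have d: "c \<in> charts_at A (chart_inv c x)"
    using assms(1) chart_inv_dom[OF assms(2)] by (simp add: charts_at_def)
  have "chart_inv (cb c) (chart_map (cb c) (chart_inv c x, cotangent_of (chart_inv c x) c \<xi>)) =
     (chart_inv c x, cotangent_of (chart_inv c x) c \<xi>)"
    unfolding chart_inv_def[of "cb c"]
    by (rule inv_into_f_f[OF cb_inj[OF assms(1)]])
      (use d cotangent_of in \<open>auto simp: bundle_dom charts_at_def\<close>)
  then show ?thesis using d cotangent_of(2) chart_map_inv[OF assms(2)] by simp
qed

lemma tb_inv:
  assumes "c \<in> A" "x \<in> chart_map c ` chart_dom c"
  shows "chart_inv (tb c) (x, \<xi>) = (chart_inv c x, tangent_of (chart_inv c x) c \<xi>)"
proof -
  have d: "c \<in> charts_at A (chart_inv c x)"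
    using assms(1) chart_inv_dom[OF assms(2)] by (simp add: charts_at_def)
  have "chart_inv (tb c) (chart_map (tb c) (chart_inv c x, tangent_of (chart_inv c x) c \<xi>)) =
     (chart_inv c x, tangent_of (chart_inv c x) c \<xi>)"
    unfolding chart_inv_def[of "tb c"]
    by (rule inv_into_f_f[OF tb_inj[OF assms(1)]])
      (use d tangent_of in \<open>auto simp: bundle_dom charts_at_def\<close>)
  then show ?thesis using d tangent_of(2) chart_map_inv[OF assms(2)] by simp
qed

text \<open>Expanding \<open>\<xi>\<close> in the frame reduces joint continuity in
  \<open>(x, \<xi>)\<close> to the continuity of finitely many directional derivatives in
  \<open>x\<close>.\<close>

lemma tangent_transition_eq:
  assumes c: "c \<in> A" and d: "d \<in> A" and x: "x \<in> chart_map c ` (chart_dom c \<inter> chart_dom d)"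
  shows "(chart_map (tb d) \<circ> chart_inv (tb c)) (x, \<xi>) =
     ((chart_map d \<circ> chart_inv c) x, \<Sum>b\<in>model_frame. (\<xi> \<bullet> b) *\<^sub>R frechet_derivative (chart_map d \<circ> chart_inv c) (at x) b)"
proof -
  obtain q where q: "q \<in> chart_dom c" "q \<in> chart_dom d" "x = chart_map c q" using x by auto
  have ch: "c \<in> charts_at A q" "d \<in> charts_at A q" using q c d by (auto simp: charts_at_def)
  note lin = transition_linear[OF ch]
  have "transition_deriv c d q \<xi> = transition_deriv c d q (\<Sum>b\<in>model_frame. (\<xi> \<bullet> b) *\<^sub>R b)"
    by (simp add: frameD(2)[OF model_frame])
  also have "\<dots> = (\<Sum>b\<in>model_frame. (\<xi> \<bullet> b) *\<^sub>R transition_deriv c d q b)"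
    by (simp add: linear_sum[OF lin] linear_scale[OF lin])
  finally show ?thesis
    using tb_inv[OF c, of x \<xi>] q inv_map[OF c q(1)] ch
    by (simp add: tangent_of_def transition_deriv_def)
qed

text \<open>Covectors transform by the transpose of the derivative of the inverse coordinate change,
  which is why it is taken at the image point.\<close>

lemma cotangent_transition_eq:
  assumes c: "c \<in> A" and d: "d \<in> A" and x: "x \<in> chart_map c ` (chart_dom c \<inter> chart_dom d)"
  shows "(chart_map (cb d) \<circ> chart_inv (cb c)) (x, \<xi>) =
     ((chart_map d \<circ> chart_inv c) x,
      \<Sum>b\<in>model_frame. (\<xi> \<bullet> frechet_derivative (chart_map c \<circ> chart_inv d) (at ((chart_map d \<circ> chart_inv c) x)) b) *\<^sub>R b)"
proof -
  obtain q where q: "q \<in> chart_dom c" "q \<in> chart_dom d" "x = chart_map c q" using x by auto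
  have ch: "c \<in> charts_at A q" "d \<in> charts_at A q" using q c d by (auto simp: charts_at_def)
  show ?thesis
    using cb_inv[OF c, of x \<xi>] q inv_map[OF c q(1)] ch
    by (simp add: cotangent_of_def transition_deriv_def)
qed

lemma transition_image:
  assumes "c \<in> A" "d \<in> A"
  shows "(chart_map d \<circ> chart_inv c) ` (chart_map c ` (chart_dom c \<inter> chart_dom d)) = chart_map d ` (chart_dom d \<inter> chart_dom c)"
  unfolding image_image by (rule image_cong) (use inv_map[OF assms(1)] in auto)

lemma topological_tangent: "topological_atlas (tangent_atlas A)"
  unfolding tangent_atlas_def
proof (rule topological_atlas_image)
  fix c assume c: "c \<in> A"
  show "inj_on (chart_map (tb c)) (chart_dom (tb c))" by (rule tb_inj[OF c])
  show "open (chart_map (tb c) ` chart_dom (tb c))"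
    unfolding tb_range[OF c] using atlas_open[OF topological_A c] by (simp add: open_Times)
next
  fix c d assume c: "c \<in> A" and d: "d \<in> A"
  let ?S = "chart_map c ` (chart_dom c \<inter> chart_dom d)"
  show "open (chart_map (tb c) ` (chart_dom (tb c) \<inter> chart_dom (tb d)))"
    unfolding tb_image[OF c d] using overlap_open[OF c d] by (simp add: open_Times)
  have 1: "continuous_on ?S (chart_map d \<circ> chart_inv c)"
    "continuous_on ?S (\<lambda>x. frechet_derivative (chart_map d \<circ> chart_inv c) (at x) b)" for b
    using smooth_on_continuous smooth_on_derivative transition_smooth[OF c d] by blast+
  have "continuous_on (?S \<times> UNIV) (\<lambda>y. ((chart_map d \<circ> chart_inv c) (fst y),
     \<Sum>b\<in>model_frame. (snd y \<bullet> b) *\<^sub>R frechet_derivative (chart_map d \<circ> chart_inv c) (at (fst y)) b))"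
    by (intro continuous_intros continuous_on_compose2[OF 1(1) continuous_on_fst]
        continuous_on_compose2[OF 1(2) continuous_on_fst]) auto
  then show "continuous_on (chart_map (tb c) ` (chart_dom (tb c) \<inter> chart_dom (tb d)))
       (chart_map (tb d) \<circ> chart_inv (tb c))"
    unfolding tb_image[OF c d]
    by (rule continuous_on_eq) (use tangent_transition_eq[OF c d] in auto)
qed

lemma topological_cotangent: "topological_atlas (cotangent_atlas A)"
  unfolding cotangent_atlas_def
proof (rule topological_atlas_image)
  fix c assume c: "c \<in> A"
  show "inj_on (chart_map (cb c)) (chart_dom (cb c))" by (rule cb_inj[OF c])
  show "open (chart_map (cb c) ` chart_dom (cb c))"
    unfolding cb_range[OF c] using atlas_open[OF topological_A c] by (simp add: open_Times)
next
  fix c d assume c: "c \<in> A" and d: "d \<in> A"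
  let ?S = "chart_map c ` (chart_dom c \<inter> chart_dom d)"
  show "open (chart_map (cb c) ` (chart_dom (cb c) \<inter> chart_dom (cb d)))"
    unfolding cb_image[OF c d] using overlap_open[OF c d] by (simp add: open_Times)
  have 1: "continuous_on ?S (chart_map d \<circ> chart_inv c)"
    using smooth_on_continuous transition_smooth[OF c d] by blast
  have 2: "continuous_on (chart_map d ` (chart_dom d \<inter> chart_dom c)) (\<lambda>x. frechet_derivative (chart_map c \<circ> chart_inv d) (at x) b)" for b
    using smooth_on_continuous smooth_on_derivative transition_smooth[OF d c] by blast
  have 3: "continuous_on ?S (\<lambda>x. frechet_derivative (chart_map c \<circ> chart_inv d) (at ((chart_map d \<circ> chart_inv c) x)) b)" for b
    by (rule continuous_on_compose2[OF 2 1]) (use transition_image[OF c d] in blast)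
  have "continuous_on (?S \<times> UNIV) (\<lambda>y. ((chart_map d \<circ> chart_inv c) (fst y),
     \<Sum>b\<in>model_frame. (snd y \<bullet> frechet_derivative (chart_map c \<circ> chart_inv d) (at ((chart_map d \<circ> chart_inv c) (fst y))) b) *\<^sub>R b))"
    by (intro continuous_intros continuous_on_compose2[OF 1 continuous_on_fst]
        continuous_on_compose2[OF 3 continuous_on_fst]) auto
  then show "continuous_on (chart_map (cb c) ` (chart_dom (cb c) \<inter> chart_dom (cb d)))
       (chart_map (cb d) \<circ> chart_inv (cb c))"
    unfolding cb_image[OF c d]
    by (rule continuous_on_eq) (use cotangent_transition_eq[OF c d] in auto)
qed

end

section \<open>The canonical symplectic form, and the cotangent bundle as a space\<close>

lemma symplectic_form_bilinear: "bounded_bilinear (symplectic_form :: 'e::real_inner \<times> 'e \<Rightarrow> _)"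
proof
  fix a a' b b' :: "'e \<times> 'e" and r :: real
  show "symplectic_form (a + a') b = symplectic_form a b + symplectic_form a' b"
    "symplectic_form a (b + b') = symplectic_form a b + symplectic_form a b'"
    "symplectic_form (r *\<^sub>R a) b = r *\<^sub>R symplectic_form a b"
    "symplectic_form a (r *\<^sub>R b) = r *\<^sub>R symplectic_form a b"
    by (simp_all add: symplectic_form_def inner_add_left inner_add_right algebra_simps)
  have "norm (symplectic_form a b) \<le> norm a * norm b * 2" for a b :: "'e \<times> 'e"
  proof -
    have 1: "norm (fst z) \<le> norm z" "norm (snd z) \<le> norm z" for z :: "'e \<times> 'e"
      using norm_fst_le[of "fst z" "snd z"] norm_snd_le[of "snd z" "fst z"] by auto
    have "\<bar>snd a \<bullet> fst b\<bar> \<le> norm a * norm b" "\<bar>fst a \<bullet> snd b\<bar> \<le> norm a * norm b"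
      by (rule order_trans[OF Cauchy_Schwarz_ineq2] mult_mono 1 norm_ge_zero)+
    then show ?thesis unfolding symplectic_form_def real_norm_def by linarith
  qed
  then show "\<exists>K. \<forall>a b::'e \<times> 'e. norm (symplectic_form a b) \<le> norm a * norm b * K" by blast
qed

lemma symplectic_form_skew: "symplectic_form a b = - symplectic_form b a"
  by (simp add: symplectic_form_def inner_commute)

lemma symplectic_form_eqI:
  assumes "\<And>\<eta>. symplectic_form \<xi> \<eta> = symplectic_form \<xi>' \<eta>"
  shows "\<xi> = \<xi>'"
proof -
  have "fst \<xi> \<bullet> w = fst \<xi>' \<bullet> w" "snd \<xi> \<bullet> w = snd \<xi>' \<bullet> w" for w
    using assms[of "(0, w)"] assms[of "(w, 0)"] by (auto simp: symplectic_form_def)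
  then show ?thesis using vector_eq_rdot by (metis prod_eqI)
qed

context closed_manifold begin

lemma cotangent_points: "z \<in> points (cotangent_atlas A) \<longleftrightarrow> fst z \<in> points A \<and> snd z \<in> cotangent_space A (fst z)"
  by (auto simp: points_def cotangent_atlas_def bundle_dom)

lemma tangent_points: "z \<in> points (tangent_atlas A) \<longleftrightarrow> fst z \<in> points A \<and> snd z \<in> tangent_space A (fst z)"
  by (auto simp: points_def tangent_atlas_def bundle_dom)

lemma cb_atlas: "c \<in> A \<Longrightarrow> cb c \<in> cotangent_atlas A"
  by (simp add: cotangent_atlas_def)

lemma tb_atlas: "c \<in> A \<Longrightarrow> tb c \<in> tangent_atlas A"
  by (simp add: tangent_atlas_def)

lemma cb_dom_points: "c \<in> A \<Longrightarrow> z \<in> chart_dom (cb c) \<Longrightarrow> z \<in> points (cotangent_atlas A)"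
  by (auto simp: points_def cotangent_atlas_def)

abbreviation Cot :: "('m \<times> ('m, 'e) coords) topology" where
  "Cot \<equiv> manifold_topology (cotangent_atlas A)"

abbreviation Tan :: "('m \<times> ('m, 'e) coords) topology" where
  "Tan \<equiv> manifold_topology (tangent_atlas A)"

lemmas cb_inv_map = chart_inv_map[OF topological_cotangent cb_atlas]
lemmas tb_inv_map = chart_inv_map[OF topological_tangent tb_atlas]
lemmas cb_preimage_open = chart_preimage_open[OF topological_cotangent cb_atlas]
lemmas topspace_Cot = topspace_atlas[OF topological_cotangent]
lemmas topspace_Tan = topspace_atlas[OF topological_tangent]

lemma cb_mem_range: "c \<in> A \<Longrightarrow> q \<in> chart_dom c \<Longrightarrow> (chart_map c q, \<xi>) \<in> chart_map (cb c) ` chart_dom (cb c)"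
  by (auto simp: cb_range simp del: bundle_map)

text \<open>Coordinate changes of the base lift to symplectic maps. The second derivative of the
  base change contributes to the momentum part of the differential, but it drops out of the
  symplectic form because it is symmetric. The last clause says that the lift covers the base
  change.\<close>

lemma cotangent_transition:
  assumes c: "c \<in> charts_at A q" and d: "d \<in> charts_at A q" and p: "p \<in> cotangent_space A q"
  shows "\<exists>T. ((chart_map (cb d) \<circ> chart_inv (cb c)) has_derivative T) (at (chart_map c q, p c)) \<and>
     (\<forall>u v. symplectic_form (T u) (T v) = symplectic_form u v) \<and>
     (\<forall>u. fst (T u) = transition_deriv c d q (fst u))"
proof -
  have cA: "c \<in> A" "d \<in> A" and q: "q \<in> chart_dom c" "q \<in> chart_dom d"
    using c d by (auto simp: charts_at_def)
  define \<tau> \<sigma> where "\<tau> = chart_map d \<circ> chart_inv c" and "\<sigma> = chart_map c \<circ> chart_inv d"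
  define y0 where "y0 = chart_map d q"
  have \<tau>q: "\<tau> (chart_map c q) = y0" using inv_map[OF cA(1) q(1)] by (simp add: \<tau>_def y0_def)
  let ?D\<tau> = "transition_deriv c d q" and ?D\<sigma> = "transition_deriv d c q"
  have D\<sigma>: "?D\<sigma> = frechet_derivative \<sigma> (at y0)" by (simp add: transition_deriv_def \<sigma>_def y0_def)
  define S' where "S' = chart_map d ` (chart_dom d \<inter> chart_dom c)"
  have S': "open S'" "y0 \<in> S'" using overlap_open[OF cA(2,1)] q by (auto simp: S'_def y0_def)
  have sm: "smooth_on S' \<sigma>" unfolding S'_def \<sigma>_def by (rule transition_smooth[OF cA(2,1)])
  define s where "s v k = frechet_derivative (\<lambda>z. frechet_derivative \<sigma> (at z) v) (at y0) k" for v k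
  have s_sym: "s v k = s k v" for v k
    unfolding s_def by (rule second_derivative_symmetric[OF model_frame S' sm])
  have s_der: "((\<lambda>z. frechet_derivative \<sigma> (at z) v) has_derivative s v) (at y0)" for v
    unfolding s_def by (rule smooth_onD[OF smooth_on_derivative[OF sm] S'(2)])
  have s_lin: "linear (s v)" for v using s_der has_derivative_linear by blast
  have d\<tau>: "(\<tau> has_derivative ?D\<tau>) (at (chart_map c q))"
    unfolding \<tau>_def by (rule transition_has_derivative[OF c d])
  \<comment> \<open>Product rule for the transposed derivative of \<open>\<sigma>\<close> at
    \<open>\<tau> x\<close> applied to \<open>\<xi>\<close>: one summand differentiates
    \<open>\<xi>\<close>, the other the point \<open>\<tau> x\<close>.\<close>
  let ?T = "\<lambda>u. (?D\<tau> (fst u), \<Sum>b\<in>model_frame. (snd u \<bullet> ?D\<sigma> b + p c \<bullet> s b (?D\<tau> (fst u))) *\<^sub>R b)"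
  let ?g = "\<lambda>y. (\<tau> (fst y), \<Sum>b\<in>model_frame. (snd y \<bullet> frechet_derivative \<sigma> (at (\<tau> (fst y))) b) *\<^sub>R b)"
  have \<tau>_fst: "((\<lambda>y. \<tau> (fst y)) has_derivative (\<lambda>u. ?D\<tau> (fst u))) (at (chart_map c q, p c))"
    by (rule has_derivative_compose[where f = fst]) (auto intro!: derivative_eq_intros d\<tau>)
  have h: "((\<lambda>y. frechet_derivative \<sigma> (at (\<tau> (fst y))) b) has_derivative (\<lambda>u. s b (?D\<tau> (fst u)))) (at (chart_map c q, p c))" for b
    by (rule has_derivative_compose[OF \<tau>_fst]) (simp add: \<tau>q s_der)
  have "(?g has_derivative ?T) (at (chart_map c q, p c))"
    by (rule has_derivative_eq_rhs)
      (rule has_derivative_Pair[OF \<tau>_fst] has_derivative_sum has_derivative_scaleR_left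
        has_derivative_inner has_derivative_snd has_derivative_ident h | simp add: \<tau>q D\<sigma> add.commute)+
  moreover have "open (chart_map c ` (chart_dom c \<inter> chart_dom d) \<times> (UNIV :: 'e set))"
    by (intro open_Times overlap_open cA open_UNIV)
  moreover have "(chart_map c q, p c) \<in> chart_map c ` (chart_dom c \<inter> chart_dom d) \<times> UNIV" using q by auto
  moreover have "?g y = (chart_map (cb d) \<circ> chart_inv (cb c)) y"
    if "y \<in> chart_map c ` (chart_dom c \<inter> chart_dom d) \<times> UNIV" for y
    using cotangent_transition_eq[OF cA, of "fst y" "snd y"] that by (auto simp: \<tau>_def \<sigma>_def)
  ultimately have der: "((chart_map (cb d) \<circ> chart_inv (cb c)) has_derivative ?T) (at (chart_map c q, p c))"
    by (rule has_derivative_transform_within_open)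
  have snd_T: "snd (?T u) \<bullet> v = snd u \<bullet> ?D\<sigma> v + p c \<bullet> s v (?D\<tau> (fst u))" for u v
  proof -
    have "linear (\<lambda>v. snd u \<bullet> ?D\<sigma> v + p c \<bullet> s (?D\<tau> (fst u)) v)"
      using linear_add[OF transition_linear[OF d c]] linear_scale[OF transition_linear[OF d c]]
        linear_add[OF s_lin] linear_scale[OF s_lin]
      by (intro linearI) (simp_all add: inner_add_right algebra_simps)
    from frame_riesz[OF model_frame this, of v] show ?thesis
      by (simp add: s_sym[of _ "?D\<tau> (fst u)"] inner_commute)
  qed
  have inv: "?D\<sigma> (?D\<tau> w) = w" for w
    by (simp add: transition_compose[OF c d c] transition_refl[OF c])
  have "symplectic_form (?T u) (?T v) = symplectic_form u v" for u v
    unfolding symplectic_form_def snd_T inner_commute[of "fst (?T u)"]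
    by (simp add: inv s_sym[of "?D\<tau> (fst v)"] inner_commute)
  with der show ?thesis by (intro exI[of _ ?T]) auto
qed

lemma continuous_projection: "continuous_map Cot (manifold_topology A) fst"
proof (rule continuous_map_from_atlas[OF topological_cotangent])
  show "fst z \<in> topspace (manifold_topology A)" if "z \<in> points (cotangent_atlas A)" for z
    using that unfolding topspace_atlas[OF topological_A] cotangent_points by blast
  fix z assume z: "z \<in> points (cotangent_atlas A)"
  then obtain c where c: "c \<in> A" "z \<in> chart_dom (cb c)"
    by (auto simp: points_def cotangent_atlas_def)
  show "\<exists>c\<in>cotangent_atlas A. z \<in> chart_dom c \<and>
     (\<forall>W. openin (manifold_topology A) W \<and> fst z \<in> W \<longrightarrow>
       (\<exists>V. open V \<and> chart_map c z \<in> V \<and> (\<forall>x'\<in>chart_dom c. chart_map c x' \<in> V \<longrightarrow> fst x' \<in> W)))"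
  proof (intro bexI[of _ "cb c"] conjI allI impI cb_atlas c)
    fix W assume W: "openin (manifold_topology A) W \<and> fst z \<in> W"
    let ?V = "chart_map c ` (W \<inter> chart_dom c) \<times> (UNIV :: 'e set)"
    have "open ?V" using open_image_chart[OF topological_A _ c(1)] W by (simp add: open_Times)
    moreover have "chart_map (cb c) z \<in> ?V" using W c by (auto simp: bundle_dom)
    moreover have "fst x' \<in> W" if x': "x' \<in> chart_dom (cb c)" "chart_map (cb c) x' \<in> ?V" for x'
    proof -
      obtain w where "w \<in> W" "w \<in> chart_dom c" "chart_map c (fst x') = chart_map c w" using x' by auto
      then have "fst x' = w" using atlas_inj[OF topological_A c(1)] x'(1) by (auto simp: bundle_dom dest: inj_onD)
      then show ?thesis using \<open>w \<in> W\<close> by simp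
    qed
    ultimately show "\<exists>V. open V \<and> chart_map (cb c) z \<in> V \<and> (\<forall>x'\<in>chart_dom (cb c). chart_map (cb c) x' \<in> V \<longrightarrow> fst x' \<in> W)"
      by (intro exI[of _ ?V] conjI ballI impI)
  qed
qed

lemma Hausdorff_Cot: "Hausdorff_space Cot"
  unfolding Hausdorff_space_def topspace_Cot
proof (intro allI impI)
  fix z w assume zw: "z \<in> points (cotangent_atlas A) \<and> w \<in> points (cotangent_atlas A) \<and> z \<noteq> w"
  show "\<exists>U V. openin Cot U \<and> openin Cot V \<and> z \<in> U \<and> w \<in> V \<and> disjnt U V"
  proof (cases "fst z = fst w")
    case False
    have "fst z \<in> topspace (manifold_topology A)" "fst w \<in> topspace (manifold_topology A)"
      using zw by (auto simp: topspace_atlas[OF topological_A] cotangent_points)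
    with False Hausdorff_A[unfolded Hausdorff_space_def, rule_format, of "fst z" "fst w"] obtain U V where UV: "openin (manifold_topology A) U" "openin (manifold_topology A) V"
      "fst z \<in> U" "fst w \<in> V" "disjnt U V"
      by blast
    have o: "openin Cot {x \<in> topspace Cot. fst x \<in> U}" "openin Cot {x \<in> topspace Cot. fst x \<in> V}"
      using openin_continuous_map_preimage[OF continuous_projection] UV by blast+
    show ?thesis
      by (intro exI conjI, rule o(1), rule o(2)) (use UV zw in \<open>auto simp: topspace_Cot disjnt_iff\<close>)
  next
    case True
    obtain c where c: "c \<in> A" "z \<in> chart_dom (cb c)"
      using zw by (auto simp: points_def cotangent_atlas_def)
    then have w: "w \<in> chart_dom (cb c)" using True zw by (auto simp: bundle_dom cotangent_points)
    have "chart_map (cb c) z \<noteq> chart_map (cb c) w"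
      using inj_onD[OF cb_inj[OF c(1)], of z w] c(2) w zw by blast
    then obtain U V where UV: "open U" "open V" "chart_map (cb c) z \<in> U" "chart_map (cb c) w \<in> V" "U \<inter> V = {}"
      using hausdorff by metis
    show ?thesis
      by (intro exI conjI, rule cb_preimage_open[OF c(1) UV(1)], rule cb_preimage_open[OF c(1) UV(2)])
        (use UV c w in \<open>auto simp: disjnt_iff simp del: bundle_map\<close>)
  qed
qed

lemma cotangent_inhabited:
  assumes "q \<in> points A"
  shows "\<exists>p. (q, p) \<in> points (cotangent_atlas A)"
  using charts_at_nonempty[OF assms] cotangent_of(1) assms by (force simp: cotangent_points)

text \<open>In a bundle chart the fibre is affine, and on the line through \<open>p\<close> and
  \<open>p'\<close> the parameters with values in \<open>T\<close> form a nonempty clopen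
  set.\<close>

lemma clopen_fibre:
  assumes T: "openin Cot T" "closedin Cot T" and z: "(q, p) \<in> T" and w: "(q, p') \<in> points (cotangent_atlas A)"
  shows "(q, p') \<in> T"
proof -
  have zp: "(q, p) \<in> points (cotangent_atlas A)"
    using z openin_subset[OF T(1)] by (auto simp: topspace_Cot)
  obtain c where c: "c \<in> charts_at A q" 
    using charts_at_nonempty[of q] zp unfolding cotangent_points fst_conv by blast
  then have cA: "c \<in> A" "q \<in> chart_dom c" by (auto simp: charts_at_def)
  define \<gamma> where "\<gamma> = (\<lambda>r. chart_inv (cb c) (chart_map c q, p c + r *\<^sub>R (p' c - p c)))"
  have "continuous_map euclideanreal (top_of_set (chart_map (cb c) ` chart_dom (cb c)))
     (\<lambda>r. (chart_map c q, p c + r *\<^sub>R (p' c - p c)))"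
    using cb_mem_range[OF cA] by (auto simp: continuous_map_in_subtopology intro!: continuous_intros)
  from continuous_map_compose[OF this chart_inv_continuous[OF topological_cotangent cb_atlas[OF cA(1)]]]
  have \<gamma>: "continuous_map euclideanreal Cot \<gamma>" by (simp add: o_def \<gamma>_def)
  have "open {r. \<gamma> r \<in> T}" "closed {r. \<gamma> r \<in> T}"
    using openin_continuous_map_preimage[OF \<gamma> T(1)] closedin_continuous_map_preimage[OF \<gamma> T(2)] by auto
  moreover have "\<gamma> 0 = (q, p)" "\<gamma> 1 = (q, p')"
    using cb_inv_map[OF cA(1), of "(q, p)"] cb_inv_map[OF cA(1), of "(q, p')"] zp w cA(2)
    by (auto simp: \<gamma>_def bundle_dom cotangent_points)
  moreover from this have "0 \<in> {r. \<gamma> r \<in> T}" using z by simp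
  ultimately have "{r. \<gamma> r \<in> T} = UNIV" using clopen[of "{r. \<gamma> r \<in> T}"] by blast
  then have "\<gamma> 1 \<in> T" by blast
  then show ?thesis using \<open>\<gamma> 1 = (q, p')\<close> by simp
qed

lemma open_projection:
  assumes T: "openin Cot T"
  shows "openin (manifold_topology A) (fst ` T)"
  unfolding openin_atlas[OF topological_A]
proof (intro conjI ballI)
  show "fst ` T \<subseteq> points A" using openin_subset[OF T] by (auto simp: topspace_Cot cotangent_points)
  fix c assume c: "c \<in> A"
  have "chart_map c ` (fst ` T \<inter> chart_dom c) = fst ` (chart_map (cb c) ` (T \<inter> chart_dom (cb c)))"
  proof (intro equalityI subsetI)
    fix y assume "y \<in> chart_map c ` (fst ` T \<inter> chart_dom c)"
    then obtain z where z: "z \<in> T" "fst z \<in> chart_dom c" "y = chart_map c (fst z)" by auto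
    then have "z \<in> chart_dom (cb c)" using openin_subset[OF T] by (auto simp: bundle_dom topspace_Cot cotangent_points)
    with z show "y \<in> fst ` (chart_map (cb c) ` (T \<inter> chart_dom (cb c)))"
      by (auto intro!: rev_image_eqI[of z] simp: image_image)
  qed (auto simp: bundle_dom intro!: imageI rev_image_eqI)
  moreover have "open (chart_map (cb c) ` (T \<inter> chart_dom (cb c)))"
    by (rule open_image_chart[OF topological_cotangent T cb_atlas[OF c]])
  ultimately show "open (chart_map c ` (fst ` T \<inter> chart_dom c))" by (simp add: open_image_fst)
qed

text \<open>A clopen set consists of whole fibres, so it and its complement have disjoint open
  projections that cover the connected base. Connectedness will force the maps of the isotopy to be
  onto.\<close>

lemma connected_Cot: "connected_space Cot"
  unfolding connected_space_clopen_in
proof (intro allI impI)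
  fix T assume T: "openin Cot T \<and> closedin Cot T"
  let ?T' = "topspace Cot - T"
  have T': "openin Cot ?T'" "closedin Cot ?T'" using T by auto
  have sub: "T \<subseteq> topspace Cot" using T openin_subset by blast
  have disj: "fst ` T \<inter> fst ` ?T' = {}"
  proof (rule ccontr)
    assume "fst ` T \<inter> fst ` ?T' \<noteq> {}"
    then obtain z w where zw: "z \<in> T" "w \<in> ?T'" "fst z = fst w" by auto
    moreover have "(fst w, snd z) = z" using zw(3) by (simp add: prod_eq_iff)
    ultimately show False
      using clopen_fibre[of T "fst w" "snd z" "snd w"] T by (simp add: topspace_Cot)
  qed
  have cover: "topspace (manifold_topology A) \<subseteq> fst ` T \<union> fst ` ?T'"
    using cotangent_inhabited by (force simp: topspace_atlas[OF topological_A] topspace_Cot image_iff)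
  have "fst ` T = {} \<or> fst ` ?T' = {}"
    using connected_A[unfolded connected_space_def] open_projection T T' disj cover by meson
  then show "T = {} \<or> T = topspace Cot" using sub by auto
qed

end

section \<open>Hamiltonian vector fields and their orbits\<close>

context closed_manifold begin

definition ham :: "('m, 'e) chart \<Rightarrow> ('m, 'e) hamiltonian \<Rightarrow> real \<times> 'e \<times> 'e \<Rightarrow> real" where
  "ham c H = (\<lambda>(t, y). H t (chart_inv (cb c) y))"

text \<open>Frame coordinates of the vector dual to \<open>- D\<close> under the symplectic form:
  its position part is the derivative in \<open>p\<close>, its momentum part minus the derivative in
  \<open>q\<close>.\<close>

definition sgrad :: "('e \<times> 'e \<Rightarrow> real) \<Rightarrow> 'e \<times> 'e" where
  "sgrad D = (\<Sum>b\<in>model_frame. D (0, b) *\<^sub>R (b, 0)) + (\<Sum>b\<in>model_frame. D (b, 0) *\<^sub>R (0, - b))"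

text \<open>The derivative is taken in time and space jointly and evaluated on directions
  \<open>(0, u)\<close>, so that \<open>vf\<close> inherits joint smoothness from
  \<open>ham c H\<close>.\<close>

definition vf :: "('m, 'e) chart \<Rightarrow> ('m, 'e) hamiltonian \<Rightarrow> real \<times> 'e \<times> 'e \<Rightarrow> 'e \<times> 'e" where
  "vf c H x = sgrad (\<lambda>u. frechet_derivative (ham c H) (at x) (0, u))"

abbreviation smooth_ham :: "('m, 'e) hamiltonian \<Rightarrow> bool" where
  "smooth_ham \<equiv> smooth_time_function (cotangent_atlas A)"

definition cdom :: "('m, 'e) chart \<Rightarrow> (real \<times> 'e \<times> 'e) set" where
  "cdom c = UNIV \<times> chart_map (cb c) ` chart_dom (cb c)"

lemma cdom_iff: "c \<in> A \<Longrightarrow> (t, y) \<in> cdom c \<longleftrightarrow> fst y \<in> chart_map c ` chart_dom c"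
  by (cases y) (simp add: cdom_def cb_range mem_Times_iff del: bundle_map)

lemma open_cdom: "c \<in> A \<Longrightarrow> open (cdom c)"
  unfolding cdom_def by (intro open_Times open_UNIV atlas_open[OF topological_cotangent cb_atlas])

lemma cdom_point: "z \<in> chart_dom (cb c) \<Longrightarrow> (t, chart_map (cb c) z) \<in> cdom c"
  by (auto simp: cdom_def)

lemma frames: "\<exists>B :: ('e \<times> 'e) set. frame B" "\<exists>B :: (real \<times> 'e \<times> 'e) set. frame B"
  using frame_Times[OF model_frame model_frame] frame_Times[OF frame_real] by blast+

lemma sgrad: 
  assumes D: "linear D"
  shows "symplectic_form (sgrad D) \<eta> = - D \<eta>"
proof -
  interpret s: bounded_bilinear "symplectic_form :: 'e \<times> 'e \<Rightarrow> _" by (rule symplectic_form_bilinear)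
  have 1: "linear (\<lambda>w. D (0, w))" "linear (\<lambda>w. D (w, 0))"
    using linear_add[OF D, of "(0, _)" "(0, _)"] linear_scale[OF D, of _ "(0, _)"]
      linear_add[OF D, of "(_, 0)" "(_, 0)"] linear_scale[OF D, of _ "(_, 0)"]
    by (auto intro!: linearI)
  have "symplectic_form (sgrad D) \<eta> = (\<Sum>b\<in>model_frame. D (0, b) * (- (b \<bullet> snd \<eta>))) + (\<Sum>b\<in>model_frame. D (b, 0) * (- (b \<bullet> fst \<eta>)))"
    by (simp add: sgrad_def s.add_left s.sum_left s.scaleR_left) (simp add: symplectic_form_def)
  also have "\<dots> = - (snd \<eta> \<bullet> (\<Sum>b\<in>model_frame. D (0, b) *\<^sub>R b)) - fst \<eta> \<bullet> (\<Sum>b\<in>model_frame. D (b, 0) *\<^sub>R b)"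
    by (simp add: inner_sum_right sum_negf inner_commute)
  also have "\<dots> = - D (0, snd \<eta>) - D (fst \<eta>, 0)"
    using frame_riesz[OF model_frame 1(1), of "snd \<eta>"] frame_riesz[OF model_frame 1(2), of "fst \<eta>"] by simp
  also have "\<dots> = - D ((fst \<eta>, 0) + (0, snd \<eta>))" by (subst linear_add[OF D]) simp
  finally show ?thesis by simp
qed

lemma sgrad_unique:
  assumes "linear D"
  shows "(THE \<xi>. \<forall>\<eta>. symplectic_form \<xi> \<eta> = - D \<eta>) = sgrad D"
  using sgrad[OF assms] by (intro the_equality) (auto intro!: symplectic_form_eqI)

lemma ham_smooth:
  assumes "smooth_ham H" "c \<in> A"
  shows "smooth_on (cdom c) (ham c H)"
  using assms(1) cb_atlas[OF assms(2)] unfolding smooth_time_function_def cdom_def ham_def by blast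

lemma ham_derivative:
  assumes "smooth_ham H" "c \<in> A" "x \<in> cdom c"
  shows "(ham c H has_derivative frechet_derivative (ham c H) (at x)) (at x)"
  by (rule smooth_onD[OF ham_smooth[OF assms(1,2)] assms(3)])

lemma linear_slice:
  assumes "linear (D :: real \<times> 'e \<times> 'e \<Rightarrow> 'w::real_vector)"
  shows "linear (\<lambda>u. D (0, u))"
  using linear_add[OF assms, of "(0, _)" "(0, _)"] linear_scale[OF assms, of _ "(0, _)"]
  by (auto intro!: linearI)

lemma has_derivative_slice:
  fixes g :: "real \<times> 'e \<times> 'e \<Rightarrow> 'w::real_normed_vector"
  assumes "(g has_derivative D) (at (t, y))"
  shows "((\<lambda>y. g (t, y)) has_derivative (\<lambda>u. D (0, u))) (at y)"
  by (rule has_derivative_compose[where f = "\<lambda>y. (t, y)"]) (auto intro!: derivative_eq_intros assms)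

lemma vf_symplectic:
  assumes "smooth_ham H" "c \<in> A" "x \<in> cdom c"
  shows "symplectic_form (vf c H x) \<eta> = - frechet_derivative (ham c H) (at x) (0, \<eta>)"
  unfolding vf_def
  by (rule sgrad[OF linear_slice[OF has_derivative_linear[OF ham_derivative[OF assms]]]])

lemma vf_fst:
  assumes "smooth_ham H" "c \<in> A" "x \<in> cdom c"
  shows "fst (vf c H x) \<bullet> w = frechet_derivative (ham c H) (at x) (0, 0, w)"
  using vf_symplectic[OF assms, of "(0, w)"] by (simp add: symplectic_form_def)

lemma vf_snd:
  assumes "smooth_ham H" "c \<in> A" "x \<in> cdom c"
  shows "snd (vf c H x) \<bullet> w = - frechet_derivative (ham c H) (at x) (0, w, 0)"
  using vf_symplectic[OF assms, of "(w, 0)"] by (simp add: symplectic_form_def)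

lemma hamiltonian_vector_field_eq:
  assumes H: "smooth_ham H" and c: "c \<in> A" and z: "z \<in> chart_dom (cb c)"
  shows "hamiltonian_vector_field (cb c) H t z = vf c H (t, chart_map (cb c) z)"
proof -
  have "((\<lambda>y. ham c H (t, y)) has_derivative (\<lambda>u. frechet_derivative (ham c H) (at (t, chart_map (cb c) z)) (0, u)))
     (at (chart_map (cb c) z))"
    by (rule has_derivative_slice[OF ham_derivative[OF H c cdom_point[OF z]]])
  moreover have "(\<lambda>y. ham c H (t, y)) = H t \<circ> chart_inv (cb c)" by (auto simp: ham_def)
  ultimately have d: "((H t \<circ> chart_inv (cb c)) has_derivative (\<lambda>u. frechet_derivative (ham c H) (at (t, chart_map (cb c) z)) (0, u)))
     (at (chart_map (cb c) z))" by metis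
  show ?thesis
    unfolding hamiltonian_vector_field_def vf_def
    by (simp only: frechet_derivative_at[OF d, symmetric])
      (rule sgrad_unique[OF has_derivative_linear[OF d]])
qed

lemma vf_smooth:
  assumes "smooth_ham H" "c \<in> A"
  shows "smooth_on (cdom c) (vf c H)"
proof -
  have "smooth_on (cdom c) (\<lambda>x. frechet_derivative (ham c H) (at x) v *\<^sub>R w)" for v and w :: "'e \<times> 'e"
    by (rule smooth_on_bounded_linear[OF open_cdom[OF assms(2)] bounded_linear_scaleR_left
          smooth_on_derivative[OF ham_smooth[OF assms]]])
  then show ?thesis
    unfolding vf_def[abs_def] sgrad_def
    by (intro smooth_on_add smooth_on_sum open_cdom assms)
qed

text \<open>Pairing the linearised field on \<open>u\<close> with \<open>v\<close> gives minus the
  second derivative of the Hamiltonian, which is symmetric in \<open>u\<close> and \<open>v\<close>;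
  the linearisation thus lies in the symplectic Lie algebra.\<close>

lemma vf_linearization_symplectic:
  assumes H: "smooth_ham H" and c: "c \<in> A" and x: "x \<in> cdom c"
  shows "symplectic_form (frechet_derivative (vf c H) (at x) (0, u)) v +
    symplectic_form u (frechet_derivative (vf c H) (at x) (0, v)) = 0"
proof -
  obtain B :: "(real \<times> 'e \<times> 'e) set" where B: "frame B" using frames(2) by blast
  note o = open_cdom[OF c]
  interpret s: bounded_bilinear "symplectic_form :: 'e \<times> 'e \<Rightarrow> _" by (rule symplectic_form_bilinear)
  let ?D2 = "\<lambda>u v. frechet_derivative (\<lambda>x. frechet_derivative (ham c H) (at x) (0, u)) (at x) (0, v)"
  have *: "symplectic_form (frechet_derivative (vf c H) (at x) (0, u)) v = - ?D2 v u" for u v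
  proof -
    have d: "vf c H differentiable (at x)"
      using smooth_onD[OF vf_smooth[OF H c] x] by (auto simp: differentiable_def)
    have "symplectic_form (frechet_derivative (vf c H) (at x) (0, u)) v
      = frechet_derivative (\<lambda>x. symplectic_form (vf c H x) v) (at x) (0, u)"
      using frechet_derivative_bounded_linear[OF d s.bounded_linear_left] by simp
    also have "\<dots> = frechet_derivative (\<lambda>x. - frechet_derivative (ham c H) (at x) (0, v)) (at x) (0, u)"
      using frechet_derivative_cong_open[OF o x vf_symplectic[OF H c]] by simp
    also have "\<dots> = - ?D2 v u"
      using smooth_onD[OF smooth_on_derivative[OF ham_smooth[OF H c], of "(0, v)"] x]
      by (intro frechet_derivative_bounded_linear bounded_linear_minus bounded_linear_ident)
        (unfold differentiable_def, rule exI)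
    finally show ?thesis .
  qed
  show ?thesis
    using second_derivative_symmetric[OF B o x ham_smooth[OF H c], of "(0, u)" "(0, v)"] *[of u v] *[of v u]
    by (simp add: symplectic_form_skew[of u])
qed

subsection \<open>Orbits in charts\<close>

abbreviation orbit :: "('m, 'e) hamiltonian \<Rightarrow> (real \<Rightarrow> 'm \<times> ('m, 'e) coords) \<Rightarrow> bool" where
  "orbit \<equiv> hamiltonian_orbit A"

lemma orbit_continuous: "orbit H z \<Longrightarrow> continuous_map euclideanreal Cot z"
  by (simp add: hamiltonian_orbit_def)

lemma orbit_points: "orbit H z \<Longrightarrow> z t \<in> points (cotangent_atlas A)"
  using continuous_map_image_subset_topspace[OF orbit_continuous, of H z] by (auto simp: topspace_Cot)

lemma point_chart: "z \<in> points (cotangent_atlas A) \<Longrightarrow> \<exists>c\<in>A. z \<in> chart_dom (cb c)"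
  by (auto simp: points_def cotangent_atlas_def)

lemma orbit_derivative:
  assumes H: "smooth_ham H" and z: "orbit H z" and c: "c \<in> A" and t: "z t \<in> chart_dom (cb c)"
  shows "((\<lambda>s. chart_map (cb c) (z s)) has_vector_derivative vf c H (t, chart_map (cb c) (z t))) (at t)"
proof -
  have "cb c \<in> charts_at (cotangent_atlas A) (z t)" using c t by (simp add: charts_at_def cb_atlas)
  then show ?thesis
    using z hamiltonian_vector_field_eq[OF H c t] unfolding hamiltonian_orbit_def by metis
qed

lemma orbitI:
  assumes H: "smooth_ham H" and cont: "continuous_map euclideanreal Cot z"
    and d: "\<And>t c. c \<in> A \<Longrightarrow> z t \<in> chart_dom (cb c) \<Longrightarrow>
      ((\<lambda>s. chart_map (cb c) (z s)) has_vector_derivative vf c H (t, chart_map (cb c) (z t))) (at t)"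
  shows "orbit H z"
  unfolding hamiltonian_orbit_def
proof (intro conjI allI ballI cont)
  fix t c' assume "c' \<in> charts_at (cotangent_atlas A) (z t)"
  then obtain c where c: "c \<in> A" "c' = cb c" "z t \<in> chart_dom (cb c)"
    by (auto simp: charts_at_def cotangent_atlas_def)
  show "((\<lambda>s. chart_map c' (z s)) has_vector_derivative hamiltonian_vector_field c' H t (z t)) (at t)"
    unfolding c(2) hamiltonian_vector_field_eq[OF H c(1,3)] by (rule d[OF c(1,3)])
qed

lemma orbit_chart_nbhd:
  assumes z: "orbit H z" and c: "c \<in> A" and t: "z t \<in> chart_dom (cb c)" and r: "r > 0"
  shows "\<exists>\<delta>>0. \<forall>\<tau>\<in>ball t \<delta>. z \<tau> \<in> chart_dom (cb c) \<and> norm (chart_map (cb c) (z \<tau>) - chart_map (cb c) (z t)) < r"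
proof -
  have "openin Cot {x \<in> chart_dom (cb c). chart_map (cb c) x \<in> ball (chart_map (cb c) (z t)) r}"
    by (rule cb_preimage_open[OF c open_ball])
  from openin_continuous_map_preimage[OF orbit_continuous[OF z] this]
  have "open {\<tau>. z \<tau> \<in> chart_dom (cb c) \<and> chart_map (cb c) (z \<tau>) \<in> ball (chart_map (cb c) (z t)) r}" by simp
  moreover have "t \<in> {\<tau>. z \<tau> \<in> chart_dom (cb c) \<and> chart_map (cb c) (z \<tau>) \<in> ball (chart_map (cb c) (z t)) r}"
    using t r by simp
  ultimately obtain \<delta> where "\<delta> > 0" "ball t \<delta> \<subseteq> {\<tau>. z \<tau> \<in> chart_dom (cb c) \<and> chart_map (cb c) (z \<tau>) \<in> ball (chart_map (cb c) (z t)) r}"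
    using open_contains_ball by blast
  then show ?thesis by (intro exI[of _ \<delta>]) (auto simp: dist_norm norm_minus_commute subset_iff simp del: bundle_map)
qed

text \<open>A flow box along the reference orbit \<open>z0\<close>: on \<open>W\<close> the field
  has the Lipschitz constant \<open>C\<close>, and an orbit that is \<open>\<rho>\<close>-close to
  \<open>z0\<close> at any one time of the interval stays in \<open>W\<close> during all of it. Two
  times of the interval differ by less than \<open>2 * \<delta>\<close>, so the bound on
  \<open>2 * \<delta> * C\<close> is the smallness that \<open>local_flow\<close> asks for.\<close>

definition controlled ::
  "('m, 'e) hamiltonian \<Rightarrow> (real \<Rightarrow> 'm \<times> ('m, 'e) coords) \<Rightarrow> ('m, 'e) chart \<Rightarrow> real \<Rightarrow> real \<Rightarrow> real \<Rightarrow> real \<Rightarrow>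
   ('e \<times> 'e) set \<Rightarrow> bool" where
  "controlled H z0 c \<tau>0 \<delta> \<rho> C W \<longleftrightarrow> \<delta> > 0 \<and> \<rho> > 0 \<and> C \<ge> 0 \<and> 2 * \<delta> * C \<le> 1/4 \<and> ball \<tau>0 \<delta> \<times> W \<subseteq> cdom c \<and>
    (\<forall>\<tau>\<in>ball \<tau>0 \<delta>. \<forall>x\<in>W. \<forall>y\<in>W. norm (vf c H (\<tau>, x) - vf c H (\<tau>, y)) \<le> C * norm (x - y)) \<and>
    (\<forall>\<tau>\<in>ball \<tau>0 \<delta>. z0 \<tau> \<in> chart_dom (cb c) \<and> chart_map (cb c) (z0 \<tau>) \<in> W) \<and> open W \<and>
    (\<forall>s\<in>ball \<tau>0 \<delta>. \<forall>z. orbit H z \<and> z s \<in> chart_dom (cb c) \<and>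
        norm (chart_map (cb c) (z s) - chart_map (cb c) (z0 s)) < \<rho> \<longrightarrow>
        (\<forall>\<tau>\<in>ball \<tau>0 \<delta>. z \<tau> \<in> chart_dom (cb c) \<and> chart_map (cb c) (z \<tau>) \<in> W))"

lemma controlledD:
  assumes "controlled H z0 c \<tau>0 \<delta> \<rho> C W"
  shows "\<delta> > 0" "\<rho> > 0" "C \<ge> 0" "2 * \<delta> * C \<le> 1/4" "ball \<tau>0 \<delta> \<times> W \<subseteq> cdom c" "open W"
    and "\<And>\<tau> x y. \<tau> \<in> ball \<tau>0 \<delta> \<Longrightarrow> x \<in> W \<Longrightarrow> y \<in> W \<Longrightarrow> norm (vf c H (\<tau>, x) - vf c H (\<tau>, y)) \<le> C * norm (x - y)"
    and "\<And>\<tau>. \<tau> \<in> ball \<tau>0 \<delta> \<Longrightarrow> z0 \<tau> \<in> chart_dom (cb c)"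
    and "\<And>\<tau>. \<tau> \<in> ball \<tau>0 \<delta> \<Longrightarrow> chart_map (cb c) (z0 \<tau>) \<in> W"
    and "\<And>s z \<tau>. s \<in> ball \<tau>0 \<delta> \<Longrightarrow> orbit H z \<Longrightarrow> z s \<in> chart_dom (cb c) \<Longrightarrow>
        norm (chart_map (cb c) (z s) - chart_map (cb c) (z0 s)) < \<rho> \<Longrightarrow> \<tau> \<in> ball \<tau>0 \<delta> \<Longrightarrow>
        z \<tau> \<in> chart_dom (cb c)"
    and "\<And>s z \<tau>. s \<in> ball \<tau>0 \<delta> \<Longrightarrow> orbit H z \<Longrightarrow> z s \<in> chart_dom (cb c) \<Longrightarrow>
        norm (chart_map (cb c) (z s) - chart_map (cb c) (z0 s)) < \<rho> \<Longrightarrow> \<tau> \<in> ball \<tau>0 \<delta> \<Longrightarrow>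
        chart_map (cb c) (z \<tau>) \<in> W"
  using assms unfolding controlled_def by blast+

text \<open>Strict differentiability of the field at the centre gives a Lipschitz constant on a
  ball, and the interval of times is then made short against it. The set \<open>N\<close> allows
  further open conditions to be imposed on the box.\<close>

lemma local_chart:
  assumes H: "smooth_ham H" and z0: "orbit H z0" and c: "c \<in> A" and t0: "z0 \<tau>0 \<in> chart_dom (cb c)"
    and N: "open N" "(\<tau>0, chart_map (cb c) (z0 \<tau>0)) \<in> N"
  shows "\<exists>\<delta> \<rho> C W. controlled H z0 c \<tau>0 \<delta> \<rho> C W \<and> ball \<tau>0 \<delta> \<times> W \<subseteq> N"
proof -
  let ?m = "chart_map (cb c)"
  define y0 where "y0 = ?m (z0 \<tau>0)"
  obtain B :: "(real \<times> 'e \<times> 'e) set" where B: "frame B" using frames(2) by blast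
  obtain B2 :: "('e \<times> 'e) set" where B2: "frame B2" using frames(1) by blast
  have x0: "(\<tau>0, y0) \<in> N \<inter> cdom c" using N t0 by (simp add: y0_def cdom_point del: bundle_map)
  have "open (N \<inter> cdom c)" using N open_cdom[OF c] by blast
  then obtain \<delta>0 where \<delta>0: "\<delta>0 > 0" "ball (\<tau>0, y0) \<delta>0 \<subseteq> N \<inter> cdom c"
    using x0 open_contains_ball by blast
  let ?D = "frechet_derivative (vf c H) (at (\<tau>0, y0))"
  obtain \<delta>1 where \<delta>1: "\<delta>1 > 0" and st: "\<And>x y. x \<in> ball (\<tau>0, y0) \<delta>1 \<Longrightarrow> y \<in> ball (\<tau>0, y0) \<delta>1 \<Longrightarrow>
     norm (vf c H y - vf c H x - ?D (y - x)) \<le> 1 * norm (y - x)"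
    using smooth_on_strict[OF B open_cdom[OF c] IntD2[OF x0] vf_smooth[OF H c] zero_less_one] by blast
  have D: "bounded_linear ?D"
    using smooth_onD[OF vf_smooth[OF H c], of "(\<tau>0, y0)"] x0 has_derivative_bounded_linear by blast
  obtain K where K: "K > 0" "\<And>v. norm (?D v) \<le> norm v * K"
    using bounded_linear.pos_bounded[OF D] by blast
  \<comment> \<open>\<open>K\<close> bounds the derivative at the centre, and the strictness
    estimate with constant 1 adds 1.\<close>
  define C where "C = K + 1"
  define r where "r = min \<delta>0 \<delta>1 / 8"
  have r: "r > 0" "4 * r < \<delta>0" "4 * r < \<delta>1" using \<delta>0 \<delta>1 by (auto simp: r_def)
  obtain \<delta>2 where \<delta>2: "\<delta>2 > 0" "\<And>\<tau>. \<tau> \<in> ball \<tau>0 \<delta>2 \<Longrightarrow> z0 \<tau> \<in> chart_dom (cb c) \<and> norm (?m (z0 \<tau>) - y0) < r"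
    using orbit_chart_nbhd[OF z0 c t0 r(1)] unfolding y0_def by blast
  define \<delta> where "\<delta> = min (min r \<delta>2) (1 / (8 * C))"
  have C: "C > 0" using K by (simp add: C_def)
  have "\<delta> * C \<le> 1 / (8 * C) * C" using C unfolding \<delta>_def by (intro mult_right_mono) auto
  then have \<delta>: "\<delta> > 0" "\<delta> \<le> r" "\<delta> \<le> \<delta>2" "2 * \<delta> * C \<le> 1/4"
    using C r \<delta>2 by (auto simp: \<delta>_def)
  define W where "W = ball y0 (2 * r)"
  have inball: "(\<tau>, x) \<in> ball (\<tau>0, y0) (4 * r)" if "\<tau> \<in> ball \<tau>0 \<delta>" "x \<in> W" for \<tau> x
  proof -
    have "norm (\<tau>0 - \<tau>, y0 - x) \<le> norm (\<tau>0 - \<tau>) + norm (y0 - x)" by (rule norm_Pair_le)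
    then show ?thesis using that \<delta> by (simp add: W_def dist_norm)
  qed
  have sub: "ball \<tau>0 \<delta> \<times> W \<subseteq> N \<inter> cdom c" 
  proof (rule subsetI)
    fix x assume "x \<in> ball \<tau>0 \<delta> \<times> W"
    then have "x \<in> ball (\<tau>0, y0) (4 * r)" using inball[of "fst x" "snd x"] by (auto simp: mem_Times_iff)
    then have "x \<in> ball (\<tau>0, y0) \<delta>0" using r(2) by simp
    then show "x \<in> N \<inter> cdom c" using \<delta>0(2) by blast
  qed
  have lip: "norm (vf c H (\<tau>, x) - vf c H (\<tau>, y)) \<le> C * norm (x - y)"
    if "\<tau> \<in> ball \<tau>0 \<delta>" "x \<in> W" "y \<in> W" for \<tau> x y
  proof -
    have "(\<tau>, x) \<in> ball (\<tau>0, y0) \<delta>1" "(\<tau>, y) \<in> ball (\<tau>0, y0) \<delta>1" using inball that r by fastforce+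
    from st[OF this(2,1)] K(2)[of "(\<tau>, x) - (\<tau>, y)"]
    have "norm (vf c H (\<tau>, x) - vf c H (\<tau>, y)) \<le> norm ((\<tau>, x) - (\<tau>, y)) * K + 1 * norm ((\<tau>, x) - (\<tau>, y))"
      using norm_triangle_ineq2[of "vf c H (\<tau>, x) - vf c H (\<tau>, y)" "?D ((\<tau>, x) - (\<tau>, y))"] by linarith
    also have "\<dots> = C * norm (x - y)" by (simp add: C_def algebra_simps)
    finally show ?thesis .
  qed
  have base: "z0 \<tau> \<in> chart_dom (cb c)" "norm (?m (z0 \<tau>) - y0) < r" "?m (z0 \<tau>) \<in> W" if "\<tau> \<in> ball \<tau>0 \<delta>" for \<tau>
  proof -
    have "\<tau> \<in> ball \<tau>0 \<delta>2" using that \<delta> by simp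
    from \<delta>2(2)[OF this] show "z0 \<tau> \<in> chart_dom (cb c)" "norm (?m (z0 \<tau>) - y0) < r" by blast+
    then show "?m (z0 \<tau>) \<in> W" using r(1) by (simp add: W_def dist_norm norm_minus_commute del: bundle_map)
  qed
  \<comment> \<open>An orbit starting within \<open>r / 4\<close> of the reference orbit stays
    within \<open>r / 2\<close> of it by the Gronwall estimate, hence within \<open>3/2 * r\<close>
    of \<open>y0\<close>. The closed ball of that radius lies in \<open>W\<close>, so the orbit
    cannot reach the boundary of \<open>W\<close>.\<close>
  have conf: "z \<tau> \<in> {x \<in> chart_dom (cb c). ?m x \<in> W}"
    if s: "s \<in> ball \<tau>0 \<delta>" and z: "orbit H z" and zs: "z s \<in> chart_dom (cb c)" "norm (?m (z s) - ?m (z0 s)) < r / 4"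
      and \<tau>: "\<tau> \<in> ball \<tau>0 \<delta>" for s z \<tau>
  proof (rule curve_confined[OF orbit_continuous[OF z], where C = "{x \<in> chart_dom (cb c). ?m x \<in> cball y0 (3/2 * r)}"
        and s = s and t = \<tau>])
    show "openin Cot {x \<in> chart_dom (cb c). ?m x \<in> W}" unfolding W_def by (rule cb_preimage_open[OF c open_ball])
    have sub': "cball y0 (3/2 * r) \<subseteq> W" using r by (auto simp: W_def)
    then show "{x \<in> chart_dom (cb c). ?m x \<in> cball y0 (3/2 * r)} \<subseteq> {x \<in> chart_dom (cb c). ?m x \<in> W}" by blast
    have "W \<subseteq> ?m ` chart_dom (cb c)"
    proof
      fix x assume "x \<in> W"
      then have "(\<tau>0, x) \<in> cdom c" using sub \<delta>(1) by auto
      then show "x \<in> ?m ` chart_dom (cb c)" by (simp add: cdom_def del: bundle_map)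
    qed
    with sub' have "cball y0 (3/2 * r) \<subseteq> ?m ` chart_dom (cb c)" by blast
    then have "compactin Cot {x \<in> chart_dom (cb c). ?m x \<in> cball y0 (3/2 * r)}"
      by (intro compactin_chart_preimage[OF topological_cotangent cb_atlas[OF c]] frame_compact[OF B2]) auto
    then show "closedin Cot {x \<in> chart_dom (cb c). ?m x \<in> cball y0 (3/2 * r)}"
      by (rule compactin_imp_closedin[OF Hausdorff_Cot])
    have "norm (?m (z s) - y0) < r / 4 + r"
      using zs(2) base(2)[OF s] norm_triangle_ineq[of "?m (z s) - ?m (z0 s)" "?m (z0 s) - y0"] by (simp del: bundle_map)
    then show "z s \<in> {x \<in> chart_dom (cb c). ?m x \<in> W}"
      using zs(1) r by (simp add: W_def dist_norm norm_minus_commute del: bundle_map)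
    show "\<tau> \<in> closed_segment s \<tau>" by simp
    fix \<sigma> assume \<sigma>: "\<sigma> \<in> closed_segment s \<tau>"
      and in_W: "\<And>\<kappa>. \<kappa> \<in> closed_segment s \<sigma> \<Longrightarrow> z \<kappa> \<in> {x \<in> chart_dom (cb c). ?m x \<in> W}"
    have seg: "closed_segment s \<sigma> \<subseteq> ball \<tau>0 \<delta>"
      using s \<tau> \<sigma> convex_ball[of \<tau>0 \<delta>] by (meson closed_segment_subset subsetD)
    have len: "\<bar>\<sigma> - s\<bar> * C \<le> 1/2"
    proof -
      have "\<sigma> \<in> ball \<tau>0 \<delta>" using seg by auto
      then have "\<bar>\<sigma> - s\<bar> \<le> 2 * \<delta>" using s by (simp add: dist_real_def)
      then have "\<bar>\<sigma> - s\<bar> * C \<le> 2 * \<delta> * C" using C by (intro mult_right_mono) auto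
      with \<delta> show ?thesis by linarith
    qed
    have "norm (?m (z \<sigma>) - ?m (z0 \<sigma>)) \<le> 2 * norm (?m (z s) - ?m (z0 s)) + 2 * \<bar>\<sigma> - s\<bar> * 0"
    proof (rule short_gronwall[where u = "\<lambda>\<tau>. ?m (z \<tau>) - ?m (z0 \<tau>)" and C = C])
      fix \<kappa> assume \<kappa>: "\<kappa> \<in> closed_segment s \<sigma>"
      then have \<kappa>b: "\<kappa> \<in> ball \<tau>0 \<delta>" using seg by blast
      show "((\<lambda>\<tau>. ?m (z \<tau>) - ?m (z0 \<tau>)) has_vector_derivative vf c H (\<kappa>, ?m (z \<kappa>)) - vf c H (\<kappa>, ?m (z0 \<kappa>)))
        (at \<kappa> within closed_segment s \<sigma>)"
      proof -
        have zd: "z \<kappa> \<in> chart_dom (cb c)" using in_W[OF \<kappa>] by blast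
        show ?thesis
          by (rule has_vector_derivative_diff[OF
                has_vector_derivative_at_within[OF orbit_derivative[OF H z c zd]]
                has_vector_derivative_at_within[OF orbit_derivative[OF H z0 c base(1)[OF \<kappa>b]]]])
      qed
      show "norm (vf c H (\<kappa>, ?m (z \<kappa>)) - vf c H (\<kappa>, ?m (z0 \<kappa>))) \<le> C * norm (?m (z \<kappa>) - ?m (z0 \<kappa>)) + 0"
        using lip[OF \<kappa>b _ base(3)[OF \<kappa>b], of "?m (z \<kappa>)"] in_W[OF \<kappa>] by simp
    qed (use len C in auto)
    then have "norm (?m (z \<sigma>) - ?m (z0 \<sigma>)) \<le> r / 2" using zs(2) by (simp del: bundle_map)
    moreover have "norm (?m (z0 \<sigma>) - y0) < r" using base seg by blast
    ultimately have "norm (?m (z \<sigma>) - y0) \<le> 3/2 * r"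
      using norm_triangle_ineq[of "?m (z \<sigma>) - ?m (z0 \<sigma>)" "?m (z0 \<sigma>) - y0"] by (simp del: bundle_map)
    moreover have "z \<sigma> \<in> chart_dom (cb c)" using in_W[of \<sigma>] by simp
    ultimately show "z \<sigma> \<in> {x \<in> chart_dom (cb c). ?m x \<in> cball y0 (3/2 * r)}"
      by (simp add: dist_norm norm_minus_commute del: bundle_map)
  qed
  have "controlled H z0 c \<tau>0 \<delta> (r/4) C W"
    unfolding controlled_def
  proof (intro conjI ballI allI impI)
    show "open W" by (simp add: W_def)
    show "norm (vf c H (\<tau>, x) - vf c H (\<tau>, y)) \<le> C * norm (x - y)"
      if "\<tau> \<in> ball \<tau>0 \<delta>" "x \<in> W" "y \<in> W" for \<tau> x y by (rule lip[OF that])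
    show "z0 \<tau> \<in> chart_dom (cb c)" "?m (z0 \<tau>) \<in> W" if "\<tau> \<in> ball \<tau>0 \<delta>" for \<tau>
      using base[OF that] by blast+
    show "z \<tau> \<in> chart_dom (cb c)" "?m (z \<tau>) \<in> W"
      if "s \<in> ball \<tau>0 \<delta>" "orbit H z \<and> z s \<in> chart_dom (cb c) \<and> norm (?m (z s) - ?m (z0 s)) < r / 4"
        "\<tau> \<in> ball \<tau>0 \<delta>" for s z \<tau>
      using conf[OF that(1) _ _ _ that(3)] that(2) by blast+
    show "ball \<tau>0 \<delta> \<times> W \<subseteq> cdom c" using sub by blast
  qed (use \<delta> r C in simp_all)
  moreover have "ball \<tau>0 \<delta> \<times> W \<subseteq> N" using sub by blast
  ultimately show ?thesis by blast
qed

text \<open>Coincidence of two orbits is an open condition by the Gronwall estimate in a flow box,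
  and a closed one by the Hausdorff property.\<close>

lemma orbit_unique:
  assumes H: "smooth_ham H" and z: "orbit H z" and w: "orbit H w" and eq: "z t0 = w t0"
  shows "z t = w t"
proof -
  let ?E = "{t. z t = w t}"
  have "open ?E"
    unfolding open_contains_ball
  proof (rule ballI)
    fix s assume s: "s \<in> ?E"
    obtain c where c: "c \<in> A" "w s \<in> chart_dom (cb c)" using point_chart[OF orbit_points[OF w]] by blast
    let ?m = "chart_map (cb c)"
    obtain \<delta> \<rho> C W where ctl: "controlled H w c s \<delta> \<rho> C W"
      using local_chart[OF H w c open_UNIV UNIV_I] by blast
    note 1 = controlledD(1-4)[OF ctl] and lip = controlledD(7)[OF ctl]
    have ins: "s \<in> ball s \<delta>" using 1 by simp
    have zW: "z \<tau> \<in> chart_dom (cb c)" "?m (z \<tau>) \<in> W" and wW: "w \<tau> \<in> chart_dom (cb c)" "?m (w \<tau>) \<in> W"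
      if "\<tau> \<in> ball s \<delta>" for \<tau>
      using controlledD(10,11)[OF ctl ins z _ _ that] controlledD(8,9)[OF ctl that] s c 1
      by (auto simp del: bundle_map)
    have "z \<tau> = w \<tau>" if \<tau>: "\<tau> \<in> ball s \<delta>" for \<tau>
    proof -
      have seg: "closed_segment s \<tau> \<subseteq> ball s \<delta>" using \<tau> ins convex_ball by (intro closed_segment_subset)
      have "\<bar>\<tau> - s\<bar> * C \<le> 2 * \<delta> * C" using \<tau> 1 by (intro mult_right_mono) (auto simp: dist_real_def)
      then have len: "\<bar>\<tau> - s\<bar> * C \<le> 1/2" using 1 by linarith
      have "norm (?m (z \<tau>) - ?m (w \<tau>)) \<le> 2 * norm (?m (z s) - ?m (w s)) + 2 * \<bar>\<tau> - s\<bar> * 0"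
      proof (rule short_gronwall[where u = "\<lambda>\<tau>. ?m (z \<tau>) - ?m (w \<tau>)" and C = C])
        fix \<kappa> assume \<kappa>: "\<kappa> \<in> closed_segment s \<tau>"
        then have \<kappa>b: "\<kappa> \<in> ball s \<delta>" using seg by blast
        show "((\<lambda>\<tau>. ?m (z \<tau>) - ?m (w \<tau>)) has_vector_derivative vf c H (\<kappa>, ?m (z \<kappa>)) - vf c H (\<kappa>, ?m (w \<kappa>)))
          (at \<kappa> within closed_segment s \<tau>)"
          by (rule has_vector_derivative_diff[OF
                has_vector_derivative_at_within[OF orbit_derivative[OF H z c(1) zW(1)[OF \<kappa>b]]]
                has_vector_derivative_at_within[OF orbit_derivative[OF H w c(1) wW(1)[OF \<kappa>b]]]])
        show "norm (vf c H (\<kappa>, ?m (z \<kappa>)) - vf c H (\<kappa>, ?m (w \<kappa>))) \<le> C * norm (?m (z \<kappa>) - ?m (w \<kappa>)) + 0"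
          using lip[OF \<kappa>b zW(2)[OF \<kappa>b] wW(2)[OF \<kappa>b]] by simp
      qed (use len 1 in auto)
      then have "?m (z \<tau>) = ?m (w \<tau>)" using s by (simp del: bundle_map)
      then show ?thesis using inj_onD[OF cb_inj[OF c(1)]] zW[OF \<tau>] wW[OF \<tau>] by blast
    qed
    then have "ball s \<delta> \<subseteq> ?E" by blast
    then show "\<exists>e>0. ball s e \<subseteq> ?E" using 1(1) by blast
  qed
  moreover have "open (- ?E)"
    unfolding open_subopen[of "- ?E"]
  proof (rule ballI)
    fix s assume s: "s \<in> - ?E"
    then obtain U V where UV: "openin Cot U" "openin Cot V" "z s \<in> U" "w s \<in> V" "disjnt U V"
      using Hausdorff_Cot[unfolded Hausdorff_space_def topspace_Cot, rule_format, of "z s" "w s"]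
        orbit_points[OF z] orbit_points[OF w] by auto
    have "open {t. z t \<in> U}" "open {t. w t \<in> V}"
      using openin_continuous_map_preimage[OF orbit_continuous[OF z] UV(1)]
        openin_continuous_map_preimage[OF orbit_continuous[OF w] UV(2)] by auto
    then have "open ({t. z t \<in> U} \<inter> {t. w t \<in> V})" by blast
    moreover have "{t. z t \<in> U} \<inter> {t. w t \<in> V} \<subseteq> - ?E"
    proof
      fix t assume t: "t \<in> {t. z t \<in> U} \<inter> {t. w t \<in> V}"
      show "t \<in> - ?E"
      proof
        assume "t \<in> ?E"
        then have "w t \<in> U \<inter> V" using t by (simp del: Int_iff) (simp add: Int_iff)
        then show False using UV(5) by (simp only: disjnt_def empty_iff)
      qed
    qed
    moreover have "s \<in> {t. z t \<in> U} \<inter> {t. w t \<in> V}" using UV by simp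
    ultimately show "\<exists>T. open T \<and> s \<in> T \<and> T \<subseteq> - ?E" by (intro exI conjI)
  qed
  then have "closed ?E" by (simp add: closed_def)
  ultimately have "?E = {} \<or> ?E = UNIV" using clopen[of ?E] by blast
  then show ?thesis using eq by blast
qed

end

section \<open>Hamiltonian isotopies\<close>

context closed_manifold begin

text \<open>The base component of the Hamiltonian vector field, equal to the fibre derivative of
  \<open>H t\<close>: the vector that the Legendre transformation assigns to
  \<open>z\<close>.\<close>

definition velocity :: "('m, 'e) hamiltonian \<Rightarrow> real \<Rightarrow> 'm \<times> ('m, 'e) coords \<Rightarrow> ('m, 'e) coords" where
  "velocity H t z = (\<lambda>c. if c \<in> charts_at A (fst z) then fst (vf c H (t, chart_map (cb c) z)) else 0)"

lemma cb_dom: "z \<in> points (cotangent_atlas A) \<Longrightarrow> z \<in> chart_dom (cb c) \<longleftrightarrow> fst z \<in> chart_dom c"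
  by (auto simp: bundle_dom cotangent_points)

lemma charts_at_cb: "c \<in> charts_at A (fst z) \<Longrightarrow> z \<in> points (cotangent_atlas A) \<Longrightarrow> z \<in> chart_dom (cb c)"
  by (auto simp: charts_at_def cb_dom)

lemma ham_transition:
  assumes H: "smooth_ham H" and c: "c \<in> charts_at A (fst z)" and d: "d \<in> charts_at A (fst z)"
    and z: "z \<in> points (cotangent_atlas A)"
    and T: "((chart_map (cb d) \<circ> chart_inv (cb c)) has_derivative T) (at (chart_map (cb c) z))"
  shows "frechet_derivative (ham c H) (at (t, chart_map (cb c) z)) (0, u) =
    frechet_derivative (ham d H) (at (t, chart_map (cb d) z)) (0, T u)"
proof -
  have cA: "c \<in> A" "d \<in> A" using c d by (auto simp: charts_at_def)
  have zc: "z \<in> chart_dom (cb c)" "z \<in> chart_dom (cb d)" using charts_at_cb c d z by auto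
  let ?m = "chart_map (cb c) z" and ?\<psi> = "chart_map (cb d) \<circ> chart_inv (cb c)"
  have \<psi>: "?\<psi> ?m = chart_map (cb d) z" using cb_inv_map[OF cA(1) zc(1)] by (simp del: bundle_map)
  have 1: "((\<lambda>y. ham d H (t, y)) has_derivative (\<lambda>u. frechet_derivative (ham d H) (at (t, chart_map (cb d) z)) (0, u))) (at (?\<psi> ?m))"
    unfolding \<psi> by (rule has_derivative_slice[OF ham_derivative[OF H cA(2) cdom_point[OF zc(2)]]])
  have "((\<lambda>y. ham d H (t, ?\<psi> y)) has_derivative (\<lambda>u. frechet_derivative (ham d H) (at (t, chart_map (cb d) z)) (0, T u))) (at ?m)"
    by (rule has_derivative_compose[OF T 1])
  moreover have "open (chart_map (cb c) ` (chart_dom (cb c) \<inter> chart_dom (cb d)))"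
    by (rule atlas_open_Int[OF topological_cotangent cb_atlas[OF cA(1)] cb_atlas[OF cA(2)]])
  moreover have "?m \<in> chart_map (cb c) ` (chart_dom (cb c) \<inter> chart_dom (cb d))" using zc by blast
  moreover have "ham d H (t, ?\<psi> y) = ham c H (t, y)"
    if y: "y \<in> chart_map (cb c) ` (chart_dom (cb c) \<inter> chart_dom (cb d))" for y
  proof -
    obtain w where "w \<in> chart_dom (cb c)" "w \<in> chart_dom (cb d)" "y = chart_map (cb c) w" using y by blast
    then show ?thesis using cb_inv_map[OF cA(1)] cb_inv_map[OF cA(2)] by (simp add: ham_def del: bundle_map)
  qed
  ultimately have "((\<lambda>y. ham c H (t, y)) has_derivative (\<lambda>u. frechet_derivative (ham d H) (at (t, chart_map (cb d) z)) (0, T u))) (at ?m)"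
    by (rule has_derivative_transform_within_open)
  from has_derivative_unique[OF has_derivative_slice[OF ham_derivative[OF H cA(1) cdom_point[OF zc(1)]]] this]
  show ?thesis by metis
qed

text \<open>Tested against \<open>w\<close>, the velocity is the derivative of \<open>H\<close> in
  the vertical direction \<open>(0, w)\<close>. The lifted coordinate change maps vertical
  directions to vertical ones, and by its symplecticity it acts on them as the inverse transpose of
  the base change.\<close>

lemma velocity_tangent:
  assumes H: "smooth_ham H" and z: "z \<in> points (cotangent_atlas A)"
  shows "velocity H t z \<in> tangent_space A (fst z)"
  unfolding tangent_space_def mem_Collect_eq
proof (intro conjI allI impI ballI)
  show "velocity H t z c = 0" if "c \<notin> charts_at A (fst z)" for c using that by (simp add: velocity_def)
  fix c d assume c: "c \<in> charts_at A (fst z)" and d: "d \<in> charts_at A (fst z)"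
  have cA: "c \<in> A" "d \<in> A" using c d by (auto simp: charts_at_def)
  have zc: "z \<in> chart_dom (cb c)" "z \<in> chart_dom (cb d)" using charts_at_cb c d z by auto
  have p: "snd z \<in> cotangent_space A (fst z)" using z by (simp add: cotangent_points)
  obtain T where T: "((chart_map (cb c) \<circ> chart_inv (cb d)) has_derivative T) (at (chart_map (cb d) z))"
    and sT: "\<And>u v. symplectic_form (T u) (T v) = symplectic_form u v"
    and fT: "\<And>u. fst (T u) = transition_deriv d c (fst z) (fst u)"
    using cotangent_transition[OF d c p] by auto
  let ?vc = "fst (vf c H (t, chart_map (cb c) z))" and ?vd = "fst (vf d H (t, chart_map (cb d) z))"
  have "?vd \<bullet> w = transition_deriv c d (fst z) ?vc \<bullet> w" for w
  proof -
    have T0: "fst (T (0, w)) = 0" using fT[of "(0, w)"] linear_0[OF transition_linear[OF d c]] by simp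
    have key: "snd (T (0, w)) \<bullet> x = w \<bullet> transition_deriv c d (fst z) x" for x
      using sT[of "(0, w)" "(transition_deriv c d (fst z) x, 0)"] fT[of "(transition_deriv c d (fst z) x, 0)"] T0
      by (simp add: symplectic_form_def transition_compose[OF c d c] transition_refl[OF c])
    have "?vd \<bullet> w = frechet_derivative (ham d H) (at (t, chart_map (cb d) z)) (0, (0, w))"
      by (rule vf_fst[OF H cA(2) cdom_point[OF zc(2)]])
    also have "\<dots> = frechet_derivative (ham c H) (at (t, chart_map (cb c) z)) (0, T (0, w))"
      by (rule ham_transition[OF H d c z T])
    also have "T (0, w) = (0, snd (T (0, w)))" using T0 by (simp add: prod_eq_iff)
    also have "frechet_derivative (ham c H) (at (t, chart_map (cb c) z)) (0, (0, snd (T (0, w)))) = ?vc \<bullet> snd (T (0, w))"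
      using vf_fst[OF H cA(1) cdom_point[OF zc(1)]] by simp
    finally show ?thesis using key[of ?vc] by (simp add: inner_commute)
  qed
  then have "?vd = transition_deriv c d (fst z) ?vc" by (rule inner_eqI)
  then show "velocity H t z d = transition_deriv c d (fst z) (velocity H t z c)"
    using c d by (simp add: velocity_def)
qed

text \<open>The form \<open>\<theta> = p dq - \<eta>\<close> in the chart \<open>c\<close>. Its
  value on the Hamiltonian vector field, freed from charts, is \<open>liouville_vf\<close>.\<close>

definition liouville :: "('m, 'e) one_form \<Rightarrow> ('m, 'e) chart \<Rightarrow> 'm \<times> ('m, 'e) coords \<Rightarrow> 'e \<times> 'e \<Rightarrow> real" where
  "liouville \<eta> c z \<xi> = (snd z c - \<eta> (fst z) c) \<bullet> fst \<xi>"

definition liouville_vf :: "('m, 'e) one_form \<Rightarrow> ('m, 'e) hamiltonian \<Rightarrow> real \<Rightarrow> 'm \<times> ('m, 'e) coords \<Rightarrow> real" where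
  "liouville_vf \<eta> H t z = pairing A (fst z) (snd z) (velocity H t z) - pairing A (fst z) (\<eta> (fst z)) (velocity H t z)"

lemma liouville_vf_eq:
  assumes H: "smooth_ham H" and z: "z \<in> points (cotangent_atlas A)" and \<eta>: "closed_one_form A \<eta>"
    and c: "c \<in> charts_at A (fst z)"
  shows "liouville_vf \<eta> H t z = liouville \<eta> c z (vf c H (t, chart_map (cb c) z))"
proof -
  have "snd z \<in> cotangent_space A (fst z)" "\<eta> (fst z) \<in> cotangent_space A (fst z)"
    using z \<eta> by (auto simp: cotangent_points closed_one_form_def)
  then show ?thesis
    unfolding liouville_vf_def using pairing_eq[OF _ velocity_tangent[OF H z] c]
    by (simp add: liouville_def velocity_def c inner_diff_left)
qed

lemma liouville_linear: "linear (liouville \<eta> c z)"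
  by (intro linearI) (simp_all add: liouville_def inner_add_right)

lemma liouville_transition:
  assumes z: "z \<in> points (cotangent_atlas A)" and \<eta>: "closed_one_form A \<eta>"
    and c: "c \<in> charts_at A (fst z)" and d: "d \<in> charts_at A (fst z)"
    and "fst u' = transition_deriv c d (fst z) (fst u)"
  shows "liouville \<eta> d z u' = liouville \<eta> c z u"
proof -
  have "snd z \<in> cotangent_space A (fst z)" "\<eta> (fst z) \<in> cotangent_space A (fst z)"
    using z \<eta> by (auto simp: cotangent_points closed_one_form_def)
  then show ?thesis
    using cotangent_space_inner[OF _ c d] by (simp add: liouville_def assms(5) inner_diff_left)
qed

lemma one_form_local:
  assumes \<eta>: "closed_one_form A \<eta>" and c: "c \<in> A"
  shows "smooth_on (chart_map c ` chart_dom c) (\<lambda>x. \<eta> (chart_inv c x) c)"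
    and "x \<in> chart_map c ` chart_dom c \<Longrightarrow>
      frechet_derivative (\<lambda>x. \<eta> (chart_inv c x) c) (at x) u \<bullet> w = frechet_derivative (\<lambda>x. \<eta> (chart_inv c x) c) (at x) w \<bullet> u"
  using \<eta> c unfolding closed_one_form_def Let_def by blast+

end

text \<open>
  \<open>potential z t\<close> is the action of the orbit of \<open>F\<close> from \<open>z\<close> up to time \<open>t\<close>, where \<open>t\<close> is at most
  1. It is a primitive of \<open>\<Phi>\<^sub>t\<^sup>*\<theta> - \<theta>\<close> for \<open>\<theta> = p dq - \<eta>\<close>.
\<close>

locale hamiltonian_isotopy = closed_manifold A
  for A :: "('m, 'e::real_inner) atlas" +
  fixes F :: "('m, 'e) hamiltonian" and K0 :: "('m \<times> ('m, 'e) coords) set"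
    and \<Phi> :: "real \<Rightarrow> 'm \<times> ('m, 'e) coords \<Rightarrow> 'm \<times> ('m, 'e) coords"
    and \<eta> :: "('m, 'e) one_form" and potential :: "'m \<times> ('m, 'e) coords \<Rightarrow> real \<Rightarrow> real"
  assumes F: "smooth_ham F"
    and K0: "compactin Cot K0" "\<And>t z. z \<in> points (cotangent_atlas A) \<Longrightarrow> z \<notin> K0 \<Longrightarrow> F t z = 0"
    and \<Phi>: "\<And>z. z \<in> points (cotangent_atlas A) \<Longrightarrow> orbit F (\<lambda>t. \<Phi> t z)"
      "\<And>z. z \<in> points (cotangent_atlas A) \<Longrightarrow> \<Phi> 0 z = z"
    and \<eta>: "closed_one_form A \<eta>"
    and potential: "\<And>z t. z \<in> points (cotangent_atlas A) \<Longrightarrow> t \<in> {0..1} \<Longrightarrow>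
      (potential z has_vector_derivative liouville_vf \<eta> F t (\<Phi> t z) - F t (\<Phi> t z)) (at t within {0..1})"
      "\<And>z. z \<in> points (cotangent_atlas A) \<Longrightarrow> potential z 0 = 0"
begin

abbreviation "M \<equiv> points (cotangent_atlas A)"

lemma \<Phi>_points: "z \<in> M \<Longrightarrow> \<Phi> t z \<in> M"
  using orbit_points[OF \<Phi>(1)] .

lemma \<Phi>_inj:
  assumes "z \<in> M" "w \<in> M" "\<Phi> s z = \<Phi> s w"
  shows "z = w"
  using orbit_unique[OF F \<Phi>(1)[OF assms(1)] \<Phi>(1)[OF assms(2)] assms(3), of 0] \<Phi>(2) assms by simp

end

text \<open>One step of the isotopy, from time \<open>s\<close> to time \<open>t\<close>, inside a
  flow box along the orbit of \<open>z0\<close>. The point \<open>x h\<close> is taken at time 0;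
  its orbit is displaced by \<open>h\<close> from that of \<open>z0\<close> at time
  \<open>s\<close>, as seen in the chart. \<open>Kg\<close> is a Lipschitz constant for the
  coordinates of \<open>\<eta>\<close>, and \<open>V\<close> bounds the vector field. The times lie
  in \<open>{0..1}\<close>, where \<open>potential\<close> has its derivative.\<close>

locale flow_chart = hamiltonian_isotopy A F K0 \<Phi> \<eta> potential
  for A :: "('m, 'e::real_inner) atlas" and F K0 \<Phi> \<eta> potential +
  fixes z0 c \<tau>0 \<delta> \<rho> C W s t r x Kg V
  assumes z0: "z0 \<in> M" and c: "c \<in> A"
    and ctl: "controlled F (\<lambda>\<tau>. \<Phi> \<tau> z0) c \<tau>0 \<delta> \<rho> C W"
    and s: "s \<in> ball \<tau>0 \<delta>" "s \<in> {0..1}" and t: "t \<in> ball \<tau>0 \<delta>" "t \<in> {0..1}"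
    and r: "0 < r" "r \<le> \<rho>"
    and x: "\<And>h. norm h < r \<Longrightarrow> x h \<in> M"
      "\<And>h. norm h < r \<Longrightarrow> \<Phi> s (x h) \<in> chart_dom (cb c)"
      "\<And>h. norm h < r \<Longrightarrow> chart_map (cb c) (\<Phi> s (x h)) = chart_map (cb c) (\<Phi> s z0) + h"
    and Kg: "\<And>y y'. y \<in> W \<Longrightarrow> y' \<in> W \<Longrightarrow>
      norm (\<eta> (chart_inv c (fst y)) c - \<eta> (chart_inv c (fst y')) c) \<le> Kg * norm (fst y - fst y')"
    and V: "\<And>\<tau> y. \<tau> \<in> ball \<tau>0 \<delta> \<Longrightarrow> y \<in> W \<Longrightarrow> norm (vf c F (\<tau>, y)) \<le> V"
begin

abbreviation "m \<equiv> chart_map (cb c)"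
definition X where "X h \<tau> = m (\<Phi> \<tau> (x h))"
definition L where "L \<tau> v = frechet_derivative (vf c F) (at (\<tau>, X 0 \<tau>)) (0, v)"

lemma segI: "closed_segment s t \<subseteq> ball \<tau>0 \<delta>" "closed_segment s t \<subseteq> {0..1}"
  using s t by (intro closed_segment_subset convex_ball; simp)+

lemma x0: "x 0 = z0"
proof -
  have "\<Phi> s (x 0) = \<Phi> s z0"
    using inj_onD[OF cb_inj[OF c], of "\<Phi> s (x 0)" "\<Phi> s z0"] x(2,3)[of 0] controlledD(8)[OF ctl s(1)] r
    by (simp del: bundle_map)
  then show ?thesis using \<Phi>_inj[OF x(1)[of 0] z0] r by simp
qed

lemma X0: "X 0 \<tau> = m (\<Phi> \<tau> z0)"
  by (simp add: X_def x0)

lemma X_chart: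
  assumes h: "norm h < r" and \<tau>: "\<tau> \<in> ball \<tau>0 \<delta>"
  shows "\<Phi> \<tau> (x h) \<in> chart_dom (cb c)" "X h \<tau> \<in> W"
proof -
  have "norm (m (\<Phi> s (x h)) - m (\<Phi> s z0)) < \<rho>" using x(3)[OF h] h r by simp
  from controlledD(10,11)[OF ctl s(1) \<Phi>(1)[OF x(1)[OF h]] x(2)[OF h] this \<tau>]
  show "\<Phi> \<tau> (x h) \<in> chart_dom (cb c)" "X h \<tau> \<in> W" by (simp_all add: X_def del: bundle_map)
qed

lemma X_sol:
  assumes h: "norm h < r" and \<tau>: "\<tau> \<in> ball \<tau>0 \<delta>"
  shows "(X h has_vector_derivative vf c F (\<tau>, X h \<tau>)) (at \<tau>)"
  using orbit_derivative[OF F \<Phi>(1)[OF x(1)[OF h]] c X_chart(1)[OF h \<tau>]]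
  by (simp only: X_def[abs_def])

lemma W_cdom: "\<tau> \<in> ball \<tau>0 \<delta> \<Longrightarrow> y \<in> W \<Longrightarrow> (\<tau>, y) \<in> cdom c"
  using controlledD(5)[OF ctl] by blast

lemma compact_path: "compact ((\<lambda>\<tau>. (\<tau>, X 0 \<tau>)) ` closed_segment s t)"
proof (intro compact_continuous_image compact_segment continuous_on_Pair continuous_on_id)
  show "continuous_on (closed_segment s t) (X 0)"
  proof (rule continuous_at_imp_continuous_on, rule ballI)
    fix \<tau> assume "\<tau> \<in> closed_segment s t"
    then have "\<tau> \<in> ball \<tau>0 \<delta>" using segI(1) by blast
    then show "isCont (X 0) \<tau>" using r by (intro has_vector_derivative_continuous[OF X_sol]) simp_all
  qed
qed

lemma path_cdom: "(\<lambda>\<tau>. (\<tau>, X 0 \<tau>)) ` closed_segment s t \<subseteq> cdom c"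
proof
  fix y assume "y \<in> (\<lambda>\<tau>. (\<tau>, X 0 \<tau>)) ` closed_segment s t"
  then obtain \<tau> where "\<tau> \<in> closed_segment s t" "y = (\<tau>, X 0 \<tau>)" by blast
  then show "y \<in> cdom c" using W_cdom[of \<tau> "X 0 \<tau>"] X_chart(2)[of 0 \<tau>] segI(1) r by (simp add: subset_iff)
qed

lemma flow: "\<exists>B. local_flow B (\<lambda>\<tau> y. vf c F (\<tau>, y)) X s t r C L"
proof -
  obtain B :: "('e \<times> 'e) set" where B: "frame B" using frames(1) by blast
  obtain B3 :: "(real \<times> 'e \<times> 'e) set" where B3: "frame B3" using frames(2) by blast
  have r0: "norm (0 :: 'e \<times> 'e) < r" using r by simp
  have "local_flow B (\<lambda>\<tau> y. vf c F (\<tau>, y)) X s t r C L"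
  proof (rule local_flow.intro)
    show "frame B" "0 < r" "0 \<le> C" using B r controlledD(3)[OF ctl] by auto
    have "\<bar>t - s\<bar> \<le> 2 * \<delta>" using s t by (simp add: dist_real_def)
    then have "\<bar>t - s\<bar> * C \<le> 2 * \<delta> * C" using controlledD(3)[OF ctl] by (intro mult_right_mono) auto
    then show "\<bar>t - s\<bar> * C \<le> 1/4" using controlledD(4)[OF ctl] by linarith
    show "(X h has_vector_derivative vf c F (\<tau>, X h \<tau>)) (at \<tau> within closed_segment s t)"
      if "norm h < r" "\<tau> \<in> closed_segment s t" for h \<tau>
      by (rule has_vector_derivative_at_within[OF X_sol[OF that(1) subsetD[OF segI(1) that(2)]]])
    show "X h s = X 0 s + h" if "norm h < r" for h
      unfolding X_def x0 by (rule x(3)[OF that])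
    show "norm (vf c F (\<tau>, X h \<tau>) - vf c F (\<tau>, X k \<tau>)) \<le> C * norm (X h \<tau> - X k \<tau>)"
      if "norm h < r" "norm k < r" "\<tau> \<in> closed_segment s t" for h k \<tau>
      using controlledD(7)[OF ctl _ X_chart(2)[OF that(1)] X_chart(2)[OF that(2)]] segI(1) that(3) by blast
    fix \<tau> assume \<tau>: "\<tau> \<in> closed_segment s t"
    then have \<tau>b: "\<tau> \<in> ball \<tau>0 \<delta>" using segI by blast
    note d = has_derivative_slice[OF smooth_onD[OF vf_smooth[OF F c] W_cdom[OF \<tau>b X_chart(2)[OF r0 \<tau>b]]]]
    show "linear (L \<tau>)" unfolding L_def[abs_def] using has_derivative_linear[OF d] .
    show "norm (L \<tau> v) \<le> C * norm v" for v
      using derivative_norm_diff_le[OF d controlledD(6)[OF ctl] X_chart(2)[OF r0 \<tau>b] linear_zero, of C v]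
        controlledD(7)[OF ctl \<tau>b _ X_chart(2)[OF r0 \<tau>b]] by (simp add: L_def)
  next
    fix \<epsilon> :: real assume "\<epsilon> > 0"
    from smooth_on_strict_compact[OF B3 open_cdom[OF c] compact_path path_cdom vf_smooth[OF F c] this]
    obtain d where d: "d > 0" and st: "\<And>\<tau> y. \<tau> \<in> closed_segment s t \<Longrightarrow> y \<in> ball (\<tau>, X 0 \<tau>) d \<Longrightarrow>
      norm (vf c F y - vf c F (\<tau>, X 0 \<tau>) - frechet_derivative (vf c F) (at (\<tau>, X 0 \<tau>)) (y - (\<tau>, X 0 \<tau>)))
        \<le> \<epsilon> * norm (y - (\<tau>, X 0 \<tau>))" by blast
    have "norm (vf c F (\<tau>, y) - vf c F (\<tau>, X 0 \<tau>) - L \<tau> (y - X 0 \<tau>)) \<le> \<epsilon> * norm (y - X 0 \<tau>)"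
      if "\<tau> \<in> closed_segment s t" "y \<in> ball (X 0 \<tau>) d" for \<tau> y
      using st[OF that(1), of "(\<tau>, y)"] that(2) by (simp add: L_def dist_Pair_Pair)
    with d show "\<exists>\<delta>>0. \<forall>\<tau>\<in>closed_segment s t. \<forall>y\<in>ball (X 0 \<tau>) \<delta>.
      norm (vf c F (\<tau>, y) - vf c F (\<tau>, X 0 \<tau>) - L \<tau> (y - X 0 \<tau>)) \<le> \<epsilon> * norm (y - X 0 \<tau>)" by blast
  qed
  then show ?thesis by blast
qed

lemma flow_symplectic:
  assumes "((\<lambda>h. X h t) has_derivative Y) (at 0)"
  shows "symplectic_form (Y u) (Y v) = symplectic_form u v"
proof -
  obtain B where "local_flow B (\<lambda>\<tau> y. vf c F (\<tau>, y)) X s t r C L" using flow by blast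
  then interpret l: local_flow B "\<lambda>\<tau> y. vf c F (\<tau>, y)" X s t r C L .
  show ?thesis
  proof (rule l.flow_preserves[OF symplectic_form_bilinear _ assms])
    fix \<tau> u v assume "\<tau> \<in> closed_segment s t"
    then have "(\<tau>, X 0 \<tau>) \<in> cdom c" using path_cdom by blast
    from vf_linearization_symplectic[OF F c this]
    show "symplectic_form (L \<tau> u) v + symplectic_form u (L \<tau> v) = 0" by (simp add: L_def)
  qed
qed

text \<open>
  With \<open>\<theta> = p dq - \<eta>\<close>, the exterior derivative of \<open>\<theta>\<close> is the symplectic form, because \<open>\<eta>\<close> is
  closed; this is the infinitesimal form of \<open>d(\<theta>(X\<^sub>F) - F) = L\<^sub>X \<theta>\<close>.
\<close>

lemma flow_action:
  assumes Y: "((\<lambda>h. X h t) has_derivative Y) (at 0)"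
  shows "((\<lambda>h. potential (x h) t - potential (x h) s) has_derivative
    (\<lambda>u. liouville \<eta> c (\<Phi> t z0) (Y u) - liouville \<eta> c (\<Phi> s z0) u)) (at 0)"
proof -
  obtain B where "local_flow B (\<lambda>\<tau> y. vf c F (\<tau>, y)) X s t r C L" using flow by blast
  then interpret l: local_flow B "\<lambda>\<tau> y. vf c F (\<tau>, y)" X s t r C L .
  define g where "g q = \<eta> (chart_inv c q) c" for q
  define D where "D \<tau> = frechet_derivative g (at (fst (X 0 \<tau>)))" for \<tau>
  define v where "v h \<tau> = vf c F (\<tau>, X h \<tau>)" for h \<tau>
  let ?U = "chart_map c ` chart_dom c"
  have Uopen: "open ?U" by (rule atlas_open[OF topological_A c])
  have g_smooth: "smooth_on ?U g" unfolding g_def by (rule one_form_local(1)[OF \<eta> c])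
  have r0: "norm (0 :: 'e \<times> 'e) < r" using r by simp
  have XU: "fst (X h \<tau>) \<in> ?U" if "norm h < r" "\<tau> \<in> closed_segment s t" for h :: "'e \<times> 'e" and \<tau>
    using X_chart(1)[OF that(1)] segI(1) that(2) by (auto simp: X_def bundle_dom)
  have D: "(g has_derivative D \<tau>) (at (fst (X 0 \<tau>)))" if "\<tau> \<in> closed_segment s t" for \<tau>
    unfolding D_def by (rule smooth_onD[OF g_smooth XU[OF r0 that]])
  have D_lin: "linear (D \<tau>)" if "\<tau> \<in> closed_segment s t" for \<tau> using D[OF that] has_derivative_linear by blast
  have D_sym: "D \<tau> u \<bullet> w = D \<tau> w \<bullet> u" if "\<tau> \<in> closed_segment s t" for \<tau> u w
    unfolding D_def g_def by (rule one_form_local(2)[OF \<eta> c XU[OF r0 that]])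
  have liouville_X: "liouville \<eta> c (\<Phi> \<tau> (x h)) \<xi> = (snd (X h \<tau>) - g (fst (X h \<tau>))) \<bullet> fst \<xi>"
    if "norm h < r" "\<tau> \<in> closed_segment s t" for h :: "'e \<times> 'e" and \<tau> \<xi>
    using inv_map[OF c, of "fst (\<Phi> \<tau> (x h))"] X_chart(1)[OF that(1)] segI(1) that(2)
    by (auto simp: liouville_def X_def g_def bundle_dom subset_iff)
  \<comment> \<open>\<open>b\<close> is the action density \<open>\<theta>(X\<^sub>F) - F\<close> in
    coordinates, and \<open>d\<close> the time derivative of the form along the reference orbit
    applied to the displacement; their variations have to agree to first order in
    \<open>h\<close>.\<close>
  define b where "b h \<tau> = (snd (X h \<tau>) - g (fst (X h \<tau>))) \<bullet> fst (v h \<tau>) - ham c F (\<tau>, X h \<tau>)" for h \<tau>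
  define d where "d h \<tau> = (snd (v 0 \<tau>) - D \<tau> (fst (v 0 \<tau>))) \<bullet> fst (X h \<tau> - X 0 \<tau>)
     + (snd (X 0 \<tau>) - g (fst (X 0 \<tau>))) \<bullet> fst (v h \<tau> - v 0 \<tau>)" for h \<tau>
  have "((\<lambda>h. potential (x h) t - potential (x h) s) has_derivative
    (\<lambda>u. liouville \<eta> c (\<Phi> t (x 0)) (Y u) - liouville \<eta> c (\<Phi> s (x 0)) u)) (at 0)"
  proof (rule l.flow_action_derivative[where \<theta> = "\<lambda>\<tau>. liouville \<eta> c (\<Phi> \<tau> (x 0))" and b = b and d = d and \<sigma> = "\<lambda>h. potential (x h)", OF _ _ _ _ Y])
    show "linear (liouville \<eta> c (\<Phi> \<tau> (x 0)))" for \<tau> by (rule liouville_linear)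
    fix h :: "'e \<times> 'e" and \<tau> assume h: "norm h < r" and \<tau>: "\<tau> \<in> closed_segment s t"
    have \<tau>b: "\<tau> \<in> ball \<tau>0 \<delta>" "\<tau> \<in> {0..1}" using \<tau> segI by blast+
    have P: "\<Phi> \<tau> (x h) \<in> M" by (rule \<Phi>_points[OF x(1)[OF h]])
    have cc: "c \<in> charts_at A (fst (\<Phi> \<tau> (x h)))"
      using X_chart(1)[OF h \<tau>b(1)] c by (simp add: charts_at_def bundle_dom)
    have "b h \<tau> = liouville_vf \<eta> F \<tau> (\<Phi> \<tau> (x h)) - F \<tau> (\<Phi> \<tau> (x h))"
      unfolding liouville_vf_eq[OF F P \<eta> cc] liouville_X[OF h \<tau>] b_def v_def ham_def
      using cb_inv_map[OF c X_chart(1)[OF h \<tau>b(1)]] by (simp add: X_def del: bundle_map)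
    then show "(potential (x h) has_vector_derivative b h \<tau>) (at \<tau> within closed_segment s t)"
      using has_vector_derivative_within_subset[OF potential(1)[OF x(1)[OF h] \<tau>b(2)] segI(2)] by simp
    have vX: "(X k has_vector_derivative v k \<tau>) (at \<tau> within closed_segment s t)" if "norm k < r" for k
      unfolding v_def by (rule has_vector_derivative_at_within[OF X_sol[OF that \<tau>b(1)]])
    have vg: "((\<lambda>\<tau>. g (fst (X 0 \<tau>))) has_vector_derivative D \<tau> (fst (v 0 \<tau>))) (at \<tau> within closed_segment s t)"
      using has_derivative_compose[OF has_derivative_fst[OF vX[OF r0, unfolded has_vector_derivative_def]] D[OF \<tau>]]
      by (simp add: has_vector_derivative_def linear_scale[OF D_lin[OF \<tau>]])
    have "((\<lambda>\<tau>. (snd (X 0 \<tau>) - g (fst (X 0 \<tau>))) \<bullet> fst (X h \<tau> - X 0 \<tau>)) has_vector_derivative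
      (snd (X 0 \<tau>) - g (fst (X 0 \<tau>))) \<bullet> fst (v h \<tau> - v 0 \<tau>) + (snd (v 0 \<tau>) - D \<tau> (fst (v 0 \<tau>))) \<bullet> fst (X h \<tau> - X 0 \<tau>))
      (at \<tau> within closed_segment s t)"
      by (intro bounded_bilinear.has_vector_derivative[OF bounded_bilinear_inner] has_vector_derivative_diff vg
          bounded_linear.has_vector_derivative[OF bounded_linear_snd] bounded_linear.has_vector_derivative[OF bounded_linear_fst] vX r0 h)
    then show "((\<lambda>\<tau>. liouville \<eta> c (\<Phi> \<tau> (x 0)) (X h \<tau> - X 0 \<tau>)) has_vector_derivative d h \<tau>) (at \<tau> within closed_segment s t)"
      unfolding d_def add.commute[of "(snd (v 0 \<tau>) - _) \<bullet> _"]
      by (rule has_vector_derivative_transform[OF \<tau>, rotated]) (simp add: liouville_X[OF r0])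
  next
    fix \<epsilon> :: real assume \<epsilon>: "\<epsilon> > 0"
    define k where "k = 1 + \<bar>Kg\<bar>"
    have V0: "V \<ge> 0" using V[OF s(1) X_chart(2)[OF r0 s(1)]] norm_ge_zero order_trans by blast
    have C0: "C \<ge> 0" using controlledD(3)[OF ctl] .
    define Q where "Q = 4 * k * C + 2 * V + 2"
    have Q: "Q \<ge> 0" using V0 C0 by (simp add: Q_def k_def)
    define e where "e = \<epsilon> / (Q + 1)"
    have e: "e > 0" "e * Q \<le> \<epsilon>" unfolding e_def by (rule small_factor[OF \<epsilon> Q])+
    obtain B3 :: "(real \<times> 'e \<times> 'e) set" where B3: "frame B3" using frames(2) by blast
    obtain d1 where d1: "d1 > 0" and st1: "\<And>\<tau> y. \<tau> \<in> closed_segment s t \<Longrightarrow> y \<in> ball (\<tau>, X 0 \<tau>) d1 \<Longrightarrow>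
      norm (ham c F y - ham c F (\<tau>, X 0 \<tau>) - frechet_derivative (ham c F) (at (\<tau>, X 0 \<tau>)) (y - (\<tau>, X 0 \<tau>)))
        \<le> e * norm (y - (\<tau>, X 0 \<tau>))"
      using smooth_on_strict_compact[OF B3 open_cdom[OF c] compact_path path_cdom ham_smooth[OF F c] e(1)] by blast
    have cp: "compact ((\<lambda>\<tau>. fst (X 0 \<tau>)) ` closed_segment s t)"
      using compact_continuous_image[OF continuous_on_fst[OF continuous_on_snd[OF continuous_on_id]] compact_path]
      by (simp add: image_image)
    have "(\<lambda>\<tau>. fst (X 0 \<tau>)) ` closed_segment s t \<subseteq> ?U" using XU[OF r0] by blast
    from smooth_on_strict_compact[OF model_frame Uopen cp this g_smooth e(1)]
    obtain d2 where d2: "d2 > 0" and st2: "\<And>\<tau> y. \<tau> \<in> closed_segment s t \<Longrightarrow> y \<in> ball (fst (X 0 \<tau>)) d2 \<Longrightarrow>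
      norm (g y - g (fst (X 0 \<tau>)) - D \<tau> (y - fst (X 0 \<tau>))) \<le> e * norm (y - fst (X 0 \<tau>))"
      unfolding D_def by blast
    \<comment> \<open>The bound by \<open>e / 2\<close> makes the displacement smaller than
      \<open>e\<close>, so that its square is at most \<open>e\<close> times the
      displacement.\<close>
    define \<kappa> where "\<kappa> = min r (min (min d1 d2) e / 2)"
    have \<kappa>: "\<kappa> > 0" using r d1 d2 e by (simp add: \<kappa>_def)
    have "\<bar>b h \<tau> - b 0 \<tau> - d h \<tau>\<bar> \<le> \<epsilon> * norm h" if h: "norm h < \<kappa>" and \<tau>: "\<tau> \<in> closed_segment s t"
      for h :: "'e \<times> 'e" and \<tau>
    proof -
      have hr: "norm h < r" and h2: "2 * norm h < d1" "2 * norm h < d2" "2 * norm h < e"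
        using h by (auto simp: \<kappa>_def)
      have \<tau>b: "\<tau> \<in> ball \<tau>0 \<delta>" using \<tau> segI by blast
      define \<xi> where "\<xi> = X h \<tau> - X 0 \<tau>"
      have n\<xi>: "norm \<xi> \<le> 2 * norm h" using l.near[OF hr r0 \<tau>] by (simp add: \<xi>_def)
      have nf: "norm (fst \<xi>) \<le> norm \<xi>" "norm (snd \<xi>) \<le> norm \<xi>"
        using norm_fst_le[of "fst \<xi>" "snd \<xi>"] norm_snd_le[of "snd \<xi>" "fst \<xi>"] by auto
      define R1 where "R1 = ham c F (\<tau>, X h \<tau>) - ham c F (\<tau>, X 0 \<tau>) - frechet_derivative (ham c F) (at (\<tau>, X 0 \<tau>)) (0, \<xi>)"
      define R2 where "R2 = g (fst (X h \<tau>)) - g (fst (X 0 \<tau>)) - D \<tau> (fst \<xi>)"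
      have "dist (\<tau>, X 0 \<tau>) (\<tau>, X h \<tau>) = norm \<xi>" by (simp add: dist_Pair_Pair \<xi>_def dist_norm norm_minus_commute)
      then have "(\<tau>, X h \<tau>) \<in> ball (\<tau>, X 0 \<tau>) d1" using n\<xi> h2 by simp
      from st1[OF \<tau> this] have R1: "\<bar>R1\<bar> \<le> e * norm \<xi>" by (simp add: R1_def \<xi>_def)
      have "dist (fst (X 0 \<tau>)) (fst (X h \<tau>)) = norm (fst \<xi>)" by (simp add: \<xi>_def dist_norm norm_minus_commute)
      then have "fst (X h \<tau>) \<in> ball (fst (X 0 \<tau>)) d2" using n\<xi> nf h2 by simp
      from st2[OF \<tau> this] have "norm R2 \<le> e * norm (fst \<xi>)" by (simp add: R2_def \<xi>_def)
      also have "\<dots> \<le> e * norm \<xi>" using nf e by (intro mult_left_mono) auto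
      finally have R2: "norm R2 \<le> e * norm \<xi>" .
      have D_bd: "norm (D \<tau> (fst \<xi>)) \<le> \<bar>Kg\<bar> * norm \<xi>"
      proof -
        have "norm (D \<tau> (fst \<xi>) - 0) \<le> \<bar>Kg\<bar> * norm (fst \<xi>)"
        proof (rule derivative_norm_diff_le[OF D[OF \<tau>], where L = "\<lambda>_. 0" and U = "fst ` W"])
          show "open (fst ` W)" by (rule open_image_fst[OF controlledD(6)[OF ctl]])
          show "fst (X 0 \<tau>) \<in> fst ` W" using X_chart(2)[OF r0 \<tau>b] by blast
          show "linear (\<lambda>_::'e. 0::'e)" by (rule linear_zero)
          fix y assume "y \<in> fst ` W"
          then obtain w where w: "w \<in> W" "y = fst w" by blast
          have "norm (g y - g (fst (X 0 \<tau>))) \<le> Kg * norm (y - fst (X 0 \<tau>))"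
            unfolding g_def w(2) by (rule Kg[OF w(1) X_chart(2)[OF r0 \<tau>b]])
          also have "\<dots> \<le> \<bar>Kg\<bar> * norm (y - fst (X 0 \<tau>))" by (intro mult_right_mono) auto
          finally show "norm (g y - g (fst (X 0 \<tau>)) - 0) \<le> \<bar>Kg\<bar> * norm (y - fst (X 0 \<tau>))" by simp
        qed
        also have "\<dots> \<le> \<bar>Kg\<bar> * norm \<xi>" using nf by (intro mult_left_mono) auto
        finally show ?thesis by simp
      qed
      have hd: "frechet_derivative (ham c F) (at (\<tau>, X 0 \<tau>)) (0, \<xi>) = - symplectic_form (v 0 \<tau>) \<xi>"
        using vf_symplectic[OF F c W_cdom[OF \<tau>b X_chart(2)[OF r0 \<tau>b]], of \<xi>] by (simp add: v_def)
      have A1: "snd (X h \<tau>) = snd (X 0 \<tau>) + snd \<xi>" by (simp add: \<xi>_def)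
      have A2: "g (fst (X h \<tau>)) = g (fst (X 0 \<tau>)) + D \<tau> (fst \<xi>) + R2" by (simp add: R2_def)
      have A3: "ham c F (\<tau>, X h \<tau>) = ham c F (\<tau>, X 0 \<tau>) - (snd (v 0 \<tau>) \<bullet> fst \<xi> - fst (v 0 \<tau>) \<bullet> snd \<xi>) + R1"
        using hd by (simp add: R1_def symplectic_form_def)
      \<comment> \<open>All terms of first order cancel: those of the Hamiltonian by the definition
        of its vector field, those of \<open>\<eta>\<close> by \<open>D_sym\<close>, that is, by
        closedness. What remains is quadratic in the displacement or contains a Taylor error
        \<open>R1\<close> or \<open>R2\<close>.\<close>
      have "b h \<tau> - b 0 \<tau> - d h \<tau> = (snd \<xi> - D \<tau> (fst \<xi>)) \<bullet> fst (v h \<tau> - v 0 \<tau>) - R2 \<bullet> fst (v h \<tau>) - R1"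
        unfolding b_def d_def A1 A2 A3 \<xi>_def[symmetric]
        using D_sym[OF \<tau>, of "fst \<xi>" "fst (v 0 \<tau>)"]
        by (simp add: inner_add_left inner_diff_left inner_diff_right inner_commute[of "snd \<xi>"] algebra_simps)
      then have "\<bar>b h \<tau> - b 0 \<tau> - d h \<tau>\<bar> \<le> \<bar>(snd \<xi> - D \<tau> (fst \<xi>)) \<bullet> fst (v h \<tau> - v 0 \<tau>)\<bar> + \<bar>R2 \<bullet> fst (v h \<tau>)\<bar> + \<bar>R1\<bar>"
        by linarith
      also have "\<dots> \<le> (k * norm \<xi>) * (C * norm \<xi>) + (e * norm \<xi>) * V + e * norm \<xi>"
      proof (intro add_mono R1)
        have "norm (snd \<xi> - D \<tau> (fst \<xi>)) \<le> k * norm \<xi>"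
          using norm_diff_le_add[OF nf(2) D_bd] by (simp add: k_def algebra_simps)
        moreover have "norm (fst (v h \<tau> - v 0 \<tau>)) \<le> C * norm \<xi>"
          using norm_fst_le[of "fst (v h \<tau> - v 0 \<tau>)" "snd (v h \<tau> - v 0 \<tau>)", unfolded prod.collapse] l.lips[OF hr r0 \<tau>]
          unfolding v_def \<xi>_def by linarith
        ultimately show "\<bar>(snd \<xi> - D \<tau> (fst \<xi>)) \<bullet> fst (v h \<tau> - v 0 \<tau>)\<bar> \<le> (k * norm \<xi>) * (C * norm \<xi>)"
          by (intro order_trans[OF Cauchy_Schwarz_ineq2] mult_mono) (auto simp: k_def)
        have "norm (fst (v h \<tau>)) \<le> V"
          using norm_fst_le[of "fst (v h \<tau>)" "snd (v h \<tau>)"] V[OF \<tau>b X_chart(2)[OF hr \<tau>b]] by (simp add: v_def)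
        then show "\<bar>R2 \<bullet> fst (v h \<tau>)\<bar> \<le> (e * norm \<xi>) * V"
          using R2 e by (intro order_trans[OF Cauchy_Schwarz_ineq2] mult_mono) auto
      qed
      also have "\<dots> = (k * C * norm \<xi> + e * V + e) * norm \<xi>" by (simp add: algebra_simps)
      also have "\<dots> \<le> (k * C * e + e * V + e) * (2 * norm h)"
        using n\<xi> h2 C0 V0 e by (intro mult_mono add_mono mult_left_mono) (auto simp: k_def)
      also have "\<dots> \<le> (e * Q) * norm h"
      proof -
        have "0 \<le> k * C * e" using C0 e by (simp add: k_def)
        then have "(k * C * e + e * V + e) * 2 \<le> e * Q" unfolding Q_def by (simp add: algebra_simps)
        from mult_right_mono[OF this norm_ge_zero[of h]] show ?thesis by (simp add: algebra_simps)
      qed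
      also have "\<dots> \<le> \<epsilon> * norm h" using e by (intro mult_right_mono) auto
      finally show ?thesis .
    qed
    with \<kappa> show "\<exists>\<delta>>0. \<forall>h \<tau>. norm h < \<delta> \<and> \<tau> \<in> closed_segment s t \<longrightarrow> \<bar>b h \<tau> - b 0 \<tau> - d h \<tau>\<bar> \<le> \<epsilon> * norm h"
      by blast
  qed
  then show ?thesis by (simp only: x0)
qed

end

section \<open>Regularity of the isotopy, propagated along single orbits\<close>

context closed_manifold begin

lemma point_charts_at: "z \<in> points (cotangent_atlas A) \<Longrightarrow> \<exists>c. c \<in> charts_at A (fst z)"
  unfolding cotangent_points using charts_at_nonempty by blast

lemma openin_Cot_subset: "openin Cot U \<Longrightarrow> U \<subseteq> points (cotangent_atlas A)"
  using openin_subset[of Cot U] by (simp add: topspace_Cot)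

end

context hamiltonian_isotopy begin

text \<open>The infinitesimal content of being exact symplectic, at the single point
  \<open>z\<close>: the last clause says that the differential of \<open>potential\<close> is the
  pullback of \<open>\<theta>\<close> minus \<open>\<theta>\<close>. One \<open>Y\<close> links all
  the clauses.\<close>

definition flow_derivative :: "'m \<times> ('m, 'e) coords \<Rightarrow> ('m, 'e) chart \<Rightarrow> ('m, 'e) chart \<Rightarrow> real \<Rightarrow> bool" where
  "flow_derivative z c d t \<longleftrightarrow> (\<exists>Y.
     ((\<lambda>y. chart_map (cb d) (\<Phi> t (chart_inv (cb c) y))) has_derivative Y) (at (chart_map (cb c) z)) \<and>
     (\<forall>u v. symplectic_form (Y u) (Y v) = symplectic_form u v) \<and>
     ((\<lambda>y. potential (chart_inv (cb c) y) t) has_derivative (\<lambda>u. liouville \<eta> d (\<Phi> t z) (Y u) - liouville \<eta> c z u)) (at (chart_map (cb c) z)))"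

text \<open>Continuity, and in \<open>flow_open\<close> openness, is stated at one point because the
  flow boxes that propagate it depend on the orbit of \<open>z\<close>.\<close>

definition flow_cont :: "'m \<times> ('m, 'e) coords \<Rightarrow> real \<Rightarrow> bool" where
  "flow_cont z t \<longleftrightarrow> (\<forall>V. openin Cot V \<and> \<Phi> t z \<in> V \<longrightarrow> (\<exists>U. openin Cot U \<and> z \<in> U \<and> \<Phi> t ` U \<subseteq> V))"

definition flow_open :: "'m \<times> ('m, 'e) coords \<Rightarrow> real \<Rightarrow> bool" where
  "flow_open z t \<longleftrightarrow> (\<forall>U. openin Cot U \<and> z \<in> U \<longrightarrow> (\<exists>V. openin Cot V \<and> \<Phi> t z \<in> V \<and> V \<subseteq> \<Phi> t ` U))"

definition flow_good :: "'m \<times> ('m, 'e) coords \<Rightarrow> ('m, 'e) chart \<Rightarrow> real \<Rightarrow> bool" where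
  "flow_good z c t \<longleftrightarrow> flow_cont z t \<and> flow_open z t \<and> (\<forall>d\<in>charts_at A (fst (\<Phi> t z)). flow_derivative z c d t)"

text \<open>A change of the target chart composes \<open>Y\<close> with a lifted coordinate change,
  which is symplectic and respects \<open>\<theta>\<close>. Continuity at \<open>z\<close> keeps
  nearby images in the chart \<open>d\<close>.\<close>

lemma flow_derivative_change:
  assumes z: "z \<in> M" and c: "c \<in> charts_at A (fst z)" and cont: "flow_cont z t"
    and d: "d \<in> charts_at A (fst (\<Phi> t z))" "flow_derivative z c d t" and e: "e \<in> charts_at A (fst (\<Phi> t z))"
  shows "flow_derivative z c e t"
proof -
  have cA: "c \<in> A" "d \<in> A" "e \<in> A" using c d e by (auto simp: charts_at_def)
  have zc: "z \<in> chart_dom (cb c)" by (rule charts_at_cb[OF c z])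
  have zd: "\<Phi> t z \<in> chart_dom (cb d)" by (rule charts_at_cb[OF d(1) \<Phi>_points[OF z]])
  have p: "snd (\<Phi> t z) \<in> cotangent_space A (fst (\<Phi> t z))" using \<Phi>_points[OF z] by (simp add: cotangent_points)
  obtain Y where Y: "((\<lambda>y. chart_map (cb d) (\<Phi> t (chart_inv (cb c) y))) has_derivative Y) (at (chart_map (cb c) z))"
    and sY: "\<And>u v. symplectic_form (Y u) (Y v) = symplectic_form u v"
    and S: "((\<lambda>y. potential (chart_inv (cb c) y) t) has_derivative (\<lambda>u. liouville \<eta> d (\<Phi> t z) (Y u) - liouville \<eta> c z u)) (at (chart_map (cb c) z))"
    using d(2) unfolding flow_derivative_def by blast
  obtain T where T: "((chart_map (cb e) \<circ> chart_inv (cb d)) has_derivative T) (at (chart_map (cb d) (\<Phi> t z)))"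
    and sT: "\<And>u v. symplectic_form (T u) (T v) = symplectic_form u v"
    and fT: "\<And>u. fst (T u) = transition_deriv d e (fst (\<Phi> t z)) (fst u)"
    using cotangent_transition[OF d(1) e p] by auto
  have inv: "chart_inv (cb c) (chart_map (cb c) z) = z" by (rule cb_inv_map[OF cA(1) zc])
  obtain U where U: "openin Cot U" "z \<in> U" "\<Phi> t ` U \<subseteq> chart_dom (cb d)"
    using cont chart_dom_open[OF topological_cotangent cb_atlas[OF cA(2)]] zd unfolding flow_cont_def by blast
  let ?S = "chart_map (cb c) ` (U \<inter> chart_dom (cb c))"
  have "((\<lambda>y. (chart_map (cb e) \<circ> chart_inv (cb d)) (chart_map (cb d) (\<Phi> t (chart_inv (cb c) y)))) has_derivative (\<lambda>u. T (Y u)))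
    (at (chart_map (cb c) z))"
    by (rule has_derivative_compose[OF Y]) (simp only: inv T)
  moreover have "open ?S" by (rule open_image_chart[OF topological_cotangent U(1) cb_atlas[OF cA(1)]])
  moreover have "chart_map (cb c) z \<in> ?S" using U(2) zc by blast
  moreover have "(chart_map (cb e) \<circ> chart_inv (cb d)) (chart_map (cb d) (\<Phi> t (chart_inv (cb c) y))) =
      chart_map (cb e) (\<Phi> t (chart_inv (cb c) y))" if y: "y \<in> ?S" for y
  proof -
    obtain w where w: "w \<in> U" "w \<in> chart_dom (cb c)" "y = chart_map (cb c) w" using y by blast
    have "chart_inv (cb c) y = w" unfolding w(3) by (rule cb_inv_map[OF cA(1) w(2)])
    moreover have "\<Phi> t w \<in> chart_dom (cb d)" using U(3) w(1) by blast
    ultimately show ?thesis using cb_inv_map[OF cA(2)] by (simp del: bundle_map)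
  qed
  ultimately have "((\<lambda>y. chart_map (cb e) (\<Phi> t (chart_inv (cb c) y))) has_derivative (\<lambda>u. T (Y u))) (at (chart_map (cb c) z))"
    by (rule has_derivative_transform_within_open)
  moreover have "liouville \<eta> e (\<Phi> t z) (T u) = liouville \<eta> d (\<Phi> t z) u" for u
    by (rule liouville_transition[OF \<Phi>_points[OF z] \<eta> d(1) e fT])
  ultimately show ?thesis
    unfolding flow_derivative_def using S sT sY by (intro exI[of _ "\<lambda>u. T (Y u)"]) auto
qed

lemma flow_good_zero:
  assumes z: "z \<in> M" and c: "c \<in> charts_at A (fst z)"
  shows "flow_good z c 0"
proof -
  have cA: "c \<in> A" using c by (auto simp: charts_at_def)
  have zc: "z \<in> chart_dom (cb c)" by (rule charts_at_cb[OF c z])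
  have sub: "U \<subseteq> M" if "openin Cot U" for U using openin_subset[OF that] by (simp add: topspace_Cot)
  have cont: "flow_cont z 0"
    unfolding flow_cont_def
  proof (intro allI impI)
    fix V assume V: "openin Cot V \<and> \<Phi> 0 z \<in> V"
    then have "\<Phi> 0 ` V = V" using sub[of V] \<Phi>(2) by force
    then show "\<exists>U. openin Cot U \<and> z \<in> U \<and> \<Phi> 0 ` U \<subseteq> V" using V \<Phi>(2)[OF z] by (intro exI[of _ V]) simp
  qed
  have opn: "flow_open z 0"
    unfolding flow_open_def
  proof (intro allI impI)
    fix V assume V: "openin Cot V \<and> z \<in> V"
    then have "\<Phi> 0 ` V = V" using sub[of V] \<Phi>(2) by force
    then show "\<exists>U. openin Cot U \<and> \<Phi> 0 z \<in> U \<and> U \<subseteq> \<Phi> 0 ` V" using V \<Phi>(2)[OF z] by (intro exI[of _ V]) simp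
  qed
  let ?S = "chart_map (cb c) ` chart_dom (cb c)"
  have oS: "open ?S" by (rule atlas_open[OF topological_cotangent cb_atlas[OF cA]])
  have zS: "chart_map (cb c) z \<in> ?S" using zc by blast
  have inM: "chart_inv (cb c) y \<in> M" if "y \<in> ?S" for y
    using chart_inv_dom[OF that] cb_dom_points[OF cA] by blast
  have 1: "((\<lambda>y. chart_map (cb c) (\<Phi> 0 (chart_inv (cb c) y))) has_derivative (\<lambda>u. u)) (at (chart_map (cb c) z))"
    by (rule has_derivative_transform_within_open[OF has_derivative_ident oS zS])
      (use inM \<Phi>(2) chart_map_inv[of _ "cb c"] in \<open>simp del: bundle_map\<close>)
  have 2: "((\<lambda>y. potential (chart_inv (cb c) y) 0) has_derivative (\<lambda>u. 0)) (at (chart_map (cb c) z))"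
    by (rule has_derivative_transform_within_open[OF has_derivative_const[of 0] oS zS])
      (use inM potential(2) in simp)
  have "flow_derivative z c c 0"
    unfolding flow_derivative_def using 1 2 \<Phi>(2)[OF z] by (intro exI[of _ "\<lambda>u. u"]) simp
  then show ?thesis
    unfolding flow_good_def using cont opn flow_derivative_change[OF z c cont] c \<Phi>(2)[OF z] by simp
qed

text \<open>The box is chosen for \<open>\<tau>0\<close> before \<open>s\<close> and
  \<open>t\<close>, which are in arbitrary order: the property passes forwards and backwards in
  time, as the induction over a connected interval demands.\<close>

lemma flow_good_step:
  assumes z: "z \<in> M" and c0: "c0 \<in> charts_at A (fst z)"
  shows "\<exists>\<delta>>0. \<forall>s\<in>ball \<tau>0 \<delta> \<inter> {0..1}. \<forall>t\<in>ball \<tau>0 \<delta> \<inter> {0..1}. flow_good z c0 s \<longrightarrow> flow_good z c0 t"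
proof -
  obtain c where c: "c \<in> A" "\<Phi> \<tau>0 z \<in> chart_dom (cb c)" using point_chart[OF \<Phi>_points[OF z]] by blast
  have c0A: "c0 \<in> A" using c0 by (auto simp: charts_at_def)
  have zc0: "z \<in> chart_dom (cb c0)" by (rule charts_at_cb[OF c0 z])
  let ?m = "chart_map (cb c)" and ?U = "chart_map c ` chart_dom c"
  define y0 where "y0 = ?m (\<Phi> \<tau>0 z)"
  define g where "g q = \<eta> (chart_inv c q) c" for q
  have Uopen: "open ?U" by (rule atlas_open[OF topological_A c(1)])
  have g_smooth: "smooth_on ?U g" unfolding g_def by (rule one_form_local(1)[OF \<eta> c(1)])
  have y0U: "fst y0 \<in> ?U" using c(2) by (simp add: y0_def bundle_dom)
  let ?D = "frechet_derivative g (at (fst y0))"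
  obtain dg where dg: "dg > 0" and stg: "\<And>q q'. q \<in> ball (fst y0) dg \<Longrightarrow> q' \<in> ball (fst y0) dg \<Longrightarrow>
     norm (g q' - g q - ?D (q' - q)) \<le> 1 * norm (q' - q)"
    using smooth_on_strict[OF model_frame Uopen y0U g_smooth zero_less_one] by blast
  obtain K where K: "\<And>v. norm (?D v) \<le> norm v * K"
    using bounded_linear.bounded[OF has_derivative_bounded_linear[OF smooth_onD[OF g_smooth y0U]]] by blast
  define V where "V = norm (vf c F (\<tau>0, y0)) + 1"
  \<comment> \<open>On \<open>N\<close> the field is bounded by \<open>V\<close>, and the
    coordinates of \<open>\<eta>\<close> obey the strictness estimate; a box inside \<open>N\<close>
    supplies the constants of \<open>flow_chart\<close>.\<close>
  define N where "N = (cdom c \<inter> vf c F -` ball 0 V) \<inter> UNIV \<times> (ball (fst y0) dg \<times> UNIV)"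
  have N: "open N" "(\<tau>0, y0) \<in> N"
  proof -
    have "open (cdom c \<inter> vf c F -` ball 0 V)"
      by (rule continuous_open_preimage[OF smooth_on_continuous[OF vf_smooth[OF F c(1)]] open_cdom[OF c(1)] open_ball])
    then show "open N" unfolding N_def by (intro open_Int[of "_ \<inter> _"] open_Times open_UNIV open_ball)
    show "(\<tau>0, y0) \<in> N" using cdom_point[OF c(2), of \<tau>0] dg by (cases y0) (simp add: N_def V_def y0_def)
  qed
  obtain \<delta> \<rho> C W where ctl: "controlled F (\<lambda>\<tau>. \<Phi> \<tau> z) c \<tau>0 \<delta> \<rho> C W" and WN: "ball \<tau>0 \<delta> \<times> W \<subseteq> N"
    using local_chart[OF F \<Phi>(1)[OF z] c N[unfolded y0_def]] by blast
  note ctlD = controlledD[OF ctl]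
  have Kg: "norm (\<eta> (chart_inv c (fst y)) c - \<eta> (chart_inv c (fst y')) c) \<le> (K + 1) * norm (fst y - fst y')"
    if "y \<in> W" "y' \<in> W" for y y'
  proof -
    have "(\<tau>0, y) \<in> N" "(\<tau>0, y') \<in> N" using WN ctlD(1) that by auto
    then have b: "fst y \<in> ball (fst y0) dg" "fst y' \<in> ball (fst y0) dg" by (auto simp: N_def)
    show ?thesis
      using stg[OF b(2,1)] K[of "fst y - fst y'"]
        norm_triangle_ineq2[of "g (fst y) - g (fst y')" "?D (fst y - fst y')"] by (simp add: g_def algebra_simps)
  qed
  have V: "norm (vf c F (\<tau>, y)) \<le> V" if "\<tau> \<in> ball \<tau>0 \<delta>" "y \<in> W" for \<tau> y
  proof -
    have "(\<tau>, y) \<in> N" using WN that by blast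
    then show ?thesis by (simp add: N_def)
  qed
  have "flow_good z c0 t" if s: "s \<in> ball \<tau>0 \<delta>" "s \<in> {0..1}" and t: "t \<in> ball \<tau>0 \<delta>" "t \<in> {0..1}"
    and good: "flow_good z c0 s" for s t
  proof -
    define ys where "ys = ?m (\<Phi> s z)"
    have cont_s: "flow_cont z s" and open_s: "flow_open z s" using good by (auto simp: flow_good_def)
    have sdom: "\<Phi> s z \<in> chart_dom (cb c)" by (rule ctlD(8)[OF s(1)])
    have tdom: "\<Phi> t z \<in> chart_dom (cb c)" by (rule ctlD(8)[OF t(1)])
    have cs: "c \<in> charts_at A (fst (\<Phi> s z))" and ct: "c \<in> charts_at A (fst (\<Phi> t z))"
      using sdom tdom c by (auto simp: charts_at_def bundle_dom)
    \<comment> \<open>Openness at time \<open>s\<close> means that all small displacements at that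
      time are realised by orbits that start near \<open>z\<close> at time 0. This is the source of
      the family \<open>x\<close>.\<close>
    have hit: "\<exists>e>0. \<forall>y\<in>ball ys e. \<exists>w\<in>U. \<Phi> s w \<in> chart_dom (cb c) \<and> ?m (\<Phi> s w) = y"
      if U: "openin Cot U" "z \<in> U" for U
    proof -
      obtain Vs where Vs: "openin Cot Vs" "\<Phi> s z \<in> Vs" "Vs \<subseteq> \<Phi> s ` U"
        using open_s U unfolding flow_open_def by blast
      have "open (?m ` (Vs \<inter> chart_dom (cb c)))"
        by (rule open_image_chart[OF topological_cotangent Vs(1) cb_atlas[OF c(1)]])
      moreover have "ys \<in> ?m ` (Vs \<inter> chart_dom (cb c))" unfolding ys_def using Vs(2) sdom by blast
      ultimately obtain e where "e > 0" "ball ys e \<subseteq> ?m ` (Vs \<inter> chart_dom (cb c))"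
        using open_contains_ball by blast
      then show ?thesis using Vs(3) by (intro exI[of _ e]) blast
    qed
    have "openin Cot M" using openin_topspace[of Cot] by (simp add: topspace_Cot)
    from hit[OF this z] obtain r0 where r0: "r0 > 0"
      "\<And>y. y \<in> ball ys r0 \<Longrightarrow> \<exists>w\<in>M. \<Phi> s w \<in> chart_dom (cb c) \<and> ?m (\<Phi> s w) = y" by blast
    define r where "r = min r0 \<rho>"
    have r: "0 < r" "r \<le> \<rho>" "r \<le> r0" using r0 ctlD(2) by (auto simp: r_def)
    have "\<exists>w. norm h < r \<longrightarrow> w \<in> M \<and> \<Phi> s w \<in> chart_dom (cb c) \<and> ?m (\<Phi> s w) = ys + h" for h
      using r0(2)[of "ys + h"] r(3) by (cases "norm h < r") (auto simp: dist_norm simp del: bundle_map)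
    then obtain x where x: "\<And>h. norm h < r \<Longrightarrow> x h \<in> M" "\<And>h. norm h < r \<Longrightarrow> \<Phi> s (x h) \<in> chart_dom (cb c)"
      "\<And>h. norm h < r \<Longrightarrow> ?m (\<Phi> s (x h)) = ys + h" by metis
    interpret fc: flow_chart A F K0 \<Phi> \<eta> potential z c \<tau>0 \<delta> \<rho> C W s t r x "K + 1" V
      by unfold_locales (use z c ctl s t r x Kg V in \<open>simp_all add: ys_def del: bundle_map\<close>)
    obtain B where lf: "local_flow B (\<lambda>\<tau> y. vf c F (\<tau>, y)) fc.X s t r C fc.L" using fc.flow by blast
    interpret l: local_flow B "\<lambda>\<tau> y. vf c F (\<tau>, y)" fc.X s t r C fc.L by (rule lf)
    obtain Y' where Y': "((\<lambda>h. fc.X h t) has_derivative Y') (at 0)" using l.flow_differentiable by blast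
    have xeq: "x (?m (\<Phi> s w) - ys) = w" if w: "w \<in> M" "\<Phi> s w \<in> chart_dom (cb c)" "norm (?m (\<Phi> s w) - ys) < r" for w
    proof -
      have "?m (\<Phi> s (x (?m (\<Phi> s w) - ys))) = ?m (\<Phi> s w)" using x(3)[OF w(3)] by (simp del: bundle_map)
      from inj_onD[OF cb_inj[OF c(1)] this x(2)[OF w(3)] w(2)] show ?thesis
        by (rule \<Phi>_inj[OF x(1)[OF w(3)] w(1)])
    qed
    have Xeq: "\<Phi> t w \<in> chart_dom (cb c)" "fc.X (?m (\<Phi> s w) - ys) t = ?m (\<Phi> t w)"
      if w: "w \<in> M" "\<Phi> s w \<in> chart_dom (cb c)" "norm (?m (\<Phi> s w) - ys) < r" for w
      using fc.X_chart(1)[OF w(3) t(1)] unfolding fc.X_def xeq[OF w] by simp_all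
    have near_s: "\<exists>U. openin Cot U \<and> z \<in> U \<and> (\<forall>w\<in>U. w \<in> M \<and> \<Phi> s w \<in> chart_dom (cb c) \<and> norm (?m (\<Phi> s w) - ys) < e)"
      if e: "e > 0" for e
    proof -
      have "openin Cot {w \<in> chart_dom (cb c). ?m w \<in> ball ys e}" by (rule cb_preimage_open[OF c(1) open_ball])
      moreover have "\<Phi> s z \<in> {w \<in> chart_dom (cb c). ?m w \<in> ball ys e}" using sdom e by (simp add: ys_def)
      ultimately obtain U where U: "openin Cot U" "z \<in> U" "\<Phi> s ` U \<subseteq> {w \<in> chart_dom (cb c). ?m w \<in> ball ys e}"
        using cont_s unfolding flow_cont_def by blast
      have "\<forall>w\<in>U. w \<in> M \<and> \<Phi> s w \<in> chart_dom (cb c) \<and> norm (?m (\<Phi> s w) - ys) < e"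
      proof
        fix w assume w: "w \<in> U"
        then have "\<Phi> s w \<in> {w \<in> chart_dom (cb c). ?m w \<in> ball ys e}" using U(3) by blast
        moreover have "w \<in> M" using openin_subset[OF U(1)] w by (auto simp: topspace_Cot)
        ultimately show "w \<in> M \<and> \<Phi> s w \<in> chart_dom (cb c) \<and> norm (?m (\<Phi> s w) - ys) < e"
          by (simp add: dist_norm norm_minus_commute del: bundle_map)
      qed
      with U show ?thesis by blast
    qed
    have X0t: "fc.X 0 t = ?m (\<Phi> t z)" by (rule fc.X0)
    have cont_t: "flow_cont z t"
      unfolding flow_cont_def
    proof (intro allI impI)
      fix V assume V: "openin Cot V \<and> \<Phi> t z \<in> V"
      have "open (?m ` (V \<inter> chart_dom (cb c)))"
        using V by (intro open_image_chart[OF topological_cotangent _ cb_atlas[OF c(1)]]) blast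
      moreover have "fc.X 0 t \<in> ?m ` (V \<inter> chart_dom (cb c))" unfolding X0t using V tdom by blast
      ultimately obtain e where e: "e > 0" "ball (fc.X 0 t) e \<subseteq> ?m ` (V \<inter> chart_dom (cb c))"
        using open_contains_ball by blast
      have "min r (e / 2) > 0" using r e by simp
      from near_s[OF this] obtain U where U: "openin Cot U" "z \<in> U"
        "\<And>w. w \<in> U \<Longrightarrow> w \<in> M \<and> \<Phi> s w \<in> chart_dom (cb c) \<and> norm (?m (\<Phi> s w) - ys) < min r (e / 2)" by blast
      have "\<Phi> t w \<in> V" if w: "w \<in> U" for w
      proof -
        have w1: "w \<in> M" "\<Phi> s w \<in> chart_dom (cb c)" "norm (?m (\<Phi> s w) - ys) < r"
          and w2: "norm (?m (\<Phi> s w) - ys) < e / 2" using U(3)[OF w] by auto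
        have "norm (fc.X (?m (\<Phi> s w) - ys) t - fc.X 0 t) \<le> 2 * norm (?m (\<Phi> s w) - ys - 0)"
          using w1(3) r by (intro l.near) auto
        then have "norm (?m (\<Phi> t w) - fc.X 0 t) < e" using w2 unfolding Xeq(2)[OF w1] by (simp del: bundle_map)
        then have "?m (\<Phi> t w) \<in> ball (fc.X 0 t) e" by (simp add: dist_norm norm_minus_commute del: bundle_map)
        then obtain v where v: "v \<in> V" "v \<in> chart_dom (cb c)" "?m (\<Phi> t w) = ?m v" using e(2) by blast
        from inj_onD[OF cb_inj[OF c(1)] v(3) Xeq(1)[OF w1] v(2)] show ?thesis using v(1) by simp
      qed
      with U show "\<exists>U. openin Cot U \<and> z \<in> U \<and> \<Phi> t ` U \<subseteq> V" by blast
    qed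
    have open_t: "flow_open z t"
      unfolding flow_open_def
    proof (intro allI impI)
      fix U assume U: "openin Cot U \<and> z \<in> U"
      from hit[OF conjunct1[OF U] conjunct2[OF U]] obtain e where e: "e > 0" "\<And>y. y \<in> ball ys e \<Longrightarrow> \<exists>w\<in>U. \<Phi> s w \<in> chart_dom (cb c) \<and> ?m (\<Phi> s w) = y"
        by blast
      define q where "q = min e r / 2"
      have q: "0 < q" "q < r" "q < e" using e r by (auto simp: q_def)
      let ?V = "{w \<in> chart_dom (cb c). ?m w \<in> ball (fc.X 0 t) (q / 2)}"
      have "openin Cot ?V" by (rule cb_preimage_open[OF c(1) open_ball])
      moreover have "\<Phi> t z \<in> ?V" using tdom q by (simp add: X0t)
      moreover have "w \<in> \<Phi> t ` U" if w: "w \<in> ?V" for w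
      proof -
        have "norm (?m w - fc.X 0 t) \<le> q / 2" using w by (simp add: dist_norm norm_minus_commute del: bundle_map)
        from l.flow_onto[OF q(1,2) this] obtain h where h: "norm h \<le> q" "fc.X h t = ?m w" by blast
        have hr: "norm h < r" using h q by simp
        have "ys + h \<in> ball ys e" using h q by (simp add: dist_norm)
        from e(2)[OF this] obtain u where u: "u \<in> U" "\<Phi> s u \<in> chart_dom (cb c)" "?m (\<Phi> s u) = ys + h" by blast
        have uM: "u \<in> M" using u(1) U openin_subset[of Cot U] by (auto simp: topspace_Cot)
        have hh: "?m (\<Phi> s u) - ys = h" using u(3) by simp
        have "u = x h" using xeq[OF uM u(2)] hr unfolding hh by simp
        then have "?m (\<Phi> t u) = ?m w" using h(2) unfolding fc.X_def by simp
        moreover have "\<Phi> t u \<in> chart_dom (cb c)" using fc.X_chart(1)[OF hr t(1)] \<open>u = x h\<close> by simp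
        ultimately have "\<Phi> t u = w" using inj_onD[OF cb_inj[OF c(1)]] w by blast
        then show ?thesis using u(1) by blast
      qed
      ultimately show "\<exists>V. openin Cot V \<and> \<Phi> t z \<in> V \<and> V \<subseteq> \<Phi> t ` U" by blast
    qed
    let ?inv = "chart_inv (cb c0)" and ?p = "chart_map (cb c0) z"
    have inv_p: "?inv ?p = z" by (rule cb_inv_map[OF c0A zc0])
    have "flow_derivative z c0 c s" using good cs by (auto simp: flow_good_def)
    then obtain Y where Y: "((\<lambda>y. ?m (\<Phi> s (?inv y))) has_derivative Y) (at ?p)"
      and sY: "\<And>u v. symplectic_form (Y u) (Y v) = symplectic_form u v"
      and S: "((\<lambda>y. potential (?inv y) s) has_derivative (\<lambda>u. liouville \<eta> c (\<Phi> s z) (Y u) - liouville \<eta> c0 z u)) (at ?p)"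
      unfolding flow_derivative_def by blast
    define f where "f y = ?m (\<Phi> s (?inv y)) - ys" for y
    have f: "(f has_derivative Y) (at ?p)"
      unfolding f_def using has_derivative_diff[OF Y has_derivative_const[of ys]] by simp
    have fp: "f ?p = 0" by (simp add: f_def inv_p ys_def del: bundle_map)
    obtain U where U: "openin Cot U" "z \<in> U"
      "\<And>w. w \<in> U \<Longrightarrow> w \<in> M \<and> \<Phi> s w \<in> chart_dom (cb c) \<and> norm (?m (\<Phi> s w) - ys) < r"
      using near_s[OF r(1)] by blast
    let ?S = "chart_map (cb c0) ` (U \<inter> chart_dom (cb c0))"
    have oS: "open ?S" by (rule open_image_chart[OF topological_cotangent U(1) cb_atlas[OF c0A]])
    have pS: "?p \<in> ?S" using U(2) zc0 by blast
    have inU: "?inv y \<in> U" if y: "y \<in> ?S" for y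
    proof -
      obtain w where "w \<in> U" "w \<in> chart_dom (cb c0)" "y = chart_map (cb c0) w" using y by blast
      then show ?thesis using cb_inv_map[OF c0A] by (simp del: bundle_map)
    qed
    have "((\<lambda>y. fc.X (f y) t) has_derivative (\<lambda>u. Y' (Y u))) (at ?p)"
      by (rule has_derivative_compose[OF f]) (simp only: fp Y')
    from this oS pS
    have d1: "((\<lambda>y. ?m (\<Phi> t (?inv y))) has_derivative (\<lambda>u. Y' (Y u))) (at ?p)"
    proof (rule has_derivative_transform_within_open)
      fix y assume "y \<in> ?S"
      from U(3)[OF inU[OF this]] show "fc.X (f y) t = ?m (\<Phi> t (?inv y))"
        unfolding f_def using Xeq(2)[of "?inv y"] by blast
    qed
    \<comment> \<open>The action from \<open>s\<close> to \<open>t\<close> is differentiated by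
      \<open>flow_action\<close> and added to the action up to \<open>s\<close>; the two values of
      \<open>\<theta>\<close> at time \<open>s\<close> cancel.\<close>
    have "((\<lambda>y. potential (x (f y)) t - potential (x (f y)) s) has_derivative
       (\<lambda>u. liouville \<eta> c (\<Phi> t z) (Y' (Y u)) - liouville \<eta> c (\<Phi> s z) (Y u))) (at ?p)"
      by (rule has_derivative_compose[OF f]) (simp only: fp fc.flow_action[OF Y'])
    from has_derivative_add[OF S this]
    have "((\<lambda>y. potential (?inv y) s + (potential (x (f y)) t - potential (x (f y)) s)) has_derivative
       (\<lambda>u. liouville \<eta> c (\<Phi> t z) (Y' (Y u)) - liouville \<eta> c0 z u)) (at ?p)" by simp
    from this oS pS
    have d2: "((\<lambda>y. potential (?inv y) t) has_derivative (\<lambda>u. liouville \<eta> c (\<Phi> t z) (Y' (Y u)) - liouville \<eta> c0 z u)) (at ?p)"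
    proof (rule has_derivative_transform_within_open)
      fix y assume "y \<in> ?S"
      from U(3)[OF inU[OF this]] have "x (f y) = ?inv y"
        unfolding f_def using xeq[of "?inv y"] by blast
      then show "potential (?inv y) s + (potential (x (f y)) t - potential (x (f y)) s) = potential (?inv y) t" by simp
    qed
    have "flow_derivative z c0 c t"
      unfolding flow_derivative_def using d1 d2 sY fc.flow_symplectic[OF Y']
      by (intro exI[of _ "\<lambda>u. Y' (Y u)"]) simp
    then show ?thesis
      unfolding flow_good_def using cont_t open_t flow_derivative_change[OF z c0 cont_t ct] by blast
  qed
  then show ?thesis using ctlD(1) by (intro exI[of _ \<delta>]) blast
qed

lemma flow_good:
  assumes z: "z \<in> M" and c: "c \<in> charts_at A (fst z)" and t: "t \<in> {0..1}"
  shows "flow_good z c t"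
proof (rule connected_induction_simple[of "{0..1}" 0 t])
  show "connected {0..1::real}" by simp
  show "flow_good z c 0" by (rule flow_good_zero[OF z c])
  fix a :: real assume a: "a \<in> {0..1}"
  obtain \<delta> where \<delta>: "\<delta> > 0" "\<And>s t. s \<in> ball a \<delta> \<inter> {0..1} \<Longrightarrow> t \<in> ball a \<delta> \<inter> {0..1} \<Longrightarrow> flow_good z c s \<Longrightarrow> flow_good z c t"
    using flow_good_step[OF z c, of a] by blast
  have "openin (top_of_set {0..1}) (ball a \<delta> \<inter> {0..1})"
    unfolding Int_commute[of "ball a \<delta>"] by (intro openin_open_Int open_ball)
  then show "\<exists>T. openin (top_of_set {0..1}) T \<and> a \<in> T \<and> (\<forall>x\<in>T. \<forall>y\<in>T. flow_good z c x \<longrightarrow> flow_good z c y)"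
  proof (intro exI[of _ "ball a \<delta> \<inter> {0..1}"] conjI ballI impI)
    show "a \<in> ball a \<delta> \<inter> {0..1}" using a \<delta>(1) by simp
    show "flow_good z c y" if "x \<in> ball a \<delta> \<inter> {0..1}" "y \<in> ball a \<delta> \<inter> {0..1}" "flow_good z c x" for x y
      by (rule \<delta>(2)[OF that])
  qed
qed (use t in auto)

lemma flow_continuous:
  assumes "t \<in> {0..1}"
  shows "continuous_map Cot Cot (\<Phi> t)"
  unfolding continuous_map_eq_topcontinuous_at topcontinuous_at_def topspace_Cot
proof (intro ballI conjI allI impI)
  fix z assume z: "z \<in> M"
  show "z \<in> M" by fact
  show "\<Phi> t \<in> M \<rightarrow> M" using \<Phi>_points by blast
  fix V assume V: "openin Cot V \<and> \<Phi> t z \<in> V"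
  obtain c where "c \<in> charts_at A (fst z)" using point_charts_at[OF z] by blast
  from flow_good[OF z this assms] V obtain U where "openin Cot U" "z \<in> U" "\<Phi> t ` U \<subseteq> V"
    unfolding flow_good_def flow_cont_def by blast
  then show "\<exists>U. openin Cot U \<and> z \<in> U \<and> (\<forall>y\<in>U. \<Phi> t y \<in> V)" by blast
qed

lemma flow_open_map:
  assumes "t \<in> {0..1}"
  shows "open_map Cot Cot (\<Phi> t)"
  unfolding open_map_def
proof (intro allI impI)
  fix U assume U: "openin Cot U"
  show "openin Cot (\<Phi> t ` U)"
  proof (subst openin_subopen, rule ballI)
    fix w assume "w \<in> \<Phi> t ` U"
    then obtain z where z: "z \<in> U" "w = \<Phi> t z" by blast
    have zM: "z \<in> M" using openin_Cot_subset[OF U] z by blast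
    obtain c where "c \<in> charts_at A (fst z)" using point_charts_at[OF zM] by blast
    from flow_good[OF zM this assms] U z show "\<exists>T. openin Cot T \<and> w \<in> T \<and> T \<subseteq> \<Phi> t ` U"
      unfolding flow_good_def flow_open_def by blast
  qed
qed

section \<open>The isotopy outside the support, and its surjectivity\<close>

lemma complement_open: "openin Cot (M - K0)"
  using compactin_imp_closedin[OF Hausdorff_Cot K0(1)] by (simp add: closedin_def topspace_Cot)

lemma vf_outside:
  assumes z: "z \<in> M" "z \<notin> K0" and c: "c \<in> A" "z \<in> chart_dom (cb c)"
  shows "vf c F (t, chart_map (cb c) z) = 0"
proof -
  let ?S = "chart_map (cb c) ` ((M - K0) \<inter> chart_dom (cb c))"
  have oS: "open ?S" by (rule open_image_chart[OF topological_cotangent complement_open cb_atlas[OF c(1)]])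
  have zS: "chart_map (cb c) z \<in> ?S" using z c by blast
  have "0 = ham c F (t, y)" if y: "y \<in> ?S" for y
  proof -
    obtain w where "w \<in> M" "w \<notin> K0" "w \<in> chart_dom (cb c)" "y = chart_map (cb c) w" using y by blast
    then show ?thesis using cb_inv_map[OF c(1), of w] K0(2)[of w] by (simp add: ham_def del: bundle_map)
  qed
  from has_derivative_transform_within_open[OF has_derivative_const oS zS this]
  have "((\<lambda>y. ham c F (t, y)) has_derivative (\<lambda>u. 0)) (at (chart_map (cb c) z))" .
  from has_derivative_unique[OF has_derivative_slice[OF ham_derivative[OF F c(1) cdom_point[OF c(2)]]] this]
  show ?thesis by (simp add: vf_def sgrad_def flip: zero_prod_def)
qed

lemma flow_fixed:
  assumes z: "z \<in> M" "z \<notin> K0"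
  shows "\<Phi> t z = z"
proof -
  have "orbit F (\<lambda>_. z)"
  proof (rule orbitI[OF F])
    show "continuous_map euclideanreal Cot (\<lambda>_. z)" using z by (simp add: topspace_Cot)
    show "((\<lambda>s. chart_map (cb c) z) has_vector_derivative vf c F (t, chart_map (cb c) z)) (at t)"
      if "c \<in> A" "z \<in> chart_dom (cb c)" for t c
      by (simp only: has_vector_derivative_const vf_outside[OF z that])
  qed
  from orbit_unique[OF F \<Phi>(1)[OF z(1)] this, of 0 t] show ?thesis using \<Phi>(2)[OF z(1)] by simp
qed

lemma action_outside:
  assumes z: "z \<in> M" "z \<notin> K0"
  shows "potential z 1 = 0"
proof -
  obtain c where c: "c \<in> charts_at A (fst z)" using point_charts_at[OF z(1)] by blast
  have cA: "c \<in> A" using c by (simp add: charts_at_def)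
  have "liouville_vf \<eta> F t (\<Phi> t z) - F t (\<Phi> t z) = 0" for t
    unfolding flow_fixed[OF z] K0(2)[OF z] liouville_vf_eq[OF F z(1) \<eta> c] vf_outside[OF z cA charts_at_cb[OF c z(1)]]
    by (simp add: liouville_def)
  then have "(potential z has_vector_derivative 0) (at t within {0..1})" if "t \<in> {0..1}" for t
    using potential(1)[OF z(1) that] by simp
  then obtain k where "\<And>t. t \<in> {0..1} \<Longrightarrow> potential z t = k"
    using has_vector_derivative_zero_constant[of "{0..1}" "potential z"] by auto
  from this[of 0] this[of 1] show ?thesis using potential(2)[OF z(1)] by simp
qed

text \<open>Openness of the image comes from \<open>flow_open_map\<close>. For closedness the image
  is split into the compact image of \<open>K0\<close> and the closure of the rest, on which the map
  is the identity.\<close>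

lemma flow_surjective:
  assumes t: "t \<in> {0..1}"
  shows "\<Phi> t ` M = M"
proof -
  have Mtop: "topspace Cot = M" by (rule topspace_Cot)
  have sub: "\<Phi> t ` M \<subseteq> M" using \<Phi>_points by blast
  have K0M: "K0 \<subseteq> M" using K0(1) compactin_subset_topspace Mtop by blast
  have "openin Cot (\<Phi> t ` M)" using flow_open_map[OF t] openin_topspace[of Cot] unfolding open_map_def Mtop by blast
  moreover have "closedin Cot (\<Phi> t ` M)"
  proof -
    \<comment> \<open>\<open>M - K0\<close> is open and in general not closed; its closure is still
      fixed pointwise, by continuity and the Hausdorff property.\<close>
    have fixed: "\<Phi> t z = z" if z: "z \<in> Cot closure_of (M - K0)" for z
    proof (rule ccontr)
      assume ne: "\<Phi> t z \<noteq> z"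
      have zM: "z \<in> M" using z by (simp add: in_closure_of Mtop)
      from ne obtain U V where UV: "openin Cot U" "openin Cot V" "\<Phi> t z \<in> U" "z \<in> V" "disjnt U V"
        using Hausdorff_Cot[unfolded Hausdorff_space_def Mtop, rule_format, of "\<Phi> t z" z] zM \<Phi>_points[OF zM] by blast
      have "openin Cot (V \<inter> {w \<in> topspace Cot. \<Phi> t w \<in> U})"
        using UV openin_continuous_map_preimage[OF flow_continuous[OF t]] by blast
      moreover have "z \<in> V \<inter> {w \<in> topspace Cot. \<Phi> t w \<in> U}" using UV zM by (simp add: Mtop)
      ultimately have "\<exists>y. y \<in> M - K0 \<and> y \<in> V \<inter> {w \<in> topspace Cot. \<Phi> t w \<in> U}"
        by (intro z[unfolded in_closure_of, THEN conjunct2, THEN spec, THEN mp] conjI)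
      then obtain w where "w \<in> M - K0" "w \<in> V" "\<Phi> t w \<in> U" by blast
      moreover have "\<Phi> t w = w" using \<open>w \<in> M - K0\<close> by (intro flow_fixed) blast+
      ultimately have "w \<in> U \<inter> V" by simp
      then show False using UV(5) by (simp only: disjnt_def empty_iff)
    qed
    have "\<Phi> t ` M = \<Phi> t ` K0 \<union> Cot closure_of (M - K0)"
    proof (intro equalityI subsetI)
      fix w assume "w \<in> \<Phi> t ` M"
      then obtain z where z: "z \<in> M" "w = \<Phi> t z" by blast
      show "w \<in> \<Phi> t ` K0 \<union> Cot closure_of (M - K0)"
      proof (cases "z \<in> K0")
        case False
        have "M - K0 \<subseteq> Cot closure_of (M - K0)" by (rule closure_of_subset) (auto simp: Mtop)
        then show ?thesis using z False flow_fixed[OF z(1) False] by auto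
      qed (use z in blast)
    next
      fix w assume w: "w \<in> \<Phi> t ` K0 \<union> Cot closure_of (M - K0)"
      show "w \<in> \<Phi> t ` M"
      proof (cases "w \<in> \<Phi> t ` K0")
        case False
        then have "w \<in> Cot closure_of (M - K0)" using w by blast
        then have "\<Phi> t w = w" "w \<in> M" using fixed by (auto simp: in_closure_of Mtop)
        then show ?thesis by (intro image_eqI[of w "\<Phi> t" w]) simp_all
      qed (use K0M in blast)
    qed
    moreover have "closedin Cot (\<Phi> t ` K0)"
      by (rule compactin_imp_closedin[OF Hausdorff_Cot image_compactin[OF K0(1) flow_continuous[OF t]]])
    ultimately show ?thesis by (simp add: closedin_Un)
  qed
  moreover have "\<Phi> t ` M \<noteq> {}"
    using nonempty_A cotangent_inhabited by blast
  ultimately show ?thesis using connected_Cot unfolding connected_space_clopen_in Mtop by blast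
qed

end

section \<open>The Legendre transformation\<close>

text \<open>
  A point at which \<open>G a\<close> is larger than on a sphere around it keeps this property for nearby \<open>a\<close>;
  by strict concavity the maximum is then inside the sphere.
\<close>

lemma maximizer_continuous:
  fixes G :: "'a::metric_space \<times> 'v::real_inner \<Rightarrow> real" and B :: "'v set"
  assumes B: "frame B" and S: "open S" and G: "continuous_on (S \<times> UNIV) G"
    and conc: "\<And>a p p' u. a \<in> S \<Longrightarrow> p \<noteq> p' \<Longrightarrow> 0 < u \<Longrightarrow> u < 1 \<Longrightarrow>
      (1 - u) * G (a, p) + u * G (a, p') < G (a, (1 - u) *\<^sub>R p + u *\<^sub>R p')"
    and max: "\<And>a p. a \<in> S \<Longrightarrow> G (a, p) \<le> G (a, m a)"
  shows "continuous_on S m"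
proof (rule continuous_at_imp_continuous_on, rule ballI)
  fix a assume a: "a \<in> S"
  have strict: "G (a, p) < G (a, m a)" if "p \<noteq> m a" for p
  proof -
    have "(1/2) * G (a, p) + (1/2) * G (a, m a) < G (a, (1 - 1/2) *\<^sub>R p + (1/2) *\<^sub>R m a)"
      using conc[OF a that, of "1/2"] by simp
    also have "\<dots> \<le> G (a, m a)" by (rule max[OF a])
    finally show ?thesis by simp
  qed
  show "isCont m a"
    unfolding isCont_def tendsto_iff
  proof (intro allI impI)
    fix e :: real assume e: "e > 0"
    let ?K = "sphere (m a) e"
    define W where "W = {x \<in> S \<times> (UNIV :: 'v set). G x - G (fst x, m a) \<in> {..<0}}"
    have cont: "continuous_on (S \<times> UNIV) (\<lambda>x. G x - G (fst x, m a))"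
      by (intro continuous_intros G continuous_on_compose2[OF G]) auto
    have oW: "open W"
      using continuous_open_preimage[OF cont open_Times[OF S open_UNIV] open_lessThan, of 0]
      by (simp add: W_def vimage_def Int_def)
    have K: "compact ?K"
    proof (rule frame_compact[OF B])
      have "?K = cball (m a) e - ball (m a) e" by auto
      then show "closed ?K" by (simp add: closed_Diff)
      show "bounded ?K" by (rule bounded_subset[OF bounded_cball sphere_cball])
    qed
    have "{a} \<times> ?K \<subseteq> W" using strict a e by (auto simp: W_def)
    from Elementary_Topology.tube_lemma[OF K oW this] obtain X0 where X0: "a \<in> X0" "open X0" "X0 \<times> ?K \<subseteq> W" by blast
    have "dist (m b) (m a) < e" if b: "b \<in> X0 \<inter> S" for b
    proof (rule ccontr)
      assume "\<not> dist (m b) (m a) < e"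
      then have far: "norm (m b - m a) \<ge> e" by (simp add: dist_norm)
      \<comment> \<open>Places \<open>p\<close> at distance \<open>e\<close> from \<open>m a\<close>
        on the segment to \<open>m b\<close>. There \<open>G (b, p)\<close> is below
        \<open>G (b, m a)\<close>, which concavity and the maximum at \<open>m b\<close>
        forbid.\<close>
      define u where "u = e / norm (m b - m a)"
      have "norm (m b - m a) > 0" using e far by linarith
      then have u: "0 < u" "u \<le> 1" using e far by (simp_all add: u_def divide_le_eq del: zero_less_norm_iff)
      define p where "p = (1 - u) *\<^sub>R m a + u *\<^sub>R m b"
      have "m a - p = - (u *\<^sub>R (m b - m a))" by (simp add: p_def algebra_simps)
      moreover have "m b \<noteq> m a" using e far by auto
      ultimately have "dist (m a) p = e" using e by (simp add: dist_norm u_def)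
      then have "(b, p) \<in> W" using X0(3) b by auto
      then have lt: "G (b, p) < G (b, m a)" by (simp add: W_def)
      have "m a \<noteq> m b" using e far by auto
      have "G (b, m a) \<le> G (b, p)"
      proof (cases "u = 1")
        case True
        then have "p = m b" by (simp add: p_def)
        then show ?thesis using max[of b "m a"] b by simp
      next
        case False
        then have "(1 - u) * G (b, m a) + u * G (b, m b) < G (b, p)"
          using conc[of b "m a" "m b" u] b u \<open>m a \<noteq> m b\<close> by (simp add: p_def)
        moreover have "u * G (b, m a) \<le> u * G (b, m b)" using max[of b "m a"] b u by (intro mult_left_mono) auto
        ultimately show ?thesis by (simp add: algebra_simps)
      qed
      with lt show False by simp
    qed
    then show "\<forall>\<^sub>F x in at a. dist (m x) (m a) < e"
      using X0 S a by (intro eventually_at_topological[THEN iffD2] exI[of _ "X0 \<inter> S"]) auto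
  qed
qed

text \<open>With the slope \<open>norm v + 1\<close>, the function is at most
  \<open>- norm p\<close> outside a ball; a radius of at least \<open>\<bar>k 0\<bar>\<close> brings
  this below the value at 0, so the maximum over the ball is global.\<close>

lemma superlinear_maximum_exists:
  fixes k :: "'v::real_inner \<Rightarrow> real" and B :: "'v set"
  assumes B: "frame B" and k: "continuous_on UNIV k"
    and sup: "\<And>K. \<exists>R. \<forall>p. norm p \<ge> R \<longrightarrow> k p \<ge> K * norm p"
  shows "\<exists>p. \<forall>p'. p' \<bullet> v - k p' \<le> p \<bullet> v - k p"
proof -
  obtain R where R: "\<And>p. norm p \<ge> R \<Longrightarrow> k p \<ge> (norm v + 1) * norm p" using sup by blast
  define r where "r = max R \<bar>k 0\<bar>"
  have "compact (cball (0::'v) r)" by (rule frame_compact[OF B]) auto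
  moreover have "(0::'v) \<in> cball 0 r" by (simp add: r_def)
  moreover have "continuous_on (cball 0 r) (\<lambda>p. p \<bullet> v - k p)"
    by (intro continuous_intros continuous_on_subset[OF k]) auto
  ultimately obtain p where p: "p \<in> cball 0 r" "\<And>p'. p' \<in> cball 0 r \<Longrightarrow> p' \<bullet> v - k p' \<le> p \<bullet> v - k p"
    using continuous_attains_sup[of "cball 0 r" "\<lambda>p. p \<bullet> v - k p"] by (metis empty_iff)
  have "p' \<bullet> v - k p' \<le> p \<bullet> v - k p" for p'
  proof (cases "p' \<in> cball 0 r")
    case False
    then have n: "norm p' \<ge> R" "norm p' \<ge> \<bar>k 0\<bar>" by (auto simp: r_def)
    have "p' \<bullet> v \<le> norm p' * norm v" by (rule norm_cauchy_schwarz)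
    then have "p' \<bullet> v - k p' \<le> - norm p'" using R[OF n(1)] by (simp add: algebra_simps)
    also have "\<dots> \<le> 0 \<bullet> v - k 0" using n(2) by simp
    also have "\<dots> \<le> p \<bullet> v - k p" using p(2)[of 0] \<open>(0::'v) \<in> cball 0 r\<close> by blast
    finally show ?thesis .
  qed (use p in blast)
  then show ?thesis by blast
qed

lemma convex_gradient_le:
  fixes k :: "'v::real_inner \<Rightarrow> real"
  assumes conv: "\<And>u. 0 < u \<Longrightarrow> u < 1 \<Longrightarrow> k ((1 - u) *\<^sub>R p + u *\<^sub>R p') \<le> (1 - u) * k p + u * k p'"
    and D: "(k has_derivative (\<lambda>w. g \<bullet> w)) (at p)"
  shows "k p + g \<bullet> (p' - p) \<le> k p'"
proof -
  have "((\<lambda>u. k (p + u *\<^sub>R (p' - p))) has_derivative (\<lambda>u. g \<bullet> (u *\<^sub>R (p' - p)))) (at 0)"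
    by (rule has_derivative_compose[where g = k and f = "\<lambda>u. p + u *\<^sub>R (p' - p)"])
      (auto intro!: derivative_eq_intros simp: D)
  then have "((\<lambda>u. k (p + u *\<^sub>R (p' - p))) has_real_derivative (g \<bullet> (p' - p))) (at 0)"
    by (simp add: has_field_derivative_def mult_commute_abs)
  then have "((\<lambda>u. (k (p + u *\<^sub>R (p' - p)) - k p) / u) \<longlongrightarrow> g \<bullet> (p' - p)) (at_right 0)"
    by (auto simp: has_field_derivative_iff intro: filterlim_mono at_le)
  moreover have "\<forall>\<^sub>F u in at_right 0. (k (p + u *\<^sub>R (p' - p)) - k p) / u \<le> k p' - k p"
    unfolding eventually_at_right_field
  proof (intro exI[of _ 1] conjI allI impI)
    fix u :: real assume u: "u > 0" "u < 1"
    have "p + u *\<^sub>R (p' - p) = (1 - u) *\<^sub>R p + u *\<^sub>R p'" by (simp add: algebra_simps)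
    then have "k (p + u *\<^sub>R (p' - p)) - k p \<le> u * (k p' - k p)" using conv[OF u] by (simp add: algebra_simps)
    then show "(k (p + u *\<^sub>R (p' - p)) - k p) / u \<le> k p' - k p" using u by (simp add: field_simps)
  qed simp
  ultimately have "g \<bullet> (p' - p) \<le> k p' - k p"
    by (intro tendsto_upperbound) auto
  then show ?thesis by simp
qed

locale tonelli_hamiltonian = closed_manifold A
  for A :: "('m, 'e::real_inner) atlas" +
  fixes H :: "('m, 'e) hamiltonian"
  assumes tonelli: "tonelli A H"
begin

lemma H: "smooth_ham H"
  and convex_H: "fiberwise_strictly_convex A H"
  and superlinear_H: "fiberwise_superlinear A H"
  and complete_H: "complete_flow A H"
  using tonelli by (auto simp: tonelli_def)

lemma ham_eq:
  assumes "c \<in> charts_at A q"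
  shows "ham c H (t, chart_map c q, \<xi>) = H t (q, cotangent_of q c \<xi>)"
proof -
  have c: "c \<in> A" "q \<in> chart_dom c" using assms by (auto simp: charts_at_def)
  then show ?thesis using cb_inv[OF c(1), of "chart_map c q" \<xi>] inv_map[OF c] by (simp add: ham_def)
qed

lemma ham_convex:
  assumes c: "c \<in> charts_at A q" and u: "0 < u" "u < 1" and ne: "\<xi> \<noteq> \<xi>'"
  shows "ham c H (t, chart_map c q, (1 - u) *\<^sub>R \<xi> + u *\<^sub>R \<xi>') <
    (1 - u) * ham c H (t, chart_map c q, \<xi>) + u * ham c H (t, chart_map c q, \<xi>')"
proof -
  have q: "q \<in> points A" using c by (auto simp: charts_at_def points_def)
  have "cotangent_of q c \<xi> \<noteq> cotangent_of q c \<xi>'" using ne cotangent_of(2)[OF c] by metis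
  moreover have "cotangent_of q c ((1 - u) *\<^sub>R \<xi> + u *\<^sub>R \<xi>') =
      (\<lambda>d. (1 - u) *\<^sub>R cotangent_of q c \<xi> d + u *\<^sub>R cotangent_of q c \<xi>' d)"
    by (auto simp: cotangent_of_def fun_eq_iff inner_add_left scaleR_add_left sum.distrib scaleR_sum_right)
  ultimately show ?thesis
    unfolding ham_eq[OF c]
    using convex_H[unfolded fiberwise_strictly_convex_def, rule_format, OF q cotangent_of(1)[OF c] cotangent_of(1)[OF c]] u
    by simp
qed

lemma ham_superlinear:
  assumes c: "c \<in> charts_at A q"
  shows "\<exists>R. \<forall>\<xi>. norm \<xi> \<ge> R \<longrightarrow> ham c H (t, chart_map c q, \<xi>) \<ge> K * norm \<xi>"
proof -
  have q: "q \<in> points A" using c by (auto simp: charts_at_def points_def)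
  from superlinear_H[unfolded fiberwise_superlinear_def, rule_format, OF q c, of K t]
  obtain R where "\<forall>p\<in>cotangent_space A q. norm (p c) \<ge> R \<longrightarrow> H t (q, p) \<ge> K * norm (p c)" by blast
  then show ?thesis unfolding ham_eq[OF c] using cotangent_of[OF c] by (intro exI[of _ R]) metis
qed

section \<open>The fibre derivative and its inverse\<close>

definition fibre_velocity :: "('m, 'e) chart \<Rightarrow> real \<times> 'e \<times> 'e \<Rightarrow> 'e" where
  "fibre_velocity c x = fst (vf c H x)"

lemma ham_fibre_derivative:
  assumes c: "c \<in> charts_at A q"
  shows "((\<lambda>\<xi>. ham c H (t, chart_map c q, \<xi>)) has_derivative (\<lambda>w. fibre_velocity c (t, chart_map c q, \<xi>) \<bullet> w)) (at \<xi>)"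
proof -
  have cA: "c \<in> A" and x: "(t, chart_map c q, \<xi>) \<in> cdom c" using c by (auto simp: charts_at_def cdom_iff)
  have "((\<lambda>\<xi>. ham c H (t, chart_map c q, \<xi>)) has_derivative (\<lambda>w. frechet_derivative (ham c H) (at (t, chart_map c q, \<xi>)) (0, 0, w))) (at \<xi>)"
    by (rule has_derivative_compose[where f = "\<lambda>\<xi>. (t, chart_map c q, \<xi>)"])
      (auto intro!: derivative_eq_intros ham_derivative[OF H cA x])
  then show ?thesis by (simp add: fibre_velocity_def vf_fst[OF H cA x])
qed

text \<open>For a concave function critical points and maxima coincide: convexity of
  \<open>H\<close> gives the tangent inequality, and at a maximum the derivative vanishes.\<close>

lemma fibre_velocity_iff_max:
  assumes c: "c \<in> charts_at A q"
  shows "fibre_velocity c (t, chart_map c q, \<xi>) = v \<longleftrightarrow>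
    (\<forall>\<xi>'. \<xi>' \<bullet> v - ham c H (t, chart_map c q, \<xi>') \<le> \<xi> \<bullet> v - ham c H (t, chart_map c q, \<xi>))"
proof
  assume v: "fibre_velocity c (t, chart_map c q, \<xi>) = v"
  show "\<forall>\<xi>'. \<xi>' \<bullet> v - ham c H (t, chart_map c q, \<xi>') \<le> \<xi> \<bullet> v - ham c H (t, chart_map c q, \<xi>)"
  proof
    fix \<xi>'
    have "ham c H (t, chart_map c q, \<xi>) + v \<bullet> (\<xi>' - \<xi>) \<le> ham c H (t, chart_map c q, \<xi>')"
    proof (rule convex_gradient_le)
      show "((\<lambda>\<xi>. ham c H (t, chart_map c q, \<xi>)) has_derivative (\<lambda>w. v \<bullet> w)) (at \<xi>)"
        using ham_fibre_derivative[OF c] v by metis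
      show "ham c H (t, chart_map c q, (1 - u) *\<^sub>R \<xi> + u *\<^sub>R \<xi>')
        \<le> (1 - u) * ham c H (t, chart_map c q, \<xi>) + u * ham c H (t, chart_map c q, \<xi>')" if "0 < u" "u < 1" for u
      proof (cases "\<xi> = \<xi>'")
        case True
        then show ?thesis by (simp add: algebra_simps flip: scaleR_add_left)
      qed (use ham_convex[OF c that] in \<open>simp add: less_imp_le\<close>)
    qed
    then show "\<xi>' \<bullet> v - ham c H (t, chart_map c q, \<xi>') \<le> \<xi> \<bullet> v - ham c H (t, chart_map c q, \<xi>)"
      by (simp add: inner_diff_right inner_commute)
  qed
next
  assume m: "\<forall>\<xi>'. \<xi>' \<bullet> v - ham c H (t, chart_map c q, \<xi>') \<le> \<xi> \<bullet> v - ham c H (t, chart_map c q, \<xi>)"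
  have "((\<lambda>\<xi>. \<xi> \<bullet> v - ham c H (t, chart_map c q, \<xi>)) has_derivative (\<lambda>w. w \<bullet> v - fibre_velocity c (t, chart_map c q, \<xi>) \<bullet> w)) (at \<xi>)"
    by (intro has_derivative_diff ham_fibre_derivative[OF c] bounded_linear.has_derivative[OF bounded_linear_inner_left] has_derivative_ident)
  from differential_zero_maxmin[OF UNIV_I open_UNIV this] m
  have eq: "(\<lambda>w. w \<bullet> v - fibre_velocity c (t, chart_map c q, \<xi>) \<bullet> w) = (\<lambda>v. 0)" by blast
  have "fibre_velocity c (t, chart_map c q, \<xi>) \<bullet> w = v \<bullet> w" for w
    using fun_cong[OF eq, of w] by (simp add: inner_commute)
  then show "fibre_velocity c (t, chart_map c q, \<xi>) = v" by (rule inner_eqI)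
qed

text \<open>The midpoint of two different maximisers would have a larger value.\<close>

lemma max_unique:
  assumes c: "c \<in> charts_at A q"
    and 1: "fibre_velocity c (t, chart_map c q, \<xi>) = v" and 2: "fibre_velocity c (t, chart_map c q, \<xi>') = v"
  shows "\<xi> = \<xi>'"
proof (rule ccontr)
  assume ne: "\<xi> \<noteq> \<xi>'"
  let ?h = "\<lambda>\<xi>. ham c H (t, chart_map c q, \<xi>)"
  have "?h ((1 - 1/2) *\<^sub>R \<xi> + (1/2) *\<^sub>R \<xi>') < (1 - 1/2) * ?h \<xi> + (1/2) * ?h \<xi>'"
    by (rule ham_convex[OF c _ _ ne]) auto
  moreover have "((1 - 1/2) *\<^sub>R \<xi> + (1/2) *\<^sub>R \<xi>') \<bullet> v - ?h ((1 - 1/2) *\<^sub>R \<xi> + (1/2) *\<^sub>R \<xi>') \<le> \<xi> \<bullet> v - ?h \<xi>"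
    "\<xi>' \<bullet> v - ?h \<xi>' \<le> \<xi> \<bullet> v - ?h \<xi>" "\<xi> \<bullet> v - ?h \<xi> \<le> \<xi>' \<bullet> v - ?h \<xi>'"
    using 1[unfolded fibre_velocity_iff_max[OF c]] 2[unfolded fibre_velocity_iff_max[OF c]] by blast+
  ultimately show False by (simp add: inner_add_left)
qed

lemma max_exists:
  assumes c: "c \<in> charts_at A q"
  shows "\<exists>\<xi>. fibre_velocity c (t, chart_map c q, \<xi>) = v"
  unfolding fibre_velocity_iff_max[OF c]
proof (rule superlinear_maximum_exists[OF model_frame _ ham_superlinear[OF c]])
  show "continuous_on UNIV (\<lambda>\<xi>. ham c H (t, chart_map c q, \<xi>))"
    by (intro continuous_at_imp_continuous_on ballI has_derivative_continuous[OF ham_fibre_derivative[OF c]])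
qed

definition fibre_momentum :: "('m, 'e) chart \<Rightarrow> real \<times> 'e \<times> 'e \<Rightarrow> 'e" where
  "fibre_momentum c = (\<lambda>(t, x, v). SOME \<xi>. fibre_velocity c (t, x, \<xi>) = v)"

lemma fibre_velocity_fibre_momentum:
  assumes "c \<in> A" "x \<in> chart_map c ` chart_dom c"
  shows "fibre_velocity c (t, x, fibre_momentum c (t, x, v)) = v"
proof -
  obtain q where "c \<in> charts_at A q" "x = chart_map c q" using assms by (auto simp: charts_at_def)
  from someI_ex[OF max_exists[OF this(1), of t v]] show ?thesis unfolding fibre_momentum_def \<open>x = _\<close> by simp
qed

lemma fibre_momentum_fibre_velocity:
  assumes "c \<in> A" "x \<in> chart_map c ` chart_dom c"
  shows "fibre_momentum c (t, x, fibre_velocity c (t, x, \<xi>)) = \<xi>"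
proof -
  obtain q where q: "c \<in> charts_at A q" "x = chart_map c q" using assms by (auto simp: charts_at_def)
  show ?thesis
    using max_unique[OF q(1), of t "fibre_momentum c (t, x, fibre_velocity c (t, x, \<xi>))" _ \<xi>] fibre_velocity_fibre_momentum[OF assms] unfolding q(2) by blast
qed

lemma cdom_eq: "c \<in> A \<Longrightarrow> cdom c = UNIV \<times> chart_map c ` chart_dom c \<times> UNIV"
  by (simp add: cdom_def cb_range del: bundle_map)

text \<open>As the Hessian of \<open>H\<close> in the fibre may be singular,
  \<open>fibre_momentum\<close> need not be differentiable. It is continuous as the maximiser of a
  function strictly concave in \<open>\<xi>\<close> and continuous in all its variables.\<close>

lemma fibre_momentum_continuous:
  assumes c: "c \<in> A"
  shows "continuous_on (cdom c) (fibre_momentum c)"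
proof (rule maximizer_continuous[OF model_frame open_cdom[OF c], where
      G = "\<lambda>((t, x, v), \<xi>). \<xi> \<bullet> v - ham c H (t, x, \<xi>)"])
  have "continuous_on (cdom c \<times> UNIV) (\<lambda>y. snd y \<bullet> snd (snd (fst y)) - ham c H (fst (fst y), fst (snd (fst y)), snd y))"
    by (intro continuous_intros continuous_on_compose2[OF smooth_on_continuous[OF ham_smooth[OF H c]]])
      (auto simp: cdom_eq[OF c])
  then show "continuous_on (cdom c \<times> UNIV) (\<lambda>((t, x, v), \<xi>). \<xi> \<bullet> v - ham c H (t, x, \<xi>))"
    by (simp add: split_beta)
next
  fix a and p p' :: 'e and u :: real
  assume a: "a \<in> cdom c" and u: "p \<noteq> p'" "0 < u" "u < 1"
  obtain t q v where q: "a = (t, chart_map c q, v)" "c \<in> charts_at A q"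
    using a c by (auto simp: cdom_eq[OF c] charts_at_def)
  show "(1 - u) * (case (a, p) of (x, xa) \<Rightarrow> (case x of (t, x, v) \<Rightarrow> \<lambda>\<xi>. \<xi> \<bullet> v - ham c H (t, x, \<xi>)) xa) +
    u * (case (a, p') of (x, xa) \<Rightarrow> (case x of (t, x, v) \<Rightarrow> \<lambda>\<xi>. \<xi> \<bullet> v - ham c H (t, x, \<xi>)) xa)
    < (case (a, (1 - u) *\<^sub>R p + u *\<^sub>R p') of (x, xa) \<Rightarrow> (case x of (t, x, v) \<Rightarrow> \<lambda>\<xi>. \<xi> \<bullet> v - ham c H (t, x, \<xi>)) xa)"
    using ham_convex[OF q(2) u(2,3,1), of t] unfolding q(1) by (simp add: algebra_simps)
next
  fix a p assume a: "a \<in> cdom c"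
  obtain t q v where q: "a = (t, chart_map c q, v)" "c \<in> charts_at A q"
    using a c by (auto simp: cdom_eq[OF c] charts_at_def)
  have "chart_map c q \<in> chart_map c ` chart_dom c" using q(2) by (auto simp: charts_at_def)
  from fibre_velocity_fibre_momentum[OF c this] show "(case (a, p) of (x, xa) \<Rightarrow> (case x of (t, x, v) \<Rightarrow> \<lambda>\<xi>. \<xi> \<bullet> v - ham c H (t, x, \<xi>)) xa)
    \<le> (case (a, fibre_momentum c a) of (x, xa) \<Rightarrow> (case x of (t, x, v) \<Rightarrow> \<lambda>\<xi>. \<xi> \<bullet> v - ham c H (t, x, \<xi>)) xa)"
    unfolding fibre_velocity_iff_max[OF q(2)] q(1) by simp
qed

abbreviation "M \<equiv> points (cotangent_atlas A)"
abbreviation "TM \<equiv> points (tangent_atlas A)"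

definition legendre :: "real \<Rightarrow> 'm \<times> ('m, 'e) coords \<Rightarrow> 'm \<times> ('m, 'e) coords" where
  "legendre t z = (fst z, velocity H t z)"

text \<open>The chart is an arbitrary choice; \<open>legendre_inv_chart\<close> shows that the
  formula then holds in every chart.\<close>

definition legendre_inv :: "real \<Rightarrow> 'm \<times> ('m, 'e) coords \<Rightarrow> 'm \<times> ('m, 'e) coords" where
  "legendre_inv t w = (let c = (SOME c. c \<in> charts_at A (fst w))
     in (fst w, cotangent_of (fst w) c (fibre_momentum c (t, chart_map c (fst w), snd w c))))"

lemma legendre_points: "z \<in> M \<Longrightarrow> legendre t z \<in> TM"
  using velocity_tangent[OF H, of z t] by (simp add: legendre_def tangent_points cotangent_points)

lemma legendre_chart:
  assumes "c \<in> charts_at A (fst z)"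
  shows "snd (legendre t z) c = fibre_velocity c (t, chart_map (cb c) z)"
  using assms by (simp add: legendre_def velocity_def fibre_velocity_def)

lemma legendre_inj:
  assumes z: "z \<in> M" and w: "w \<in> M" and eq: "legendre t z = legendre t w"
  shows "z = w"
proof -
  have f: "fst z = fst w" using eq by (simp add: legendre_def)
  obtain c where c: "c \<in> charts_at A (fst z)" using point_charts_at[OF z] by blast
  have "snd z c = snd w c"
    using legendre_chart[OF c, of t] legendre_chart[of c w t] c eq f
    by (intro max_unique[OF c, of t "snd z c" "snd (legendre t z) c"]) simp_all
  moreover have "snd z = cotangent_of (fst z) c (snd z c)" "snd w = cotangent_of (fst w) c (snd w c)"
    using z w c f by (auto simp: cotangent_points intro!: cotangent_spaceD)
  ultimately show ?thesis using f by (metis prod_eqI)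
qed

lemma legendre_inv_points: "w \<in> TM \<Longrightarrow> legendre_inv t w \<in> M"
  and legendre_legendre_inv: "w \<in> TM \<Longrightarrow> legendre t (legendre_inv t w) = w"
proof -
  assume w: "w \<in> TM"
  define c where "c = (SOME c. c \<in> charts_at A (fst w))"
  have "\<exists>c. c \<in> charts_at A (fst w)" using w charts_at_nonempty unfolding tangent_points by blast
  then have c: "c \<in> charts_at A (fst w)" unfolding c_def by (rule someI_ex)
  let ?\<xi> = "fibre_momentum c (t, chart_map c (fst w), snd w c)"
  have eq: "legendre_inv t w = (fst w, cotangent_of (fst w) c ?\<xi>)" by (simp add: legendre_inv_def c_def Let_def)
  show M: "legendre_inv t w \<in> M" using w cotangent_of(1)[OF c] by (simp add: eq cotangent_points tangent_points)
  have "snd (legendre t (legendre_inv t w)) c = snd w c"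
    using legendre_chart[of c "legendre_inv t w" t] c fibre_velocity_fibre_momentum[of c "chart_map c (fst w)" t "snd w c"] cotangent_of(2)[OF c]
    by (simp add: eq charts_at_def)
  moreover have "snd (legendre t (legendre_inv t w)) \<in> tangent_space A (fst w)" "snd w \<in> tangent_space A (fst w)"
    using legendre_points[OF M, of t] w by (auto simp: tangent_points legendre_def eq)
  ultimately have "snd (legendre t (legendre_inv t w)) = snd w" using tangent_spaceD[OF _ c] by metis
  then show "legendre t (legendre_inv t w) = w" by (simp add: prod_eq_iff legendre_def eq)
qed

lemma legendre_inv_legendre: "z \<in> M \<Longrightarrow> legendre_inv t (legendre t z) = z"
  by (rule legendre_inj[of _ _ t]) (simp_all add: legendre_inv_points legendre_points legendre_legendre_inv)

lemma fst_legendre_inv: "fst (legendre_inv t w) = fst w"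
  by (simp add: legendre_inv_def Let_def)

lemma legendre_inv_chart:
  assumes w: "w \<in> TM" and c: "c \<in> charts_at A (fst w)"
  shows "snd (legendre_inv t w) c = fibre_momentum c (t, chart_map (tb c) w)"
proof -
  have "snd w c = fibre_velocity c (t, chart_map (cb c) (legendre_inv t w))"
    using legendre_chart[of c "legendre_inv t w" t] c legendre_legendre_inv[OF w, of t] by (simp add: fst_legendre_inv)
  then show ?thesis using fibre_momentum_fibre_velocity[of c "chart_map c (fst w)" t "snd (legendre_inv t w) c"] c
    by (simp add: charts_at_def fst_legendre_inv)
qed

text \<open>The maximum defining the Lagrangian is attained at the momentum of the velocity.\<close>

lemma lagrangian_legendre:
  assumes z: "z \<in> M"
  shows "lagrangian_of A H t (legendre t z) = pairing A (fst z) (snd z) (velocity H t z) - H t z"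
proof -
  have p: "snd z \<in> cotangent_space A (fst z)" using z by (simp add: cotangent_points)
  note v = velocity_tangent[OF H z, of t]
  obtain c where c: "c \<in> charts_at A (fst z)" using point_charts_at[OF z] by blast
  have Hc: "H t (fst z, p) = ham c H (t, chart_map c (fst z), p c)" if "p \<in> cotangent_space A (fst z)" for p
    unfolding ham_eq[OF c] using cotangent_spaceD[OF that c] by simp
  have eq: "pairing A (fst z) p (velocity H t z) - H t (fst z, p) =
      p c \<bullet> velocity H t z c - ham c H (t, chart_map c (fst z), p c)" if "p \<in> cotangent_space A (fst z)" for p
    using pairing_eq[OF that v c] Hc[OF that] by simp
  have vc: "fibre_velocity c (t, chart_map c (fst z), snd z c) = velocity H t z c"
    using legendre_chart[OF c, of t] by (simp add: legendre_def)
  show ?thesis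
    unfolding lagrangian_of_def legendre_def prod.case
  proof (rule Greatest_equality)
    show "\<exists>p\<in>cotangent_space A (fst z). pairing A (fst z) (snd z) (velocity H t z) - H t z =
       pairing A (fst z) p (velocity H t z) - H t (fst z, p)"
      using p by (intro bexI[of _ "snd z"]) auto
    fix y assume "\<exists>p\<in>cotangent_space A (fst z). y = pairing A (fst z) p (velocity H t z) - H t (fst z, p)"
    then obtain p' where p': "p' \<in> cotangent_space A (fst z)" "y = pairing A (fst z) p' (velocity H t z) - H t (fst z, p')" by blast
    show "y \<le> pairing A (fst z) (snd z) (velocity H t z) - H t z"
      using vc[unfolded fibre_velocity_iff_max[OF c]] eq[OF p'(1)] eq[OF p] p'(2) by simp
  qed
qed

section \<open>The Lagrangian in a chart and its first derivatives\<close>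

definition lag :: "('m, 'e) chart \<Rightarrow> real \<Rightarrow> 'e \<Rightarrow> 'e \<Rightarrow> real" where
  "lag c t x v = fibre_momentum c (t, x, v) \<bullet> v - ham c H (t, x, fibre_momentum c (t, x, v))"

lemma lagrangian_chart:
  assumes c: "c \<in> A" and x: "x \<in> chart_map c ` chart_dom c"
  shows "lagrangian_of A H t (chart_inv (tb c) (x, v)) = lag c t x v"
proof -
  have "(x, v) \<in> chart_map (tb c) ` chart_dom (tb c)" using x by (simp add: tb_range[OF c] del: bundle_map)
  then obtain w where w: "w \<in> chart_dom (tb c)" "(x, v) = chart_map (tb c) w" by blast
  have wi: "chart_inv (tb c) (x, v) = w" unfolding w(2) by (rule tb_inv_map[OF c w(1)])
  have wT: "w \<in> TM" using w(1) c by (auto simp: points_def tangent_atlas_def)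
  have cw: "c \<in> charts_at A (fst w)" using w(1) c by (auto simp: charts_at_def bundle_dom)
  define z where "z = legendre_inv t w"
  have z: "z \<in> M" "legendre t z = w" using legendre_inv_points[OF wT] legendre_legendre_inv[OF wT] by (simp_all add: z_def)
  have fz: "fst z = fst w" by (simp add: z_def fst_legendre_inv)
  have cz: "c \<in> charts_at A (fst z)" using cw fz by simp
  have sz: "snd z c = fibre_momentum c (t, x, v)" using legendre_inv_chart[OF wT cw, of t] w(2) by (simp add: z_def)
  have vz: "velocity H t z = snd w" using z(2) by (auto simp: legendre_def)
  have p: "snd z \<in> cotangent_space A (fst z)" using z(1) by (simp add: cotangent_points)
  have "pairing A (fst z) (snd z) (velocity H t z) = snd z c \<bullet> snd w c"
    using pairing_eq[OF p velocity_tangent[OF H z(1), of t] cz] unfolding vz .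
  moreover have "H t z = ham c H (t, x, snd z c)"
    using ham_eq[OF cz, of t "snd z c"] cotangent_spaceD[OF p cz] w(2) fz by (cases z) simp
  ultimately show ?thesis
    using lagrangian_legendre[OF z(1), of t] unfolding z(2) wi lag_def sz[symmetric] using w(2) by simp
qed

text \<open>The Fenchel inequality, which encloses the increments of \<open>lag\<close> from both
  sides.\<close>

lemma lag_max:
  assumes c: "c \<in> A" and x: "x \<in> chart_map c ` chart_dom c"
  shows "\<xi> \<bullet> v - ham c H (t, x, \<xi>) \<le> lag c t x v"
proof -
  obtain q where q: "c \<in> charts_at A q" "x = chart_map c q" using assms by (auto simp: charts_at_def)
  show ?thesis using fibre_velocity_fibre_momentum[OF assms, of t v] unfolding q(2) fibre_velocity_iff_max[OF q(1)] lag_def by blast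
qed

text \<open>An envelope argument: the momentum of \<open>v\<close> used at \<open>y\<close>, and
  that of \<open>y\<close> used at \<open>v\<close>, enclose the increment of \<open>lag\<close>
  between two pairings, which are close by the continuity of \<open>fibre_momentum\<close>.\<close>

lemma lag_derivative_v:
  assumes c: "c \<in> A" and x: "x \<in> chart_map c ` chart_dom c"
  shows "((\<lambda>v. lag c t x v) has_derivative (\<lambda>w. fibre_momentum c (t, x, v) \<bullet> w)) (at v)"
  unfolding has_derivative_at_alt
proof (intro conjI allI impI)
  show "bounded_linear (\<lambda>w. fibre_momentum c (t, x, v) \<bullet> w)" by (rule bounded_linear_inner_right)
  fix e :: real assume e: "e > 0"
  have "isCont (\<lambda>v. fibre_momentum c (t, x, v)) v"
  proof -
    have "continuous_on UNIV (\<lambda>v. fibre_momentum c (t, x, v))"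
      by (rule continuous_on_compose2[OF fibre_momentum_continuous[OF c]]) (use x in \<open>auto intro!: continuous_intros simp: cdom_eq[OF c]\<close>)
    then show ?thesis by (simp add: continuous_on_eq_continuous_at)
  qed
  then obtain d where d: "d > 0" "\<And>v'. dist v' v < d \<Longrightarrow> dist (fibre_momentum c (t, x, v')) (fibre_momentum c (t, x, v)) < e"
    using e unfolding continuous_at_eps_delta by blast
  show "\<exists>d>0. \<forall>y. norm (y - v) < d \<longrightarrow> norm (lag c t x y - lag c t x v - fibre_momentum c (t, x, v) \<bullet> (y - v)) \<le> e * norm (y - v)"
  proof (intro exI[of _ d] conjI allI impI d(1))
    fix y assume y: "norm (y - v) < d"
    let ?P = "fibre_momentum c (t, x, v)" and ?Q = "fibre_momentum c (t, x, y)"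
    have lo: "?P \<bullet> (y - v) \<le> lag c t x y - lag c t x v"
      using lag_max[OF c x, of ?P y t] by (simp add: lag_def[of c t x v] inner_diff_right)
    have hi: "lag c t x y - lag c t x v \<le> ?Q \<bullet> (y - v)"
      using lag_max[OF c x, of ?Q v t] by (simp add: lag_def[of c t x y] inner_diff_right)
    have "?Q \<bullet> (y - v) - ?P \<bullet> (y - v) \<le> norm (?Q - ?P) * norm (y - v)"
      using norm_cauchy_schwarz[of "?Q - ?P" "y - v"] by (simp add: inner_diff_left)
    also have "\<dots> \<le> e * norm (y - v)"
      using d(2)[of y] y by (intro mult_right_mono) (auto simp: dist_norm)
    finally show "norm (lag c t x y - lag c t x v - ?P \<bullet> (y - v)) \<le> e * norm (y - v)" using lo hi by simp
  qed
qed

lemma lag_derivative_x: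
  assumes c: "c \<in> A" and x: "x \<in> chart_map c ` chart_dom c"
  shows "((\<lambda>x. lag c t x v) has_derivative (\<lambda>u. snd (vf c H (t, x, fibre_momentum c (t, x, v))) \<bullet> u)) (at x)"
  unfolding has_derivative_at_alt
proof (intro conjI allI impI)
  let ?P = "\<lambda>y. fibre_momentum c (t, y, v)" and ?U = "chart_map c ` chart_dom c"
  have Uo: "open ?U" by (rule atlas_open[OF topological_A c])
  show "bounded_linear (\<lambda>u. snd (vf c H (t, x, ?P x)) \<bullet> u)" by (rule bounded_linear_inner_right)
  fix e :: real assume e: "e > 0"
  obtain B :: "(real \<times> 'e \<times> 'e) set" where B: "frame B" using frames(2) by blast
  have xc: "(t, x, ?P x) \<in> cdom c" using x by (simp add: cdom_eq[OF c])
  obtain d1 where d1: "d1 > 0" and st: "\<And>y y'. y \<in> ball (t, x, ?P x) d1 \<Longrightarrow> y' \<in> ball (t, x, ?P x) d1 \<Longrightarrow>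
    norm (ham c H y' - ham c H y - frechet_derivative (ham c H) (at (t, x, ?P x)) (y' - y)) \<le> e * norm (y' - y)"
    using smooth_on_strict[OF B open_cdom[OF c] xc ham_smooth[OF H c] e] by blast
  have "isCont ?P x"
  proof -
    have "continuous_on ?U ?P"
      by (rule continuous_on_compose2[OF fibre_momentum_continuous[OF c]]) (auto intro!: continuous_intros simp: cdom_eq[OF c])
    then show ?thesis using continuous_on_eq_continuous_at[OF Uo, THEN iffD1] x by blast
  qed
  moreover have "d1 / 2 > 0" using d1 by simp
  ultimately obtain d2 where d2: "d2 > 0" "\<And>y. dist y x < d2 \<Longrightarrow> dist (?P y) (?P x) < d1 / 2"
    unfolding continuous_at_eps_delta by blast
  obtain d3 where d3: "d3 > 0" "ball x d3 \<subseteq> ?U" using Uo x open_contains_ball by blast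
  have main: "\<bar>ham c H (t, y, p) - ham c H (t, x, p) + snd (vf c H (t, x, ?P x)) \<bullet> (y - x)\<bar> \<le> e * norm (y - x)"
    if y: "norm (y - x) < d1 / 2" and p: "dist p (?P x) < d1 / 2" for y p
  proof -
    have in_ball: "(t, y', p) \<in> ball (t, x, ?P x) d1" if "norm (y' - x) < d1 / 2" for y'
    proof -
      have "dist (t, x, ?P x) (t, y', p) = norm (x - y', ?P x - p)" by (simp add: dist_norm)
      also have "\<dots> \<le> norm (x - y') + norm (?P x - p)" by (rule norm_Pair_le)
      also have "\<dots> < d1" using that p by (simp add: dist_norm norm_minus_commute)
      finally show ?thesis by simp
    qed
    have "norm (ham c H (t, y, p) - ham c H (t, x, p) - frechet_derivative (ham c H) (at (t, x, ?P x)) ((t, y, p) - (t, x, p)))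
       \<le> e * norm ((t, y, p) - (t, x, p))"
      using d1 by (intro st in_ball y) simp
    moreover have "frechet_derivative (ham c H) (at (t, x, ?P x)) ((t, y, p) - (t, x, p)) = - (snd (vf c H (t, x, ?P x)) \<bullet> (y - x))"
      using vf_snd[OF H c xc, of "y - x"] by simp
    ultimately show ?thesis by simp
  qed
  show "\<exists>d>0. \<forall>y. norm (y - x) < d \<longrightarrow> norm (lag c t y v - lag c t x v - snd (vf c H (t, x, ?P x)) \<bullet> (y - x)) \<le> e * norm (y - x)"
  proof (intro exI[of _ "min (d1/2) (min d2 d3)"] conjI allI impI)
    show "0 < min (d1/2) (min d2 d3)" using d1 d2 d3 by simp
    fix y assume y: "norm (y - x) < min (d1/2) (min d2 d3)"
    then have "y \<in> ball x d3" by (simp add: dist_norm norm_minus_commute)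
    then have yU: "y \<in> ?U" using d3 by blast
    have lo: "lag c t y v - lag c t x v \<ge> - (ham c H (t, y, ?P x) - ham c H (t, x, ?P x))"
      using lag_max[OF c yU, of "?P x" v t] by (simp add: lag_def[of c t x v])
    have hi: "lag c t y v - lag c t x v \<le> - (ham c H (t, y, ?P y) - ham c H (t, x, ?P y))"
      using lag_max[OF c x, of "?P y" v t] by (simp add: lag_def[of c t y v])
    have m: "\<bar>ham c H (t, y, ?P x) - ham c H (t, x, ?P x) + snd (vf c H (t, x, ?P x)) \<bullet> (y - x)\<bar> \<le> e * norm (y - x)"
      "\<bar>ham c H (t, y, ?P y) - ham c H (t, x, ?P y) + snd (vf c H (t, x, ?P x)) \<bullet> (y - x)\<bar> \<le> e * norm (y - x)"
      using y d1 d2(2)[of y] by (auto intro!: main simp: dist_norm)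
    show "norm (lag c t y v - lag c t x v - snd (vf c H (t, x, ?P x)) \<bullet> (y - x)) \<le> e * norm (y - x)"
      using lo hi m unfolding real_norm_def by linarith
  qed
qed

end

section \<open>Continuity tested in charts, derivatives tested on components\<close>

lemma continuous_map_between_atlases:
  assumes A: "topological_atlas \<A>" and B: "topological_atlas \<B>"
    and loc: "\<And>t z. z \<in> points \<A> \<Longrightarrow> \<exists>c\<in>\<A>. \<exists>d\<in>\<B>. \<exists>\<Lambda>. z \<in> chart_dom c \<and>
      continuous_on (UNIV \<times> chart_map c ` chart_dom c) \<Lambda> \<and>
      (\<forall>t'. \<forall>z'\<in>chart_dom c. f (t', z') \<in> chart_dom d \<and> chart_map d (f (t', z')) = \<Lambda> (t', chart_map c z'))"
  shows "continuous_map (prod_topology euclideanreal (manifold_topology \<A>)) (manifold_topology \<B>) f"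
proof (rule continuous_map_into_atlas[OF B])
  fix y assume y: "y \<in> topspace (prod_topology euclideanreal (manifold_topology \<A>))"
  obtain t z where tz: "y = (t, z)" "z \<in> points \<A>" using y by (auto simp: topspace_atlas[OF A])
  from loc[OF tz(2)] obtain c d \<Lambda> where c: "c \<in> \<A>" "d \<in> \<B>" "z \<in> chart_dom c"
    and \<Lambda>: "continuous_on (UNIV \<times> chart_map c ` chart_dom c) \<Lambda>"
    and eq: "\<And>t' z'. z' \<in> chart_dom c \<Longrightarrow> f (t', z') \<in> chart_dom d"
      "\<And>t' z'. z' \<in> chart_dom c \<Longrightarrow> chart_map d (f (t', z')) = \<Lambda> (t', chart_map c z')" by blast
  show "\<exists>d\<in>\<B>. f y \<in> chart_dom d \<and> (\<forall>V. open V \<and> chart_map d (f y) \<in> V \<longrightarrow>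
    (\<exists>U. openin (prod_topology euclideanreal (manifold_topology \<A>)) U \<and> y \<in> U \<and>
      (\<forall>y'\<in>U. f y' \<in> chart_dom d \<and> chart_map d (f y') \<in> V)))"
  proof (intro bexI[OF _ c(2)] conjI allI impI)
    show "f y \<in> chart_dom d" unfolding tz(1) by (rule eq(1)[OF c(3)])
    fix V assume V: "open V \<and> chart_map d (f y) \<in> V"
    let ?D = "UNIV \<times> chart_map c ` chart_dom c"
    have "open (?D \<inter> \<Lambda> -` V)"
      using V by (intro continuous_open_preimage[OF \<Lambda>] open_Times open_UNIV atlas_open[OF A c(1)]) blast
    moreover have "(t, chart_map c z) \<in> ?D \<inter> \<Lambda> -` V"
      using V eq(2)[OF c(3)] c(3) by (auto simp: tz(1))
    ultimately obtain I W where IW0: "open I" "open W" "(t, chart_map c z) \<in> I \<times> W" "I \<times> W \<subseteq> ?D \<inter> \<Lambda> -` V"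
      by (rule open_prod_elim)
    then have IW: "open I" "open W" "t \<in> I" "chart_map c z \<in> W" "I \<times> W \<subseteq> ?D \<inter> \<Lambda> -` V" by simp_all
    let ?U = "I \<times> {x \<in> chart_dom c. chart_map c x \<in> W}"
    have "openin (prod_topology euclideanreal (manifold_topology \<A>)) ?U"
      using IW(1) chart_preimage_open[OF A c(1) IW(2)] by (simp add: openin_prod_Times_iff)
    moreover have "y \<in> ?U" using tz c IW by simp
    moreover have "\<forall>y'\<in>?U. f y' \<in> chart_dom d \<and> chart_map d (f y') \<in> V"
    proof
      fix y' assume y': "y' \<in> ?U"
      obtain t' z' where z': "y' = (t', z')" "t' \<in> I" "z' \<in> chart_dom c" "chart_map c z' \<in> W" using y' by blast
      have "(t', chart_map c z') \<in> \<Lambda> -` V" using z' IW(5) by blast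
      then show "f y' \<in> chart_dom d \<and> chart_map d (f y') \<in> V"
        unfolding z'(1) using eq[OF z'(3), of t'] by simp
    qed
    ultimately show "\<exists>U. openin (prod_topology euclideanreal (manifold_topology \<A>)) U \<and> y \<in> U \<and>
      (\<forall>y'\<in>U. f y' \<in> chart_dom d \<and> chart_map d (f y') \<in> V)" by (intro exI conjI)
  qed
qed

lemma continuous_map_real_atlas:
  assumes A: "topological_atlas \<A>"
    and loc: "\<And>z. z \<in> points \<A> \<Longrightarrow> \<exists>c\<in>\<A>. \<exists>\<Lambda>. z \<in> chart_dom c \<and>
      continuous_on (UNIV \<times> chart_map c ` chart_dom c) \<Lambda> \<and>
      (\<forall>t'. \<forall>z'\<in>chart_dom c. f (t', z') = \<Lambda> (t', chart_map c z'))"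
  shows "continuous_map (prod_topology euclideanreal (manifold_topology \<A>)) euclideanreal f"
  unfolding continuous_map_eq_topcontinuous_at topcontinuous_at_def
proof (intro ballI conjI allI impI)
  fix y assume y: "y \<in> topspace (prod_topology euclideanreal (manifold_topology \<A>))"
  show "y \<in> topspace (prod_topology euclideanreal (manifold_topology \<A>))" by fact
  show "f \<in> topspace (prod_topology euclideanreal (manifold_topology \<A>)) \<rightarrow> topspace euclideanreal" by simp
  obtain t z where tz: "y = (t, z)" "z \<in> points \<A>" using y by (auto simp: topspace_atlas[OF A])
  from loc[OF tz(2)] obtain c \<Lambda> where c: "c \<in> \<A>" "z \<in> chart_dom c"
    and \<Lambda>: "continuous_on (UNIV \<times> chart_map c ` chart_dom c) \<Lambda>"
    and eq: "\<And>t' z'. z' \<in> chart_dom c \<Longrightarrow> f (t', z') = \<Lambda> (t', chart_map c z')" by blast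
  fix V assume V: "openin euclideanreal V \<and> f y \<in> V"
  let ?D = "UNIV \<times> chart_map c ` chart_dom c"
  have "open (?D \<inter> \<Lambda> -` V)"
    using V by (intro continuous_open_preimage[OF \<Lambda>] open_Times open_UNIV atlas_open[OF A c(1)]) simp
  moreover have "(t, chart_map c z) \<in> ?D \<inter> \<Lambda> -` V"
    using V eq[OF c(2)] c(2) by (auto simp: tz(1))
  ultimately obtain I W where IW0: "open I" "open W" "(t, chart_map c z) \<in> I \<times> W" "I \<times> W \<subseteq> ?D \<inter> \<Lambda> -` V"
    by (rule open_prod_elim)
  then have IW: "open I" "open W" "t \<in> I" "chart_map c z \<in> W" "I \<times> W \<subseteq> ?D \<inter> \<Lambda> -` V" by simp_all
  let ?U = "I \<times> {x \<in> chart_dom c. chart_map c x \<in> W}"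
  have "openin (prod_topology euclideanreal (manifold_topology \<A>)) ?U"
    using IW(1) chart_preimage_open[OF A c(1) IW(2)] by (simp add: openin_prod_Times_iff)
  moreover have "y \<in> ?U" using tz c IW by simp
  moreover have "\<forall>y'\<in>?U. f y' \<in> V"
  proof
    fix y' assume y': "y' \<in> ?U"
    obtain t' z' where z': "y' = (t', z')" "t' \<in> I" "z' \<in> chart_dom c" "chart_map c z' \<in> W" using y' by blast
    have "(t', chart_map c z') \<in> \<Lambda> -` V" using z' IW(5) by blast
    then show "f y' \<in> V" unfolding z'(1) using eq[OF z'(3), of t'] by simp
  qed
  ultimately show "\<exists>U. openin (prod_topology euclideanreal (manifold_topology \<A>)) U \<and> y \<in> U \<and> (\<forall>y'\<in>U. f y' \<in> V)"
    by (intro exI conjI)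
qed

text \<open>Translates between the Euler-Lagrange equation, which is tested on single vectors, and
  Hamilton's equation, which is vectorial.\<close>

lemma has_vector_derivative_inner_iff:
  fixes P :: "real \<Rightarrow> 'v::real_inner" and B :: "'v set"
  assumes B: "frame B"
  shows "(P has_vector_derivative v) (at t) \<longleftrightarrow> (\<forall>w. ((\<lambda>s. P s \<bullet> w) has_real_derivative v \<bullet> w) (at t))"
proof
  assume "(P has_vector_derivative v) (at t)"
  then show "\<forall>w. ((\<lambda>s. P s \<bullet> w) has_real_derivative v \<bullet> w) (at t)"
    using bounded_linear.has_vector_derivative[OF bounded_linear_inner_left]
    by (auto simp: has_real_derivative_iff_has_vector_derivative)
next
  assume d: "\<forall>w. ((\<lambda>s. P s \<bullet> w) has_real_derivative v \<bullet> w) (at t)"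
  have "((\<lambda>s. \<Sum>b\<in>B. (P s \<bullet> b) *\<^sub>R b) has_vector_derivative (\<Sum>b\<in>B. (v \<bullet> b) *\<^sub>R b)) (at t)"
    using d by (intro has_vector_derivative_sum bounded_linear.has_vector_derivative[OF bounded_linear_scaleR_left])
      (auto simp: has_real_derivative_iff_has_vector_derivative)
  then show "(P has_vector_derivative v) (at t)" by (simp add: frameD(2)[OF B])
qed

lemma has_vector_derivative_Pair_iff:
  fixes x :: "real \<Rightarrow> 'v::real_normed_vector" and P :: "real \<Rightarrow> 'w::real_normed_vector"
  shows "((\<lambda>s. (x s, P s)) has_vector_derivative v) (at t) \<longleftrightarrow>
    (x has_vector_derivative fst v) (at t) \<and> (P has_vector_derivative snd v) (at t)"
proof
  assume d: "((\<lambda>s. (x s, P s)) has_vector_derivative v) (at t)"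
  show "(x has_vector_derivative fst v) (at t) \<and> (P has_vector_derivative snd v) (at t)"
    using bounded_linear.has_vector_derivative[OF bounded_linear_fst d]
      bounded_linear.has_vector_derivative[OF bounded_linear_snd d] by simp
next
  assume "(x has_vector_derivative fst v) (at t) \<and> (P has_vector_derivative snd v) (at t)"
  then have "((\<lambda>s. (x s, P s)) has_derivative (\<lambda>h. (h *\<^sub>R fst v, h *\<^sub>R snd v))) (at t)"
    unfolding has_vector_derivative_def by (intro has_derivative_Pair) auto
  then show "((\<lambda>s. (x s, P s)) has_vector_derivative v) (at t)"
    unfolding has_vector_derivative_def by (rule has_derivative_eq_rhs) (simp add: prod_eq_iff fun_eq_iff)
qed

context tonelli_hamiltonian begin

lemma legendre_continuous: "continuous_map (prod_topology euclideanreal Cot) Tan (\<lambda>(t, z). legendre t z)"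
proof (rule continuous_map_between_atlases[OF topological_cotangent topological_tangent])
  fix z assume z: "z \<in> M"
  obtain c where c: "c \<in> A" "z \<in> chart_dom (cb c)" using point_chart[OF z] by blast
  let ?\<Lambda> = "\<lambda>x. (fst (snd x), fibre_velocity c x)"
  have "continuous_on (cdom c) ?\<Lambda>"
    unfolding fibre_velocity_def
    by (intro continuous_intros smooth_on_continuous[OF vf_smooth[OF H c(1)]])
  moreover have "legendre t' z' \<in> chart_dom (tb c) \<and> chart_map (tb c) (legendre t' z') = ?\<Lambda> (t', chart_map (cb c) z')"
    if z': "z' \<in> chart_dom (cb c)" for t' z'
  proof -
    have "z' \<in> M" by (rule cb_dom_points[OF c(1) z'])
    then have "legendre t' z' \<in> TM" by (rule legendre_points)
    moreover have "c \<in> charts_at A (fst z')" using z' c by (auto simp: charts_at_def bundle_dom)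
    ultimately show ?thesis using legendre_chart[of c z' t']
      by (auto simp: bundle_dom tangent_points legendre_def charts_at_def)
  qed
  ultimately show "\<exists>c\<in>cotangent_atlas A. \<exists>d\<in>tangent_atlas A. \<exists>\<Lambda>. z \<in> chart_dom c \<and>
      continuous_on (UNIV \<times> chart_map c ` chart_dom c) \<Lambda> \<and>
      (\<forall>t'. \<forall>z'\<in>chart_dom c. (case (t', z') of (t, z) \<Rightarrow> legendre t z) \<in> chart_dom d \<and>
         chart_map d (case (t', z') of (t, z) \<Rightarrow> legendre t z) = \<Lambda> (t', chart_map c z'))"
    unfolding prod.case cdom_def
    using c by (intro bexI[OF _ cb_atlas[OF c(1)]] bexI[OF _ tb_atlas[OF c(1)]] exI[of _ ?\<Lambda>]) blast
qed

lemma legendre_inv_continuous: "continuous_map (prod_topology euclideanreal Tan) Cot (\<lambda>(t, w). legendre_inv t w)"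
proof (rule continuous_map_between_atlases[OF topological_tangent topological_cotangent])
  fix w assume w: "w \<in> TM"
  obtain c where c: "c \<in> A" "w \<in> chart_dom (tb c)"
    using w by (auto simp: points_def tangent_atlas_def)
  let ?\<Lambda> = "\<lambda>x. (fst (snd x), fibre_momentum c x)"
  have "continuous_on (UNIV \<times> chart_map (tb c) ` chart_dom (tb c)) ?\<Lambda>"
    unfolding tb_range[OF c(1)]
    by (intro continuous_intros fibre_momentum_continuous[OF c(1), unfolded cdom_eq[OF c(1)]])
  moreover have "legendre_inv t' z' \<in> chart_dom (cb c) \<and> chart_map (cb c) (legendre_inv t' z') = ?\<Lambda> (t', chart_map (tb c) z')"
    if z': "z' \<in> chart_dom (tb c)" for t' z'
  proof -
    have zT: "z' \<in> TM" using c(1) z' by (auto simp: points_def tangent_atlas_def)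
    then have "legendre_inv t' z' \<in> M" by (rule legendre_inv_points)
    moreover have "c \<in> charts_at A (fst z')" using z' c by (auto simp: charts_at_def bundle_dom)
    ultimately show ?thesis using legendre_inv_chart[OF zT, of c t']
      by (auto simp: bundle_dom cotangent_points fst_legendre_inv charts_at_def)
  qed
  ultimately show "\<exists>c\<in>tangent_atlas A. \<exists>d\<in>cotangent_atlas A. \<exists>\<Lambda>. w \<in> chart_dom c \<and>
      continuous_on (UNIV \<times> chart_map c ` chart_dom c) \<Lambda> \<and>
      (\<forall>t'. \<forall>z'\<in>chart_dom c. (case (t', z') of (t, z) \<Rightarrow> legendre_inv t z) \<in> chart_dom d \<and>
         chart_map d (case (t', z') of (t, z) \<Rightarrow> legendre_inv t z) = \<Lambda> (t', chart_map c z'))"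
    unfolding prod.case
    using c by (intro bexI[OF _ cb_atlas[OF c(1)]] bexI[OF _ tb_atlas[OF c(1)]] exI[of _ ?\<Lambda>]) blast
qed

lemma legendre_curve_continuous:
  assumes "continuous_map euclideanreal Cot z"
  shows "continuous_map euclideanreal Tan (\<lambda>t. legendre t (z t))"
  using continuous_map_compose[OF _ legendre_continuous, of euclideanreal "\<lambda>t. (t, z t)"] assms
  by (simp add: o_def continuous_map_pairedI continuous_map_id[unfolded id_def])

lemma legendre_inv_curve_continuous:
  assumes "continuous_map euclideanreal Tan w"
  shows "continuous_map euclideanreal Cot (\<lambda>t. legendre_inv t (w t))"
  using continuous_map_compose[OF _ legendre_inv_continuous, of euclideanreal "\<lambda>t. (t, w t)"] assms
  by (simp add: o_def continuous_map_pairedI continuous_map_id[unfolded id_def])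

abbreviation "Lag \<equiv> lagrangian_of A H"

text \<open>The momentum \<open>P s\<close> is the derivative of the Lagrangian in the velocity, so
  the second condition is the momentum half of Hamilton's equations. The first is the position half,
  because the fibre velocity at \<open>P t\<close> is \<open>\<xi> t\<close>. The curve stays in the
  chart near \<open>t\<close>, which suffices for derivatives at \<open>t\<close>.\<close>

lemma euler_lagrange_chart:
  assumes w: "continuous_map euclideanreal Tan w" and c: "c \<in> A" and t: "w t \<in> chart_dom (tb c)"
  shows "(let x = (\<lambda>s. fst (chart_map (tb c) (w s)));
            \<xi> = (\<lambda>s. snd (chart_map (tb c) (w s)));
            Lc = (\<lambda>s y \<zeta>. Lag s (chart_inv (tb c) (y, \<zeta>)))
        in (x has_vector_derivative \<xi> t) (at t) \<and>
           (\<forall>w. ((\<lambda>s. frechet_derivative (\<lambda>\<zeta>. Lc s (x s) \<zeta>) (at (\<xi> s)) w)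
              has_real_derivative frechet_derivative (\<lambda>y. Lc t y (\<xi> t)) (at (x t)) w) (at t))) \<longleftrightarrow>
     ((\<lambda>s. chart_map (cb c) (legendre_inv s (w s))) has_vector_derivative vf c H (t, chart_map (cb c) (legendre_inv t (w t)))) (at t)"
proof -
  define x where "x s = chart_map c (fst (w s))" for s
  define \<xi> where "\<xi> s = snd (w s) c" for s
  define P where "P s = fibre_momentum c (s, x s, \<xi> s)" for s
  let ?S = "{s. w s \<in> chart_dom (tb c)}" and ?U = "chart_map c ` chart_dom c"
  have oS: "open ?S" by (rule chart_curve_continuous(1)[OF topological_tangent w tb_atlas[OF c]])
  have oU: "open ?U" by (rule atlas_open[OF topological_A c])
  have xU: "x s \<in> ?U" if "s \<in> ?S" for s using that by (auto simp: x_def bundle_dom)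
  have cb_eq: "chart_map (cb c) (legendre_inv s (w s)) = (x s, P s)" if "s \<in> ?S" for s
  proof -
    have "w s \<in> TM" using that c by (auto simp: points_def tangent_atlas_def)
    moreover have "c \<in> charts_at A (fst (w s))" using that c by (auto simp: charts_at_def bundle_dom)
    ultimately show ?thesis using legendre_inv_chart[of "w s" c s] by (simp add: fst_legendre_inv x_def P_def \<xi>_def)
  qed
  have Lv: "frechet_derivative (\<lambda>\<zeta>. Lag s (chart_inv (tb c) (x s, \<zeta>))) (at (\<xi> s)) u = P s \<bullet> u" if s: "s \<in> ?S" for s u
  proof -
    have "(\<lambda>\<zeta>. Lag s (chart_inv (tb c) (x s, \<zeta>))) = (\<lambda>\<zeta>. lag c s (x s) \<zeta>)"
      using lagrangian_chart[OF c xU[OF s]] by blast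
    then show ?thesis
      using fun_cong[OF frechet_derivative_at[OF lag_derivative_v[OF c xU[OF s]], symmetric]] by (simp add: P_def)
  qed
  have tS: "t \<in> ?S" using t by simp
  have Lx: "frechet_derivative (\<lambda>y. Lag t (chart_inv (tb c) (y, \<xi> t))) (at (x t)) u = snd (vf c H (t, x t, P t)) \<bullet> u" for u
  proof -
    have "frechet_derivative (\<lambda>y. Lag t (chart_inv (tb c) (y, \<xi> t))) (at (x t)) = frechet_derivative (\<lambda>y. lag c t y (\<xi> t)) (at (x t))"
      using lagrangian_chart[OF c] by (intro frechet_derivative_cong_open[OF oU xU[OF tS]]) blast
    then show ?thesis
      using fun_cong[OF frechet_derivative_at[OF lag_derivative_x[OF c xU[OF tS]], symmetric]] by (simp add: P_def)
  qed
  have fst_vf: "fst (vf c H (t, x t, P t)) = \<xi> t"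
    using fibre_velocity_fibre_momentum[OF c xU[OF tS], of t "\<xi> t"] by (simp add: fibre_velocity_def P_def)
  have ev: "\<forall>\<^sub>F s in nhds t. s \<in> ?S" using oS tS by (rule eventually_nhds_in_open)
  have D1: "((\<lambda>s. frechet_derivative (\<lambda>\<zeta>. Lag s (chart_inv (tb c) (x s, \<zeta>))) (at (\<xi> s)) u) has_real_derivative l) (at t)
     \<longleftrightarrow> ((\<lambda>s. P s \<bullet> u) has_real_derivative l) (at t)" for u l
    by (intro DERIV_cong_ev refl eventually_mono[OF ev] Lv)
  have D2: "((\<lambda>s. chart_map (cb c) (legendre_inv s (w s))) has_vector_derivative v) (at t) \<longleftrightarrow>
     ((\<lambda>s. (x s, P s)) has_vector_derivative v) (at t)" for v
    by (intro has_vector_derivative_cong_ev refl eventually_mono[OF ev]) (use cb_eq t in \<open>auto simp del: bundle_map\<close>)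
  show ?thesis
    unfolding Let_def D2 has_vector_derivative_Pair_iff cb_eq[OF tS] has_vector_derivative_inner_iff[OF model_frame, of P] fst_vf
    unfolding bundle_map fst_conv snd_conv x_def[symmetric] \<xi>_def[symmetric] D1 Lx ..
qed

lemma euler_lagrange_imp_orbit:
  assumes w: "euler_lagrange_orbit A Lag w"
  shows "orbit H (\<lambda>t. legendre_inv t (w t))"
proof (rule orbitI[OF H])
  have wc: "continuous_map euclideanreal Tan w" using w by (simp add: euler_lagrange_orbit_def)
  then show "continuous_map euclideanreal Cot (\<lambda>t. legendre_inv t (w t))" by (rule legendre_inv_curve_continuous)
  fix t c assume c: "c \<in> A" "legendre_inv t (w t) \<in> chart_dom (cb c)"
  have "w t \<in> TM" using continuous_map_image_subset_topspace[OF wc] by (auto simp: topspace_Tan)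
  then have t: "w t \<in> chart_dom (tb c)" using c by (auto simp: bundle_dom fst_legendre_inv tangent_points)
  then have "tb c \<in> charts_at (tangent_atlas A) (w t)" using c by (simp add: charts_at_def tb_atlas)
  with w show "((\<lambda>s. chart_map (cb c) (legendre_inv s (w s))) has_vector_derivative vf c H (t, chart_map (cb c) (legendre_inv t (w t)))) (at t)"
    unfolding euler_lagrange_chart[OF wc c(1) t, symmetric] euler_lagrange_orbit_def by blast
qed

lemma orbit_imp_euler_lagrange:
  assumes z: "orbit H z"
  shows "euler_lagrange_orbit A Lag (\<lambda>t. legendre t (z t))"
  unfolding euler_lagrange_orbit_def
proof (intro conjI allI ballI)
  show wc: "continuous_map euclideanreal Tan (\<lambda>t. legendre t (z t))"
    by (rule legendre_curve_continuous[OF orbit_continuous[OF z]])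
  fix t c' assume "c' \<in> charts_at (tangent_atlas A) (legendre t (z t))"
  then obtain c where c: "c \<in> A" "c' = tb c" "legendre t (z t) \<in> chart_dom (tb c)"
    by (auto simp: charts_at_def tangent_atlas_def)
  have zt: "z s \<in> M" for s by (rule orbit_points[OF z])
  then have "z t \<in> chart_dom (cb c)" using c(3) by (auto simp: bundle_dom legendre_def cotangent_points)
  from orbit_derivative[OF H z c(1) this]
  show "let x = (\<lambda>s. fst (chart_map c' (legendre s (z s))));
            \<xi> = (\<lambda>s. snd (chart_map c' (legendre s (z s))));
            Lc = (\<lambda>s y \<zeta>. Lag s (chart_inv c' (y, \<zeta>)))
        in (x has_vector_derivative \<xi> t) (at t) \<and>
           (\<forall>w. ((\<lambda>s. frechet_derivative (\<lambda>\<zeta>. Lc s (x s) \<zeta>) (at (\<xi> s)) w)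
              has_real_derivative frechet_derivative (\<lambda>y. Lc t y (\<xi> t)) (at (x t)) w) (at t))"
    unfolding c(2) euler_lagrange_chart[OF wc c(1,3)] legendre_inv_legendre[OF zt] .
qed

end

text \<open>A maximal independent subset of the frame is a finite basis. Serves to turn the
  injectivity of a symplectic differential into surjectivity.\<close>

lemma frame_linear_surj:
  fixes f :: "'v::real_inner \<Rightarrow> 'v" and B :: "'v set"
  assumes B: "frame B" and f: "linear f" and inj: "inj f"
  shows "surj f"
proof -
  have sp: "span B = UNIV"
  proof -
    have "x \<in> span B" for x
    proof -
      have "(\<Sum>b\<in>B. (x \<bullet> b) *\<^sub>R b) \<in> span B" by (intro span_sum span_scale span_base)
      then show ?thesis by (simp add: frameD(2)[OF B])
    qed
    then show ?thesis by blast
  qed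
  obtain C where C: "C \<subseteq> B" "independent C" "span C = UNIV"
    using real_vector.maximal_independent_subset[of B] sp span_mono span_span
    by (metis UNIV_I span_eq subsetI subset_UNIV top.extremum_uniqueI)
  have "finite C" using C(1) frameD(1)[OF B] finite_subset by blast
  interpret fd: finite_dimensional_vector_space "(*\<^sub>R)" C
    using C \<open>finite C\<close> real_vector.vector_space_axioms
    by (intro finite_dimensional_vector_space.intro finite_dimensional_vector_space_axioms.intro)
      (simp_all add: span_raw_def dependent_raw_def)
  show ?thesis using f inj by (intro fd.linear_inj_imp_surj) (simp_all add: linear_def)
qed

context tonelli_hamiltonian begin

text \<open>\<open>vf\<close> is defined through a derivative in time and space. This form involves
  only \<open>H t\<close> at the one time, as is required to compare the fields at two times where
  \<open>H\<close> agrees.\<close>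

lemma vf_slice:
  assumes c: "c \<in> A" and y: "(t, y) \<in> cdom c"
  shows "vf c H (t, y) = sgrad (frechet_derivative (\<lambda>y. H t (chart_inv (cb c) y)) (at y))"
  unfolding vf_def
  using frechet_derivative_at[OF has_derivative_slice[OF ham_derivative[OF H c y]]] by (simp add: ham_def)

end

section \<open>Periodicity in time\<close>

lemma time_class_shift: "time_class t = time_class s \<longleftrightarrow> (\<exists>n. s = t + of_int n)"
proof
  assume "time_class t = time_class s"
  moreover have "s \<in> time_class s" by (simp add: time_class_def)
  ultimately have "s \<in> time_class t" by (simp only:)
  then have "s - t \<in> \<int>" by (simp only: time_class_def mem_Collect_eq)
  then obtain n where "s - t = of_int n" by (auto elim: Ints_cases)
  then show "\<exists>n. s = t + of_int n" by (intro exI[of _ n]) simp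
next
  assume "\<exists>n. s = t + of_int n"
  then obtain n where n: "s = t + of_int n" by blast
  have "r - t \<in> \<int> \<longleftrightarrow> r - s \<in> \<int>" for r
  proof
    assume "r - t \<in> \<int>"
    then have "(r - t) - of_int n \<in> \<int>" by (rule Ints_diff) simp
    then show "r - s \<in> \<int>" by (simp only: n diff_diff_eq)
  next
    assume "r - s \<in> \<int>"
    then have "(r - s) + of_int n \<in> \<int>" by (rule Ints_add) simp
    moreover have "(r - s) + of_int n = r - t" by (simp add: n)
    ultimately show "r - t \<in> \<int>" by (simp only:)
  qed
  then show "time_class t = time_class s" by (simp add: time_class_def)
qed

locale periodic_tonelli = tonelli_hamiltonian A H
  for A :: "('m, 'e::real_inner) atlas" and H +
  assumes periodic: "time_periodic A H"
begin

lemma H_shift: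
  assumes z: "z \<in> M"
  shows "H (t + of_int n) z = H t z"
proof (induction n rule: int_induct[where k = 0])
  case (step1 i)
  then show ?case using periodic[unfolded time_periodic_def, rule_format, OF z, of "t + of_int i"]
    by (simp add: algebra_simps)
next
  case (step2 i)
  then show ?case using periodic[unfolded time_periodic_def, rule_format, OF z, of "t + of_int (i - 1)"]
    by (simp add: algebra_simps)
qed simp

lemma vf_shift:
  assumes c: "c \<in> A" and z: "z \<in> chart_dom (cb c)"
  shows "vf c H (t + of_int n, chart_map (cb c) z) = vf c H (t, chart_map (cb c) z)"
proof -
  let ?S = "chart_map (cb c) ` chart_dom (cb c)"
  have "frechet_derivative (\<lambda>y. H (t + of_int n) (chart_inv (cb c) y)) (at (chart_map (cb c) z)) =
    frechet_derivative (\<lambda>y. H t (chart_inv (cb c) y)) (at (chart_map (cb c) z))"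
  proof (rule frechet_derivative_cong_open[of ?S])
    show "open ?S" by (rule atlas_open[OF topological_cotangent cb_atlas[OF c]])
    show "chart_map (cb c) z \<in> ?S" using z by blast
    show "H (t + of_int n) (chart_inv (cb c) y) = H t (chart_inv (cb c) y)" if "y \<in> ?S" for y
      using chart_inv_dom[OF that] cb_dom_points[OF c] by (intro H_shift) blast
  qed
  then show ?thesis using vf_slice[OF c cdom_point[OF z]] by metis
qed

lemma velocity_shift: "z \<in> M \<Longrightarrow> velocity H (t + of_int n) z = velocity H t z"
  unfolding velocity_def
proof (rule ext, rule if_cong[OF refl _ refl])
  fix c assume "z \<in> M" "c \<in> charts_at A (fst z)"
  then have "c \<in> A" "z \<in> chart_dom (cb c)" using charts_at_cb[of c z] by (simp_all add: charts_at_def)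
  then show "fst (vf c H (t + of_int n, chart_map (cb c) z)) = fst (vf c H (t, chart_map (cb c) z))"
    by (simp only: vf_shift)
qed

lemma legendre_shift: "z \<in> M \<Longrightarrow> legendre (t + of_int n) z = legendre t z"
  by (simp add: legendre_def velocity_shift)

lemma legendre_inv_shift:
  assumes w: "w \<in> TM"
  shows "legendre_inv (t + of_int n) w = legendre_inv t w"
proof (rule legendre_inj[of _ _ "t + of_int n"])
  show "legendre (t + of_int n) (legendre_inv (t + of_int n) w) = legendre (t + of_int n) (legendre_inv t w)"
    unfolding legendre_legendre_inv[OF w] legendre_shift[OF legendre_inv_points[OF w]] ..
qed (rule legendre_inv_points[OF w])+

lemma orbit_shift:
  assumes z: "orbit H z"
  shows "orbit H (\<lambda>s. z (s + of_int n))"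
proof (rule orbitI[OF H])
  have "continuous_map euclideanreal euclideanreal (\<lambda>s. s + of_int n)"
    unfolding continuous_map_iff_continuous2 by (intro continuous_intros)
  from continuous_map_compose[OF this orbit_continuous[OF z]]
  show "continuous_map euclideanreal Cot (\<lambda>s. z (s + of_int n))" by (simp add: o_def)
  fix t c assume c: "c \<in> A" "z (t + of_int n) \<in> chart_dom (cb c)"
  have "((\<lambda>s. chart_map (cb c) (z (s + of_int n))) has_vector_derivative
      1 *\<^sub>R vf c H (t + of_int n, chart_map (cb c) (z (t + of_int n)))) (at t)"
    by (rule vector_diff_chain_at[of "\<lambda>s. s + of_int n" 1 t "\<lambda>s. chart_map (cb c) (z s)", unfolded o_def])
      (auto intro!: derivative_eq_intros orbit_derivative[OF H z c] simp del: bundle_map)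
  then show "((\<lambda>s. chart_map (cb c) (z (s + of_int n))) has_vector_derivative
      vf c H (t, chart_map (cb c) (z (t + of_int n)))) (at t)"
    unfolding vf_shift[OF c] by (simp del: bundle_map)
qed

text \<open>The flow is a definite description, so every Euler-Lagrange curve through the same point
  of the phase space must give the same value. Its time may differ by an integer; shifted back and
  transformed into a Hamiltonian orbit, it agrees with \<open>z\<close> by uniqueness.\<close>

lemma euler_lagrange_flow_eq:
  assumes z: "orbit H z"
  shows "euler_lagrange_flow A Lag s (time_class t, legendre t (z t)) = (time_class (t + s), legendre (t + s) (z (t + s)))"
  unfolding euler_lagrange_flow_def
proof (rule the_equality)
  show "\<exists>w t'. euler_lagrange_orbit A Lag w \<and> (time_class t, legendre t (z t)) = (time_class t', w t') \<and>
     (time_class (t + s), legendre (t + s) (z (t + s))) = (time_class (t' + s), w (t' + s))"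
    using orbit_imp_euler_lagrange[OF z] by (intro exI[of _ "\<lambda>t. legendre t (z t)"] exI[of _ t]) simp
  fix y' assume "\<exists>w t'. euler_lagrange_orbit A Lag w \<and> (time_class t, legendre t (z t)) = (time_class t', w t') \<and>
     y' = (time_class (t' + s), w (t' + s))"
  then obtain w t' where w: "euler_lagrange_orbit A Lag w" "time_class t = time_class t'" "legendre t (z t) = w t'"
    "y' = (time_class (t' + s), w (t' + s))" by blast
  obtain n where n: "t' = t + of_int n" using w(2) unfolding time_class_shift by blast
  have wT: "w r \<in> TM" for r
    using continuous_map_image_subset_topspace[of euclideanreal Tan w] w(1)
    by (auto simp: topspace_Tan euler_lagrange_orbit_def)
  have zM: "z r \<in> M" for r by (rule orbit_points[OF z])
  define z' where "z' r = legendre_inv (r + of_int n) (w (r + of_int n))" for r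
  have z': "orbit H z'" unfolding z'_def by (rule orbit_shift[OF euler_lagrange_imp_orbit[OF w(1)]])
  have "z' t = legendre_inv (t + of_int n) (legendre t (z t))" using w(3) by (simp add: z'_def n)
  also have "\<dots> = z t" using legendre_inv_shift[OF legendre_points[OF zM]] legendre_inv_legendre[OF zM] by simp
  finally have "z' (t + s) = z (t + s)" by (rule orbit_unique[OF H z' z])
  then have "legendre (t' + s) (legendre_inv (t' + s) (w (t' + s))) = legendre (t' + s) (z (t + s))"
    by (simp add: z'_def n algebra_simps)
  then have "w (t' + s) = legendre (t' + s) (z (t + s))" by (simp add: legendre_legendre_inv[OF wT])
  also have "\<dots> = legendre (t + s) (z (t + s))"
    using legendre_shift[OF zM, of "t + s" n "t + s"] by (simp add: n algebra_simps)
  finally show "y' = (time_class (t + s), legendre (t + s) (z (t + s)))"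
    using w(4) time_class_shift[of "t + s" "t' + s"] n by auto
qed

end

text \<open>In the application \<open>K\<close> is the composition of \<open>H\<close> with the
  given element of \<open>hamiltonian_group\<close>, which is known to agree with
  \<open>\<Phi> 1\<close> only on the cotangent bundle; hence the restriction in
  \<open>K_eq\<close>.\<close>

locale conjugated = hamiltonian_isotopy A F K0 \<Phi> \<eta> potential + H: periodic_tonelli A H + K: periodic_tonelli A K
  for A :: "('m, 'e::real_inner) atlas" and F K0 \<Phi> \<eta> potential H K +
  assumes K_eq: "\<And>t z. z \<in> points (cotangent_atlas A) \<Longrightarrow> K t z = H t (\<Phi> 1 z)"
begin

abbreviation "\<phi> \<equiv> \<Phi> 1"

text \<open>The symplectic differential \<open>Y\<close> intertwines the differentials of
  \<open>K\<close> and \<open>H\<close>, hence carries the Hamiltonian vector of the one to that of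
  the other. Inserted in the differential of the potential, this gives the difference of the two
  values of \<open>\<theta>\<close>.\<close>

lemma conjugate_derivative:
  assumes z: "orbit K z" and d: "d \<in> charts_at A (fst (\<phi> (z t)))"
  shows "((\<lambda>s. chart_map (cb d) (\<phi> (z s))) has_vector_derivative vf d H (t, chart_map (cb d) (\<phi> (z t)))) (at t)"
    and "((\<lambda>s. potential (z s) 1) has_real_derivative liouville_vf \<eta> H t (\<phi> (z t)) - liouville_vf \<eta> K t (z t)) (at t)"
proof -
  let ?z = "z t"
  have zM: "?z \<in> M" by (rule orbit_points[OF z])
  obtain c where c: "c \<in> charts_at A (fst ?z)" using point_charts_at[OF zM] by blast
  have cA: "c \<in> A" and dA: "d \<in> A" using c d by (auto simp: charts_at_def)
  have zc: "?z \<in> chart_dom (cb c)" by (rule charts_at_cb[OF c zM])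
  have pd: "\<phi> ?z \<in> chart_dom (cb d)" by (rule charts_at_cb[OF d \<Phi>_points[OF zM]])
  let ?m = "chart_map (cb c) ?z"
  have inv: "chart_inv (cb c) ?m = ?z" by (rule cb_inv_map[OF cA zc])
  have good: "flow_good ?z c 1" by (rule flow_good[OF zM c]) simp
  then obtain Y where Y: "((\<lambda>y. chart_map (cb d) (\<phi> (chart_inv (cb c) y))) has_derivative Y) (at ?m)"
    and sY: "\<And>u v. symplectic_form (Y u) (Y v) = symplectic_form u v"
    and S: "((\<lambda>y. potential (chart_inv (cb c) y) 1) has_derivative (\<lambda>u. liouville \<eta> d (\<phi> ?z) (Y u) - liouville \<eta> c ?z u)) (at ?m)"
    using d unfolding flow_good_def flow_derivative_def by blast
  let ?vK = "vf c K (t, ?m)" and ?vH = "vf d H (t, chart_map (cb d) (\<phi> ?z))"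
  have linY: "linear Y" using Y has_derivative_linear by blast
  have curve: "((\<lambda>s. chart_map (cb c) (z s)) has_vector_derivative ?vK) (at t)"
    by (rule orbit_derivative[OF K.H z cA zc])
  have oS: "open {s. z s \<in> chart_dom (cb c)}"
    by (rule chart_curve_continuous(1)[OF topological_cotangent orbit_continuous[OF z] cb_atlas[OF cA]])
  have inv_s: "chart_inv (cb c) (chart_map (cb c) (z s)) = z s" if "s \<in> {s. z s \<in> chart_dom (cb c)}" for s
    using cb_inv_map[OF cA] that by blast
  have tS: "t \<in> {s. z s \<in> chart_dom (cb c)}" using zc by simp
  have YvK: "Y ?vK = ?vH"
  proof -
    have "inj Y"
    proof (rule injI)
      fix u v assume "Y u = Y v"
      then have "symplectic_form u w = symplectic_form v w" for w using sY[of u w] sY[of v w] by simp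
      then show "u = v" by (rule symplectic_form_eqI)
    qed
    obtain B :: "('e \<times> 'e) set" where B: "frame B" using frames(1) by blast
    \<comment> \<open>A Hamiltonian vector is characterised by testing against all vectors, so each
      of them has to be of the form \<open>Y u\<close>.\<close>
    have surj: "surj Y" by (rule frame_linear_surj[OF B linY \<open>inj Y\<close>])
    obtain U where U: "openin Cot U" "?z \<in> U" "\<phi> ` U \<subseteq> chart_dom (cb d)"
      using good chart_dom_open[OF topological_cotangent cb_atlas[OF dA]] pd unfolding flow_good_def flow_cont_def by blast
    let ?S = "chart_map (cb c) ` (U \<inter> chart_dom (cb c))"
    have dH: "((\<lambda>y. ham d H (t, y)) has_derivative (\<lambda>u. frechet_derivative (ham d H) (at (t, chart_map (cb d) (\<phi> ?z))) (0, u)))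
       (at (chart_map (cb d) (\<phi> ?z)))"
      by (rule has_derivative_slice[OF ham_derivative[OF H.H dA cdom_point[OF pd]]])
    have "((\<lambda>y. ham d H (t, chart_map (cb d) (\<phi> (chart_inv (cb c) y)))) has_derivative
      (\<lambda>u. frechet_derivative (ham d H) (at (t, chart_map (cb d) (\<phi> ?z))) (0, Y u))) (at ?m)"
      by (rule has_derivative_compose[OF Y]) (simp only: inv dH)
    moreover have "open ?S" by (rule open_image_chart[OF topological_cotangent U(1) cb_atlas[OF cA]])
    moreover have "?m \<in> ?S" using U(2) zc by blast
    moreover have "ham d H (t, chart_map (cb d) (\<phi> (chart_inv (cb c) y))) = ham c K (t, y)" if y: "y \<in> ?S" for y
    proof -
      obtain w where w: "w \<in> U" "w \<in> chart_dom (cb c)" "y = chart_map (cb c) w" using y by blast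
      have wi: "chart_inv (cb c) y = w" unfolding w(3) by (rule cb_inv_map[OF cA w(2)])
      have "\<phi> w \<in> chart_dom (cb d)" using U(3) w(1) by blast
      moreover have "w \<in> M" by (rule cb_dom_points[OF cA w(2)])
      ultimately show ?thesis using cb_inv_map[OF dA, of "\<phi> w"] K_eq[of w t] by (simp add: ham_def wi del: bundle_map)
    qed
    ultimately have "((\<lambda>y. ham c K (t, y)) has_derivative
      (\<lambda>u. frechet_derivative (ham d H) (at (t, chart_map (cb d) (\<phi> ?z))) (0, Y u))) (at ?m)"
      by (rule has_derivative_transform_within_open)
    from has_derivative_unique[OF has_derivative_slice[OF ham_derivative[OF K.H cA cdom_point[OF zc]]] this]
    have DK: "frechet_derivative (ham c K) (at (t, ?m)) (0, u) = frechet_derivative (ham d H) (at (t, chart_map (cb d) (\<phi> ?z))) (0, Y u)" for u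
      by (rule fun_cong)
    show ?thesis
    proof (rule symplectic_form_eqI)
      fix w
      obtain u where u: "w = Y u" using surj by (rule surjE)
      have "symplectic_form (Y ?vK) (Y u) = - frechet_derivative (ham c K) (at (t, ?m)) (0, u)"
        unfolding sY by (rule vf_symplectic[OF K.H cA cdom_point[OF zc]])
      also have "\<dots> = symplectic_form ?vH (Y u)"
        unfolding DK vf_symplectic[OF H.H dA cdom_point[OF pd]] ..
      finally show "symplectic_form (Y ?vK) w = symplectic_form ?vH w" unfolding u .
    qed
  qed
  have "((\<lambda>s. chart_map (cb d) (\<phi> (chart_inv (cb c) (chart_map (cb c) (z s))))) has_derivative (\<lambda>h. Y (h *\<^sub>R ?vK))) (at t)"
    by (rule has_derivative_compose[OF curve[unfolded has_vector_derivative_def] Y])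
  then have "((\<lambda>s. chart_map (cb d) (\<phi> (chart_inv (cb c) (chart_map (cb c) (z s))))) has_vector_derivative ?vH) (at t)"
    unfolding has_vector_derivative_def linear_scale[OF linY] YvK .
  then show "((\<lambda>s. chart_map (cb d) (\<phi> (z s))) has_vector_derivative ?vH) (at t)"
    by (rule has_vector_derivative_transform_within_open[OF _ oS tS]) (simp only: inv_s)
  have lin: "linear (\<lambda>u. liouville \<eta> d (\<phi> ?z) (Y u) - liouville \<eta> c ?z u)" using S has_derivative_linear by blast
  have "((\<lambda>s. potential (chart_inv (cb c) (chart_map (cb c) (z s))) 1) has_derivative
     (\<lambda>h. liouville \<eta> d (\<phi> ?z) (Y (h *\<^sub>R ?vK)) - liouville \<eta> c ?z (h *\<^sub>R ?vK))) (at t)"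
    by (rule has_derivative_compose[OF curve[unfolded has_vector_derivative_def] S])
  then have "((\<lambda>s. potential (chart_inv (cb c) (chart_map (cb c) (z s))) 1) has_vector_derivative
     (liouville \<eta> d (\<phi> ?z) ?vH - liouville \<eta> c ?z ?vK)) (at t)"
    unfolding has_vector_derivative_def linear_scale[OF lin, unfolded] YvK[symmetric] .
  then have "((\<lambda>s. potential (z s) 1) has_vector_derivative (liouville \<eta> d (\<phi> ?z) ?vH - liouville \<eta> c ?z ?vK)) (at t)"
    by (rule has_vector_derivative_transform_within_open[OF _ oS tS]) (simp only: inv_s)
  then show "((\<lambda>s. potential (z s) 1) has_real_derivative liouville_vf \<eta> H t (\<phi> ?z) - liouville_vf \<eta> K t ?z) (at t)"
    unfolding liouville_vf_eq[OF H.H \<Phi>_points[OF zM] \<eta> d] liouville_vf_eq[OF K.H zM \<eta> c]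
      has_real_derivative_iff_has_vector_derivative .
qed

lemma conjugate_orbit:
  assumes z: "orbit K z"
  shows "orbit H (\<lambda>t. \<phi> (z t))"
proof (rule orbitI[OF H.H])
  show "continuous_map euclideanreal Cot (\<lambda>t. \<phi> (z t))"
    using continuous_map_compose[OF orbit_continuous[OF z] flow_continuous[of 1]] by (simp add: o_def)
  fix t d assume "d \<in> A" "\<phi> (z t) \<in> chart_dom (cb d)"
  then have "d \<in> charts_at A (fst (\<phi> (z t)))" by (auto simp: charts_at_def bundle_dom)
  from conjugate_derivative(1)[OF z this]
  show "((\<lambda>s. chart_map (cb d) (\<phi> (z s))) has_vector_derivative vf d H (t, chart_map (cb d) (\<phi> (z t)))) (at t)" .
qed

lemma action_derivative:
  assumes z: "orbit K z"
  shows "((\<lambda>s. potential (z s) 1) has_real_derivative liouville_vf \<eta> H t (\<phi> (z t)) - liouville_vf \<eta> K t (z t)) (at t)"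
proof -
  obtain d where "d \<in> charts_at A (fst (\<phi> (z t)))"
    using point_charts_at[OF \<Phi>_points[OF orbit_points[OF z]]] by blast
  from conjugate_derivative(2)[OF z this] show ?thesis .
qed

end

section \<open>Transport of invariant measures\<close>

text \<open>\<open>invariant_measures\<close> detached from the manifold, so that one transport
  lemma serves both directions of the conjugacy.\<close>

definition invariant_probs :: "'y measure \<Rightarrow> (real \<Rightarrow> 'y \<Rightarrow> 'y) \<Rightarrow> 'y measure set" where
  "invariant_probs N f = {\<mu>. prob_space \<mu> \<and> sets \<mu> = sets N \<and>
     (\<forall>s. f s \<in> measurable \<mu> \<mu> \<and> distr \<mu> \<mu> (f s) = \<mu>)}"

text \<open>
  The integral of the derivative \<open>g\<close> of a bounded function \<open>S\<close> along the flow vanishes by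
  dominated convergence of difference quotients, so that no joint measurability of the flow is
  needed.
\<close>

lemma transport_invariant_prob:
  fixes N :: "'y measure"
  assumes \<Psi>: "\<Psi> \<in> measurable N N" "\<Psi>i \<in> measurable N N" "\<And>y. y \<in> space N \<Longrightarrow> \<Psi> (\<Psi>i y) = y"
    and conj: "\<And>s y. y \<in> space N \<Longrightarrow> fH s (\<Psi> y) = \<Psi> (fK s y)"
    and act: "\<And>y. y \<in> space N \<Longrightarrow> aK y = aH (\<Psi> y) + g y"
    and S: "S \<in> borel_measurable N" "\<And>y. y \<in> space N \<Longrightarrow> \<bar>S y\<bar> \<le> bS"
    and Sd: "\<And>h y. y \<in> space N \<Longrightarrow> \<bar>S (fK h y) - S y\<bar> \<le> \<bar>h\<bar> * bD"
    and lim: "\<And>y. y \<in> space N \<Longrightarrow>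
      (\<lambda>n. real (Suc n) * (S (fK (1 / real (Suc n)) y) - S y)) \<longlonglongrightarrow> g y"
    and \<mu>: "\<mu> \<in> invariant_probs N fK" "integrable \<mu> aK"
  shows "distr \<mu> N \<Psi> \<in> invariant_probs N fH" "integrable (distr \<mu> N \<Psi>) aH"
    "integral\<^sup>L (distr \<mu> N \<Psi>) aH = integral\<^sup>L \<mu> aK"
proof -
  let ?\<nu> = "distr \<mu> N \<Psi>"
  have prob: "prob_space \<mu>" and sets: "sets \<mu> = sets N"
    and f\<mu>: "\<And>s. fK s \<in> measurable \<mu> \<mu>" and inv: "\<And>s. distr \<mu> \<mu> (fK s) = \<mu>"
    using \<mu>(1) by (auto simp: invariant_probs_def)
  interpret prob_space \<mu> by (rule prob)
  have sp: "space \<mu> = space N" by (rule sets_eq_imp_space_eq[OF sets])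
  have mNN: "measurable \<mu> \<mu> = measurable N N" by (rule measurable_cong_sets[OF sets sets])
  have fK: "fK s \<in> measurable N N" for s using f\<mu> by (simp add: mNN)
  have \<Psi>\<mu>: "\<Psi> \<in> measurable \<mu> N" using \<Psi>(1) measurable_cong_sets[OF sets refl] by blast
  have inv': "distr \<mu> N (fK s) = \<mu>" for s
  proof -
    have "distr \<mu> N (fK s) = distr \<mu> \<mu> (fK s)" by (rule distr_cong) (simp_all add: sets)
    then show ?thesis using inv[of s] by simp
  qed
  \<comment> \<open>Measurability of \<open>fH\<close> is inherited from \<open>fK\<close> through
    the conjugacy, with \<open>\<Psi>i\<close> as a measurable right inverse of
    \<open>\<Psi>\<close>.\<close>
  have fH: "fH s \<in> measurable N N" for s
  proof -
    have "(\<lambda>y. \<Psi> (fK s (\<Psi>i y))) \<in> measurable N N"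
      by (intro measurable_compose[OF measurable_compose[OF \<Psi>(2) fK] \<Psi>(1)])
    moreover have "\<Psi> (fK s (\<Psi>i y)) = fH s y" if "y \<in> space N" for y
      using conj[of "\<Psi>i y" s] \<Psi>(3)[OF that] measurable_space[OF \<Psi>(2) that] by simp
    ultimately show ?thesis by (subst measurable_cong[symmetric])
  qed
  have inv\<nu>: "distr ?\<nu> ?\<nu> (fH s) = ?\<nu>" for s
  proof -
    have "distr ?\<nu> ?\<nu> (fH s) = distr ?\<nu> N (fH s)" by (rule distr_cong) auto
    also have "\<dots> = distr \<mu> N (fH s \<circ> \<Psi>)" by (rule distr_distr[OF fH \<Psi>\<mu>])
    also have "\<dots> = distr \<mu> N (\<Psi> \<circ> fK s)" by (rule distr_cong) (auto simp: sp conj)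
    also have "\<dots> = distr (distr \<mu> N (fK s)) N \<Psi>"
    proof -
      have "fK s \<in> measurable \<mu> N" using fK measurable_cong_sets[OF sets refl] by blast
      from distr_distr[OF \<Psi>(1) this] show ?thesis by (rule sym)
    qed
    also have "\<dots> = ?\<nu>" unfolding inv' ..
    finally show ?thesis .
  qed
  have fH\<nu>: "fH s \<in> measurable ?\<nu> ?\<nu>" for s
    using fH measurable_cong_sets[of ?\<nu> N ?\<nu> N] by simp
  show "?\<nu> \<in> invariant_probs N fH"
    unfolding invariant_probs_def using prob_space_distr[OF \<Psi>\<mu>] inv\<nu> fH\<nu> by simp
  have bm: "borel_measurable \<mu> = (borel_measurable N :: ('y \<Rightarrow> real) set)" by (rule measurable_cong_sets[OF sets refl])
  have Sm: "S \<in> borel_measurable \<mu>" using S(1) unfolding bm .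
  define u where "u n y = real (Suc n) * (S (fK (1 / real (Suc n)) y) - S y)" for n y
  have um: "u n \<in> borel_measurable \<mu>" for n
    unfolding u_def using measurable_compose[OF f\<mu> Sm] Sm by (intro borel_measurable_times borel_measurable_diff borel_measurable_const)
  have gm: "g \<in> borel_measurable \<mu>"
    by (rule borel_measurable_LIMSEQ_real[OF _ um]) (use lim in \<open>simp add: sp u_def\<close>)
  have dom: "AE y in \<mu>. norm (u n y) \<le> bD" for n
  proof (rule AE_I2)
    fix y assume "y \<in> space \<mu>"
    from Sd[of y "1 / real (Suc n)"] this have "\<bar>S (fK (1 / real (Suc n)) y) - S y\<bar> \<le> (1 / real (Suc n)) * bD" by (simp add: sp)
    then have "real (Suc n) * \<bar>S (fK (1 / real (Suc n)) y) - S y\<bar> \<le> real (Suc n) * ((1 / real (Suc n)) * bD)"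
      by (intro mult_left_mono) auto
    also have "\<dots> = bD" by (simp del: of_nat_Suc)
    finally show "norm (u n y) \<le> bD" by (simp only: u_def real_norm_def abs_mult abs_of_nat)
  qed
  have limAE: "AE y in \<mu>. (\<lambda>n. u n y) \<longlonglongrightarrow> g y" by (rule AE_I2) (use lim in \<open>simp add: sp u_def\<close>)
  have wint: "integrable \<mu> (\<lambda>_. bD)" by simp
  have gint: "integrable \<mu> g" by (rule integrable_dominated_convergence[OF gm um wint limAE dom])
  have Sint: "integrable \<mu> S"
    by (rule integrable_const_bound[OF _ Sm, of bS]) (use S(2) in \<open>auto simp: sp\<close>)
  have "integral\<^sup>L \<mu> (u n) = 0" for n
  proof -
    let ?f = "fK (1 / real (Suc n))"
    \<comment> \<open>Invariance at the one time 1/(n + 1) equates the integrals of \<open>S\<close>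
      before and after the flow.\<close>
    have Sf: "integral\<^sup>L \<mu> (\<lambda>y. S (?f y)) = integral\<^sup>L \<mu> S"
      using integral_distr[OF f\<mu> Sm, of "1 / real (Suc n)"] unfolding inv by simp
    have "integrable \<mu> (\<lambda>y. S (?f y))"
      using integrable_distr[OF f\<mu>, of "1 / real (Suc n)" S] Sint unfolding inv by simp
    then show ?thesis unfolding u_def using Sint Sf by simp
  qed
  then have g0: "integral\<^sup>L \<mu> g = 0"
    using integral_dominated_convergence[OF gm um wint limAE dom] LIMSEQ_unique[OF _ tendsto_const] by simp
  have aH\<Psi>: "integrable \<mu> (\<lambda>y. aH (\<Psi> y)) \<and> integral\<^sup>L \<mu> (\<lambda>y. aH (\<Psi> y)) = integral\<^sup>L \<mu> aK"
  proof -
    have "integrable \<mu> (\<lambda>y. aK y - g y)" using \<mu>(2) gint by simp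
    moreover have "integral\<^sup>L \<mu> (\<lambda>y. aK y - g y) = integral\<^sup>L \<mu> aK" using \<mu>(2) gint g0 by simp
    moreover have eq: "aK y - g y = aH (\<Psi> y)" if "y \<in> space \<mu>" for y using act[of y] that by (simp add: sp)
    have "integrable \<mu> (\<lambda>y. aK y - g y) = integrable \<mu> (\<lambda>y. aH (\<Psi> y))"
      "integral\<^sup>L \<mu> (\<lambda>y. aK y - g y) = integral\<^sup>L \<mu> (\<lambda>y. aH (\<Psi> y))"
      by (intro Bochner_Integration.integrable_cong Bochner_Integration.integral_cong refl eq; assumption)+
    ultimately show ?thesis by simp
  qed
  \<comment> \<open>Measurability of \<open>aH\<close> is recovered from that of \<open>aK\<close>,
    which is part of integrability, and of \<open>g\<close>, a limit of measurable
    functions.\<close>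
  have aHm: "aH \<in> borel_measurable N"
  proof -
    have "aK \<in> borel_measurable N" "g \<in> borel_measurable N" using \<mu>(2) gm bm by auto
    then have "(\<lambda>y. aK (\<Psi>i y) - g (\<Psi>i y)) \<in> borel_measurable N"
      by (intro borel_measurable_diff measurable_compose[OF \<Psi>(2)])
    moreover have "aK (\<Psi>i y) - g (\<Psi>i y) = aH y" if "y \<in> space N" for y
      using act[of "\<Psi>i y"] \<Psi>(3)[OF that] measurable_space[OF \<Psi>(2) that] by simp
    ultimately show ?thesis by (subst measurable_cong[symmetric])
  qed
  show "integrable ?\<nu> aH" using integrable_distr_eq[OF \<Psi>\<mu> aHm] aH\<Psi> by blast
  show "integral\<^sup>L ?\<nu> aH = integral\<^sup>L \<mu> aK" using integral_distr[OF \<Psi>\<mu> aHm] aH\<Psi> by simp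
qed

section \<open>Borel structures and the circle of times\<close>

lemma space_borel_of_topology: "space (borel_of_topology X) = topspace X"
  unfolding borel_of_topology_def by (rule space_measure_of_conv)

lemma sets_borel_of_topology: "sets (borel_of_topology X) = sigma_sets (topspace X) {W. openin X W}"
  unfolding borel_of_topology_def by (rule sets_measure_of) (use openin_subset in blast)

lemma measurable_borel_of_topology:
  assumes "continuous_map X Y f"
  shows "f \<in> measurable (borel_of_topology X) (borel_of_topology Y)"
  unfolding borel_of_topology_def[of Y]
proof (rule measurable_sigma_sets[OF sets_measure_of])
  show "{W. openin Y W} \<subseteq> Pow (topspace Y)" "{W. openin Y W} \<subseteq> Pow (topspace Y)" using openin_subset by blast+
  show "f \<in> space (borel_of_topology X) \<rightarrow> topspace Y"
    using continuous_map_image_subset_topspace[OF assms] by (auto simp: space_borel_of_topology)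
  fix W assume "W \<in> {W. openin Y W}"
  then have "openin X {x \<in> topspace X. f x \<in> W}" using openin_continuous_map_preimage[OF assms] by blast
  moreover have "f -` W \<inter> space (borel_of_topology X) = {x \<in> topspace X. f x \<in> W}"
    by (auto simp: space_borel_of_topology)
  ultimately show "f -` W \<inter> space (borel_of_topology X) \<in> sets (borel_of_topology X)"
    by (simp add: sets_borel_of_topology sigma_sets.Basic)
qed

lemma borel_measurable_borel_of_topology:
  assumes "continuous_map X euclideanreal f"
  shows "f \<in> borel_measurable (borel_of_topology X)"
proof (rule borel_measurableI)
  fix W :: "real set" assume "open W"
  then have "openin X {x \<in> topspace X. f x \<in> W}" using openin_continuous_map_preimage[OF assms] by simp
  moreover have "f -` W \<inter> space (borel_of_topology X) = {x \<in> topspace X. f x \<in> W}"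
    by (auto simp: space_borel_of_topology)
  ultimately show "f -` W \<inter> space (borel_of_topology X) \<in> sets (borel_of_topology X)"
    by (simp add: sets_borel_of_topology sigma_sets.Basic)
qed

lemma openin_circle: "openin circle_topology W \<longleftrightarrow> W \<subseteq> range time_class \<and> open (time_class -` W)"
proof -
  have "istopology (\<lambda>W. W \<subseteq> range time_class \<and> open (time_class -` W))"
    unfolding istopology_def by (auto simp: vimage_Union)
  then show ?thesis by (simp add: circle_topology_def)
qed

lemma topspace_circle: "topspace circle_topology = range time_class"
proof -
  have "time_class -` range time_class = UNIV" by auto
  then have "openin circle_topology (range time_class)" by (simp add: openin_circle)
  then have "range time_class \<subseteq> topspace circle_topology" by (rule openin_subset)
  moreover have "topspace circle_topology \<subseteq> range time_class"
    using openin_topspace[of circle_topology] unfolding openin_circle by (rule conjunct1)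
  ultimately show ?thesis by (intro equalityI)
qed

lemma time_class_some: "\<exists>n. (SOME s. s \<in> time_class t) = t + of_int n"
proof -
  have "t \<in> time_class t" by (simp add: time_class_def)
  then have "(SOME s. s \<in> time_class t) \<in> time_class t" by (rule someI)
  then have "(SOME s. s \<in> time_class t) - t \<in> \<int>" by (simp only: time_class_def mem_Collect_eq)
  then obtain n where "(SOME s. s \<in> time_class t) - t = of_int n" by (auto elim: Ints_cases)
  then show ?thesis by (intro exI[of _ n]) simp
qed

lemma continuous_map_time_class: "continuous_map euclideanreal circle_topology time_class"
  unfolding continuous_map_def by (auto simp: topspace_circle openin_circle vimage_def)

lemma open_map_time_class: "open_map euclideanreal circle_topology time_class"
  unfolding open_map_def openin_circle
proof (intro allI impI conjI)
  fix U :: "real set" assume U: "openin euclideanreal U"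
  have "time_class -` (time_class ` U) = (\<Union>n. (\<lambda>s. s + of_int n) -` U)"
  proof (intro equalityI subsetI)
    fix s assume "s \<in> time_class -` (time_class ` U)"
    then obtain r where "r \<in> U" "time_class s = time_class r" by auto
    then obtain n where "r = s + of_int n" unfolding time_class_shift by blast
    then show "s \<in> (\<Union>n. (\<lambda>s. s + of_int n) -` U)" using \<open>r \<in> U\<close> by auto
  next
    fix s assume "s \<in> (\<Union>n. (\<lambda>s. s + of_int n) -` U)"
    then obtain n where n: "s + of_int n \<in> U" by auto
    moreover have "time_class s = time_class (s + of_int n)" unfolding time_class_shift by blast
    ultimately show "s \<in> time_class -` (time_class ` U)" by blast
  qed
  moreover have "open ((\<lambda>s. s + of_int n) -` U)" for n :: int
    using U by (intro open_vimage) (auto intro!: continuous_intros)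
  ultimately show "open (time_class -` (time_class ` U))" by auto
qed auto

text \<open>Multiplying a quotient map by a space can destroy the quotient property; here the
  projection of the line to the circle is open, and openness passes to the product.\<close>

lemma quotient_map_time_class_prod:
  "quotient_map (prod_topology euclideanreal X) (prod_topology circle_topology X) (\<lambda>(t, w). (time_class t, w))"
proof (rule continuous_open_imp_quotient_map)
  show "continuous_map (prod_topology euclideanreal X) (prod_topology circle_topology X) (\<lambda>(t, w). (time_class t, w))"
    using continuous_map_compose[OF continuous_map_fst continuous_map_time_class, of X]
    by (simp add: case_prod_unfold continuous_map_pairedI continuous_map_snd o_def)
  show "open_map (prod_topology euclideanreal X) (prod_topology circle_topology X) (\<lambda>(t, w). (time_class t, w))"
    unfolding open_map_def
  proof (intro allI impI)
    fix W assume W: "openin (prod_topology euclideanreal X) W"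
    show "openin (prod_topology circle_topology X) ((\<lambda>(t, w). (time_class t, w)) ` W)"
    proof (subst openin_subopen, rule ballI)
      fix y assume "y \<in> (\<lambda>(t, w). (time_class t, w)) ` W"
      then obtain t w where tw: "(t, w) \<in> W" "y = (time_class t, w)" by auto
      obtain U V where UV: "openin euclideanreal U" "openin X V" "t \<in> U" "w \<in> V" "U \<times> V \<subseteq> W"
        using W tw(1) unfolding openin_prod_topology_alt by meson
      have "openin (prod_topology circle_topology X) (time_class ` U \<times> V)"
        using open_map_time_class UV by (simp add: openin_prod_Times_iff open_map_def)
      moreover have "y \<in> time_class ` U \<times> V" using UV tw by blast
      moreover have "time_class ` U \<times> V \<subseteq> (\<lambda>(t, w). (time_class t, w)) ` W"
        using UV(5) by (auto intro!: rev_image_eqI)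
      ultimately show "\<exists>T. openin (prod_topology circle_topology X) T \<and> y \<in> T \<and> T \<subseteq> (\<lambda>(t, w). (time_class t, w)) ` W"
        by blast
    qed
  qed
  show "(\<lambda>(t, w). (time_class t, w)) ` topspace (prod_topology euclideanreal X) = topspace (prod_topology circle_topology X)"
    by (auto simp: topspace_circle image_iff)
qed

lemma continuous_map_phase:
  assumes "continuous_map (prod_topology euclideanreal (manifold_topology (tangent_atlas A))) Y (\<lambda>(t, w). f (time_class t, w))"
  shows "continuous_map (phase_topology A) Y f"
  unfolding phase_topology_def
  by (rule continuous_compose_quotient_map[OF quotient_map_time_class_prod])
    (use assms in \<open>simp add: o_def case_prod_unfold\<close>)

section \<open>Continuity and boundedness of the terms of the action\<close>

context closed_manifold begin

lemma liouville_vf_continuous: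
  assumes H: "smooth_ham H" and \<eta>: "closed_one_form A \<eta>"
  shows "continuous_map (prod_topology euclideanreal Cot) euclideanreal (\<lambda>(t, z). liouville_vf \<eta> H t z)"
proof (rule continuous_map_real_atlas[OF topological_cotangent])
  fix z assume z: "z \<in> points (cotangent_atlas A)"
  obtain c where c: "c \<in> A" "z \<in> chart_dom (cb c)" using point_chart[OF z] by blast
  let ?\<Lambda> = "\<lambda>x. (snd (snd x) - \<eta> (chart_inv c (fst (snd x))) c) \<bullet> fst (vf c H x)"
  have 1: "continuous_on (chart_map c ` chart_dom c) (\<lambda>x. \<eta> (chart_inv c x) c)"
    by (rule smooth_on_continuous[OF one_form_local(1)[OF \<eta> c(1)]])
  have "continuous_on (cdom c) ?\<Lambda>"
    by (intro continuous_intros smooth_on_continuous[OF vf_smooth[OF H c(1)]] continuous_on_compose2[OF 1])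
      (auto simp: cdom_iff[OF c(1)])
  moreover have "liouville_vf \<eta> H t' z' = ?\<Lambda> (t', chart_map (cb c) z')" if z': "z' \<in> chart_dom (cb c)" for t' z'
  proof -
    have zM: "z' \<in> points (cotangent_atlas A)" by (rule cb_dom_points[OF c(1) z'])
    have "c \<in> charts_at A (fst z')" using z' c by (simp add: charts_at_def bundle_dom)
    from liouville_vf_eq[OF H zM \<eta> this, of t'] show ?thesis
      using inv_map[OF c(1), of "fst z'"] z' by (simp add: liouville_def bundle_dom)
  qed
  ultimately show "\<exists>c\<in>cotangent_atlas A. \<exists>\<Lambda>. z \<in> chart_dom c \<and>
      continuous_on (UNIV \<times> chart_map c ` chart_dom c) \<Lambda> \<and>
      (\<forall>t'. \<forall>z'\<in>chart_dom c. (case (t', z') of (t, z) \<Rightarrow> liouville_vf \<eta> H t z) = \<Lambda> (t', chart_map c z'))"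
    unfolding prod.case cdom_def using c by (intro bexI[OF _ cb_atlas[OF c(1)]] exI[of _ ?\<Lambda>]) blast
qed

lemma ham_continuous:
  assumes H: "smooth_ham H"
  shows "continuous_map (prod_topology euclideanreal Cot) euclideanreal (\<lambda>(t, z). H t z)"
proof (rule continuous_map_real_atlas[OF topological_cotangent])
  fix z assume z: "z \<in> points (cotangent_atlas A)"
  obtain c where c: "c \<in> A" "z \<in> chart_dom (cb c)" using point_chart[OF z] by blast
  have "continuous_on (cdom c) (ham c H)" by (rule smooth_on_continuous[OF ham_smooth[OF H c(1)]])
  moreover have "H t' z' = ham c H (t', chart_map (cb c) z')" if "z' \<in> chart_dom (cb c)" for t' z'
    using cb_inv_map[OF c(1) that] by (simp add: ham_def del: bundle_map)
  ultimately show "\<exists>c\<in>cotangent_atlas A. \<exists>\<Lambda>. z \<in> chart_dom c \<and>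
      continuous_on (UNIV \<times> chart_map c ` chart_dom c) \<Lambda> \<and>
      (\<forall>t'. \<forall>z'\<in>chart_dom c. (case (t', z') of (t, z) \<Rightarrow> H t z) = \<Lambda> (t', chart_map c z'))"
    unfolding prod.case cdom_def using c by (intro bexI[OF _ cb_atlas[OF c(1)]] exI[of _ "ham c H"]) blast
qed

end

context hamiltonian_isotopy begin

lemma action_continuous: "continuous_map Cot euclideanreal (\<lambda>z. potential z 1)"
proof -
  \<comment> \<open>The criterion concerns functions of time and point, so a dummy time is added and
    afterwards set to 0.\<close>
  have "continuous_map (prod_topology euclideanreal Cot) euclideanreal (\<lambda>(t::real, z). potential z 1)"
  proof (rule continuous_map_real_atlas[OF topological_cotangent])
    fix z assume z: "z \<in> M"
    obtain c where c: "c \<in> A" "z \<in> chart_dom (cb c)" using point_chart[OF z] by blast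
    let ?S = "chart_map (cb c) ` chart_dom (cb c)"
    have "isCont (\<lambda>y. potential (chart_inv (cb c) y) 1) y" if y: "y \<in> ?S" for y
    proof -
      obtain w where w: "w \<in> chart_dom (cb c)" "y = chart_map (cb c) w" using y by blast
      have wM: "w \<in> M" by (rule cb_dom_points[OF c(1) w(1)])
      have "c \<in> charts_at A (fst w)" using w c by (auto simp: charts_at_def bundle_dom)
      from flow_good[OF wM this, of 1] point_charts_at[OF \<Phi>_points[OF wM, of 1]]
      obtain D where "((\<lambda>y. potential (chart_inv (cb c) y) 1) has_derivative D) (at y)"
        unfolding flow_good_def flow_derivative_def w(2) by auto
      then show ?thesis by (rule has_derivative_continuous)
    qed
    then have "continuous_on ?S (\<lambda>y. potential (chart_inv (cb c) y) 1)"
      by (intro continuous_at_imp_continuous_on) blast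
    then have "continuous_on (UNIV \<times> ?S) (\<lambda>x::real \<times> 'e \<times> 'e. potential (chart_inv (cb c) (snd x)) 1)"
      by (rule continuous_on_compose2[OF _ continuous_on_snd[OF continuous_on_id]]) auto
    moreover have "potential z' 1 = potential (chart_inv (cb c) (snd (t' :: real, chart_map (cb c) z'))) 1" if "z' \<in> chart_dom (cb c)" for t' z'
      using cb_inv_map[OF c(1) that] by (simp del: bundle_map)
    ultimately show "\<exists>c\<in>cotangent_atlas A. \<exists>\<Lambda>. z \<in> chart_dom c \<and>
      continuous_on (UNIV \<times> chart_map c ` chart_dom c) \<Lambda> \<and>
      (\<forall>t'. \<forall>z'\<in>chart_dom c. (case (t' :: real, z') of (t, z) \<Rightarrow> potential z 1) = \<Lambda> (t', chart_map c z'))"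
      unfolding prod.case using c by (intro bexI[OF _ cb_atlas[OF c(1)]] exI[of _ "\<lambda>x. potential (chart_inv (cb c) (snd x)) 1"]) blast
  qed
  from continuous_map_compose[OF _ this, of Cot "\<lambda>z. (0, z)"] show ?thesis
    by (simp add: o_def continuous_map_pairedI continuous_map_id[unfolded id_def])
qed

lemma action_bounded: "\<exists>B. \<forall>z\<in>M. \<bar>potential z 1\<bar> \<le> B"
proof -
  have "compactin euclideanreal ((\<lambda>z. potential z 1) ` K0)" by (rule image_compactin[OF K0(1) action_continuous])
  then have "bounded ((\<lambda>z. potential z 1) ` K0)" by (simp add: compact_imp_bounded)
  then obtain B where B: "\<And>z. z \<in> K0 \<Longrightarrow> \<bar>potential z 1\<bar> \<le> B" by (auto simp: bounded_iff)
  have "\<bar>potential z 1\<bar> \<le> max B 0" if "z \<in> M" for z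
    using B[of z] action_outside[OF that] by (cases "z \<in> K0") auto
  then show ?thesis by blast
qed

definition \<phi>i :: "'m \<times> ('m, 'e) coords \<Rightarrow> 'm \<times> ('m, 'e) coords" where
  "\<phi>i = inv_into M (\<Phi> 1)"

lemma \<phi>i: "z \<in> M \<Longrightarrow> \<phi>i z \<in> M" "z \<in> M \<Longrightarrow> \<Phi> 1 (\<phi>i z) = z" "z \<in> M \<Longrightarrow> \<phi>i (\<Phi> 1 z) = z"
proof -
  have s: "\<Phi> 1 ` M = M" by (rule flow_surjective) simp
  have i: "inj_on (\<Phi> 1) M" using \<Phi>_inj by (blast intro: inj_onI)
  show "z \<in> M \<Longrightarrow> \<phi>i z \<in> M" "z \<in> M \<Longrightarrow> \<Phi> 1 (\<phi>i z) = z" "z \<in> M \<Longrightarrow> \<phi>i (\<Phi> 1 z) = z"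
    using inv_into_into[of z "\<Phi> 1" M] f_inv_into_f[of z "\<Phi> 1" M] inv_into_f_f[OF i] s by (simp_all add: \<phi>i_def)
qed

lemma \<phi>i_continuous: "continuous_map Cot Cot \<phi>i"
  unfolding continuous_map_def topspace_Cot
proof (intro conjI allI impI)
  show "\<phi>i \<in> M \<rightarrow> M" using \<phi>i by blast
  fix U assume U: "openin Cot U"
  have "{z \<in> M. \<phi>i z \<in> U} = \<Phi> 1 ` U"
  proof (intro equalityI subsetI)
    fix z assume "z \<in> {z \<in> M. \<phi>i z \<in> U}"
    then show "z \<in> \<Phi> 1 ` U" using \<phi>i(2)[of z] by (intro image_eqI[of _ _ "\<phi>i z"]) auto
  next
    fix z assume "z \<in> \<Phi> 1 ` U"
    then obtain w where "w \<in> U" "z = \<Phi> 1 w" by blast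
    then show "z \<in> {z \<in> M. \<phi>i z \<in> U}" using openin_Cot_subset[OF U] \<phi>i(3)[of w] \<Phi>_points[of w 1] by auto
  qed
  then show "openin Cot {z \<in> M. \<phi>i z \<in> U}" using flow_open_map[of 1] U by (simp add: open_map_def)
qed

end

section \<open>Invariance of the alpha function\<close>

context periodic_tonelli begin

lemma liouville_vf_shift: "z \<in> M \<Longrightarrow> liouville_vf \<eta> H (t + of_int n) z = liouville_vf \<eta> H t z"
  by (simp add: liouville_vf_def velocity_shift)

lemma orbit_exists: "z \<in> M \<Longrightarrow> \<exists>u. orbit H u \<and> u t = z"
  using complete_H unfolding complete_flow_def by blast

lemma action_integrand_legendre:
  assumes \<tau>: "(SOME s. s \<in> \<tau>) = t" and z: "z \<in> M"
  shows "action_integrand A Lag \<eta> (\<tau>, legendre t z) = liouville_vf \<eta> H t z - H t z"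
  using lagrangian_legendre[OF z, of t]
  unfolding action_integrand_def prod.case \<tau> liouville_vf_def by (simp add: legendre_def split_beta)

end

text \<open>The choice made in \<open>action_integrand\<close>. It need not depend continuously on
  the time class, but periodicity makes its value immaterial.\<close>

abbreviation representative :: "real set \<Rightarrow> real" where
  "representative \<tau> \<equiv> (SOME t. t \<in> \<tau>)"

section \<open>The conjugacy of the Euler-Lagrange flows on the phase space\<close>

context conjugated begin

abbreviation "TM \<equiv> points (tangent_atlas A)"
abbreviation "P \<equiv> phase_topology A"

definition conj_fwd :: "real set \<times> 'm \<times> ('m, 'e) coords \<Rightarrow> real set \<times> 'm \<times> ('m, 'e) coords" where
  "conj_fwd = (\<lambda>(\<tau>, w). (\<tau>, H.legendre (representative \<tau>) (\<phi> (K.legendre_inv (representative \<tau>) w))))"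

definition conj_bwd :: "real set \<times> 'm \<times> ('m, 'e) coords \<Rightarrow> real set \<times> 'm \<times> ('m, 'e) coords" where
  "conj_bwd = (\<lambda>(\<tau>, w). (\<tau>, K.legendre (representative \<tau>) (\<phi>i (H.legendre_inv (representative \<tau>) w))))"

text \<open>The sign makes \<open>defect\<close> its derivative along the flow of \<open>K\<close>;
  \<open>defect\<close> is the amount by which the two action integrands differ.\<close>

definition phase_potential :: "real set \<times> 'm \<times> ('m, 'e) coords \<Rightarrow> real" where
  "phase_potential = (\<lambda>(\<tau>, w). - potential (K.legendre_inv (representative \<tau>) w) 1)"

definition defect :: "real set \<times> 'm \<times> ('m, 'e) coords \<Rightarrow> real" where
  "defect = (\<lambda>(\<tau>, w). let t = representative \<tau>; z = K.legendre_inv t w in liouville_vf \<eta> K t z - liouville_vf \<eta> H t (\<phi> z))"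

lemma topspace_phase: "topspace P = range time_class \<times> TM"
  by (simp add: phase_topology_def topspace_circle topspace_Tan)

lemma phase_cases:
  assumes "y \<in> topspace P"
  obtains t z where "y = (time_class t, K.legendre t z)" "z \<in> M"
proof -
  obtain t w where "y = (time_class t, w)" "w \<in> TM" using assms by (auto simp: topspace_phase)
  then show thesis using K.legendre_inv_points[of w t] K.legendre_legendre_inv[of w t] that[of t "K.legendre_inv t w"] by simp
qed

lemma phase_cases_H:
  assumes "y \<in> topspace P"
  obtains t z where "y = (time_class t, H.legendre t (\<phi> z))" "z \<in> M"
proof -
  obtain t w where w: "y = (time_class t, w)" "w \<in> TM" using assms by (auto simp: topspace_phase)
  have "\<phi> (\<phi>i (H.legendre_inv t w)) = H.legendre_inv t w" by (rule \<phi>i(2)[OF H.legendre_inv_points[OF w(2)]])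
  then show thesis
    using w \<phi>i(1)[OF H.legendre_inv_points[OF w(2), of t]] H.legendre_legendre_inv[OF w(2), of t] that[of t "\<phi>i (H.legendre_inv t w)"] by simp
qed

lemma representative_shift:
  obtains n where "representative (time_class t) = t + of_int n"
  using time_class_some[of t] by blast

text \<open>Any real time of the class may replace the representative; continuity and the
  conjugation of the flows are verified in this form.\<close>

lemma conj_fwd_eq:
  assumes z: "z \<in> M"
  shows "conj_fwd (time_class t, K.legendre t z) = (time_class t, H.legendre t (\<phi> z))"
proof -
  obtain n where n: "representative (time_class t) = t + of_int n" by (rule representative_shift)
  show ?thesis
    using z K.legendre_points[OF z, of t] \<Phi>_points[OF z, of 1]
    by (simp add: conj_fwd_def n K.legendre_inv_shift K.legendre_inv_legendre H.legendre_shift)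
qed

lemma conj_bwd_eq:
  assumes z: "z \<in> M"
  shows "conj_bwd (time_class t, H.legendre t (\<phi> z)) = (time_class t, K.legendre t z)"
proof -
  obtain n where n: "representative (time_class t) = t + of_int n" by (rule representative_shift)
  show ?thesis
    using z H.legendre_points[OF \<Phi>_points[OF z, of 1], of t] \<Phi>_points[OF z, of 1]
    by (simp add: conj_bwd_def n H.legendre_inv_shift H.legendre_inv_legendre K.legendre_shift \<phi>i(3))
qed

lemma phase_potential_eq:
  assumes z: "z \<in> M"
  shows "phase_potential (time_class t, K.legendre t z) = - potential z 1"
proof -
  obtain n where n: "representative (time_class t) = t + of_int n" by (rule representative_shift)
  show ?thesis using z K.legendre_points[OF z, of t] by (simp add: phase_potential_def n K.legendre_inv_shift K.legendre_inv_legendre)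
qed

lemma defect_eq:
  assumes z: "z \<in> M"
  shows "defect (time_class t, K.legendre t z) = liouville_vf \<eta> K t z - liouville_vf \<eta> H t (\<phi> z)"
proof -
  obtain n where n: "representative (time_class t) = t + of_int n" by (rule representative_shift)
  show ?thesis using z K.legendre_points[OF z, of t] \<Phi>_points[OF z, of 1]
    by (simp add: defect_def n Let_def K.legendre_inv_shift K.legendre_inv_legendre K.liouville_vf_shift H.liouville_vf_shift)
qed

lemma conj_inverse: "y \<in> topspace P \<Longrightarrow> conj_fwd (conj_bwd y) = y" "y \<in> topspace P \<Longrightarrow> conj_bwd (conj_fwd y) = y"
proof -
  assume y: "y \<in> topspace P"
  from y obtain t z where "y = (time_class t, H.legendre t (\<phi> z))" "z \<in> M" by (rule phase_cases_H)
  then show "conj_fwd (conj_bwd y) = y" by (simp add: conj_fwd_eq conj_bwd_eq)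
  from y obtain t z where "y = (time_class t, K.legendre t z)" "z \<in> M" by (rule phase_cases)
  then show "conj_bwd (conj_fwd y) = y" by (simp add: conj_fwd_eq conj_bwd_eq)
qed

lemma conj_fwd_continuous: "continuous_map P P conj_fwd"
proof (rule continuous_map_phase)
  let ?X = "prod_topology euclideanreal Tan"
  have "continuous_map ?X Cot (\<lambda>y. \<phi> (K.legendre_inv (fst y) (snd y)))"
    using continuous_map_compose[OF K.legendre_inv_continuous flow_continuous[of 1]] by (simp add: o_def case_prod_unfold)
  then have "continuous_map ?X Tan (\<lambda>y. H.legendre (fst y) (\<phi> (K.legendre_inv (fst y) (snd y))))"
    using continuous_map_compose[OF _ H.legendre_continuous, of ?X "\<lambda>y. (fst y, \<phi> (K.legendre_inv (fst y) (snd y)))"]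
    by (simp add: o_def continuous_map_pairedI continuous_map_fst)
  moreover have "continuous_map ?X circle_topology (\<lambda>y. time_class (fst y))"
    using continuous_map_compose[OF continuous_map_fst continuous_map_time_class, of Tan] by (simp add: o_def)
  ultimately have "continuous_map ?X P (\<lambda>y. (time_class (fst y), H.legendre (fst y) (\<phi> (K.legendre_inv (fst y) (snd y)))))"
    unfolding phase_topology_def by (rule continuous_map_pairedI[rotated])
  moreover have "(time_class (fst y), H.legendre (fst y) (\<phi> (K.legendre_inv (fst y) (snd y)))) = conj_fwd (time_class (fst y), snd y)"
    if "y \<in> topspace ?X" for y
  proof -
    have "snd y \<in> TM" using that by (auto simp: topspace_Tan)
    then show ?thesis
      using conj_fwd_eq[OF K.legendre_inv_points, of "snd y" "fst y" "fst y"] by (simp add: K.legendre_legendre_inv)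
  qed
  ultimately show "continuous_map ?X P (\<lambda>(t, w). conj_fwd (time_class t, w))"
    unfolding case_prod_unfold by (rule continuous_map_eq)
qed

lemma conj_bwd_continuous: "continuous_map P P conj_bwd"
proof (rule continuous_map_phase)
  let ?X = "prod_topology euclideanreal Tan"
  have "continuous_map ?X Cot (\<lambda>y. \<phi>i (H.legendre_inv (fst y) (snd y)))"
    using continuous_map_compose[OF H.legendre_inv_continuous \<phi>i_continuous] by (simp add: o_def case_prod_unfold)
  then have "continuous_map ?X Tan (\<lambda>y. K.legendre (fst y) (\<phi>i (H.legendre_inv (fst y) (snd y))))"
    using continuous_map_compose[OF _ K.legendre_continuous, of ?X "\<lambda>y. (fst y, \<phi>i (H.legendre_inv (fst y) (snd y)))"]
    by (simp add: o_def continuous_map_pairedI continuous_map_fst)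
  moreover have "continuous_map ?X circle_topology (\<lambda>y. time_class (fst y))"
    using continuous_map_compose[OF continuous_map_fst continuous_map_time_class, of Tan] by (simp add: o_def)
  ultimately have "continuous_map ?X P (\<lambda>y. (time_class (fst y), K.legendre (fst y) (\<phi>i (H.legendre_inv (fst y) (snd y)))))"
    unfolding phase_topology_def by (rule continuous_map_pairedI[rotated])
  moreover have "(time_class (fst y), K.legendre (fst y) (\<phi>i (H.legendre_inv (fst y) (snd y)))) = conj_bwd (time_class (fst y), snd y)"
    if "y \<in> topspace ?X" for y
  proof -
    have w: "snd y \<in> TM" using that by (auto simp: topspace_Tan)
    note h = H.legendre_inv_points[OF w, of "fst y"]
    show ?thesis
      using conj_bwd_eq[OF \<phi>i(1)[OF h], of "fst y"] by (simp add: \<phi>i(2)[OF h] H.legendre_legendre_inv[OF w])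
  qed
  ultimately show "continuous_map ?X P (\<lambda>(t, w). conj_bwd (time_class t, w))"
    unfolding case_prod_unfold by (rule continuous_map_eq)
qed

lemma phase_potential_continuous: "continuous_map P euclideanreal phase_potential"
proof (rule continuous_map_phase)
  let ?X = "prod_topology euclideanreal Tan"
  have "continuous_map ?X euclideanreal (\<lambda>y. - potential (K.legendre_inv (fst y) (snd y)) 1)"
    using continuous_map_compose[OF K.legendre_inv_continuous action_continuous]
    by (intro continuous_map_minus) (simp add: o_def case_prod_unfold)
  moreover have "- potential (K.legendre_inv (fst y) (snd y)) 1 = phase_potential (time_class (fst y), snd y)" if "y \<in> topspace ?X" for y
  proof -
    have "snd y \<in> TM" using that by (auto simp: topspace_Tan)
    then show ?thesis
      using phase_potential_eq[OF K.legendre_inv_points, of "snd y" "fst y" "fst y"] by (simp add: K.legendre_legendre_inv)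
  qed
  ultimately show "continuous_map ?X euclideanreal (\<lambda>(t, w). phase_potential (time_class t, w))"
    unfolding case_prod_unfold by (rule continuous_map_eq)
qed

lemma flow_K:
  assumes u: "orbit K u"
  shows "euler_lagrange_flow A K.Lag s (time_class t, K.legendre t (u t)) = (time_class (t + s), K.legendre (t + s) (u (t + s)))"
  by (rule K.euler_lagrange_flow_eq[OF u])

lemma flow_H:
  assumes u: "orbit K u"
  shows "euler_lagrange_flow A H.Lag s (time_class t, H.legendre t (\<phi> (u t))) = (time_class (t + s), H.legendre (t + s) (\<phi> (u (t + s))))"
  by (rule H.euler_lagrange_flow_eq[OF conjugate_orbit[OF u]])

lemma flow_conj:
  assumes y: "y \<in> topspace P"
  shows "euler_lagrange_flow A H.Lag s (conj_fwd y) = conj_fwd (euler_lagrange_flow A K.Lag s y)"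
proof -
  obtain t z where z: "y = (time_class t, K.legendre t z)" "z \<in> M" using y by (rule phase_cases)
  obtain u where u: "orbit K u" "u t = z" using K.orbit_exists[OF z(2)] by blast
  have uM: "u r \<in> M" for r by (rule orbit_points[OF u(1)])
  show ?thesis
    unfolding z(1) u(2)[symmetric] flow_K[OF u(1)] conj_fwd_eq[OF uM] flow_H[OF u(1)] ..
qed

lemma flow_conj_bwd:
  assumes y: "y \<in> topspace P"
  shows "euler_lagrange_flow A K.Lag s (conj_bwd y) = conj_bwd (euler_lagrange_flow A H.Lag s y)"
proof -
  obtain t z where z: "y = (time_class t, H.legendre t (\<phi> z))" "z \<in> M" using y by (rule phase_cases_H)
  obtain u where u: "orbit K u" "u t = z" using K.orbit_exists[OF z(2)] by blast
  have uM: "u r \<in> M" for r by (rule orbit_points[OF u(1)])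
  show ?thesis
    unfolding z(1) u(2)[symmetric] flow_H[OF u(1)] conj_bwd_eq[OF uM] flow_K[OF u(1)] ..
qed

text \<open>\<open>K\<close> at \<open>z\<close> and \<open>H\<close> at \<open>\<phi> z\<close> are
  equal and cancel, so only the two values of \<open>\<theta>\<close> remain.\<close>

lemma action_defect:
  assumes y: "y \<in> topspace P"
  shows "action_integrand A K.Lag \<eta> y = action_integrand A H.Lag \<eta> (conj_fwd y) + defect y"
proof -
  obtain t w where w: "y = (time_class t, w)" "w \<in> TM" using y by (auto simp: topspace_phase)
  let ?r = "representative (time_class t)"
  define z where "z = K.legendre_inv ?r w"
  have z: "z \<in> M" "K.legendre ?r z = w" using K.legendre_inv_points[OF w(2)] K.legendre_legendre_inv[OF w(2)] by (simp_all add: z_def)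
  have "conj_fwd y = (time_class t, H.legendre ?r (\<phi> z))" by (simp add: conj_fwd_def w(1) z_def)
  then show ?thesis
    using K.action_integrand_legendre[OF refl z(1), where \<tau> = "time_class t" and \<eta> = \<eta>] H.action_integrand_legendre[OF refl \<Phi>_points[OF z(1), of 1], where \<tau> = "time_class t" and \<eta> = \<eta>]
    by (simp add: w(1) z(2) defect_def Let_def z_def[symmetric] K_eq[OF z(1)])
qed

text \<open>Over \<open>K0\<close> the continuous difference is bounded for times in
  \<open>{0..1}\<close>, and periodicity extends the bound to all times. Off \<open>K0\<close> an
  orbit of \<open>K\<close> moves for a short while in the open complement, where the potential
  vanishes, so the difference, being the derivative of the potential along the orbit, is 0.\<close>

lemma defect_bounded: "\<exists>B. \<forall>t. \<forall>z\<in>M. \<bar>liouville_vf \<eta> H t (\<phi> z) - liouville_vf \<eta> K t z\<bar> \<le> B"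
proof -
  let ?f = "\<lambda>(t, z). liouville_vf \<eta> H t (\<phi> z) - liouville_vf \<eta> K t z"
  let ?X = "prod_topology euclideanreal Cot"
  have "continuous_map ?X ?X (\<lambda>y. (fst y, \<phi> (snd y)))"
    using continuous_map_compose[OF continuous_map_snd flow_continuous[of 1], of euclideanreal]
    by (simp add: continuous_map_pairedI continuous_map_fst o_def)
  from continuous_map_compose[OF this liouville_vf_continuous[OF H.H \<eta>]]
  have "continuous_map ?X euclideanreal ?f"
    using liouville_vf_continuous[OF K.H \<eta>] by (simp add: case_prod_unfold o_def continuous_map_diff)
  moreover have "compactin ?X ({0..1} \<times> K0)" using K0(1) by (simp add: compactin_Times)
  ultimately have "compactin euclideanreal (?f ` ({0..1} \<times> K0))" using image_compactin by blast
  then have "bounded (?f ` ({0..1} \<times> K0))" by (simp add: compact_imp_bounded)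
  then obtain B where B: "\<And>t z. t \<in> {0..1} \<Longrightarrow> z \<in> K0 \<Longrightarrow> \<bar>?f (t, z)\<bar> \<le> B" by (fastforce simp: bounded_iff)
  have "\<bar>liouville_vf \<eta> H t (\<phi> z) - liouville_vf \<eta> K t z\<bar> \<le> max B 0" if z: "z \<in> M" for t z
  proof (cases "z \<in> K0")
    case True
    have "liouville_vf \<eta> H (frac t + of_int \<lfloor>t\<rfloor>) (\<phi> z) = liouville_vf \<eta> H (frac t) (\<phi> z)"
      "liouville_vf \<eta> K (frac t + of_int \<lfloor>t\<rfloor>) z = liouville_vf \<eta> K (frac t) z"
      using H.liouville_vf_shift[OF \<Phi>_points[OF z]] K.liouville_vf_shift[OF z] by blast+
    then have "liouville_vf \<eta> H t (\<phi> z) - liouville_vf \<eta> K t z = ?f (frac t, z)" by (simp add: frac_def)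
    moreover have "frac t \<in> {0..1}" using frac_ge_0[of t] frac_lt_1[of t] by simp
    ultimately show ?thesis using B[OF _ True, of "frac t"] by simp
  next
    case False
    obtain u where u: "orbit K u" "u t = z" using K.orbit_exists[OF z] by blast
    have op: "open {s. u s \<in> M - K0}"
      using openin_continuous_map_preimage[OF orbit_continuous[OF u(1)] complement_open] by simp
    have tS: "t \<in> {s. u s \<in> M - K0}" using u z False by simp
    have eq: "0 = potential (u s) 1" if "s \<in> {s. u s \<in> M - K0}" for s using action_outside[of "u s"] that by simp
    have "((\<lambda>s. potential (u s) 1) has_real_derivative 0) (at t)"
      by (rule has_field_derivative_transform_within_open[OF DERIV_const op tS eq])
    from DERIV_unique[OF action_derivative[OF u(1)] this] show ?thesis by (simp add: u(2))
  qed
  then show ?thesis by blast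
qed

lemma difference_quotient_limit:
  assumes "(f has_real_derivative D) (at t)"
  shows "(\<lambda>n. real (Suc n) * (f (t + 1 / real (Suc n)) - f t)) \<longlonglongrightarrow> D"
proof -
  have "((\<lambda>h. (f (t + h) - f t) / h) \<longlongrightarrow> D) (at 0)" using assms by (simp add: DERIV_def)
  moreover have "filterlim (\<lambda>n. 1 / real (Suc n)) (at 0) sequentially"
    unfolding filterlim_at using lim_inverse_n' LIMSEQ_Suc[OF lim_1_over_n] by (simp del: of_nat_Suc)
  ultimately have "(\<lambda>n. (f (t + 1 / real (Suc n)) - f t) / (1 / real (Suc n))) \<longlonglongrightarrow> D"
    by (rule filterlim_compose)
  then show ?thesis by (simp add: mult.commute del: of_nat_Suc)
qed

text \<open>Transport is applied in both directions. For the way back the map is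
  \<open>conj_bwd\<close>, and the correcting function is the same potential with opposite sign,
  read through \<open>conj_bwd\<close>.\<close>

lemma action_values_eq:
  "(\<exists>\<mu>\<in>invariant_measures A K.Lag. integrable \<mu> (action_integrand A K.Lag \<eta>) \<and> r = (\<integral>y. action_integrand A K.Lag \<eta> y \<partial>\<mu>)) \<longleftrightarrow>
   (\<exists>\<mu>\<in>invariant_measures A H.Lag. integrable \<mu> (action_integrand A H.Lag \<eta>) \<and> r = (\<integral>y. action_integrand A H.Lag \<eta> y \<partial>\<mu>))"
proof -
  let ?N = "borel_of_topology P"
  let ?fK = "euler_lagrange_flow A K.Lag" and ?fH = "euler_lagrange_flow A H.Lag"
  let ?aK = "action_integrand A K.Lag \<eta>" and ?aH = "action_integrand A H.Lag \<eta>"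
  have inv: "invariant_measures A L = invariant_probs ?N (euler_lagrange_flow A L)" for L
    by (simp add: invariant_measures_def invariant_probs_def)
  note sp = space_borel_of_topology[of P]
  have m: "conj_fwd \<in> measurable ?N ?N" "conj_bwd \<in> measurable ?N ?N"
    by (intro measurable_borel_of_topology conj_fwd_continuous conj_bwd_continuous)+
  have pm: "phase_potential \<in> borel_measurable ?N" by (rule borel_measurable_borel_of_topology[OF phase_potential_continuous])
  obtain B0 where B0: "\<And>z. z \<in> M \<Longrightarrow> \<bar>potential z 1\<bar> \<le> B0" using action_bounded by blast
  obtain Bd where Bd: "\<And>t z. z \<in> M \<Longrightarrow> \<bar>liouville_vf \<eta> H t (\<phi> z) - liouville_vf \<eta> K t z\<bar> \<le> Bd" using defect_bounded by blast
  have p_bd: "\<bar>phase_potential y\<bar> \<le> B0" if y: "y \<in> topspace P" for y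
  proof -
    obtain t z where "y = (time_class t, K.legendre t z)" "z \<in> M" using y by (rule phase_cases)
    then show ?thesis using B0 by (simp add: phase_potential_eq)
  qed
  have along: "\<bar>phase_potential (?fK h y) - phase_potential y\<bar> \<le> \<bar>h\<bar> * Bd"
    "(\<lambda>n. real (Suc n) * (phase_potential (?fK (1 / real (Suc n)) y) - phase_potential y)) \<longlonglongrightarrow> defect y" if y: "y \<in> topspace P" for y h
  proof -
    obtain t z where z: "y = (time_class t, K.legendre t z)" "z \<in> M" using y by (rule phase_cases)
    obtain u where u: "orbit K u" "u t = z" using K.orbit_exists[OF z(2)] by blast
    have uM: "u s \<in> M" for s by (rule orbit_points[OF u(1)])
    have p: "phase_potential (?fK h y) = - potential (u (t + h)) 1" for h
      unfolding z(1) u(2)[symmetric] flow_K[OF u(1)] phase_potential_eq[OF uM] ..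
    have p0: "phase_potential y = - potential (u t) 1" unfolding z(1) u(2)[symmetric] phase_potential_eq[OF uM] ..
    have d: "((\<lambda>s. potential (u s) 1) has_real_derivative liouville_vf \<eta> H s (\<phi> (u s)) - liouville_vf \<eta> K s (u s)) (at s)" for s
      by (rule action_derivative[OF u(1)])
    have "norm (potential (u (t + h)) 1 - potential (u t) 1) \<le> Bd * norm ((t + h) - t)"
      by (rule field_differentiable_bound[of UNIV "\<lambda>s. potential (u s) 1"
            "\<lambda>s. liouville_vf \<eta> H s (\<phi> (u s)) - liouville_vf \<eta> K s (u s)"]) (auto intro: d Bd[OF uM])
    then show "\<bar>phase_potential (?fK h y) - phase_potential y\<bar> \<le> \<bar>h\<bar> * Bd" by (simp add: p p0 mult.commute abs_minus_commute)
    have "defect y = - (liouville_vf \<eta> H t (\<phi> (u t)) - liouville_vf \<eta> K t (u t))"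
      unfolding z(1) u(2)[symmetric] defect_eq[OF uM] by simp
    moreover have "(\<lambda>n. real (Suc n) * (- potential (u (t + 1 / real (Suc n))) 1 - - potential (u t) 1)) \<longlonglongrightarrow>
       - (liouville_vf \<eta> H t (\<phi> (u t)) - liouville_vf \<eta> K t (u t))"
      by (rule difference_quotient_limit[OF DERIV_minus[OF d]])
    ultimately show "(\<lambda>n. real (Suc n) * (phase_potential (?fK (1 / real (Suc n)) y) - phase_potential y)) \<longlonglongrightarrow> defect y"
      by (simp only: p p0)
  qed
  have bwd: "conj_bwd y \<in> topspace P" if "y \<in> topspace P" for y
    using that measurable_space[OF m(2)] by (simp add: sp)
  note KH = transport_invariant_prob[OF m(1,2), where fH = ?fH and fK = ?fK and aK = ?aK and aH = ?aH
      and g = defect and S = phase_potential and bS = B0 and bD = Bd, unfolded sp, OF conj_inverse(1) flow_conj action_defect pm p_bd along]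
  have act': "?aH y = ?aK (conj_bwd y) + - defect (conj_bwd y)" if y: "y \<in> topspace P" for y
    using action_defect[OF bwd[OF y]] conj_inverse(1)[OF y] by simp
  have pm': "(\<lambda>y. - phase_potential (conj_bwd y)) \<in> borel_measurable ?N"
    using measurable_compose[OF m(2) pm] by simp
  have p_bd': "\<bar>- phase_potential (conj_bwd y)\<bar> \<le> B0" if "y \<in> topspace P" for y using p_bd[OF bwd[OF that]] by simp
  have along': "\<bar>- phase_potential (conj_bwd (?fH h y)) - - phase_potential (conj_bwd y)\<bar> \<le> \<bar>h\<bar> * Bd"
    "(\<lambda>n. real (Suc n) * (- phase_potential (conj_bwd (?fH (1 / real (Suc n)) y)) - - phase_potential (conj_bwd y))) \<longlonglongrightarrow> - defect (conj_bwd y)"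
    if y: "y \<in> topspace P" for y h
  proof -
    note f = flow_conj_bwd[OF y, symmetric]
    show "\<bar>- phase_potential (conj_bwd (?fH h y)) - - phase_potential (conj_bwd y)\<bar> \<le> \<bar>h\<bar> * Bd"
      using along(1)[OF bwd[OF y], of h] unfolding f by (simp add: abs_minus_commute)
    have "(\<lambda>n. - (real (Suc n) * (phase_potential (?fK (1 / real (Suc n)) (conj_bwd y)) - phase_potential (conj_bwd y)))) \<longlonglongrightarrow> - defect (conj_bwd y)"
      by (rule tendsto_minus[OF along(2)[OF bwd[OF y]]])
    then show "(\<lambda>n. real (Suc n) * (- phase_potential (conj_bwd (?fH (1 / real (Suc n)) y)) - - phase_potential (conj_bwd y))) \<longlonglongrightarrow> - defect (conj_bwd y)"
      unfolding f by (simp add: right_diff_distrib del: of_nat_Suc)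
  qed
  note HK = transport_invariant_prob[OF m(2,1), where fH = ?fK and fK = ?fH and aK = ?aH and aH = ?aK
      and g = "\<lambda>y. - defect (conj_bwd y)" and S = "\<lambda>y. - phase_potential (conj_bwd y)" and bS = B0 and bD = Bd,
      unfolded sp, OF conj_inverse(2) flow_conj_bwd act' pm' p_bd' along']
  show ?thesis
    unfolding inv
  proof
    assume "\<exists>\<mu>\<in>invariant_probs ?N ?fK. integrable \<mu> ?aK \<and> r = integral\<^sup>L \<mu> ?aK"
    then obtain \<mu> where \<mu>: "\<mu> \<in> invariant_probs ?N ?fK" "integrable \<mu> ?aK" "r = integral\<^sup>L \<mu> ?aK" by blast
    show "\<exists>\<mu>\<in>invariant_probs ?N ?fH. integrable \<mu> ?aH \<and> r = integral\<^sup>L \<mu> ?aH"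
      using KH[OF _ _ _ _ _ _ \<mu>(1,2)] \<mu>(3) by (intro bexI[of _ "distr \<mu> ?N conj_fwd"]) simp_all
  next
    assume "\<exists>\<mu>\<in>invariant_probs ?N ?fH. integrable \<mu> ?aH \<and> r = integral\<^sup>L \<mu> ?aH"
    then obtain \<mu> where \<mu>: "\<mu> \<in> invariant_probs ?N ?fH" "integrable \<mu> ?aH" "r = integral\<^sup>L \<mu> ?aH" by blast
    show "\<exists>\<mu>\<in>invariant_probs ?N ?fK. integrable \<mu> ?aK \<and> r = integral\<^sup>L \<mu> ?aK"
      using HK[OF _ _ _ _ _ _ \<mu>(1,2)] \<mu>(3) by (intro bexI[of _ "distr \<mu> ?N conj_bwd"]) simp_all
  qed
qed

end

text \<open>A class contains the form that generates it, because that form minus itself is the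
  differential of the constant 0; so the choice is made from a nonempty set, all of whose members
  are closed.\<close>

lemma first_cohomology_closed:
  assumes "a \<in> first_cohomology A"
  shows "closed_one_form A (SOME \<eta>. \<eta> \<in> a)"
proof -
  obtain \<theta> where \<theta>: "closed_one_form A \<theta>" "a = cohomologous A `` {\<theta>}"
    using assms by (auto simp: first_cohomology_def quotient_def)
  have "smooth_function A (\<lambda>_. 0)"
    by (simp add: smooth_function_def o_def smooth_on_const)
  moreover have "frechet_derivative ((\<lambda>_. 0 :: real) \<circ> chart_inv c) (at x) u = 0" for c :: "('a, 'b) chart" and x u
    using fun_cong[OF frechet_derivative_at[OF has_derivative_const[of "0::real" "at x"], symmetric]] by (simp add: o_def)
  ultimately have "(\<theta>, \<theta>) \<in> cohomologous A"
    using \<theta>(1) by (auto simp: cohomologous_def intro!: exI[of _ "\<lambda>_. 0"])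
  then have "\<theta> \<in> a" using \<theta>(2) by simp
  then have "(SOME \<eta>. \<eta> \<in> a) \<in> a" by (rule someI[of "\<lambda>\<eta>. \<eta> \<in> a"])
  then show ?thesis unfolding \<theta>(2) by (auto simp: cohomologous_def)
qed

theorem corollary1p12:
  fixes A :: "('m, 'e::real_inner) atlas"
    and H :: "('m, 'e) hamiltonian"
    and \<phi> :: "'m \<times> ('m, 'e) coords \<Rightarrow> 'm \<times> ('m, 'e) coords"
  assumes "closed_connected_manifold A"
    and "tonelli A H"
    and "time_periodic A H"
    and "\<phi> \<in> hamiltonian_group A"
    and "tonelli A (\<lambda>t z. H t (\<phi> z))"
  shows "\<forall>a\<in>first_cohomology A. mather_alpha A (\<lambda>t z. H t (\<phi> z)) a = mather_alpha A H a"
proof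
  fix a assume a: "a \<in> first_cohomology A"
  \<comment> \<open>The same choice as in \<open>mather_alpha\<close>, so that the potential is
    built for the very form whose integrals are compared.\<close>
  define \<eta> where "\<eta> = (SOME \<eta>. \<eta> \<in> a)"
  have \<eta>: "closed_one_form A \<eta>" unfolding \<eta>_def by (rule first_cohomology_closed[OF a])
  interpret closed_manifold A by unfold_locales (rule assms(1))
  let ?M = "points (cotangent_atlas A)"
  obtain F where F: "smooth_time_function (cotangent_atlas A) F" "compactly_supported A F"
    and orb: "\<And>z0. z0 \<in> ?M \<Longrightarrow> \<exists>z. hamiltonian_orbit A F z \<and> z 0 = z0 \<and> z 1 = \<phi> z0"
    using assms(4) by (auto simp: hamiltonian_group_def)
  obtain K0 where K0: "compactin Cot K0" "\<And>t z. z \<in> ?M \<Longrightarrow> z \<notin> K0 \<Longrightarrow> F t z = 0"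
    using F(2) by (auto simp: compactly_supported_def)
  obtain Z where Z: "\<And>z. z \<in> ?M \<Longrightarrow> orbit F (Z z) \<and> Z z 0 = z \<and> Z z 1 = \<phi> z" using orb by metis
  define \<Phi> where "\<Phi> t z = Z z t" for t z
  have \<phi>_eq: "\<phi> z = \<Phi> 1 z" if "z \<in> ?M" for z using Z[OF that] by (simp add: \<Phi>_def)
  \<comment> \<open>The action density is continuous along each orbit and has an antiderivative on
    \<open>{0..1}\<close>, normalised to vanish at time 0.\<close>
  have "\<exists>g. (\<forall>t\<in>{0..1}. (g has_vector_derivative liouville_vf \<eta> F t (\<Phi> t z) - F t (\<Phi> t z)) (at t within {0..1})) \<and> g 0 = 0"
    if z: "z \<in> ?M" for z
  proof -
    have "continuous_map euclideanreal Cot (Z z)" using Z[OF z] orbit_continuous by blast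
    then have c: "continuous_map euclideanreal (prod_topology euclideanreal Cot) (\<lambda>t. (t, Z z t))"
      by (simp add: continuous_map_pairedI continuous_map_id[unfolded id_def])
    have "continuous_map euclideanreal euclideanreal (\<lambda>t. liouville_vf \<eta> F t (Z z t) - F t (Z z t))"
      using continuous_map_compose[OF c liouville_vf_continuous[OF F(1) \<eta>]] continuous_map_compose[OF c ham_continuous[OF F(1)]]
      by (simp add: o_def case_prod_unfold continuous_on_diff)
    then have "continuous_on {0..1} (\<lambda>t. liouville_vf \<eta> F t (\<Phi> t z) - F t (\<Phi> t z))"
      by (auto simp: \<Phi>_def intro: continuous_on_subset)
    from antiderivative_continuous[OF this] obtain g where
      g: "\<And>t. t \<in> {0..1} \<Longrightarrow> (g has_vector_derivative liouville_vf \<eta> F t (\<Phi> t z) - F t (\<Phi> t z)) (at t within {0..1})" by blast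
    show ?thesis
      by (intro exI[of _ "\<lambda>t. g t - g 0"]) (auto intro!: derivative_eq_intros g)
  qed
  then obtain potential where potential: "\<And>z t. z \<in> ?M \<Longrightarrow> t \<in> {0..1} \<Longrightarrow>
      (potential z has_vector_derivative liouville_vf \<eta> F t (\<Phi> t z) - F t (\<Phi> t z)) (at t within {0..1})"
    "\<And>z. z \<in> ?M \<Longrightarrow> potential z 0 = 0" by metis
  interpret iso: hamiltonian_isotopy A F K0 \<Phi> \<eta> potential
    by unfold_locales (use F(1) K0 Z \<eta> potential in \<open>auto simp: \<Phi>_def\<close>)
  have per: "time_periodic A (\<lambda>t z. H t (\<phi> z))"
    using assms(3) iso.\<Phi>_points by (simp add: time_periodic_def \<phi>_eq)
  interpret conj: conjugated A F K0 \<Phi> \<eta> potential H "\<lambda>t z. H t (\<phi> z)"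
    by unfold_locales (use assms per \<phi>_eq in simp_all)
  \<comment> \<open>\<open>LEAST\<close> depends only on its predicate, and the predicates of the
    two Hamiltonians are equivalent for every value.\<close>
  show "mather_alpha A (\<lambda>t z. H t (\<phi> z)) a = mather_alpha A H a"
    unfolding mather_alpha_def Let_def \<eta>_def[symmetric] conj.action_values_eq ..
qed

end
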